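(* Let $1<p<\infty$, $0<q<p$, $\alpha=\frac1q-\frac1p$ and $b\in\Lambda_\alpha(\mathbb D)$. Then for any $\beta,\gamma\in\mathbb R$ with $\beta\ne-1$, the operator $\Pi_{\beta,\gamma}(H_b)$ is continuous from $\mathcal H^q(\mathbb D)$ into $\mathcal H^p(\mathbb D)$. More precisely, there exists a constant $C$ (independent of $b$), uniformly bounded for $\gamma\in\mathbb R$ and $\beta$ in a compact subset of $\mathbb R\setminus\{-1,0\}$, such that $$\Vert\Pi_{\beta,\gamma}(H_b)\Vert_{\mathcal H^q(\mathbb D)\to\mathcal H^p(\mathbb D)}\le C\,\Vert H_b\Vert_{\mathcal H^q(\mathbb D)\to\mathcal H^p(\mathbb D)}.$$
   Context: $\mathbb D$ is the unit disc and $\mathcal H^p(\mathbb D)$, $p>0$, is the complex (holomorphic) Hardy space. $\Lambda_\alpha(\mathbb D)$, $\alpha>0$, is the space of functions holomorphic in $\mathbb D$ whose boundary values belong to the usual Lipschitz (Hölder–Zygmund) space $\Lambda_\alpha(\mathbb T)$ of $2\pi$-periodic functions. For $b(\zeta)=\sum_{k\ge0}b_k\zeta^k$, the Hankel operator with symbol $b$ acts on $f(z)=\sum_{n\ge0}a_nz^n$ (initially a polynomial) by $$H_bf(z)=\frac1{2\pi}\int_{\partial\mathbb D}\frac{b(\zeta)f(\overline\zeta)}{1-\overline\zeta z}\,d\sigma(\zeta)=\sum_{m\ge0}\Big(\sum_{n\ge0}a_nb_{m+n}\Big)z^m,$$ i.e. its matrix is $(b_{m+n})_{m,n\in\mathbb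 N}$ ($m$ the output index). For $\beta,\gamma\in\mathbb R$, the truncation $\Pi_{\beta,\gamma}(H_b)$ is the operator whose matrix has $(m,n)$-entry $b_{m+n}$ if $m\ge\beta n+\gamma$, and $0$ otherwise. Continuity from $\mathcal H^q(\mathbb D)$ into $\mathcal H^p(\mathbb D)$ means boundedness on polynomials (hence a bounded extension). For $b\in\Lambda_\alpha(\mathbb D)$, $H_b$ itself is bounded from $\mathcal H^q(\mathbb D)$ into $\mathcal H^p(\mathbb D)$. Constants may depend on $p,q$. *)

theory Defs
  imports "HOL-Complex_Analysis.Complex_Analysis" "HOL-Computational_Algebra.Polynomial"
begin

text \<open>The value is the supremum over \<open>0 \<le> r < 1\<close> of the integral means, possibly infinite.
  The mean is the intended one whenever \<open>f\<close> is continuous on the open unit disc. For \<open>p < 1\<close>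
  this is only a quasi-norm.\<close>

definition hardy_norm :: "real \<Rightarrow> (complex \<Rightarrow> complex) \<Rightarrow> ennreal" where
  "hardy_norm p f = (SUP r\<in>{0..<1}. ennreal
     ((1 / (2 * pi) * integral {0..2 * pi} (\<lambda>t. norm (f (of_real r * cis t)) powr p)) powr (1 / p)))"

definition hardy_space :: "real \<Rightarrow> (complex \<Rightarrow> complex) set" where
  "hardy_space p = {f. f holomorphic_on ball 0 1 \<and> hardy_norm p f < \<infinity>}"

text \<open>The Hoelder-Zygmund scale on the real line: Hoelder condition for \<open>\<alpha> < 1\<close>, Zygmund's
  second-difference condition for \<open>\<alpha> = 1\<close>, and for \<open>\<alpha> > 1\<close> the derivative has order \<open>\<alpha> - 1\<close>.\<close>

inductive hoelder_zygmund :: "real \<Rightarrow> (real \<Rightarrow> complex) \<Rightarrow> bool" where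
  hoelder: "0 < \<alpha> \<Longrightarrow> \<alpha> < 1 \<Longrightarrow> (\<And>x h. norm (g (x + h) - g x) \<le> C * \<bar>h\<bar> powr \<alpha>)
    \<Longrightarrow> hoelder_zygmund \<alpha> g"
| zygmund: "continuous_on UNIV g \<Longrightarrow> (\<And>x h. norm (g (x + h) + g (x - h) - 2 * g x) \<le> C * \<bar>h\<bar>)
    \<Longrightarrow> hoelder_zygmund 1 g"
| derivative: "1 < \<alpha> \<Longrightarrow> (\<And>x. (g has_vector_derivative g' x) (at x))
    \<Longrightarrow> hoelder_zygmund (\<alpha> - 1) g' \<Longrightarrow> hoelder_zygmund \<alpha> g"

definition Lipschitz_circle :: "real \<Rightarrow> (real \<Rightarrow> complex) set" where
  "Lipschitz_circle \<alpha> = {g. (\<forall>t. g (t + 2 * pi) = g t) \<and> hoelder_zygmund \<alpha> g}"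

text \<open>Boundary values are unrestricted limits from inside the disc; since \<open>g\<close> is continuous this
  says that \<open>b\<close> extends continuously to the closed disc with boundary function \<open>g\<close>.\<close>

definition Lipschitz_disc :: "real \<Rightarrow> (complex \<Rightarrow> complex) set" where
  "Lipschitz_disc \<alpha> = {b. b holomorphic_on ball 0 1 \<and>
     (\<exists>g\<in>Lipschitz_circle \<alpha>. \<forall>t. (b \<longlongrightarrow> g t) (at (cis t) within ball 0 1))}"

definition taylor_coeff :: "(complex \<Rightarrow> complex) \<Rightarrow> nat \<Rightarrow> complex" where
  "taylor_coeff b k = (deriv ^^ k) b 0 / fact k"

text \<open>Matrices are indexed as \<open>M m n\<close> with \<open>m\<close> the output and \<open>n\<close> the input index.\<close>

definition matrix_operator :: "(nat \<Rightarrow> nat \<Rightarrow> complex) \<Rightarrow> complex poly \<Rightarrow> complex \<Rightarrow> complex" where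
  "matrix_operator M f z = (\<Sum>m. (\<Sum>n\<le>degree f. coeff f n * M m n) * z ^ m)"

definition hankel_matrix :: "(complex \<Rightarrow> complex) \<Rightarrow> nat \<Rightarrow> nat \<Rightarrow> complex" where
  "hankel_matrix b m n = taylor_coeff b (m + n)"

definition truncation :: "real \<Rightarrow> real \<Rightarrow> (nat \<Rightarrow> nat \<Rightarrow> complex) \<Rightarrow> nat \<Rightarrow> nat \<Rightarrow> complex" where
  "truncation \<beta> \<gamma> M m n = (if real m \<ge> \<beta> * real n + \<gamma> then M m n else 0)"

definition hankel :: "(complex \<Rightarrow> complex) \<Rightarrow> complex poly \<Rightarrow> complex \<Rightarrow> complex" where
  "hankel b = matrix_operator (hankel_matrix b)"

definition truncated_hankel ::
    "real \<Rightarrow> real \<Rightarrow> (complex \<Rightarrow> complex) \<Rightarrow> complex poly \<Rightarrow> complex \<Rightarrow> complex" where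
  "truncated_hankel \<beta> \<gamma> b = matrix_operator (truncation \<beta> \<gamma> (hankel_matrix b))"

text \<open>Operators are given on the dense subspace of polynomials.\<close>

definition hardy_continuous ::
    "real \<Rightarrow> real \<Rightarrow> (complex poly \<Rightarrow> complex \<Rightarrow> complex) \<Rightarrow> bool" where
  "hardy_continuous q p T \<longleftrightarrow> (\<forall>f. T f \<in> hardy_space p) \<and>
     (\<exists>C::real. \<forall>f. hardy_norm p (T f) \<le> ennreal C * hardy_norm q (poly f))"

definition hardy_opnorm ::
    "real \<Rightarrow> real \<Rightarrow> (complex poly \<Rightarrow> complex \<Rightarrow> complex) \<Rightarrow> ennreal" where
  "hardy_opnorm q p T = (SUP f\<in>{f. hardy_norm q (poly f) \<le> 1}. hardy_norm p (T f))"

end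

theory Submission
  imports Defs
begin

text \<open>
  A Beta integral writes \<open>1 / binom (M + k) k\<close> as \<open>k \<integral> e^(k-1) (1-e)^M de\<close> over \<open>(0,1)\<close>. Hence a truncated
  Hankel operator is an average over \<open>e\<close> of truncated operators whose symbols are damped by \<open>(1-e)^M\<close>, and the
  damped symbols have size \<open>N e^(\<alpha>-k)\<close> when the series \<open>\<Sum> binom (M + k) k b_M z^M\<close> is at most
  \<open>N (1-|z|)^(\<alpha>-k)\<close>. The gain \<open>e^\<alpha>\<close> is what makes absolute estimates sufficient.

  For fixed \<open>e\<close>, the truncated rows or columns are Cauchy-type integrals of the symbol with the factor
  \<open>s^C cis (a C) / (1 - s cis a)\<close>, where \<open>C\<close> is the integer threshold. Replacing \<open>C\<close> by the real
  number \<open>\<beta> n + \<gamma>\<close> leaves an error that Bessel's inequality makes square summable; the loss it causes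
  in \<open>e\<close> is smaller than \<open>e^\<alpha>\<close>. In the main part the sum over \<open>n\<close> is geometric with frequency
  \<open>(1 + \<beta>) a\<close>, which is where \<open>\<beta> \<noteq> -1\<close> enters, and it is dominated by the kernel \<open>e^(-\<kappa>) (e + |1 - cis t|)^(\<kappa>-1)\<close>.
  Poisson majorants of \<open>|f|^(q/p)\<close> and the Hardy-Littlewood-Sobolev inequality then control the integral over \<open>e\<close>.
  For \<open>p > 2\<close> the geometric sum runs over the inputs, for \<open>p \<le> 2\<close> over the outputs; in the second case the slope is
  \<open>1/\<beta>\<close> and the region is replaced by its complement if \<open>\<beta> > 0\<close>.

  The constant \<open>N\<close> is finite for symbols in the Hoelder-Zygmund class, by integrating second differences
  against \<open>(1-z)^(-k-1)\<close>, and it is at most a multiple of the norm of \<open>H_b\<close>, by testing \<open>H_b\<close> on \<open>(1 - w z)^(-k)\<close> and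
  evaluating at \<open>w\<close>.
\<close>

subsection \<open>The circle\<close>

text \<open>For a fixed \<open>e\<close> the main part can be as large as \<open>e^(-al)\<close>, so
  taking norms before integrating against \<open>e^(al-1)\<close> would leave the divergent integral
  of \<open>1/e\<close>. The integral over \<open>e\<close> is therefore evaluated at fixed points
  of the circle. This needs a majorant of \<open>|f|\<close> that is linear in a function of
  \<open>X = |f|^q\<close>, also for \<open>q < 1\<close>; \<open>layer\<close> is that function.
  Its factor \<open>min(X, 1/e)^al\<close> integrates against \<open>e^(al-1-\<kappa>)\<close> to a
  multiple of \<open>X^\<kappa>\<close>, and \<open>1/p + \<kappa>\<close> and
  \<open>1 - 1/p\<close> are matching Hardy-Littlewood-Sobolev exponents for
  \<open>chord^(\<kappa>-1)\<close>. The free exponent \<kappa> > 0 also avoids a logarithm in the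
  integral of a product of two Cauchy-type kernels.

  The distinction by p comes from the rounding error, which is controlled in mean square only. With
  sums over inputs it meets the mean square of f, at a loss of order 1/q - 1/2 in
  \<open>1/e\<close>; with sums over outputs it meets the dual function, square integrable for p
  \<le> 2, and f enters through its first mean, at a loss of order 1/q - 1. Both stay below al,
  since 1/p < 1/2 in the first case and 1/p < 1 in the second.\<close>

definition circ :: "real measure" where
  "circ = density lborel (\<lambda>t. ennreal (indicator {-pi..pi} t / (2 * pi)))"

lemma sets_circ [simp, measurable_cong]: "sets circ = sets borel"
  by (simp add: circ_def)

lemma space_circ [simp]: "space circ = UNIV"
  by (simp add: circ_def)

lemma measurable_circ [simp]: "measurable circ M = measurable borel M"
  by (rule measurable_cong_sets) auto

lemma nn_integral_circ:
  assumes [measurable]: "f \<in> borel_measurable borel"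
  shows "(\<integral>\<^sup>+t. f t \<partial>circ) = ennreal (1 / (2 * pi)) * (\<integral>\<^sup>+t. f t * indicator {-pi..pi} t \<partial>lborel)"
proof -
  have "(\<integral>\<^sup>+t. f t \<partial>circ) = (\<integral>\<^sup>+t. ennreal (indicator {-pi..pi} t / (2 * pi)) * f t \<partial>lborel)"
    unfolding circ_def by (rule nn_integral_density) auto
  also have "\<dots> = (\<integral>\<^sup>+t. ennreal (1 / (2 * pi)) * (f t * indicator {-pi..pi} t) \<partial>lborel)"
    by (intro nn_integral_cong) (auto simp: indicator_def)
  finally show ?thesis by (simp add: nn_integral_cmult)
qed

lemma emeasure_circ: "emeasure circ UNIV = 1"
proof -
  have "emeasure circ UNIV = (\<integral>\<^sup>+t. 1 \<partial>circ)" by simp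
  also have "\<dots> = ennreal (1 / (2 * pi)) * ennreal (2 * pi)"
    by (subst nn_integral_circ) auto
  also have "\<dots> = 1" by (subst ennreal_mult'[symmetric]) auto
  finally show ?thesis .
qed

interpretation circ: finite_measure circ
  by standard (simp add: emeasure_circ)

interpretation circ2: pair_sigma_finite circ circ
  by standard

lemma measure_circ: "measure circ UNIV = 1"
  by (simp add: measure_def emeasure_circ)

lemma integral_circ_const [simp]:
  "(LINT t|circ. c) = (c :: 'a :: {banach, second_countable_topology})"
  by (simp add: measure_circ)

lemma AE_circ: "AE t in circ. t \<in> {-pi..pi}"
  unfolding circ_def by (subst AE_density) (auto simp: indicator_def intro!: AE_I2)

lemma nn_integral_circ_mono:
  assumes "\<And>t. t \<in> {-pi..pi} \<Longrightarrow> f t \<le> g t"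
  shows "(\<integral>\<^sup>+t. f t \<partial>circ) \<le> (\<integral>\<^sup>+t. g t \<partial>circ)"
  by (intro nn_integral_mono_AE eventually_mono[OF AE_circ] assms)

lemma integrable_circ:
  fixes h :: "real \<Rightarrow> 'a :: {banach, second_countable_topology}"
  assumes "h \<in> borel_measurable borel" "\<And>t. t \<in> {-pi..pi} \<Longrightarrow> norm (h t) \<le> H"
  shows "integrable circ h"
  using AE_circ assms by (intro circ.integrable_const_bound[of _ H]) auto

text \<open>No integrability is required, because the Bochner integral of a non-integrable function
  is 0.\<close>

lemma norm_integral_circ_le:
  fixes h :: "real \<Rightarrow> 'a :: {banach, second_countable_topology}"
  shows "ennreal (norm (LINT t|circ. h t)) \<le> (\<integral>\<^sup>+t. ennreal (norm (h t)) \<partial>circ)"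
  by (cases "integrable circ h") (auto intro: integral_norm_bound_ennreal simp: not_integrable_integral_eq)

lemma integral_circ:
  fixes h :: "real \<Rightarrow> 'a :: {banach, second_countable_topology}"
  assumes [measurable]: "h \<in> borel_measurable borel"
  shows "(LINT t|circ. h t) = (1 / (2 * pi)) *\<^sub>R (LINT t|lborel. indicator {-pi..pi} t *\<^sub>R h t)"
proof -
  have "(LINT t|circ. h t) = (LINT t|lborel. (indicator {-pi..pi} t / (2 * pi)) *\<^sub>R h t)"
    unfolding circ_def by (rule integral_density) auto
  also have "\<dots> = (LINT t|lborel. (1 / (2 * pi)) *\<^sub>R (indicator {-pi..pi} t *\<^sub>R h t))"
    by (intro Bochner_Integration.integral_cong) (auto simp: indicator_def)
  finally show ?thesis by (simp only: integral_scaleR_right)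
qed

lemma integral_circ_FTC:
  fixes F :: "real \<Rightarrow> 'a :: euclidean_space"
  assumes "\<And>x. (F has_vector_derivative f x) (at x)" "continuous_on UNIV f"
  shows "(LINT t|circ. f t) = (1 / (2 * pi)) *\<^sub>R (F pi - F (-pi))"
proof -
  have "(LINT t|lborel. indicator {-pi..pi} t *\<^sub>R f t) = F pi - F (-pi)"
    using assms
    by (intro integral_FTC_Icc) (auto intro: has_vector_derivative_at_within continuous_on_subset)
  then show ?thesis
    using assms by (subst integral_circ) (auto intro: borel_measurable_continuous_onI)
qed

lemma cis_measurable [measurable]: "cis \<in> borel_measurable borel"
  by (intro borel_measurable_continuous_onI continuous_intros)

lemma integral_circ_cis: "(LINT t|circ. cis (of_int k * t)) = (if k = 0 then 1 else 0)"
proof (cases "k = 0")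
  case False
  define F where "F t = cis (of_int k * t) / (\<i> * of_int k)" for t :: real
  have "(F has_vector_derivative cis (of_int k * t)) (at t)" for t
    unfolding F_def cis_conv_exp using False
    by (auto intro!: derivative_eq_intros has_vector_derivative_real_field simp: field_simps)
  then have "(LINT t|circ. cis (of_int k * t)) = (1 / (2 * pi)) *\<^sub>R (F pi - F (-pi))"
    by (intro integral_circ_FTC) (auto intro!: continuous_intros)
  moreover have "cis (of_int k * pi) = cis (- (of_int k * pi))"
    using sin_zero_iff_int2[of "of_int k * pi"] by (auto simp: complex_eq_iff)
  ultimately show ?thesis using False by (simp add: F_def)
qed (simp add: measure_circ)

section \<open>Changes of variable for periodic functions\<close>

lemma nn_integral_period:
  fixes h :: "real \<Rightarrow> ennreal"
  assumes [measurable]: "h \<in> borel_measurable borel" and per: "\<And>x. h (x + 2 * pi) = h x"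
  shows "(\<integral>\<^sup>+x. h x * indicator {c..<c + 2 * pi} x \<partial>lborel)
    = (\<integral>\<^sup>+x. h x * indicator {-pi..<pi} x \<partial>lborel)"
proof -
  have per_nat: "h (x + 2 * pi * of_nat k) = h x" for x and k :: nat
  proof (induction k)
    case (Suc k)
    have "h (x + 2 * pi * of_nat (Suc k)) = h ((x + 2 * pi * of_nat k) + 2 * pi)"
      by (simp add: algebra_simps)
    then show ?case using Suc per by simp
  qed simp
  have per_int: "h (x + 2 * pi * of_int k) = h x" for x and k :: int
  proof (cases "k \<ge> 0")
    case True then show ?thesis using per_nat[of x "nat k"] by simp
  next
    case False
    then show ?thesis using per_nat[of "x + 2 * pi * of_int k" "nat (-k)"] by simp
  qed
  have shift: "(\<integral>\<^sup>+x. h x * indicator {a + 2 * pi * of_int k..<b + 2 * pi * of_int k} x \<partial>lborel)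
     = (\<integral>\<^sup>+x. h x * indicator {a..<b} x \<partial>lborel)" for a b and k :: int
    by (subst nn_integral_real_affine[where t = "2 * pi * of_int k" and c = 1])
       (auto simp: per_int add.commute[of "2 * pi * of_int k"] intro!: nn_integral_cong split: split_indicator)
  define k where "k = \<lfloor>(c + pi) / (2 * pi)\<rfloor>"
  \<comment> \<open>The odd multiple of pi in the interval from \<open>c\<close> to
    \<open>c + 2 * pi\<close>. What lies to its right is moved back by one period, and the result is
    a translate of \<open>{-pi..<pi}\<close>.\<close>
  define e where "e = -pi + 2 * pi * of_int (k + 1)"
  have "of_int k \<le> (c + pi) / (2 * pi)" "(c + pi) / (2 * pi) < of_int k + 1"
    unfolding k_def by linarith+
  then have ce: "e - 2 * pi \<le> c" "c < e"
    by (simp_all add: field_simps e_def)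
  have "(\<integral>\<^sup>+x. h x * indicator {c..<c + 2 * pi} x \<partial>lborel)
    = (\<integral>\<^sup>+x. h x * indicator {c..<e} x + h x * indicator {e..<c + 2 * pi} x \<partial>lborel)"
    using ce by (intro nn_integral_cong) (auto split: split_indicator)
  also have "\<dots> = (\<integral>\<^sup>+x. h x * indicator {c..<e} x \<partial>lborel)
      + (\<integral>\<^sup>+x. h x * indicator {e..<c + 2 * pi} x \<partial>lborel)"
    by (rule nn_integral_add) auto
  also have "(\<integral>\<^sup>+x. h x * indicator {e..<c + 2 * pi} x \<partial>lborel)
      = (\<integral>\<^sup>+x. h x * indicator {e - 2 * pi..<c} x \<partial>lborel)"
    using shift[of "e - 2 * pi" 1 c] by simp
  also have "(\<integral>\<^sup>+x. h x * indicator {c..<e} x \<partial>lborel)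
      + (\<integral>\<^sup>+x. h x * indicator {e - 2 * pi..<c} x \<partial>lborel)
      = (\<integral>\<^sup>+x. h x * indicator {c..<e} x + h x * indicator {e - 2 * pi..<c} x \<partial>lborel)"
    by (rule nn_integral_add[symmetric]) auto
  also have "\<dots> = (\<integral>\<^sup>+x. h x * indicator {e - 2 * pi..<e} x \<partial>lborel)"
    using ce by (intro nn_integral_cong) (auto split: split_indicator)
  also have "\<dots> = (\<integral>\<^sup>+x. h x * indicator {-pi + 2 * pi * of_int k..<pi + 2 * pi * of_int k} x \<partial>lborel)"
    by (simp add: e_def algebra_simps)
  also have "\<dots> = (\<integral>\<^sup>+x. h x * indicator {-pi..<pi} x \<partial>lborel)"
    by (rule shift)
  finally show ?thesis .
qed

lemma AE_lborel_neq: "AE x in lborel. x \<noteq> (c::real)"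
  by (rule AE_lborel_singleton)

lemma nn_integral_Icc_Ico:
  fixes h :: "real \<Rightarrow> ennreal"
  shows "(\<integral>\<^sup>+x. h x * indicator {a..b} x \<partial>lborel) = (\<integral>\<^sup>+x. h x * indicator {a..<b} x \<partial>lborel)"
  using AE_lborel_neq[of b] by (intro nn_integral_cong_AE) (auto simp: indicator_def)

lemma nn_integral_circ_Ico:
  assumes [measurable]: "h \<in> borel_measurable borel" and "\<And>x. h (x + 2 * pi) = h x"
  shows "(\<integral>\<^sup>+t. h t \<partial>circ) = ennreal (1 / (2 * pi)) * (\<integral>\<^sup>+x. h x * indicator {c..<c + 2 * pi} x \<partial>lborel)"
  using nn_integral_period[OF assms, of c] by (simp add: nn_integral_circ nn_integral_Icc_Ico)

lemma nn_integral_circ_shift: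
  assumes [measurable]: "h \<in> borel_measurable borel" and per: "\<And>x. h (x + 2 * pi) = h x"
  shows "(\<integral>\<^sup>+t. h (c + t) \<partial>circ) = (\<integral>\<^sup>+t. h t \<partial>circ)"
proof -
  have "(\<integral>\<^sup>+t. h t \<partial>circ)
      = ennreal (1 / (2 * pi)) * (\<integral>\<^sup>+x. h x * indicator {c - pi..<(c - pi) + 2 * pi} x \<partial>lborel)"
    by (rule nn_integral_circ_Ico) (use per in auto)
  also have "(\<integral>\<^sup>+x. h x * indicator {c - pi..<(c - pi) + 2 * pi} x \<partial>lborel)
      = (\<integral>\<^sup>+x. h (c + x) * indicator {-pi..<pi} x \<partial>lborel)"
    by (subst nn_integral_real_affine[where t = c and c = 1])
       (auto intro!: nn_integral_cong split: split_indicator)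
  finally show ?thesis by (simp add: nn_integral_circ nn_integral_Icc_Ico)
qed

lemma nn_integral_circ_reflect:
  assumes [measurable]: "h \<in> borel_measurable borel"
  shows "(\<integral>\<^sup>+t. h (- t) \<partial>circ) = (\<integral>\<^sup>+t. h t \<partial>circ)"
proof -
  have "(\<integral>\<^sup>+x. h x * indicator {-pi..pi} x \<partial>lborel) = (\<integral>\<^sup>+x. h (- x) * indicator {-pi..pi} x \<partial>lborel)"
    by (subst nn_integral_real_affine[where t = 0 and c = "-1"])
       (auto intro!: nn_integral_cong split: split_indicator)
  then show ?thesis by (simp add: nn_integral_circ)
qed

text \<open>The slope \<open>l\<close> is real, so \<open>c + l * t\<close> sweeps an interval of
  length \<open>2 * pi * |l|\<close> that need not consist of whole periods. It is enclosed in at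
  most \<open>|l| + 1\<close> periods, and the Jacobian \<open>1 / |l|\<close> turns this count into
  the stated factor.\<close>

lemma nn_integral_circ_affine_le:
  assumes h [measurable]: "h \<in> borel_measurable borel" and per: "\<And>x. h (x + 2 * pi) = h x" and "l \<noteq> 0"
  shows "(\<integral>\<^sup>+t. h (c + l * t) \<partial>circ) \<le> ennreal (1 + 1 / \<bar>l\<bar>) * (\<integral>\<^sup>+t. h t \<partial>circ)"
proof -
  define J where "J = (\<integral>\<^sup>+x. h x * indicator {-pi..<pi} x \<partial>lborel)"
  have periods: "(\<integral>\<^sup>+x. h x * indicator {d..<d + 2 * pi * of_nat k} x \<partial>lborel) = of_nat k * J"
    for d and k :: nat
  proof (induction k)
    case (Suc k)
    have "(\<integral>\<^sup>+x. h x * indicator {d..<d + 2 * pi * of_nat (Suc k)} x \<partial>lborel)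
      = (\<integral>\<^sup>+x. h x * indicator {d..<d + 2 * pi * of_nat k} x
          + h x * indicator {d + 2 * pi * of_nat k..<(d + 2 * pi * of_nat k) + 2 * pi} x \<partial>lborel)"
    proof (intro nn_integral_cong)
      fix x
      have split: "h x * indicator {d..<d + K + 2 * pi} x
          = h x * indicator {d..<d + K} x + h x * indicator {d + K..<(d + K) + 2 * pi} x"
        if "K \<ge> 0" for K
      proof -
        have "x < d + K + 2 * pi" if "x < d + K" using that pi_gt_zero by linarith
        with that show ?thesis by (auto split: split_indicator)
      qed
      have "d + 2 * pi * of_nat (Suc k) = d + 2 * pi * of_nat k + 2 * pi"
        by (simp only: of_nat_Suc distrib_left mult_1_right add.assoc add.commute add.left_commute)
      then show "h x * indicator {d..<d + 2 * pi * of_nat (Suc k)} x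
          = h x * indicator {d..<d + 2 * pi * of_nat k} x
          + h x * indicator {d + 2 * pi * of_nat k..<(d + 2 * pi * of_nat k) + 2 * pi} x"
        using split[of "2 * pi * of_nat k"] by (simp add: add.assoc del: of_nat_Suc)
    qed
    also have "\<dots> = of_nat k * J + J"
      by (subst nn_integral_add) (auto simp: Suc nn_integral_period[OF h per] J_def)
    finally show ?case by (simp add: algebra_simps)
  qed simp
  define L where "L = \<bar>l\<bar>"
  have L: "L > 0" using assms by (simp add: L_def)
  define k where "k = nat \<lceil>L\<rceil>"
  have k: "L \<le> of_nat k" "of_nat k \<le> L + 1" using L by (auto simp: k_def)
  have "(\<integral>\<^sup>+x. h (c + l * x) * indicator {-pi..<pi} x \<partial>lborel)
     = ennreal (1 / L) * (ennreal L * (\<integral>\<^sup>+x. h (c + l * x) * indicator {-pi..<pi} x \<partial>lborel))"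
    using L by (simp add: mult.assoc[symmetric] ennreal_mult'[symmetric])
  also have "ennreal L * (\<integral>\<^sup>+x. h (c + l * x) * indicator {-pi..<pi} x \<partial>lborel)
     \<le> ennreal L * (\<integral>\<^sup>+x. h (c + l * x) * indicator {c - L * pi..c + L * pi} (c + l * x) \<partial>lborel)"
  proof (rule mult_left_mono, rule nn_integral_mono)
    fix x
    have "c + l * x \<in> {c - L * pi..c + L * pi}" if "x \<in> {-pi..<pi}"
    proof -
      have "\<bar>l * x\<bar> \<le> L * pi" unfolding abs_mult L_def using that by (intro mult_left_mono) auto
      then show ?thesis by auto
    qed
    then show "h (c + l * x) * indicator {- pi..<pi} x
       \<le> h (c + l * x) * indicator {c - L * pi..c + L * pi} (c + l * x)"
      by (auto split: split_indicator)
  qed auto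
  also have "\<dots> = (\<integral>\<^sup>+x. h x * indicator {c - L * pi..c + L * pi} x \<partial>lborel)"
    unfolding L_def
    using nn_integral_real_affine[of "\<lambda>x. h x * indicator {c - \<bar>l\<bar> * pi..c + \<bar>l\<bar> * pi} x" l c] assms(3)
    by simp
  also have "\<dots> = (\<integral>\<^sup>+x. h x * indicator {c - L * pi..<c + L * pi} x \<partial>lborel)"
    by (rule nn_integral_Icc_Ico)
  also have "\<dots> \<le> (\<integral>\<^sup>+x. h x * indicator {c - L * pi..<c - L * pi + 2 * pi * of_nat k} x \<partial>lborel)"
  proof (intro nn_integral_mono)
    fix x
    have "2 * pi * L \<le> 2 * pi * of_nat k" using k by (intro mult_left_mono) auto
    moreover have "2 * pi * L = L * pi + L * pi" by (simp add: algebra_simps)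
    ultimately have le: "c + L * pi \<le> c - L * pi + 2 * pi * of_nat k" by linarith
    show "h x * indicator {c - L * pi..<c + L * pi} x
       \<le> h x * indicator {c - L * pi..<c - L * pi + 2 * pi * of_nat k} x"
      by (rule mult_left_mono, rule indicator_leI) (use le in \<open>auto intro: less_le_trans\<close>)
  qed
  also have "\<dots> = of_nat k * J" by (rule periods)
  finally have "(\<integral>\<^sup>+x. h (c + l * x) * indicator {-pi..<pi} x \<partial>lborel) \<le> ennreal (1 / L) * (of_nat k * J)"
    by (simp add: mult_left_mono)
  also have "\<dots> = ennreal (of_nat k / L) * J"
    by (simp add: ennreal_mult'[symmetric] mult.assoc[symmetric] ennreal_of_nat_eq_real_of_nat L less_imp_le)
  also have "\<dots> \<le> ennreal (1 + 1 / L) * J"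
    using k L by (intro mult_right_mono ennreal_leI) (auto simp: field_simps)
  finally have "ennreal (1 / (2 * pi)) * (\<integral>\<^sup>+x. h (c + l * x) * indicator {-pi..<pi} x \<partial>lborel)
     \<le> ennreal (1 / (2 * pi)) * (ennreal (1 + 1 / L) * J)"
    by (rule mult_left_mono) auto
  then show ?thesis
    by (simp add: nn_integral_circ nn_integral_Icc_Ico J_def L_def mult.left_commute)
qed

section \<open>The chord distance, a periodic substitute for the absolute value\<close>

definition chord :: "real \<Rightarrow> real" where
  "chord t = cmod (1 - cis t)"

lemma chord_nonneg [simp]: "0 \<le> chord t"
  by (simp add: chord_def)

lemma chord_le_2: "chord t \<le> 2"
  unfolding chord_def using norm_triangle_ineq4[of 1 "cis t"] by simp

lemma cis_period [simp]: "cis (x + 2 * pi) = cis x"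
  by (simp add: complex_eq_iff)

lemma chord_period [simp]: "chord (x + 2 * pi) = chord x"
  by (simp add: chord_def)

lemma chord_minus [simp]: "chord (- x) = chord x"
proof -
  have "1 - cis (- x) = cnj (1 - cis x)" by (simp add: complex_eq_iff)
  then show ?thesis by (metis chord_def complex_mod_cnj)
qed

lemma chord_add: "chord (x + y) \<le> chord x + chord y"
proof -
  have "1 - cis (x + y) = (1 - cis x) + cis x * (1 - cis y)"
    by (simp add: cis_mult algebra_simps)
  then have "chord (x + y) \<le> cmod (1 - cis x) + cmod (cis x * (1 - cis y))"
    unfolding chord_def by (metis norm_triangle_ineq)
  then show ?thesis by (simp add: norm_mult chord_def)
qed

lemma chord_sin: "chord t = 2 * \<bar>sin (t / 2)\<bar>"
proof -
  have "(chord t)\<^sup>2 = (1 - cos t)\<^sup>2 + (sin t)\<^sup>2"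
    by (simp add: chord_def cmod_def)
  also have "\<dots> = 2 - 2 * cos t"
    using sin_cos_squared_add[of t] by (simp add: power2_eq_square algebra_simps)
  also have "\<dots> = (2 * \<bar>sin (t / 2)\<bar>)\<^sup>2"
    using cos_double_sin[of "t / 2"] by (simp add: power_mult_distrib)
  finally show ?thesis
    by (metis abs_ge_zero chord_nonneg mult_nonneg_nonneg power2_eq_imp_eq zero_le_numeral)
qed

lemma chord_le_abs: "chord t \<le> \<bar>t\<bar>"
  using abs_sin_x_le_abs_x[of "t / 2"] by (simp add: chord_sin)

text \<open>With x = |t|/2 at most 1.6, Taylor's formula gives x - x^3/6 \<le> sin x, and x^2 \<le>
  3 makes the left side at least x/2.\<close>

lemma chord_ge_abs:
  assumes "\<bar>t\<bar> \<le> pi" shows "\<bar>t\<bar> / 2 \<le> chord t"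
proof -
  define x where "x = \<bar>t\<bar> / 2"
  have "pi < 3.2" using pi_approx by simp
  then have x: "0 \<le> x" "x \<le> 1.6" using assms by (auto simp: x_def)
  have "\<bar>sin x - (\<Sum>m<3. sin_coeff m * x ^ m)\<bar> \<le> inverse (fact 3) * \<bar>x\<bar> ^ 3"
    by (rule Maclaurin_sin_bound)
  then have "\<bar>sin x - x\<bar> \<le> x ^ 3 / 6"
    using x by (simp add: numeral_3_eq_3 sin_coeff_def fact_numeral field_simps)
  then have "x - x ^ 3 / 6 \<le> sin x" by linarith
  moreover have "x * (x * x) \<le> x * 3"
    using x mult_mono[of x "1.6" x "1.6"] by (intro mult_left_mono) auto
  ultimately have "x / 2 \<le> sin x" by (simp add: power3_eq_cube)
  moreover have "\<bar>sin (t / 2)\<bar> = \<bar>sin x\<bar>"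
    by (cases "t \<ge> 0") (auto simp: x_def)
  ultimately show ?thesis by (simp add: chord_sin x_def)
qed

lemma chord_measurable [measurable]: "chord \<in> borel_measurable borel"
  unfolding chord_def by measurable

text \<open>The modulus dominates \<open>1 - s\<close>, and moving the point radially to the circle
  changes it by at most \<open>1 - s\<close>. So the chord costs two moduli and \<open>1 - s\<close>
  a third.\<close>

lemma one_minus_cis_ge:
  assumes "0 \<le> s" "s \<le> 1"
  shows "(1 - s) + chord b \<le> 3 * cmod (1 - of_real s * cis b)"
proof -
  have "1 - s \<le> cmod (1 - of_real s * cis b)"
    using norm_triangle_ineq2[of 1 "of_real s * cis b"] assms by (simp add: norm_mult)
  moreover have "chord b \<le> cmod (1 - of_real s * cis b) + (1 - s)"
  proof -
    have "1 - cis b = (1 - of_real s * cis b) - of_real (1 - s) * cis b"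
      by (simp add: algebra_simps)
    then have "chord b \<le> cmod (1 - of_real s * cis b) + cmod (of_real (1 - s) * cis b)"
      unfolding chord_def by (metis norm_triangle_ineq4)
    then show ?thesis using assms by (simp only: norm_mult norm_of_real norm_cis) simp
  qed
  ultimately show ?thesis by linarith
qed

text \<open>On one period the chord is at least |t|/2, so the integrand is compared with a power of
  \<open>e + |t|\<close>, integrated over the whole line.\<close>

lemma chord_integral_base:
  assumes "0 < k" "0 < e"
  shows "(\<integral>\<^sup>+t. ennreal ((e + chord t) powr (-1-k)) \<partial>circ) \<le> ennreal (2 powr (1 + k) / k * e powr (-k))"
proof -
  have half: "(\<integral>\<^sup>+x. indicator {0..} x * ennreal ((e + x) powr (-1-k)) \<partial>lborel) = ennreal (e powr (-k) / k)"
  proof -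
    have "(\<integral>\<^sup>+x. indicator {e..} x * ennreal (x powr (-1-k)) \<partial>lborel) = ennreal (e powr (-k) / k)"
      using nn_integral_has_integral_lebesgue[OF _ has_integral_powr_to_inf[of "-1-k" e]] assms
      by (simp add: ennreal_mult' ennreal_indicator)
    moreover have "(\<integral>\<^sup>+x. indicator {e..} x * ennreal (x powr (-1-k)) \<partial>lborel)
       = (\<integral>\<^sup>+x. indicator {0..} x * ennreal ((e + x) powr (-1-k)) \<partial>lborel)"
      by (subst nn_integral_real_affine[where t = e and c = 1])
         (auto intro!: nn_integral_cong split: split_indicator)
    ultimately show ?thesis by simp
  qed
  have half': "(\<integral>\<^sup>+x. indicator {..0} x * ennreal ((e - x) powr (-1-k)) \<partial>lborel) = ennreal (e powr (-k) / k)"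
    unfolding half[symmetric]
    by (subst nn_integral_real_affine[where t = 0 and c = "-1"])
       (auto intro!: nn_integral_cong split: split_indicator)
  have "(\<integral>\<^sup>+t. ennreal ((e + chord t) powr (-1-k)) \<partial>circ)
     \<le> (\<integral>\<^sup>+t. ennreal (2 powr (1 + k)) * ennreal ((e + \<bar>t\<bar>) powr (-1-k)) \<partial>circ)"
  proof (rule nn_integral_circ_mono)
    fix t :: real assume "t \<in> {-pi..pi}"
    then have "\<bar>t\<bar> \<le> pi" by auto
    then have "(e + \<bar>t\<bar>) / 2 \<le> e + chord t" using chord_ge_abs[of t] assms by auto
    then have "(e + chord t) powr (-1-k) \<le> ((e + \<bar>t\<bar>) / 2) powr (-1-k)"
      using assms by (intro powr_mono2') auto
    also have "\<dots> = 2 powr (1 + k) * (e + \<bar>t\<bar>) powr (-1-k)"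
      using assms powr_minus_divide[of 2 "1 + k"] by (subst powr_divide) (auto simp: field_simps)
    finally show "ennreal ((e + chord t) powr (-1-k))
        \<le> ennreal (2 powr (1 + k)) * ennreal ((e + \<bar>t\<bar>) powr (-1-k))"
      by (simp add: ennreal_mult'[symmetric] ennreal_leI)
  qed
  also have "\<dots> = ennreal (2 powr (1 + k)) * (ennreal (1 / (2 * pi)) *
      (\<integral>\<^sup>+t. ennreal ((e + \<bar>t\<bar>) powr (-1-k)) * indicator {-pi..pi} t \<partial>lborel))"
    by (subst nn_integral_cmult) (auto simp: nn_integral_circ)
  also have "\<dots> \<le> ennreal (2 powr (1 + k)) * (ennreal (1 / (2 * pi)) *
     (\<integral>\<^sup>+t. indicator {0..} t * ennreal ((e + t) powr (-1-k))
        + indicator {..0} t * ennreal ((e - t) powr (-1-k)) \<partial>lborel))"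
    by (intro mult_left_mono nn_integral_mono) (auto split: split_indicator)
  also have "\<dots> = ennreal (2 powr (1 + k)) * (ennreal (1 / (2 * pi)) *
     (ennreal (e powr (-k) / k) + ennreal (e powr (-k) / k)))"
    by (subst nn_integral_add) (auto simp: half half')
  also have "\<dots> = ennreal (2 powr (1 + k) / k * e powr (-k) * (1 / pi))"
    using assms by (simp add: ennreal_mult'[symmetric] ennreal_plus[symmetric] del: ennreal_plus)
  also have "\<dots> \<le> ennreal (2 powr (1 + k) / k * e powr (-k) * 1)"
    using assms pi_ge_two by (intro ennreal_leI mult_left_mono) auto
  finally show ?thesis by simp
qed

lemma chord_integral:
  assumes "0 < k" "0 < e" "l \<noteq> 0"
  shows "(\<integral>\<^sup>+t. ennreal ((e + chord (c + l * t)) powr (-1-k)) \<partial>circ)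
    \<le> ennreal ((1 + 1 / \<bar>l\<bar>) * (2 powr (1 + k) / k) * e powr (-k))"
proof -
  have "(\<integral>\<^sup>+t. ennreal ((e + chord (c + l * t)) powr (-1-k)) \<partial>circ)
    \<le> ennreal (1 + 1 / \<bar>l\<bar>) * (\<integral>\<^sup>+t. ennreal ((e + chord t) powr (-1-k)) \<partial>circ)"
    using assms nn_integral_circ_affine_le[of "\<lambda>t. ennreal ((e + chord t) powr (-1-k))" l c]
    by simp
  also have "\<dots> \<le> ennreal (1 + 1 / \<bar>l\<bar>) * ennreal (2 powr (1 + k) / k * e powr (-k))"
    by (intro mult_left_mono chord_integral_base assms) auto
  also have "\<dots> = ennreal ((1 + 1 / \<bar>l\<bar>) * (2 powr (1 + k) / k) * e powr (-k))"
    using assms by (subst ennreal_mult'[symmetric]) (auto simp: mult.assoc)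
  finally show ?thesis .
qed

subsection \<open>Fourier coefficients\<close>

text \<open>The common form of all term-by-term integrations below: \<open>g n\<close> is typically
  a character or a power of a bounded function, and \<open>c n\<close> carries the decay.\<close>

lemma sums_integral_circ:
  fixes c :: "nat \<Rightarrow> complex" and g :: "nat \<Rightarrow> real \<Rightarrow> complex"
  assumes [measurable]: "h \<in> borel_measurable borel" "\<And>n. g n \<in> borel_measurable borel"
    and H: "\<And>t. norm (h t) \<le> H" and g: "\<And>n t. norm (g n t) \<le> 1"
    and c: "summable (\<lambda>n. norm (c n))"
  shows "(\<lambda>n. c n * (LINT t|circ. h t * g n t)) sums (LINT t|circ. h t * (\<Sum>n. c n * g n t))"
proof -
  have H0: "0 \<le> H" using H[of 0] norm_ge_zero[of "h 0"] by linarith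
  have b: "norm (c n * (h t * g n t)) \<le> H * norm (c n)" for n t
  proof -
    have "norm (h t) * norm (g n t) \<le> H * 1" using H g H0 by (intro mult_mono) auto
    then show ?thesis using mult_left_mono[of "norm (h t) * norm (g n t)" "H * 1" "norm (c n)"]
      by (simp add: norm_mult mult.commute)
  qed
  have int: "integrable circ (\<lambda>t. c n * (h t * g n t))" for n
    using b by (intro integrable_circ[where H = "H * norm (c n)"]) auto
  have "(\<lambda>n. LINT t|circ. c n * (h t * g n t)) sums (LINT t|circ. (\<Sum>n. c n * (h t * g n t)))"
  proof (rule sums_integral)
    show "AE t in circ. summable (\<lambda>n. norm (c n * (h t * g n t)))"
      by (rule AE_I2, rule summable_comparison_test'[OF summable_mult[OF c, of H], of 0])
         (simp only: real_norm_def abs_norm_cancel b)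
    have "norm (LINT t|circ. norm (c n * (h t * g n t))) \<le> H * norm (c n)" for n
    proof -
      have "(LINT t|circ. norm (c n * (h t * g n t))) \<le> (LINT t|circ. H * norm (c n))"
        using int by (intro integral_mono b integrable_norm) auto
      moreover have "0 \<le> (LINT t|circ. norm (c n * (h t * g n t)))"
        by (rule integral_nonneg_AE) (simp only: norm_ge_zero AE_I2)
      ultimately show ?thesis by (simp only: real_norm_def abs_of_nonneg integral_circ_const)
    qed
    then show "summable (\<lambda>n. LINT t|circ. norm (c n * (h t * g n t)))"
      by (rule summable_comparison_test'[OF summable_mult[OF c, of H], of 0])
  qed (rule int)
  moreover have "(\<Sum>n. c n * (h t * g n t)) = h t * (\<Sum>n. c n * g n t)" for t
  proof -
    have "summable (\<lambda>n. c n * g n t)"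
      by (rule summable_comparison_test'[OF c, of 0]) (simp add: norm_mult mult_left_le g)
    then show ?thesis by (subst suminf_mult[symmetric]) (auto simp: mult_ac)
  qed
  ultimately show ?thesis by simp
qed

lemma parseval_finite:
  fixes c :: "nat \<Rightarrow> complex" and \<kappa> :: "nat \<Rightarrow> int"
  assumes "finite I" "inj_on \<kappa> I"
  shows "(LINT t|circ. (cmod (\<Sum>i\<in>I. c i * cis (of_int (\<kappa> i) * t)))\<^sup>2) = (\<Sum>i\<in>I. (cmod (c i))\<^sup>2)"
proof -
  let ?s = "\<lambda>t. \<Sum>i\<in>I. c i * cis (of_int (\<kappa> i) * t)"
  have "of_real ((cmod (?s t))\<^sup>2) = (\<Sum>i\<in>I. \<Sum>j\<in>I. (c i * cnj (c j)) * cis (of_int (\<kappa> i - \<kappa> j) * t))" for t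
    by (simp only: complex_norm_square cnj_sum sum_product)
       (auto intro!: sum.cong simp: cis_cnj cis_mult algebra_simps)
  then have "of_real (LINT t|circ. (cmod (?s t))\<^sup>2)
     = (LINT t|circ. (\<Sum>i\<in>I. \<Sum>j\<in>I. (c i * cnj (c j)) * cis (of_int (\<kappa> i - \<kappa> j) * t)))"
    by (subst integral_complex_of_real[symmetric]) simp
  also have "\<dots> = (\<Sum>i\<in>I. \<Sum>j\<in>I. (c i * cnj (c j)) * (LINT t|circ. cis (of_int (\<kappa> i - \<kappa> j) * t)))"
  proof -
    have int: "integrable circ (\<lambda>t. (c i * cnj (c j)) * cis (of_int (\<kappa> i - \<kappa> j) * t))" for i j
      by (rule integrable_circ[where H = "cmod (c i * cnj (c j))"]) (auto simp: norm_mult)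
    have "(LINT t|circ. (\<Sum>i\<in>I. \<Sum>j\<in>I. (c i * cnj (c j)) * cis (of_int (\<kappa> i - \<kappa> j) * t)))
       = (\<Sum>i\<in>I. LINT t|circ. (\<Sum>j\<in>I. (c i * cnj (c j)) * cis (of_int (\<kappa> i - \<kappa> j) * t)))"
      by (intro Bochner_Integration.integral_sum Bochner_Integration.integrable_sum int)
    also have "\<dots> = (\<Sum>i\<in>I. \<Sum>j\<in>I. LINT t|circ. (c i * cnj (c j)) * cis (of_int (\<kappa> i - \<kappa> j) * t))"
      by (intro sum.cong refl Bochner_Integration.integral_sum int)
    finally show ?thesis by (simp only: integral_mult_right_zero)
  qed
  also have "\<dots> = (\<Sum>i\<in>I. \<Sum>j\<in>I. if i = j then c i * cnj (c j) else 0)"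
    unfolding integral_circ_cis
    using assms by (intro sum.cong refl) (auto simp: inj_on_def)
  also have "\<dots> = (\<Sum>i\<in>I. of_real ((cmod (c i))\<^sup>2))"
    using assms by (intro sum.cong refl) (simp only: complex_norm_square sum.delta' if_True)
  finally show ?thesis by (simp only: of_real_sum[symmetric] of_real_eq_iff)
qed

lemma bessel_inj:
  fixes h :: "real \<Rightarrow> complex" and \<kappa> :: "nat \<Rightarrow> int"
  assumes [measurable]: "h \<in> borel_measurable borel" and H: "\<And>t. t \<in> {-pi..pi} \<Longrightarrow> norm (h t) \<le> H"
    and I: "finite I" "inj_on \<kappa> I"
  shows "(\<Sum>i\<in>I. (cmod (LINT t|circ. h t * cis (of_int (\<kappa> i) * t)))\<^sup>2) \<le> (LINT t|circ. (cmod (h t))\<^sup>2)"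
proof -
  \<comment> \<open>The integrals pair \<open>h\<close> with characters without conjugation. The
    trigonometric sum with the conjugated integrals as coefficients is therefore the projection of
    \<open>cnj h\<close>, and the inequality is the nonnegativity of the squared distance between
    the two.\<close>
  define c where "c i = cnj (LINT t|circ. h t * cis (of_int (\<kappa> i) * t))" for i
  let ?s = "\<lambda>t. \<Sum>i\<in>I. c i * cis (of_int (\<kappa> i) * t)"
  have H0: "0 \<le> H" using H[of 0] norm_ge_zero[of "h 0"] pi_gt_zero by (smt (verit) atLeastAtMost_iff)
  have s_bd: "cmod (?s t) \<le> (\<Sum>i\<in>I. cmod (c i))" for t
    by (rule sum_norm_le) (simp add: norm_mult)
  have intc: "integrable circ (\<lambda>t. h t * cis (of_int (\<kappa> i) * t))" for i
    using H by (intro integrable_circ[where H = H]) (auto simp: norm_mult)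
  have int1: "integrable circ (\<lambda>t. (cmod (h t))\<^sup>2)"
    using H by (intro integrable_circ[where H = "H\<^sup>2"]) (auto simp: power_mono)
  have int3: "integrable circ (\<lambda>t. (cmod (?s t))\<^sup>2)"
    using s_bd by (intro integrable_circ[where H = "(\<Sum>i\<in>I. cmod (c i))\<^sup>2"]) (auto simp: power_mono)
  have ints: "integrable circ (\<lambda>t. h t * ?s t)"
  proof (rule integrable_circ[where H = "H * (\<Sum>i\<in>I. cmod (c i))"])
    fix t assume "t \<in> {-pi..pi}"
    then show "norm (h t * ?s t) \<le> H * (\<Sum>i\<in>I. cmod (c i))"
      unfolding norm_mult using H s_bd H0 by (intro mult_mono) auto
  qed simp
  have "(LINT t|circ. h t * ?s t) = (\<Sum>i\<in>I. c i * (LINT t|circ. h t * cis (of_int (\<kappa> i) * t)))"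
  proof -
    have "(LINT t|circ. h t * ?s t) = (LINT t|circ. (\<Sum>i\<in>I. c i * (h t * cis (of_int (\<kappa> i) * t))))"
      by (simp add: sum_distrib_left mult_ac)
    also have "\<dots> = (\<Sum>i\<in>I. LINT t|circ. c i * (h t * cis (of_int (\<kappa> i) * t)))"
      using intc by (intro Bochner_Integration.integral_sum) auto
    finally show ?thesis by simp
  qed
  also have "\<dots> = of_real (\<Sum>i\<in>I. (cmod (c i))\<^sup>2)"
    unfolding of_real_sum
    by (intro sum.cong refl) (simp only: complex_norm_square, simp add: c_def)
  finally have hs: "Re (LINT t|circ. h t * ?s t) = (\<Sum>i\<in>I. (cmod (c i))\<^sup>2)" by simp
  have ptw: "(cmod (cnj (h t) - ?s t))\<^sup>2 = (cmod (h t))\<^sup>2 + (cmod (?s t))\<^sup>2 - 2 * Re (h t * ?s t)" for t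
  proof -
    have gen: "(cmod (cnj x - y))\<^sup>2 = (cmod x)\<^sup>2 + (cmod y)\<^sup>2 - 2 * Re (x * y)" for x y
      by (simp only: cmod_power2) (simp add: power2_eq_square algebra_simps)
    show ?thesis by (rule gen)
  qed
  have "0 \<le> (LINT t|circ. (cmod (cnj (h t) - ?s t))\<^sup>2)"
    by (intro integral_nonneg_AE) auto
  also have "\<dots> = (LINT t|circ. (cmod (h t))\<^sup>2) + (LINT t|circ. (cmod (?s t))\<^sup>2) - 2 * Re (LINT t|circ. h t * ?s t)"
    unfolding ptw using int1 int3 ints
    by (simp del: Re_sum times_complex.simps)
  also have "(LINT t|circ. (cmod (?s t))\<^sup>2) = (\<Sum>i\<in>I. (cmod (c i))\<^sup>2)"
    by (rule parseval_finite[OF I])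
  finally show ?thesis unfolding hs by (simp add: c_def)
qed

text \<open>Integer thresholds make the frequencies collide. Every frequency value occurs at most
  \<mu> times, and \<open>bessel_inj\<close> is applied to one representative index per
  value.\<close>

lemma bessel:
  fixes h :: "real \<Rightarrow> complex" and \<kappa> :: "nat \<Rightarrow> int"
  assumes h: "h \<in> borel_measurable borel" "\<And>t. t \<in> {-pi..pi} \<Longrightarrow> norm (h t) \<le> H"
    and I: "finite I" and \<kappa>: "\<And>k. real (card {i\<in>I. \<kappa> i = k}) \<le> \<mu>"
  shows "(\<Sum>i\<in>I. (cmod (LINT t|circ. h t * cis (of_int (\<kappa> i) * t)))\<^sup>2) \<le> \<mu> * H\<^sup>2"
proof -
  define F where "F k = (cmod (LINT t|circ. h t * cis (of_int k * t)))\<^sup>2" for k :: int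
  have H0: "0 \<le> H" using h(2)[of 0] norm_ge_zero[of "h 0"] pi_gt_zero by (smt (verit) atLeastAtMost_iff)
  have \<mu>0: "0 \<le> \<mu>" using \<kappa>[of 0] by (meson of_nat_0_le_iff order_trans)
  define r where "r k = (SOME i. i \<in> I \<and> \<kappa> i = k)" for k
  have r: "r k \<in> I" "\<kappa> (r k) = k" if "k \<in> \<kappa> ` I" for k
    using that someI_ex[of "\<lambda>i. i \<in> I \<and> \<kappa> i = k"] unfolding r_def by auto
  have inj_r: "inj_on r (\<kappa> ` I)"
    by (rule inj_on_inverseI[where g = \<kappa>]) (rule r)
  have inj_k: "inj_on \<kappa> (r ` \<kappa> ` I)"
  proof (rule inj_on_inverseI[where g = r])
    fix x assume "x \<in> r ` \<kappa> ` I"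
    then obtain k where "k \<in> \<kappa> ` I" "x = r k" by blast
    then show "r (\<kappa> x) = x" using r(2)[of k] by simp
  qed
  have "(\<Sum>i\<in>I. F (\<kappa> i)) = (\<Sum>k\<in>\<kappa> ` I. \<Sum>i\<in>{i\<in>I. \<kappa> i = k}. F (\<kappa> i))"
    using I by (rule sum.image_gen)
  also have "\<dots> = (\<Sum>k\<in>\<kappa> ` I. real (card {i\<in>I. \<kappa> i = k}) * F k)"
    by (intro sum.cong) auto
  also have "\<dots> \<le> (\<Sum>k\<in>\<kappa> ` I. \<mu> * F k)"
    using \<kappa> by (intro sum_mono mult_right_mono) (auto simp: F_def)
  also have "\<dots> = \<mu> * (\<Sum>k\<in>\<kappa> ` I. F k)" by (simp add: sum_distrib_left)
  also have "(\<Sum>k\<in>\<kappa> ` I. F k) = (\<Sum>j\<in>r ` \<kappa> ` I. F (\<kappa> j))"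
    using inj_r r by (subst sum.reindex) (auto intro!: sum.cong)
  also have "\<dots> \<le> (LINT t|circ. (cmod (h t))\<^sup>2)"
    unfolding F_def using h I inj_k by (intro bessel_inj[where H = H]) auto
  also have "\<dots> \<le> (LINT t|circ. H\<^sup>2)"
  proof (rule integral_mono_AE)
    show "AE t in circ. (cmod (h t))\<^sup>2 \<le> H\<^sup>2"
      using AE_circ by (rule eventually_mono) (use h(2) in \<open>auto intro: power_mono\<close>)
    show "integrable circ (\<lambda>t. (cmod (h t))\<^sup>2)"
      using h by (intro integrable_circ[where H = "H\<^sup>2"]) (auto intro: power_mono)
  qed simp
  finally show ?thesis using \<mu>0 by (simp add: F_def mult_left_mono measure_circ)
qed

subsection \<open>Kernels of truncated Hankel matrices\<close>

definition pseries :: "(nat \<Rightarrow> complex) \<Rightarrow> complex \<Rightarrow> complex" where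
  "pseries B w = (\<Sum>n. B n * w ^ n)"

text \<open>One line of a truncated Hankel matrix: \<open>i\<close> is the fixed index and
  \<open>C\<close> its threshold. The power of \<open>X\<close> is the true index
  \<open>m + C\<close>, so that no phase depending on \<open>C\<close> has to be carried
  along.\<close>

definition tail_coeff :: "(nat \<Rightarrow> complex) \<Rightarrow> nat \<Rightarrow> nat \<Rightarrow> complex \<Rightarrow> complex" where
  "tail_coeff B C i X = (\<Sum>m. B (m + C + i) * X ^ (m + C))"

text \<open>The integral formula for \<open>tail_coeff\<close> with a real threshold \<open>c\<close> instead of an integer.\<close>

definition smooth_coeff :: "(nat \<Rightarrow> complex) \<Rightarrow> real \<Rightarrow> nat \<Rightarrow> real \<Rightarrow> real \<Rightarrow> complex" where
  "smooth_coeff B c i s \<phi> = (LINT a|circ. pseries B (cis (\<phi> - a)) * cis (- real i * (\<phi> - a))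
     * (of_real (s powr c) * cis (a * c)) / (1 - of_real s * cis a))"

lemma continuous_on_pseries:
  assumes "summable (\<lambda>n. norm (B n))"
  shows "continuous_on (cball 0 1) (pseries B)"
proof -
  have "uniform_limit (cball 0 1) (\<lambda>N w. \<Sum>n<N. B n * w ^ n) (\<lambda>w. \<Sum>n. B n * w ^ n) sequentially"
  proof (rule Weierstrass_m_test)
    fix n and w :: complex assume "w \<in> cball 0 1"
    then show "norm (B n * w ^ n) \<le> norm (B n)"
      by (simp add: norm_mult norm_power mult_left_le power_le_one)
  qed (rule assms)
  then have "continuous_on (cball 0 1) (\<lambda>w. \<Sum>n. B n * w ^ n)"
    by (rule uniform_limit_theorem[rotated]) (auto intro!: always_eventually continuous_intros)
  then show ?thesis by (simp add: pseries_def[abs_def])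
qed

lemma continuous_pseries_cis:
  assumes "summable (\<lambda>n. norm (B n))"
  shows "continuous_on UNIV (\<lambda>a. pseries B (cis (\<phi> - a)))"
  by (rule continuous_on_compose2[OF continuous_on_pseries[OF assms]]) (auto intro!: continuous_intros)

lemma pseries_measurable:
  assumes "summable (\<lambda>n. norm (B n))"
  shows "(\<lambda>a. pseries B (cis (\<phi> - a))) \<in> borel_measurable borel"
  by (rule borel_measurable_continuous_onI[OF continuous_pseries_cis[OF assms]])

lemma pseries_fourier:
  assumes "summable (\<lambda>n. norm (B n))"
  shows "(LINT a|circ. pseries B (cis (\<phi> - a)) * cis (- real i * (\<phi> - a)) * cis (real k * a))
    = B (k + i) * cis (real k * \<phi>)"
proof -
  define h where "h a = cis (- real i * (\<phi> - a)) * cis (real k * a)" for a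
  have [measurable]: "h \<in> borel_measurable borel" by (simp add: h_def[abs_def])
  have "(\<lambda>n. B n * (LINT a|circ. h a * cis (real n * (\<phi> - a)))) sums
      (LINT a|circ. h a * (\<Sum>n. B n * cis (real n * (\<phi> - a))))"
    by (rule sums_integral_circ[where H = 1]) (auto simp: h_def norm_mult assms)
  moreover have "(\<Sum>n. B n * cis (real n * (\<phi> - a))) = pseries B (cis (\<phi> - a))" for a
    by (simp only: pseries_def Complex.DeMoivre)
  moreover have "(LINT a|circ. h a * cis (real n * (\<phi> - a))) = (if n = k + i then cis (real k * \<phi>) else 0)" for n
  proof -
    have "h a * cis (real n * (\<phi> - a)) = cis ((real n - real i) * \<phi>) * cis (of_int (int k + int i - int n) * a)" for a
      by (simp add: h_def cis_mult algebra_simps)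
    then show ?thesis
      by (simp only: integral_mult_right_zero integral_circ_cis) auto
  qed
  ultimately have "(\<lambda>n. if n = k + i then B n * cis (real k * \<phi>) else 0) sums
      (LINT a|circ. h a * pseries B (cis (\<phi> - a)))"
    by (simp add: if_distrib cong: if_cong)
  then have "(LINT a|circ. h a * pseries B (cis (\<phi> - a))) = B (k + i) * cis (real k * \<phi>)"
    using sums_single[of "k + i" "\<lambda>n. B n * cis (real k * \<phi>)"] sums_unique2 by blast
  then show ?thesis by (simp add: h_def mult_ac)
qed

text \<open>The coefficients are recovered from the boundary values by
  \<open>pseries_fourier\<close>, and the geometric series started at \<open>C\<close> is summed
  under the integral. In this form the threshold is visible as an exponent, and the symbol enters
  through its boundary values.\<close>

lemma tail_coeff_integral:
  assumes B: "summable (\<lambda>n. norm (B n))" and A: "\<And>t. norm (pseries B (cis t)) \<le> A"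
    and s: "0 \<le> s" "s < 1"
  shows "tail_coeff B C i (of_real s * cis \<phi>) = (LINT a|circ. pseries B (cis (\<phi> - a)) * cis (- real i * (\<phi> - a))
     * (of_real s * cis a) ^ C / (1 - of_real s * cis a))"
    and "summable (\<lambda>m. B (m + C + i) * (of_real s * cis \<phi>) ^ (m + C))"
proof -
  define h where "h a = pseries B (cis (\<phi> - a)) * cis (- real i * (\<phi> - a))" for a
  note [measurable] = pseries_measurable[OF B]
  have [measurable]: "h \<in> borel_measurable borel" unfolding h_def by measurable
  have "summable (\<lambda>m. s ^ (m + C))"
    using s by (simp add: power_add summable_mult2)
  then have "(\<lambda>m. of_real (s ^ (m + C)) * (LINT a|circ. h a * cis (real (m + C) * a))) sums
      (LINT a|circ. h a * (\<Sum>m. of_real (s ^ (m + C)) * cis (real (m + C) * a)))"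
    using A s by (intro sums_integral_circ[where H = A]) (auto simp: h_def norm_mult norm_power)
  also have "(\<lambda>m. of_real (s ^ (m + C)) * (LINT a|circ. h a * cis (real (m + C) * a)))
      = (\<lambda>m. B (m + C + i) * (of_real s * cis \<phi>) ^ (m + C))"
  proof
    fix m
    have "(LINT a|circ. h a * cis (real (m + C) * a)) = B (m + C + i) * cis (real (m + C) * \<phi>)"
      unfolding h_def using pseries_fourier[OF B, of \<phi> i "m + C"] by simp
    then show "of_real (s ^ (m + C)) * (LINT a|circ. h a * cis (real (m + C) * a))
        = B (m + C + i) * (of_real s * cis \<phi>) ^ (m + C)"
      by (simp only: power_mult_distrib Complex.DeMoivre of_real_power mult_ac)
  qed
  also have "(\<lambda>a. h a * (\<Sum>m. of_real (s ^ (m + C)) * cis (real (m + C) * a)))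
      = (\<lambda>a. pseries B (cis (\<phi> - a)) * cis (- real i * (\<phi> - a))
          * (of_real s * cis a) ^ C / (1 - of_real s * cis a))"
  proof
    fix a
    have "(\<lambda>m. (of_real s * cis a) ^ C * (of_real s * cis a) ^ m) sums
        ((of_real s * cis a) ^ C * (1 / (1 - of_real s * cis a)))"
      using s by (intro sums_mult geometric_sums) (simp add: norm_mult)
    then have "(\<Sum>m. of_real (s ^ (m + C)) * cis (real (m + C) * a))
        = (of_real s * cis a) ^ C / (1 - of_real s * cis a)"
      by (simp only: power_add[symmetric] of_real_power Complex.DeMoivre[symmetric] power_mult_distrib[symmetric]
          add.commute[of C] sums_unique[symmetric] times_divide_eq_right mult_1_right)
    then show "h a * (\<Sum>m. of_real (s ^ (m + C)) * cis (real (m + C) * a))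
      = pseries B (cis (\<phi> - a)) * cis (- real i * (\<phi> - a))
          * (of_real s * cis a) ^ C / (1 - of_real s * cis a)"
      by (simp only: h_def times_divide_eq_right)
  qed
  finally have *: "(\<lambda>m. B (m + C + i) * (of_real s * cis \<phi>) ^ (m + C)) sums
    (LINT a|circ. pseries B (cis (\<phi> - a)) * cis (- real i * (\<phi> - a))
     * (of_real s * cis a) ^ C / (1 - of_real s * cis a))" .
  show "tail_coeff B C i (of_real s * cis \<phi>) = (LINT a|circ. pseries B (cis (\<phi> - a)) * cis (- real i * (\<phi> - a))
     * (of_real s * cis a) ^ C / (1 - of_real s * cis a))"
    unfolding tail_coeff_def using sums_unique[OF *] by simp
  show "summable (\<lambda>m. B (m + C + i) * (of_real s * cis \<phi>) ^ (m + C))"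
    using * by (rule sums_summable)
qed

text \<open>An affine condition on the index cuts out an order-convex set;
  \<open>geometric_sum_bound\<close> wants it as an interval.\<close>

lemma convex_nat_interval:
  assumes "finite S" "\<And>x y z. x \<in> S \<Longrightarrow> z \<in> S \<Longrightarrow> x \<le> y \<Longrightarrow> y \<le> z \<Longrightarrow> y \<in> S"
  shows "\<exists>a b::nat. S = {a..b}"
proof (cases "S = {}")
  case True then show ?thesis by (intro exI[of _ 1] exI[of _ 0]) auto
next
  case False
  have "S = {Min S..Max S}"
  proof
    show "S \<subseteq> {Min S..Max S}" using assms(1) by auto
    show "{Min S..Max S} \<subseteq> S"
    proof
      fix y assume "y \<in> {Min S..Max S}"
      then have "Min S \<le> y" "y \<le> Max S" by auto
      then show "y \<in> S"
        by (rule assms(2)[OF Min_in[OF assms(1) False] Max_in[OF assms(1) False]])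
    qed
  qed
  then show ?thesis by blast
qed

text \<open>The terms are small, but for a negative slope the ratio can have modulus \<rho> > 1, so
  the bound \<open>r ^ i\<close> is assumed for the terms and not for the ratio. The absolute sum
  gives 1 for the factor \<open>1 - r\<close>; telescoping gives two end terms, hence 6 = 3 * 2 for
  the chord.\<close>

lemma geometric_sum_bound:
  fixes z :: "nat \<Rightarrow> complex"
  assumes z: "\<And>i. i \<in> {a..b} \<Longrightarrow> norm (z i) \<le> r ^ i" and r: "0 \<le> r" "r < 1"
    and q: "\<And>i. z (Suc i) = z i * (of_real \<rho> * cis \<theta>)" and \<rho>: "\<rho> > 0"
  shows "norm (\<Sum>i\<in>{a..b}. z i) * (1 - r + chord \<theta>) \<le> 7"
proof (cases "a \<le> b")
  case ab: True
  let ?S = "\<Sum>i\<in>{a..b}. z i"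
  have "norm ?S \<le> (\<Sum>i\<in>{a..b}. r ^ i)" using z by (rule sum_norm_le)
  also have "\<dots> \<le> (\<Sum>i. r ^ i)" using r by (intro sum_le_suminf) auto
  also have "\<dots> = 1 / (1 - r)" using r by (simp add: suminf_geometric)
  finally have 1: "norm ?S * (1 - r) \<le> 1" using r by (simp add: field_simps)
  have le1: "norm (z i) \<le> 1" if "i \<in> {a..b}" for i
    using z[OF that] power_le_one[of r i] r by linarith
  have 2: "norm ?S * chord \<theta> \<le> 6"
  proof (cases "\<rho> \<le> 1")
    case True
    let ?q = "of_real \<rho> * cis \<theta>"
    have "(\<Sum>i\<in>{a..b}. z (Suc i) - z i) = z (Suc b) - z a"
      using ab by (intro sum_Suc_diff) auto
    then have "(\<Sum>i\<in>{a..b}. z (Suc i)) - ?S = z (Suc b) - z a"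
      by (simp only: sum_subtractf)
    moreover have "(\<Sum>i\<in>{a..b}. z (Suc i)) = ?S * ?q"
      by (simp only: q sum_distrib_right)
    ultimately have "?S * ?q - ?S = z b * ?q - z a" by (simp only: q)
    then have "?S * (1 - ?q) = z a - z b * ?q"
      by (simp add: algebra_simps)
    then have "norm ?S * norm (1 - ?q) = norm (z a - z b * ?q)" by (metis norm_mult)
    also have "\<dots> \<le> norm (z a) + norm (z b) * \<rho>"
      using norm_triangle_ineq4[of "z a" "z b * ?q"] \<rho> by (simp add: norm_mult)
    also have "\<dots> \<le> 1 + 1 * 1"
      using le1 ab \<rho> True by (intro add_mono mult_mono) auto
    finally have *: "norm ?S * norm (1 - ?q) \<le> 2" by simp
    have "chord \<theta> \<le> 3 * norm (1 - ?q)"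
      using one_minus_cis_ge[of \<rho> \<theta>] True \<rho> by simp
    then have "norm ?S * chord \<theta> \<le> norm ?S * (3 * norm (1 - ?q))" by (intro mult_left_mono) auto
    then show ?thesis using * by simp
  next
    case False
    \<comment> \<open>For \<rho> > 1 the progression is run backwards, so that the ratio again lies
      in the closed disc and \<open>one_minus_cis_ge\<close> applies; the chord is even in the
      angle.\<close>
    let ?q = "of_real (1 / \<rho>) * cis (- \<theta>)"
    have inv: "of_real \<rho> * cis \<theta> * ?q = 1"
      using \<rho> by (simp add: cis_mult mult_ac mult.left_commute[of "cis \<theta>"])
    have zi: "z i = z (Suc i) * ?q" for i using q[of i] inv by (simp only: mult.assoc mult_1_right)
    have "(\<Sum>i\<in>{a..b}. z (Suc i) - z i) = z (Suc b) - z a"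
      using ab by (intro sum_Suc_diff) auto
    then have "(\<Sum>i\<in>{a..b}. z (Suc i)) - ?S = z (Suc b) - z a"
      by (simp only: sum_subtractf)
    then have "((\<Sum>i\<in>{a..b}. z (Suc i)) - ?S) * ?q = (z (Suc b) - z a) * ?q" by simp
    then have "(\<Sum>i\<in>{a..b}. z (Suc i)) * ?q - ?S * ?q = z (Suc b) * ?q - z a * ?q"
      by (simp only: left_diff_distrib)
    also have "(\<Sum>i\<in>{a..b}. z (Suc i)) * ?q = ?S"
      unfolding sum_distrib_right by (intro sum.cong refl zi[symmetric])
    also have "z (Suc b) * ?q = z b" by (rule zi[symmetric])
    finally have "?S * (1 - ?q) = z b - z a * ?q" by (simp only: right_diff_distrib mult_1_right)
    then have "norm ?S * norm (1 - ?q) = norm (z b - z a * ?q)" by (metis norm_mult)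
    also have "\<dots> \<le> norm (z b) + norm (z a) * (1 / \<rho>)"
      using norm_triangle_ineq4[of "z b" "z a * ?q"] \<rho> by (simp add: norm_mult norm_divide)
    also have "\<dots> \<le> 1 + 1 * 1"
      using le1 ab \<rho> False by (intro add_mono mult_mono) auto
    finally have *: "norm ?S * norm (1 - ?q) \<le> 2" by simp
    have "(1 - 1 / \<rho>) + chord (- \<theta>) \<le> 3 * norm (1 - ?q)"
      using False \<rho> by (intro one_minus_cis_ge) auto
    moreover have "1 / \<rho> \<le> 1" using False by simp
    ultimately have "chord \<theta> \<le> 3 * norm (1 - ?q)" by (simp only: chord_minus)
    then have "norm ?S * chord \<theta> \<le> norm ?S * (3 * norm (1 - ?q))" by (intro mult_left_mono) auto
    then show ?thesis using * by simp
  qed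
  show ?thesis using 1 2 by (simp add: distrib_left)
qed simp

definition kern_const :: "real \<Rightarrow> real \<Rightarrow> real" where
  "kern_const \<kappa> L = (2 + 4 * L) * ((3 + L) * (2 powr (1 + \<kappa>) / \<kappa>))"

text \<open>By the triangle inequality the larger of the two factors is at least a constant times
  \<open>D + chord \<theta>\<close>. It is used to the power \<kappa> - 1, while the remaining
  -\<kappa> goes to the smaller factor, whose power -1-\<kappa> integrates to
  \<open>D powr (-\<kappa>)\<close>. With \<kappa> = 0 a logarithm would appear.\<close>

lemma chord_product_integral:
  assumes \<kappa>: "0 < \<kappa>" "\<kappa> < 1" and D: "0 < D" and l: "\<bar>l\<bar> \<le> L" "1 \<le> L * \<bar>l\<bar>" and L: "1 \<le> L"
  shows "(\<integral>\<^sup>+a. ennreal (1 / ((D + chord a) * (D + chord (\<theta> + l * a)))) \<partial>circ)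
    \<le> ennreal (kern_const \<kappa> L * (D powr (-\<kappa>) * (D + chord \<theta>) powr (\<kappa> - 1)))"
proof -
  have l0: "l \<noteq> 0" using l by auto
  define N where "N = 2 + 4 * L"
  define p where "p = (D + chord \<theta>) powr (\<kappa> - 1)"
  have ptw: "1 / ((D + chord a) * (D + chord (\<theta> + l * a)))
      \<le> N * p * ((D + chord a) powr (-1-\<kappa>) + (D + chord (\<theta> + l * a)) powr (-1-\<kappa>))"
    if a: "a \<in> {-pi..pi}" for a
  proof -
    define X where "X = D + chord a"
    define Y where "Y = D + chord (\<theta> + l * a)"
    have X0: "X > 0" "Y > 0" using D chord_nonneg by (auto simp: X_def Y_def add_pos_nonneg)
    have "chord \<theta> \<le> chord (\<theta> + l * a) + chord (- (l * a))"
      using chord_add[of "\<theta> + l * a" "- (l * a)"] by simp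
    moreover have "chord (l * a) \<le> 2 * L * chord a"
    proof -
      have "chord (l * a) \<le> \<bar>l\<bar> * \<bar>a\<bar>" using chord_le_abs[of "l * a"] by (simp add: abs_mult)
      also have "\<dots> \<le> L * (2 * chord a)"
      proof -
        have "\<bar>a\<bar> \<le> pi" using a by auto
        from chord_ge_abs[OF this] show ?thesis using l by (intro mult_mono) auto
      qed
      finally show ?thesis by simp
    qed
    moreover have "2 * L * chord a \<le> 2 * L * X" using D L by (intro mult_left_mono) (auto simp: X_def)
    moreover have "0 \<le> 2 * L * Y" "0 \<le> X" using X0 L by auto
    ultimately have "D + chord \<theta> \<le> (1 + 2 * L) * (X + Y)"
      by (simp add: Y_def algebra_simps)
    also have "\<dots> \<le> (1 + 2 * L) * (2 * max X Y)" using L by (intro mult_left_mono) auto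
    finally have le: "D + chord \<theta> \<le> N * max X Y" by (simp add: N_def algebra_simps)
    have N1: "N \<ge> 1" using L by (simp add: N_def)
    have "(N * max X Y) powr (\<kappa> - 1) \<le> p"
      unfolding p_def using le D \<kappa> by (intro powr_mono2') (auto simp: add_pos_nonneg)
    then have "N powr (\<kappa> - 1) * (max X Y) powr (\<kappa> - 1) \<le> p"
      using N1 X0 by (subst (asm) powr_mult) auto
    then have "N * (N powr (\<kappa> - 1) * (max X Y) powr (\<kappa> - 1)) \<le> N * p" using N1 by (intro mult_left_mono) auto
    moreover have "1 * (max X Y) powr (\<kappa> - 1) \<le> (N * N powr (\<kappa> - 1)) * (max X Y) powr (\<kappa> - 1)"
    proof (rule mult_right_mono)
      have "N * N powr (\<kappa> - 1) = N powr \<kappa>" using N1 by (simp add: powr_mult_base)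
      then show "1 \<le> N * N powr (\<kappa> - 1)" using N1 \<kappa> by (simp add: ge_one_powr_ge_zero)
    qed simp
    ultimately have maxle: "(max X Y) powr (\<kappa> - 1) \<le> N * p" by (simp add: mult.assoc)
    \<comment> \<open>The larger factor \<open>V\<close> keeps only the exponent \<kappa> - 1; the
      rest of it is traded for the same power of \<open>U\<close>.\<close>
    have split: "1 / (U * V) \<le> V powr (\<kappa> - 1) * U powr (-1-\<kappa>)" if "0 < U" "U \<le> V" for U V :: real
    proof -
      have "1 / (U * V) = U powr (-1) * V powr (-1)"
        using that by (simp add: powr_minus_divide)
      also have "V powr (-1) = V powr (\<kappa> - 1) * V powr (-\<kappa>)"
        by (simp add: powr_add[symmetric])
      also have "U powr (-1) * (V powr (\<kappa> - 1) * V powr (-\<kappa>)) \<le> U powr (-1) * (V powr (\<kappa> - 1) * U powr (-\<kappa>))"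
        using that \<kappa> by (intro mult_left_mono powr_mono2') auto
      also have "\<dots> = V powr (\<kappa> - 1) * (U powr (-1) * U powr (-\<kappa>))" by (simp only: mult_ac)
      also have "U powr (-1) * U powr (-\<kappa>) = U powr (-1-\<kappa>)"
        by (simp only: powr_add[symmetric] diff_conv_add_uminus)
      finally show ?thesis .
    qed
    have "1 / (X * Y) \<le> (max X Y) powr (\<kappa> - 1) * (X powr (-1-\<kappa>) + Y powr (-1-\<kappa>))"
    proof (cases "X \<le> Y")
      case True
      then have "1 / (X * Y) \<le> Y powr (\<kappa> - 1) * X powr (-1-\<kappa>)" using split X0 by blast
      also have "\<dots> \<le> Y powr (\<kappa> - 1) * (X powr (-1-\<kappa>) + Y powr (-1-\<kappa>))" by (intro mult_left_mono) auto
      finally show ?thesis using True by (simp add: max_def)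
    next
      case False
      then have "1 / (Y * X) \<le> X powr (\<kappa> - 1) * Y powr (-1-\<kappa>)" using split X0 by (simp add: less_imp_le)
      also have "\<dots> \<le> X powr (\<kappa> - 1) * (X powr (-1-\<kappa>) + Y powr (-1-\<kappa>))" by (intro mult_left_mono) auto
      finally show ?thesis using False by (simp add: max_def mult.commute)
    qed
    also have "\<dots> \<le> N * p * (X powr (-1-\<kappa>) + Y powr (-1-\<kappa>))"
      using maxle by (intro mult_right_mono) auto
    finally show ?thesis by (simp add: X_def Y_def)
  qed
  define Z where "Z = 2 powr (1 + \<kappa>) / \<kappa> * D powr (-\<kappa>)"
  have Np: "0 \<le> N * p" using L by (simp add: N_def p_def)
  have Z: "0 \<le> Z" using \<kappa> by (simp add: Z_def)
  have "(\<integral>\<^sup>+a. ennreal (1 / ((D + chord a) * (D + chord (\<theta> + l * a)))) \<partial>circ)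
     \<le> (\<integral>\<^sup>+a. ennreal (N * p) * (ennreal ((D + chord a) powr (-1-\<kappa>)) + ennreal ((D + chord (\<theta> + l * a)) powr (-1-\<kappa>))) \<partial>circ)"
    by (intro nn_integral_circ_mono)
       (use ptw Np in \<open>auto simp: ennreal_mult'[symmetric] ennreal_plus[symmetric] ennreal_leI simp del: ennreal_plus\<close>)
  also have "\<dots> = ennreal (N * p) * ((\<integral>\<^sup>+a. ennreal ((D + chord a) powr (-1-\<kappa>)) \<partial>circ)
      + (\<integral>\<^sup>+a. ennreal ((D + chord (\<theta> + l * a)) powr (-1-\<kappa>)) \<partial>circ))"
    by (simp add: nn_integral_cmult nn_integral_add)
  also have "\<dots> \<le> ennreal (N * p) * (ennreal Z + ennreal ((1 + 1 / \<bar>l\<bar>) * (2 powr (1 + \<kappa>) / \<kappa>) * D powr (-\<kappa>)))"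
    unfolding Z_def using \<kappa> D l0 by (intro mult_left_mono add_mono chord_integral_base chord_integral) auto
  also have "(1 + 1 / \<bar>l\<bar>) * (2 powr (1 + \<kappa>) / \<kappa>) * D powr (-\<kappa>) = (1 + 1 / \<bar>l\<bar>) * Z"
    by (simp add: Z_def)
  also have "ennreal (N * p) * (ennreal Z + ennreal ((1 + 1 / \<bar>l\<bar>) * Z)) = ennreal (N * p * (Z + (1 + 1 / \<bar>l\<bar>) * Z))"
    using Np Z by (subst ennreal_plus[symmetric]) (auto simp: ennreal_mult')
  also have "\<dots> \<le> ennreal (N * p * ((3 + L) * Z))"
  proof (intro ennreal_leI mult_left_mono Np)
    have "1 / \<bar>l\<bar> \<le> L" using l l0 by (simp add: field_simps)
    then have "(1 + 1 / \<bar>l\<bar>) * Z \<le> (1 + L) * Z" using Z by (intro mult_right_mono) auto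
    then show "Z + (1 + 1 / \<bar>l\<bar>) * Z \<le> (3 + L) * Z" using Z by (simp add: algebra_simps)
  qed
  also have "N * p * ((3 + L) * Z) = kern_const \<kappa> L * (D powr (-\<kappa>) * (D + chord \<theta>) powr (\<kappa> - 1))"
    by (simp add: kern_const_def N_def p_def Z_def)
  finally show ?thesis .
qed

text \<open>A real affine threshold turns the sum over \<open>i\<close> inside the integral into a
  geometric one. Its bound and the bound of the Cauchy denominator are the two factors in
  \<open>chord_product_integral\<close>, applied with slopes 1 and
  \<open>1 + \<beta>\<close>.\<close>

lemma smooth_sum_bound:
  fixes \<beta> \<gamma> \<eta> \<phi> :: real
  assumes B: "summable (\<lambda>n. norm (B n))" and A: "\<And>t. norm (pseries B (cis t)) \<le> A"
    and s: "0 < s" "s \<le> r" and r: "r < 1" and r': "0 < r'" "r' \<le> r"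
    and \<kappa>: "0 < \<kappa>" "\<kappa> < 1" and L: "1 \<le> L" "\<bar>1 + \<beta>\<bar> \<le> L" "1 \<le> L * \<bar>1 + \<beta>\<bar>"
  shows "norm (\<Sum>i\<in>{i0..i1}. (of_real r' * cis \<eta>) ^ i * smooth_coeff B (max 0 (\<beta> * real i + \<gamma>)) i s \<phi>)
    \<le> 42 * A * kern_const \<kappa> L * ((1 - r) powr (-\<kappa>) * (1 - r + chord (\<eta> - \<phi>)) powr (\<kappa> - 1))"
proof -
  note [measurable] = pseries_measurable[OF B]
  define D where "D = 1 - r"
  define \<theta> where "\<theta> = \<eta> - \<phi>"
  define c where "c i = max 0 (\<beta> * real i + \<gamma>)" for i :: nat
  define P where "P a = pseries B (cis (\<phi> - a))" for a
  have [measurable]: "P \<in> borel_measurable borel" unfolding P_def by measurable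
  have D: "0 < D" using r by (simp add: D_def)
  have A0: "0 \<le> A" using A[of 0] norm_ge_zero order_trans by blast
  have P: "norm (P a) \<le> A" for a by (simp add: P_def A)
  define z where "z a i = (of_real r' * cis (\<theta> + a)) ^ i * (of_real (s powr c i) * cis (a * c i))" for a i
  have den: "D + chord a \<le> 3 * norm (1 - of_real s * cis a)" for a
    using one_minus_cis_ge[of s a] s r by (simp add: D_def)
  have den0: "norm (1 - of_real s * cis a) > 0" for a
    using den[of a] D chord_nonneg[of a] by (smt (verit))
  \<comment> \<open>Where the threshold is positive, each step in \<open>i\<close> turns the phase
    by \<open>\<theta> + (1 + \<beta>) * a\<close>; where it is cut off at 0, by
    \<open>\<theta> + a\<close>. Both index sets are intervals, so two geometric sums
    suffice.\<close>
  have zsum: "norm (\<Sum>i\<in>{i0..i1}. z a i) \<le> 7 * (1 / (D + chord (\<theta> + 1 * a)) + 1 / (D + chord (\<theta> + (1 + \<beta>) * a)))" for a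
  proof -
    define zP where "zP i = (of_real r' * cis (\<theta> + a)) ^ i * (of_real (s powr (\<beta> * real i + \<gamma>)) * cis (a * (\<beta> * real i + \<gamma>)))" for i :: nat
    define zN where "zN i = (of_real r' * cis (\<theta> + a)) ^ i" for i :: nat
    define U where "U = {i \<in> {i0..i1}. 0 < \<beta> * real i + \<gamma>}"
    define V where "V = {i \<in> {i0..i1}. \<beta> * real i + \<gamma> \<le> 0}"
    have U: "\<exists>a b. U = {a..b}"
    proof (rule convex_nat_interval)
      fix x y w assume *: "x \<in> U" "w \<in> U" "x \<le> y" "y \<le> w"
      have "0 < \<beta> * real y + \<gamma>"
      proof (cases "\<beta> \<ge> 0")
        case True
        then have "\<beta> * real x \<le> \<beta> * real y" using * by (intro mult_left_mono) auto
        then show ?thesis using * by (auto simp: U_def)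
      next
        case False
        then have "\<beta> * real w \<le> \<beta> * real y" using * by (intro mult_left_mono_neg) auto
        then show ?thesis using * by (auto simp: U_def)
      qed
      then show "y \<in> U" using * by (auto simp: U_def)
    qed (simp add: U_def)
    have V: "\<exists>a b. V = {a..b}"
    proof (rule convex_nat_interval)
      fix x y w assume *: "x \<in> V" "w \<in> V" "x \<le> y" "y \<le> w"
      have "\<beta> * real y + \<gamma> \<le> 0"
      proof (cases "\<beta> \<ge> 0")
        case True
        then have "\<beta> * real y \<le> \<beta> * real w" using * by (intro mult_left_mono) auto
        then show ?thesis using * by (auto simp: V_def)
      next
        case False
        then have "\<beta> * real y \<le> \<beta> * real x" using * by (intro mult_left_mono_neg) auto
        then show ?thesis using * by (auto simp: V_def)
      qed
      then show "y \<in> V" using * by (auto simp: V_def)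
    qed (simp add: V_def)
    have aux: "x \<le> 7 * (1 / (D + d))" if "x * (1 - r + d) \<le> 7" "0 \<le> d" for x d :: real
      using that D by (simp add: D_def pos_le_divide_eq add_pos_nonneg)
    have pow: "r' ^ i \<le> r ^ i" for i using r' by (intro power_mono) auto
    have s1: "s powr x \<le> 1" if "0 \<le> x" for x
      using powr_mono'[of 0 x s] that s r by simp
    have "norm (\<Sum>i\<in>U. zP i) * (1 - r + chord (\<theta> + (1 + \<beta>) * a)) \<le> 7"
    proof -
      obtain u v where uv: "U = {u..v}" using U by blast
      show ?thesis unfolding uv
      proof (rule geometric_sum_bound[where \<rho> = "r' * s powr \<beta>"])
        fix i assume "i \<in> {u..v}"
        then have "i \<in> U" by (simp only: uv)
        then have "0 < \<beta> * real i + \<gamma>" by (simp add: U_def)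
        then have "r' ^ i * s powr (\<beta> * real i + \<gamma>) \<le> r ^ i * 1"
          using pow s1 r' s by (intro mult_mono) auto
        then show "norm (zP i) \<le> r ^ i" using r' by (simp add: zP_def norm_mult norm_power)
      next
        fix i
        have "s powr (\<beta> * real (Suc i) + \<gamma>) = s powr (\<beta> * real i + \<gamma>) * s powr \<beta>"
          by (simp add: powr_add[symmetric] algebra_simps)
        moreover have "cis (a * (\<beta> * real (Suc i) + \<gamma>)) = cis (a * (\<beta> * real i + \<gamma>)) * cis (a * \<beta>)"
          by (simp add: cis_mult algebra_simps)
        moreover have "cis (\<theta> + (1 + \<beta>) * a) = cis (\<theta> + a) * cis (a * \<beta>)"
          by (simp add: cis_mult algebra_simps)
        ultimately show "zP (Suc i) = zP i * (of_real (r' * s powr \<beta>) * cis (\<theta> + (1 + \<beta>) * a))"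
          by (simp only: zP_def power_Suc of_real_mult mult_ac)
      qed (use r' r s in auto)
    qed
    then have 1: "norm (\<Sum>i\<in>U. zP i) \<le> 7 * (1 / (D + chord (\<theta> + (1 + \<beta>) * a)))"
      by (rule aux) simp
    have "norm (\<Sum>i\<in>V. zN i) * (1 - r + chord (\<theta> + a)) \<le> 7"
    proof -
      obtain u v where uv: "V = {u..v}" using V by blast
      show ?thesis unfolding uv
        using r' r pow by (intro geometric_sum_bound[where \<rho> = "r'"]) (auto simp: zN_def norm_mult norm_power)
    qed
    then have 2: "norm (\<Sum>i\<in>V. zN i) \<le> 7 * (1 / (D + chord (\<theta> + a)))"
      by (rule aux) simp
    have "(\<Sum>i\<in>{i0..i1}. z a i) = (\<Sum>i\<in>U \<union> V. z a i)"
      by (intro sum.cong) (auto simp: U_def V_def)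
    also have "\<dots> = (\<Sum>i\<in>U. z a i) + (\<Sum>i\<in>V. z a i)"
      by (intro sum.union_disjoint) (auto simp: U_def V_def)
    also have "(\<Sum>i\<in>U. z a i) = (\<Sum>i\<in>U. zP i)"
      by (intro sum.cong refl) (simp add: U_def z_def zP_def c_def max_def)
    also have "(\<Sum>i\<in>V. z a i) = (\<Sum>i\<in>V. zN i)"
      using s by (intro sum.cong refl) (simp add: V_def z_def zN_def c_def max_absorb1)
    finally have "norm (\<Sum>i\<in>{i0..i1}. z a i) \<le> norm (\<Sum>i\<in>U. zP i) + norm (\<Sum>i\<in>V. zN i)"
      by (simp only: norm_triangle_ineq)
    then show ?thesis using 1 2 by simp
  qed
  define F where "F i a = P a * cis (- real i * (\<phi> - a)) * (of_real (s powr c i) * cis (a * c i)) / (1 - of_real s * cis a)" for i a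
  have [measurable]: "F i \<in> borel_measurable borel" for i unfolding F_def by measurable
  have den_ge: "1 - s \<le> norm (1 - of_real s * cis a)" for a
    using norm_triangle_ineq2[of 1 "of_real s * cis a"] s by (simp add: norm_mult)
  have intF: "integrable circ (\<lambda>a. (of_real r' * cis \<eta>) ^ i * F i a)" for i
  proof (intro integrable_mult_right integrable_circ[where H = "A * s powr c i / (1 - s)"])
    fix a
    show "norm (F i a) \<le> A * s powr c i / (1 - s)"
      using P den_ge[of a] s r A0 by (simp add: F_def norm_mult norm_divide frac_le mult_right_mono)
  qed simp
  have "(\<Sum>i\<in>{i0..i1}. (of_real r' * cis \<eta>) ^ i * smooth_coeff B (max 0 (\<beta> * real i + \<gamma>)) i s \<phi>)
      = (\<Sum>i\<in>{i0..i1}. LINT a|circ. (of_real r' * cis \<eta>) ^ i * F i a)"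
    unfolding smooth_coeff_def F_def c_def P_def by (intro sum.cong refl integral_mult_right_zero[symmetric])
  also have "\<dots> = (LINT a|circ. (\<Sum>i\<in>{i0..i1}. (of_real r' * cis \<eta>) ^ i * F i a))"
    by (intro Bochner_Integration.integral_sum[symmetric] intF)
  also have "\<dots> = (LINT a|circ. P a / (1 - of_real s * cis a) * (\<Sum>i\<in>{i0..i1}. z a i))"
  proof (intro Bochner_Integration.integral_cong refl)
    fix a
    have "(of_real r' * cis \<eta>) ^ i * cis (- real i * (\<phi> - a)) = (of_real r' * cis (\<theta> + a)) ^ i" for i
      by (simp only: power_mult_distrib Complex.DeMoivre mult.assoc cis_mult)
         (simp add: \<theta>_def algebra_simps)
    moreover have "x * (p * c * w / d) = p / d * ((x * c) * w)" for x p c w d :: complex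
      by (simp add: mult_ac)
    ultimately have "(of_real r' * cis \<eta>) ^ i * F i a = P a / (1 - of_real s * cis a) * z a i" for i
      by (simp only: F_def z_def)
    then show "(\<Sum>i\<in>{i0..i1}. (of_real r' * cis \<eta>) ^ i * F i a) = P a / (1 - of_real s * cis a) * (\<Sum>i\<in>{i0..i1}. z a i)"
      by (simp only: sum_distrib_left)
  qed
  finally have eq: "(\<Sum>i\<in>{i0..i1}. (of_real r' * cis \<eta>) ^ i * smooth_coeff B (max 0 (\<beta> * real i + \<gamma>)) i s \<phi>)
     = (LINT a|circ. P a / (1 - of_real s * cis a) * (\<Sum>i\<in>{i0..i1}. z a i))" .
  define k1 where "k1 a = 1 / ((D + chord a) * (D + chord (\<theta> + 1 * a)))" for a
  define k2 where "k2 a = 1 / ((D + chord a) * (D + chord (\<theta> + (1 + \<beta>) * a)))" for a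
  have k0: "0 \<le> k1 a" "0 \<le> k2 a" for a using D chord_nonneg by (auto simp: k1_def k2_def intro!: mult_nonneg_nonneg add_nonneg_nonneg)
  have [measurable]: "k1 \<in> borel_measurable borel" "k2 \<in> borel_measurable borel"
    unfolding k1_def k2_def by measurable
  have ptw: "norm (P a / (1 - of_real s * cis a) * (\<Sum>i\<in>{i0..i1}. z a i)) \<le> 21 * A * (k1 a + k2 a)" for a
  proof -
    have Da: "D + chord a > 0" using D chord_nonneg[of a] by linarith
    have "norm (P a / (1 - of_real s * cis a)) \<le> A * (3 / (D + chord a))"
    proof -
      have "1 / norm (1 - of_real s * cis a) \<le> 3 / (D + chord a)"
        using den[of a] den0[of a] Da by (simp add: field_simps)
      then have "norm (P a) * (1 / norm (1 - of_real s * cis a)) \<le> A * (3 / (D + chord a))"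
        using P A0 by (intro mult_mono) auto
      then show ?thesis by (simp add: norm_divide)
    qed
    then have "norm (P a / (1 - of_real s * cis a) * (\<Sum>i\<in>{i0..i1}. z a i))
      \<le> A * (3 / (D + chord a)) * (7 * (1 / (D + chord (\<theta> + 1 * a)) + 1 / (D + chord (\<theta> + (1 + \<beta>) * a))))"
      unfolding norm_mult using zsum[of a] A0 Da by (intro mult_mono) auto
    also have "\<dots> = 21 * A * (k1 a + k2 a)"
      by (simp add: k1_def k2_def distrib_left)
    finally show ?thesis .
  qed
  define w where "w = D powr (-\<kappa>) * (D + chord \<theta>) powr (\<kappa> - 1)"
  have w0: "0 \<le> w" by (simp add: w_def)
  have K0: "0 \<le> kern_const \<kappa> L" using \<kappa> L by (simp add: kern_const_def)
  have "ennreal (norm (LINT a|circ. P a / (1 - of_real s * cis a) * (\<Sum>i\<in>{i0..i1}. z a i)))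
     \<le> (\<integral>\<^sup>+a. ennreal (norm (P a / (1 - of_real s * cis a) * (\<Sum>i\<in>{i0..i1}. z a i))) \<partial>circ)"
    by (rule norm_integral_circ_le)
  also have "\<dots> \<le> (\<integral>\<^sup>+a. ennreal (21 * A) * (ennreal (k1 a) + ennreal (k2 a)) \<partial>circ)"
  proof (rule nn_integral_mono)
    fix a
    have "ennreal (21 * A) * (ennreal (k1 a) + ennreal (k2 a)) = ennreal (21 * A * (k1 a + k2 a))"
      using k0 A0 by (simp add: ennreal_mult' ennreal_plus[symmetric] del: ennreal_plus)
    then show "ennreal (norm (P a / (1 - of_real s * cis a) * (\<Sum>i\<in>{i0..i1}. z a i)))
        \<le> ennreal (21 * A) * (ennreal (k1 a) + ennreal (k2 a))"
      by (simp only: ennreal_leI[OF ptw])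
  qed
  also have "\<dots> = ennreal (21 * A) * ((\<integral>\<^sup>+a. ennreal (k1 a) \<partial>circ) + (\<integral>\<^sup>+a. ennreal (k2 a) \<partial>circ))"
    by (simp add: nn_integral_cmult nn_integral_add)
  also have "\<dots> \<le> ennreal (21 * A) * (ennreal (kern_const \<kappa> L * w) + ennreal (kern_const \<kappa> L * w))"
    unfolding k1_def k2_def w_def using L \<kappa> D
    by (intro mult_left_mono add_mono chord_product_integral) auto
  \<comment> \<open>42 = 2 * 3 * 7: two index ranges, the constant of
    \<open>one_minus_cis_ge\<close> for the denominator, and that of
    \<open>geometric_sum_bound\<close>.\<close>
  also have "\<dots> = ennreal (42 * A * kern_const \<kappa> L * w)"
    using K0 w0 A0 by (subst ennreal_plus[symmetric]) (auto simp: ennreal_mult'[symmetric] algebra_simps)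
  finally show ?thesis unfolding eq using K0 w0 A0
    by (subst (asm) ennreal_le_iff) (auto simp: w_def D_def \<theta>_def)
qed

section \<open>The error caused by integer thresholds\<close>

lemma card_spread:
  assumes "finite S" "\<And>x y. x \<in> S \<Longrightarrow> y \<in> S \<Longrightarrow> real x - real y \<le> d" "0 \<le> d"
  shows "real (card S) \<le> d + 1"
proof (cases "S = {}")
  case False
  have "card S \<le> card {Min S..Max S}" using assms by (intro card_mono) auto
  then have "real (card S) \<le> real (Max S) - real (Min S) + 1"
    using Min_le[OF assms(1) Max_in[OF assms(1) False]] by simp
  also have "\<dots> \<le> d + 1"
    using assms(2)[OF Max_in[OF assms(1) False] Min_in[OF assms(1) False]] by simp
  finally show ?thesis .
qed (use assms in auto)

text \<open>With a positive threshold, \<open>i + C i\<close> follows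
  \<open>(1 + \<beta>) * i\<close> up to a rounding error in [0, 1], so indices on one level differ
  by at most \<open>L\<close>. With threshold 0 the value of \<open>C i\<close> is 0 or 1 and two
  indices are possible. The two counts add up to \<open>(L + 1) + 2\<close>.\<close>

lemma card_level_le:
  assumes C: "\<And>i. max 0 (\<beta> * real i + \<gamma>) \<le> real (C i)" "\<And>i. real (C i) \<le> max 0 (\<beta> * real i + \<gamma>) + 1"
    and L: "1 \<le> L" "1 \<le> L * \<bar>1 + \<beta>\<bar>"
  shows "real (card {i \<in> {i0..i1}. int (i + C i) = k}) \<le> 3 + L"
proof -
  define U where "U = {i \<in> {i0..i1}. int (i + C i) = k \<and> 0 < \<beta> * real i + \<gamma>}"
  define V where "V = {i \<in> {i0..i1}. int (i + C i) = k \<and> \<beta> * real i + \<gamma> \<le> 0}"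
  have k: "real i + real (C i) = real_of_int k" if "int (i + C i) = k" for i using that by auto
  have "real (card U) \<le> L + 1"
  proof (rule card_spread)
    fix x y assume xy: "x \<in> U" "y \<in> U"
    then have "max 0 (\<beta> * real x + \<gamma>) = \<beta> * real x + \<gamma>" "max 0 (\<beta> * real y + \<gamma>) = \<beta> * real y + \<gamma>"
      "int (x + C x) = k" "int (y + C y) = k"
      by (auto simp: U_def)
    moreover have "(1 + \<beta>) * (real x - real y) = real x + \<beta> * real x - (real y + \<beta> * real y)"
      by (simp add: algebra_simps)
    ultimately have "\<bar>(1 + \<beta>) * (real x - real y)\<bar> \<le> 1"
      using C(1)[of x] C(2)[of x] C(1)[of y] C(2)[of y] k[of x] k[of y] by linarith
    then have "L * (\<bar>1 + \<beta>\<bar> * \<bar>real x - real y\<bar>) \<le> L * 1"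
      using L by (intro mult_left_mono) (auto simp: abs_mult)
    moreover have "1 * \<bar>real x - real y\<bar> \<le> (L * \<bar>1 + \<beta>\<bar>) * \<bar>real x - real y\<bar>"
      using L by (intro mult_right_mono) auto
    ultimately show "real x - real y \<le> L" by (simp add: mult.assoc)
  qed (use L in \<open>auto simp: U_def\<close>)
  moreover have "real (card V) \<le> 1 + 1"
  proof (rule card_spread)
    fix x y assume xy: "x \<in> V" "y \<in> V"
    then have "max 0 (\<beta> * real x + \<gamma>) = 0" "max 0 (\<beta> * real y + \<gamma>) = 0" "int (x + C x) = k" "int (y + C y) = k"
      by (auto simp: V_def)
    then show "real x - real y \<le> 1"
      using C(1)[of x] C(2)[of x] C(1)[of y] C(2)[of y] k[of x] k[of y] by linarith
  qed (auto simp: V_def)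
  moreover have "{i \<in> {i0..i1}. int (i + C i) = k} = U \<union> V" by (auto simp: U_def V_def)
  moreover have "real (card (U \<union> V)) \<le> real (card U) + real (card V)"
    using card_Un_le[of U V] by (metis of_nat_add of_nat_mono)
  ultimately show ?thesis by simp
qed

lemma exp_minus_one_sums:
  fixes z :: complex
  shows "(\<lambda>j. z * (z ^ j / fact (Suc j))) sums (exp z - 1)"
proof -
  have "(\<lambda>n. z ^ n /\<^sub>R fact n) sums exp z" by (rule exp_converges)
  then have "(\<lambda>n. z ^ Suc n /\<^sub>R fact (Suc n)) sums (exp z - z ^ 0 /\<^sub>R fact 0)"
    by (subst sums_Suc_iff) simp
  moreover have "z ^ Suc n /\<^sub>R fact (Suc n) = z * (z ^ n / fact (Suc n))" for n
    by (simp add: scaleR_conv_of_real divide_inverse mult_ac)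
  ultimately show ?thesis by simp
qed

lemma weighted_sum_square_le:
  fixes v x :: "nat \<Rightarrow> real"
  assumes "\<And>j. 0 \<le> v j"
  shows "(\<Sum>j<N. v j * x j)\<^sup>2 \<le> (\<Sum>j<N. v j) * (\<Sum>j<N. v j * (x j)\<^sup>2)"
proof -
  have "(\<Sum>j<N. sqrt (v j) * (sqrt (v j) * x j))\<^sup>2 \<le> (\<Sum>j<N. (sqrt (v j))\<^sup>2) * (\<Sum>j<N. (sqrt (v j) * x j)\<^sup>2)"
    by (rule Cauchy_Schwarz_ineq_sum)
  then show ?thesis using assms by (simp add: mult.assoc[symmetric] power_mult_distrib)
qed

lemma pi_power_sum_le: "(\<Sum>j<N. pi ^ Suc j / fact (Suc j)) \<le> exp pi"
proof -
  have s: "(\<lambda>n. pi ^ n / fact n) sums exp pi"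
    using exp_converges[of pi] by (simp add: divide_inverse mult.commute)
  have "(\<Sum>j<N. pi ^ Suc j / fact (Suc j)) = (\<Sum>j\<in>Suc ` {..<N}. pi ^ j / fact j)"
    by (subst sum.reindex) auto
  also have "\<dots> \<le> (\<Sum>n. pi ^ n / fact n)"
    by (rule sum_le_suminf[OF sums_summable[OF s]]) auto
  also have "\<dots> = exp pi" using s by (rule sums_unique[symmetric])
  finally show ?thesis .
qed

text \<open>The difference of the two integrands is a bounded function times the character of
  frequency \<open>i + C i\<close>, apart from a dependence on the rounding
  \<open>C i - c i\<close>. A power series separates that dependence from the variable
  \<open>a\<close>, and Bessel's inequality applies to every term.\<close>

lemma error_sum_bound:
  fixes c :: "nat \<Rightarrow> real" and C :: "nat \<Rightarrow> nat"
  assumes B: "summable (\<lambda>n. norm (B n))" and A: "\<And>t. norm (pseries B (cis t)) \<le> A"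
    and s: "0 < s" "s < 1" and I: "finite I"
    and c: "\<And>i. 0 \<le> c i" "\<And>i. c i \<le> real (C i)" "\<And>i. real (C i) \<le> c i + 1"
    and \<mu>: "\<And>k. real (card {i\<in>I. int (i + C i) = k}) \<le> \<mu>"
  shows "(\<Sum>i\<in>I. (norm (tail_coeff B (C i) i (of_real s * cis \<phi>) - smooth_coeff B (c i) i s \<phi>))\<^sup>2)
    \<le> \<mu> * A\<^sup>2 * (2 + 8 * (exp pi)\<^sup>2)"
proof -
  note [measurable] = pseries_measurable[OF B]
  define P where "P a = pseries B (cis (\<phi> - a))" for a
  have [measurable]: "P \<in> borel_measurable borel" unfolding P_def by measurable
  have P: "norm (P a) \<le> A" for a by (simp add: P_def A)
  have A0: "0 \<le> A" using A[of 0] norm_ge_zero order_trans by blast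
  have \<mu>0: "0 \<le> \<mu>" using \<mu>[of 0] by (meson of_nat_0_le_iff order_trans)
  define x where "x a = of_real s * cis a" for a
  have [measurable]: "x \<in> borel_measurable borel" unfolding x_def by measurable
  have den_ge: "1 - s \<le> norm (1 - x a)" for a
    using norm_triangle_ineq2[of 1 "x a"] s by (simp add: norm_mult x_def)
  have den_chord: "chord a \<le> 3 * norm (1 - x a)" for a
    using one_minus_cis_ge[of s a] s by (simp add: x_def)
  have den0: "1 - x a \<noteq> 0" for a using den_ge[of a] s by auto
  define h0 where "h0 a = P a * of_real (1 - s) / (1 - x a)" for a
  \<comment> \<open>Cut off outside the period so that its modulus is at most 1 everywhere, as
    \<open>sums_integral_circ\<close> requires. The factor pi removed here reappears in
    \<open>w\<close>.\<close>
  define g where "g a = (if \<bar>a\<bar> \<le> pi then - \<i> * of_real (a / pi) else 0)" for a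
  define h1 where "h1 a = P a * g a / (1 - x a)" for a
  have [measurable]: "h0 \<in> borel_measurable borel" "g \<in> borel_measurable borel" "h1 \<in> borel_measurable borel"
    unfolding h0_def g_def h1_def by measurable
  have h0_le: "norm (h0 a) \<le> A" for a
  proof -
    have "(1 - s) / norm (1 - x a) \<le> 1" using den_ge[of a] den0[of a] by (simp add: divide_le_eq)
    then have "norm (P a) * ((1 - s) / norm (1 - x a)) \<le> A * 1" using P A0 s by (intro mult_mono) auto
    moreover have "norm (of_real (1 - s) :: complex) = 1 - s" using s by (simp only: norm_of_real)
    ultimately show ?thesis by (simp only: h0_def norm_mult norm_divide times_divide_eq_right mult_1_right)
  qed
  have g_le: "norm (g a) \<le> 1" for a by (auto simp: g_def norm_mult norm_divide)
  \<comment> \<open>The factor \<open>a\<close> in the numerator cancels the near-singularity at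
    \<open>a = 0\<close>: |a| is at most twice the chord, hence at most 6 times the
    denominator.\<close>
  have h1_le: "norm (h1 a) \<le> 2 * A" for a
  proof (cases "\<bar>a\<bar> \<le> pi")
    case True
    have "\<bar>a\<bar> \<le> 6 * norm (1 - x a)" using chord_ge_abs[OF True] den_chord[of a] by simp
    also have "\<dots> \<le> 2 * pi * norm (1 - x a)" using pi_gt3 by (intro mult_right_mono) auto
    finally have "(\<bar>a\<bar> / pi) / norm (1 - x a) \<le> 2" using den0[of a] by (simp add: field_simps)
    then have "norm (P a) * ((\<bar>a\<bar> / pi) / norm (1 - x a)) \<le> A * 2" using P A0 by (intro mult_mono) auto
    moreover have "norm (g a) = \<bar>a\<bar> / pi" using True by (simp add: g_def norm_mult norm_divide)
    ultimately show ?thesis by (simp add: h1_def norm_mult norm_divide)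
  qed (use A0 in \<open>simp add: h1_def g_def\<close>)
  define \<kappa> where "\<kappa> i = int (i + C i)" for i
  define \<tau> where "\<tau> i = real (C i) - c i" for i
  have \<tau>: "0 \<le> \<tau> i" "\<tau> i \<le> 1" for i using c[of i] by (auto simp: \<tau>_def)
  \<comment> \<open>Coefficients of \<open>cis (- a * \<tau> i) - 1\<close> as a series in powers of
    \<open>g a\<close>, with one factor \<open>g a\<close> split off. They depend on
    \<open>i\<close> and not on \<open>a\<close>, and are dominated by the \<open>v j\<close>, whose
    sum is at most \<open>exp pi\<close>.\<close>
  define w where "w i j = (pi * \<tau> i) ^ Suc j / fact (Suc j)" for i j
  define v where "v j = pi ^ Suc j / fact (Suc j)" for j
  have v0: "0 \<le> v j" for j by (simp add: v_def)
  have w_le: "0 \<le> w i j" "w i j \<le> v j" for i j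
  proof -
    show "0 \<le> w i j" using \<tau> by (simp add: w_def)
    have "(pi * \<tau> i) ^ Suc j \<le> pi ^ Suc j" using \<tau>[of i] by (intro power_mono) (auto simp: mult_left_le)
    then show "w i j \<le> v j" unfolding w_def v_def by (intro divide_right_mono) auto
  qed
  have sum_w: "summable (\<lambda>j. norm (complex_of_real (w i j)))" for i
  proof -
    have "summable (\<lambda>j. v j)"
    proof -
      have "summable (\<lambda>n. pi ^ n / fact n)"
        using summable_exp[of pi] by (simp add: divide_inverse mult.commute)
      then show ?thesis unfolding v_def by (subst summable_Suc_iff)
    qed
    then show ?thesis
      by (rule summable_comparison_test') (use w_le[of i] in auto)
  qed
  define E0 where "E0 i = (LINT a|circ. h0 a * cis (of_int (\<kappa> i) * a))" for i
  define E1 where "E1 i j = (LINT a|circ. (h1 a * cis (of_int (\<kappa> i) * a)) * g a ^ j)" for i j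
  have E1_sums: "(\<lambda>j. of_real (w i j) * E1 i j) sums
      (LINT a|circ. (h1 a * cis (of_int (\<kappa> i) * a)) * (\<Sum>j. of_real (w i j) * g a ^ j))" for i
    unfolding E1_def
    by (rule sums_integral_circ[where H = "2 * A"])
       (use h1_le g_le sum_w in \<open>auto simp: norm_mult norm_power power_le_one\<close>)
  define H where "H i = (LINT a|circ. (h1 a * cis (of_int (\<kappa> i) * a)) * (\<Sum>j. of_real (w i j) * g a ^ j))" for i
  have gexp: "(\<Sum>j. of_real (w i j) * g a ^ j) * g a = cis (- a * \<tau> i) - 1" if "\<bar>a\<bar> \<le> pi" for i a
  proof -
    define z where "z = - \<i> * of_real (a * \<tau> i)"
    have gz: "of_real (pi * \<tau> i) * g a = z" using that by (simp add: g_def z_def)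
    have "of_real (w i j) * g a ^ j * g a = z * (z ^ j / fact (Suc j))" for j
      unfolding w_def gz[symmetric] by (simp add: power_mult_distrib mult_ac)
    then have "(\<lambda>j. of_real (w i j) * g a ^ j * g a) sums (exp z - 1)"
      using exp_minus_one_sums[of z] by simp
    moreover have "exp z = cis (- a * \<tau> i)" by (simp add: cis_conv_exp z_def)
    ultimately have s1: "(\<lambda>j. of_real (w i j) * g a ^ j * g a) sums (cis (- a * \<tau> i) - 1)" by simp
    have "summable (\<lambda>j. of_real (w i j) * g a ^ j)"
    proof (rule summable_comparison_test'[OF sum_w[of i], of 0])
      fix n show "norm (of_real (w i n) * g a ^ n) \<le> norm (complex_of_real (w i n))"
        using g_le[of a] by (simp add: norm_mult norm_power mult_left_le power_le_one)
    qed
    then have "(\<lambda>j. of_real (w i j) * g a ^ j * g a) sums ((\<Sum>j. of_real (w i j) * g a ^ j) * g a)"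
      by (intro sums_mult2 summable_sums)
    then show ?thesis using s1 by (rule sums_unique2)
  qed
  \<comment> \<open>Two separate errors. The moduli \<open>s ^ C i\<close> and
    \<open>s powr c i\<close> differ by at most \<open>1 - s\<close>, which is compensated in
    \<open>h0\<close>; the phases differ by the factor \<open>cis (- a * \<tau> i)\<close>, whose
    distance from 1 vanishes at \<open>a = 0\<close> and is compensated in
    \<open>h1\<close>.\<close>
  have diff: "tail_coeff B (C i) i (of_real s * cis \<phi>) - smooth_coeff B (c i) i s \<phi>
     = cis (- real i * \<phi>) * (of_real ((s ^ C i - s powr c i) / (1 - s)) * E0 i - of_real (s powr c i) * H i)" for i
  proof -
    let ?T = "\<lambda>a. P a * cis (- real i * (\<phi> - a)) * x a ^ C i / (1 - x a)"
    let ?M = "\<lambda>a. P a * cis (- real i * (\<phi> - a)) * (of_real (s powr c i) * cis (a * c i)) / (1 - x a)"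
    let ?K = "\<lambda>a. (h1 a * cis (of_int (\<kappa> i) * a)) * (\<Sum>j. of_real (w i j) * g a ^ j)"
    have bd: "norm (P a * cis (- real i * (\<phi> - a)) * y / (1 - x a)) \<le> A / (1 - s)" if "norm y \<le> 1" for y a
    proof -
      have "norm (P a) * norm y \<le> A * 1" using P that A0 by (intro mult_mono) auto
      then show ?thesis using den_ge[of a] s A0 by (simp add: norm_mult norm_divide frac_le)
    qed
    have intT: "integrable circ ?T"
      using s by (intro integrable_circ[where H = "A / (1 - s)"] bd) (auto simp: x_def norm_mult norm_power power_le_one)
    have sc: "s powr c i \<le> 1" using powr_mono'[of 0 "c i" s] s c by simp
    have intM: "integrable circ ?M"
      using sc by (intro integrable_circ[where H = "A / (1 - s)"] bd) (auto simp: norm_mult)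
    have int0: "integrable circ (\<lambda>a. h0 a * cis (of_int (\<kappa> i) * a))"
      using h0_le by (intro integrable_circ[where H = A]) (auto simp: norm_mult)
    have [measurable]: "?K \<in> borel_measurable borel"
      by measurable
    have intK: "integrable circ ?K"
    proof (rule integrable_circ[where H = "2 * A * (\<Sum>j. norm (complex_of_real (w i j)))"])
      fix a
      have sm: "summable (\<lambda>j. norm (of_real (w i j) * g a ^ j))"
        using g_le[of a]
        by (intro summable_comparison_test'[OF sum_w[of i], of 0]) (simp add: norm_mult norm_power mult_left_le power_le_one)
      have "norm (\<Sum>j. of_real (w i j) * g a ^ j) \<le> (\<Sum>j. norm (of_real (w i j) * g a ^ j))"
        by (rule summable_norm[OF sm])
      also have "\<dots> \<le> (\<Sum>j. norm (complex_of_real (w i j)))"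
        using g_le[of a] by (intro suminf_le sm sum_w) (simp add: norm_mult norm_power mult_left_le power_le_one)
      finally have "norm (\<Sum>j. of_real (w i j) * g a ^ j) \<le> (\<Sum>j. norm (complex_of_real (w i j)))" .
      then show "norm (?K a) \<le> 2 * A * (\<Sum>j. norm (complex_of_real (w i j)))"
        using h1_le[of a] A0 by (subst norm_mult, intro mult_mono[of "norm (h1 a * cis (of_int (\<kappa> i) * a))" "2 * A"])
          (auto simp: norm_mult)
    qed measurable
    have "tail_coeff B (C i) i (of_real s * cis \<phi>) - smooth_coeff B (c i) i s \<phi> = (LINT a|circ. ?T a) - (LINT a|circ. ?M a)"
      using tail_coeff_integral(1)[OF B A, of s "C i" i \<phi>] s by (simp add: smooth_coeff_def P_def x_def)
    also have "\<dots> = (LINT a|circ. ?T a - ?M a)"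
      using intT intM by simp
    also have "\<dots> = (LINT a|circ. cis (- real i * \<phi>) * (of_real ((s ^ C i - s powr c i) / (1 - s)) * (h0 a * cis (of_int (\<kappa> i) * a))
         - of_real (s powr c i) * ?K a))"
    proof (rule integral_cong_AE)
      show "AE a in circ. ?T a - ?M a = cis (- real i * \<phi>) * (of_real ((s ^ C i - s powr c i) / (1 - s)) * (h0 a * cis (of_int (\<kappa> i) * a))
         - of_real (s powr c i) * ?K a)"
        using AE_circ
      proof (rule eventually_mono)
        fix a assume "a \<in> {-pi..pi}"
        then have "\<bar>a\<bar> \<le> pi" by auto
        define W where "W = (\<Sum>j. of_real (w i j) * g a ^ j)"
        have W: "W * g a = cis (- a * \<tau> i) - 1" unfolding W_def by (rule gexp) fact
        have e1: "cis (- real i * (\<phi> - a)) = cis (- real i * \<phi>) * cis (real i * a)"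
          by (simp add: cis_mult algebra_simps)
        have e2: "x a ^ C i = of_real (s ^ C i) * cis (real (C i) * a)"
          by (simp only: x_def power_mult_distrib Complex.DeMoivre of_real_power)
        have e3: "cis (a * c i) = cis (real (C i) * a) * cis (- a * \<tau> i)"
          by (simp add: cis_mult \<tau>_def algebra_simps)
        have e4: "cis (of_int (\<kappa> i) * a) = cis (real i * a) * cis (real (C i) * a)"
          by (simp add: cis_mult \<kappa>_def algebra_simps)
        have s1: "1 - complex_of_real s \<noteq> 0" using s by (metis diff_eq_eq less_irrefl of_real_eq_1_iff add_0)
        have alg: "p * (u * i1) * (S1 * k1) / d - p * (u * i1) * (S2 * (k1 * q)) / d
          = u * ((S1 - S2) / o1 * (p * o1 / d * (i1 * k1)) - S2 * (p * gg / d * (i1 * k1) * W))"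
          if "W * gg = q - 1" "o1 \<noteq> 0" "d \<noteq> 0" for p u i1 S1 k1 d S2 q o1 gg :: complex
        proof -
          have q: "q = 1 + W * gg" using that by simp
          show ?thesis unfolding q using that(2,3) by (simp add: field_simps)
        qed
        show "?T a - ?M a = cis (- real i * \<phi>) * (of_real ((s ^ C i - s powr c i) / (1 - s)) * (h0 a * cis (of_int (\<kappa> i) * a))
         - of_real (s powr c i) * ?K a)"
          unfolding W_def[symmetric] e1 e2 e3 e4 h0_def h1_def of_real_divide of_real_diff of_real_1
          by (rule alg[OF W s1 den0])
      qed
    qed measurable
    also have "\<dots> = cis (- real i * \<phi>) * (of_real ((s ^ C i - s powr c i) / (1 - s)) * E0 i - of_real (s powr c i) * H i)"
      using int0 intK unfolding E0_def H_def
      by (simp only: integral_mult_right_zero Bochner_Integration.integral_diff integrable_mult_right)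
    finally show ?thesis .
  qed
  have S0: "(\<Sum>i\<in>I. (norm (E0 i))\<^sup>2) \<le> \<mu> * A\<^sup>2"
    unfolding E0_def using h0_le \<mu> I by (intro bessel) (auto simp: \<kappa>_def)
  have S1: "(\<Sum>i\<in>I. (norm (E1 i j))\<^sup>2) \<le> \<mu> * (2 * A)\<^sup>2" for j
  proof -
    have "(\<Sum>i\<in>I. (cmod (LINT a|circ. (h1 a * g a ^ j) * cis (of_int (\<kappa> i) * a)))\<^sup>2) \<le> \<mu> * (2 * A)\<^sup>2"
    proof (rule bessel)
      fix t
      have "norm (h1 t) * norm (g t) ^ j \<le> 2 * A * 1"
        using h1_le[of t] g_le[of t] A0 by (intro mult_mono) (auto simp: power_le_one)
      then show "norm (h1 t * g t ^ j) \<le> 2 * A" by (simp add: norm_mult norm_power)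
    qed (use \<mu> I in \<open>auto simp: \<kappa>_def\<close>)
    then show ?thesis by (simp add: E1_def mult_ac)
  qed
  \<comment> \<open>Cauchy-Schwarz in \<open>j\<close> with the weights \<open>v j\<close>, which do
    not depend on \<open>i\<close>, allows the sum over \<open>i\<close> to be taken first for each
    \<open>j\<close>. Partial sums are estimated and the limit is taken at the end.\<close>
  have SH: "(\<Sum>i\<in>I. (norm (H i))\<^sup>2) \<le> (exp pi)\<^sup>2 * (\<mu> * (2 * A)\<^sup>2)"
  proof (rule LIMSEQ_le_const2)
    show "(\<lambda>N. \<Sum>i\<in>I. (norm (\<Sum>j<N. of_real (w i j) * E1 i j))\<^sup>2) \<longlonglongrightarrow> (\<Sum>i\<in>I. (norm (H i))\<^sup>2)"
      using E1_sums unfolding H_def[symmetric] sums_def by (intro tendsto_sum tendsto_power tendsto_norm) auto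
    show "\<exists>N0. \<forall>N\<ge>N0. (\<Sum>i\<in>I. (norm (\<Sum>j<N. of_real (w i j) * E1 i j))\<^sup>2) \<le> (exp pi)\<^sup>2 * (\<mu> * (2 * A)\<^sup>2)"
    proof (intro exI[of _ 0] allI impI)
      fix N :: nat
      have V: "(\<Sum>j<N. v j) \<le> exp pi" unfolding v_def by (rule pi_power_sum_le)
      have V0: "0 \<le> (\<Sum>j<N. v j)" by (intro sum_nonneg v0)
      have "(norm (\<Sum>j<N. of_real (w i j) * E1 i j))\<^sup>2 \<le> (\<Sum>j<N. v j) * (\<Sum>j<N. v j * (norm (E1 i j))\<^sup>2)" for i
      proof -
        have "norm (\<Sum>j<N. of_real (w i j) * E1 i j) \<le> (\<Sum>j<N. v j * norm (E1 i j))"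
          by (rule sum_norm_le) (use w_le[of i] in \<open>simp add: norm_mult mult_right_mono\<close>)
        then have "(norm (\<Sum>j<N. of_real (w i j) * E1 i j))\<^sup>2 \<le> (\<Sum>j<N. v j * norm (E1 i j))\<^sup>2"
          by (intro power_mono) auto
        also have "\<dots> \<le> (\<Sum>j<N. v j) * (\<Sum>j<N. v j * (norm (E1 i j))\<^sup>2)"
          by (rule weighted_sum_square_le) (rule v0)
        finally show ?thesis .
      qed
      then have "(\<Sum>i\<in>I. (norm (\<Sum>j<N. of_real (w i j) * E1 i j))\<^sup>2)
          \<le> (\<Sum>i\<in>I. (\<Sum>j<N. v j) * (\<Sum>j<N. v j * (norm (E1 i j))\<^sup>2))"
        by (intro sum_mono)
      also have "\<dots> = (\<Sum>j<N. v j) * (\<Sum>j<N. v j * (\<Sum>i\<in>I. (norm (E1 i j))\<^sup>2))"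
      proof -
        have "(\<Sum>i\<in>I. \<Sum>j<N. v j * (norm (E1 i j))\<^sup>2) = (\<Sum>j<N. \<Sum>i\<in>I. v j * (norm (E1 i j))\<^sup>2)"
          by (rule sum.swap)
        then show ?thesis by (simp only: sum_distrib_left[symmetric])
      qed
      also have "\<dots> \<le> (\<Sum>j<N. v j) * (\<Sum>j<N. v j * (\<mu> * (2 * A)\<^sup>2))"
        using S1 v0 V0 by (intro mult_left_mono sum_mono) auto
      also have "\<dots> = (\<Sum>j<N. v j) * (\<Sum>j<N. v j) * (\<mu> * (2 * A)\<^sup>2)"
        by (simp only: sum_distrib_right[symmetric] mult.assoc)
      also have "\<dots> \<le> exp pi * exp pi * (\<mu> * (2 * A)\<^sup>2)"
        using V V0 \<mu>0 by (intro mult_right_mono mult_mono) auto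
      finally show "(\<Sum>i\<in>I. (norm (\<Sum>j<N. of_real (w i j) * E1 i j))\<^sup>2) \<le> (exp pi)\<^sup>2 * (\<mu> * (2 * A)\<^sup>2)"
        by (simp only: power2_eq_square)
    qed
  qed
  have each: "(norm (tail_coeff B (C i) i (of_real s * cis \<phi>) - smooth_coeff B (c i) i s \<phi>))\<^sup>2
      \<le> 2 * (norm (E0 i))\<^sup>2 + 2 * (norm (H i))\<^sup>2" for i
  proof -
    have sc: "s powr c i \<le> 1" using powr_mono'[of 0 "c i" s] s c by simp
    have "s ^ C i = s powr real (C i)" using s by (simp add: powr_realpow)
    also have "\<dots> = s powr c i * s powr \<tau> i" by (simp add: powr_add[symmetric] \<tau>_def)
    finally have eq: "s ^ C i - s powr c i = - (s powr c i * (1 - s powr \<tau> i))" by (simp add: algebra_simps)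
    have "s \<le> s powr \<tau> i" using powr_mono'[of "\<tau> i" 1 s] s \<tau>[of i] by simp
    moreover have "s powr \<tau> i \<le> 1" using powr_mono'[of 0 "\<tau> i" s] s \<tau>[of i] by simp
    ultimately have "s powr c i * (1 - s powr \<tau> i) \<le> 1 * (1 - s)" using sc by (intro mult_mono) auto
    moreover have "0 \<le> s powr c i * (1 - s powr \<tau> i)" using \<open>s powr \<tau> i \<le> 1\<close> by simp
    ultimately have r: "\<bar>(s ^ C i - s powr c i) / (1 - s)\<bar> \<le> 1" unfolding eq using s by simp
    have "norm (tail_coeff B (C i) i (of_real s * cis \<phi>) - smooth_coeff B (c i) i s \<phi>)
       = norm (of_real ((s ^ C i - s powr c i) / (1 - s)) * E0 i - of_real (s powr c i) * H i)"
      unfolding diff by (simp add: norm_mult)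
    also have "\<dots> \<le> norm (of_real ((s ^ C i - s powr c i) / (1 - s)) * E0 i) + norm (of_real (s powr c i) * H i)"
      by (rule norm_triangle_ineq4)
    also have "\<dots> \<le> 1 * norm (E0 i) + 1 * norm (H i)"
      unfolding norm_mult norm_of_real using r sc by (intro add_mono mult_right_mono) auto
    finally have "norm (tail_coeff B (C i) i (of_real s * cis \<phi>) - smooth_coeff B (c i) i s \<phi>) \<le> norm (E0 i) + norm (H i)" by simp
    then have "(norm (tail_coeff B (C i) i (of_real s * cis \<phi>) - smooth_coeff B (c i) i s \<phi>))\<^sup>2 \<le> (norm (E0 i) + norm (H i))\<^sup>2"
      by (intro power_mono) auto
    also have "\<dots> \<le> 2 * (norm (E0 i))\<^sup>2 + 2 * (norm (H i))\<^sup>2"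
      using sum_squares_bound[of "norm (E0 i)" "norm (H i)"] by (simp add: power2_sum)
    finally show ?thesis .
  qed
  have "(\<Sum>i\<in>I. (norm (tail_coeff B (C i) i (of_real s * cis \<phi>) - smooth_coeff B (c i) i s \<phi>))\<^sup>2)
      \<le> (\<Sum>i\<in>I. 2 * (norm (E0 i))\<^sup>2 + 2 * (norm (H i))\<^sup>2)"
    by (intro sum_mono each)
  also have "\<dots> = 2 * (\<Sum>i\<in>I. (norm (E0 i))\<^sup>2) + 2 * (\<Sum>i\<in>I. (norm (H i))\<^sup>2)"
    by (simp only: sum.distrib sum_distrib_left)
  \<comment> \<open>The squared bounds are \<open>A\<^sup>2\<close> for \<open>h0\<close> and
    \<open>(2 * A)\<^sup>2\<close> for \<open>h1\<close>, the latter with the square of the total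
    weight \<open>exp pi\<close>; this is the origin of
    \<open>2 + 8 * (exp pi)\<^sup>2\<close>.\<close>
  also have "\<dots> \<le> 2 * (\<mu> * A\<^sup>2) + 2 * ((exp pi)\<^sup>2 * (\<mu> * (2 * A)\<^sup>2))"
    using S0 SH by (intro add_mono mult_left_mono) auto
  also have "\<dots> = \<mu> * A\<^sup>2 * (2 + 8 * (exp pi)\<^sup>2)"
    by (simp add: power_mult_distrib algebra_simps)
  finally show ?thesis .
qed

subsection \<open>Poisson majorants\<close>

definition poisson :: "real \<Rightarrow> real \<Rightarrow> real" where
  "poisson r t = (1 - r\<^sup>2) / (cmod (1 - of_real r * cis t))\<^sup>2"

lemma poisson_measurable [measurable]: "poisson r \<in> borel_measurable borel"
  unfolding poisson_def by measurable

lemma one_minus_cis_nz: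
  assumes "0 \<le> r" "r < 1" shows "1 - complex_of_real r * cis t \<noteq> 0"
proof
  assume "1 - complex_of_real r * cis t = 0"
  then have "norm (complex_of_real r * cis t) = 1" by (metis eq_iff_diff_eq_0 norm_one)
  then show False using assms by (simp add: norm_mult)
qed

lemma poisson_nonneg: "0 \<le> r \<Longrightarrow> r < 1 \<Longrightarrow> 0 \<le> poisson r t"
  by (simp add: poisson_def power_le_one)

lemma poisson_period [simp]: "poisson r (t + 2 * pi) = poisson r t"
  by (simp add: poisson_def)

lemma poisson_le:
  assumes "0 \<le> r" "r < 1"
  shows "poisson r t \<le> 18 * (1 - r) / (1 - r + chord t)\<^sup>2"
proof -
  have D: "0 < 1 - r + chord t" using assms chord_nonneg[of t] by linarith
  have "(1 - r + chord t)\<^sup>2 \<le> (3 * cmod (1 - of_real r * cis t))\<^sup>2"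
    using one_minus_cis_ge[of r t] assms D by (intro power_mono) auto
  moreover have "1 - r\<^sup>2 \<le> 2 * (1 - r)"
    using zero_le_power2[of "1 - r"] by (simp add: power2_eq_square algebra_simps)
  moreover have "cmod (1 - of_real r * cis t) > 0" using one_minus_cis_nz[OF assms] by simp
  ultimately have "(1 - r\<^sup>2) * (1 - r + chord t)\<^sup>2 \<le> 2 * (1 - r) * (3 * cmod (1 - of_real r * cis t))\<^sup>2"
    using assms by (intro mult_mono) (auto simp: power_le_one)
  then have "(1 - r\<^sup>2) * (1 - r + chord t)\<^sup>2 \<le> (18 * (1 - r)) * (cmod (1 - of_real r * cis t))\<^sup>2"
    by (simp add: power_mult_distrib algebra_simps)
  then show ?thesis unfolding poisson_def
    using D \<open>cmod _ > 0\<close> by (simp add: frac_le_eq divide_le_eq pos_le_divide_eq mult.commute)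
qed

lemma poisson_le_inverse:
  assumes "0 \<le> r" "r < 1"
  shows "poisson r t \<le> 18 / (1 - r)"
proof -
  have D: "0 < 1 - r + chord t" using assms chord_nonneg[of t] by linarith
  have "poisson r t \<le> 18 * (1 - r) / (1 - r + chord t)\<^sup>2" by (rule poisson_le[OF assms])
  also have "\<dots> \<le> 18 * (1 - r) / (1 - r)\<^sup>2"
    using assms D by (intro divide_left_mono power_mono mult_pos_pos zero_less_power) auto
  also have "\<dots> = 18 / (1 - r)"
    by (subst power2_eq_square, subst times_divide_times_eq[symmetric]) (use assms in simp)
  finally show ?thesis .
qed

text \<open>The Poisson kernel is the Cauchy kernel plus a part with strictly negative frequencies
  in \<open>a\<close>. The boundary function has only nonpositive frequencies in \<open>a\<close>,
  so the second part integrates to 0, while the first gives \<open>tail_coeff_integral\<close> with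
  threshold 0.\<close>

lemma poisson_repr:
  assumes B: "summable (\<lambda>n. norm (B n))" and r: "0 \<le> r" "r < 1"
  shows "pseries B (of_real r * cis \<theta>) = (LINT a|circ. pseries B (cis (\<theta> - a)) * of_real (poisson r a))"
proof -
  note [measurable] = pseries_measurable[OF B]
  define P where "P a = pseries B (cis (\<theta> - a))" for a
  have [measurable]: "P \<in> borel_measurable borel" unfolding P_def by measurable
  define A where "A = (\<Sum>n. norm (B n))"
  have bound: "norm (pseries B (cis t)) \<le> A" for t
  proof -
    have sm: "summable (\<lambda>n. norm (B n * cis t ^ n))" using B by (simp add: norm_mult norm_power)
    have "norm (pseries B (cis t)) \<le> (\<Sum>n. norm (B n * cis t ^ n))"
      unfolding pseries_def by (rule summable_norm[OF sm])
    then show ?thesis by (simp add: A_def norm_mult norm_power)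
  qed
  have P: "norm (P a) \<le> A" for a by (simp add: P_def bound)
  have A0: "0 \<le> A" using bound[of 0] norm_ge_zero order_trans by blast
  have den_ge: "1 - r \<le> norm (1 - of_real r * cis a)" for a
    using norm_triangle_ineq2[of 1 "of_real r * cis a"] r by (simp add: norm_mult)
  have 1: "pseries B (of_real r * cis \<theta>) = (LINT a|circ. P a / (1 - of_real r * cis a))"
    using tail_coeff_integral(1)[OF B bound r, of 0 0 \<theta>] by (simp add: tail_coeff_def pseries_def P_def)
  have 2: "(LINT a|circ. P a * (of_real r * cis (- a) / (1 - of_real r * cis (- a)))) = 0"
  proof -
    have z: "(LINT a|circ. P a * cis (- real (Suc k) * a)) = 0" for k
    proof -
      have "(\<lambda>n. B n * (LINT a|circ. cis (- real (Suc k) * a) * cis (real n * (\<theta> - a)))) sums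
        (LINT a|circ. cis (- real (Suc k) * a) * (\<Sum>n. B n * cis (real n * (\<theta> - a))))"
        by (rule sums_integral_circ[where H = 1]) (auto simp: B)
      moreover have "(LINT a|circ. cis (- real (Suc k) * a) * cis (real n * (\<theta> - a))) = 0" for n
      proof -
        have "cis (- real (Suc k) * a) * cis (real n * (\<theta> - a)) = cis (real n * \<theta>) * cis (of_int (- int (Suc k) - int n) * a)" for a
          by (simp add: cis_mult algebra_simps)
        then show ?thesis by (simp only: integral_mult_right_zero integral_circ_cis) auto
      qed
      moreover have "(\<Sum>n. B n * cis (real n * (\<theta> - a))) = P a" for a
        by (simp only: P_def pseries_def Complex.DeMoivre)
      ultimately have "(\<lambda>n. 0) sums (LINT a|circ. cis (- real (Suc k) * a) * P a)" by simp
      then show ?thesis using sums_unique2[OF sums_zero] by (simp add: mult.commute)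
    qed
    have "(\<lambda>k. of_real (r ^ Suc k) * (LINT a|circ. P a * cis (- real (Suc k) * a))) sums
      (LINT a|circ. P a * (\<Sum>k. of_real (r ^ Suc k) * cis (- real (Suc k) * a)))"
      using r P by (intro sums_integral_circ[where H = A]) (auto simp: norm_mult norm_power intro!: summable_mult)
    then have "(\<lambda>k. 0) sums (LINT a|circ. P a * (\<Sum>k. of_real (r ^ Suc k) * cis (- real (Suc k) * a)))"
      by (simp only: z mult_zero_right)
    moreover have "(\<Sum>k. of_real (r ^ Suc k) * cis (- real (Suc k) * a)) = of_real r * cis (- a) / (1 - of_real r * cis (- a))" for a
    proof -
      have "(\<lambda>k. (of_real r * cis (- a)) * (of_real r * cis (- a)) ^ k) sums ((of_real r * cis (- a)) * (1 / (1 - of_real r * cis (- a))))"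
        using r by (intro sums_mult geometric_sums) (simp add: norm_mult)
      moreover have "(of_real r * cis (- a)) * (of_real r * cis (- a)) ^ k = of_real (r ^ Suc k) * cis (- real (Suc k) * a)" for k
      proof -
        have "(of_real r * cis (- a)) * (of_real r * cis (- a)) ^ k = (of_real r * cis (- a)) ^ Suc k"
          by (rule power_Suc[symmetric])
        also have "\<dots> = of_real (r ^ Suc k) * cis (real (Suc k) * - a)"
          by (simp only: power_mult_distrib Complex.DeMoivre of_real_power)
        finally show ?thesis by (simp only: mult_minus_left mult_minus_right)
      qed
      ultimately show ?thesis by (simp only: times_divide_eq_right mult_1_right sums_unique[symmetric])
    qed
    ultimately show ?thesis using sums_unique2[OF sums_zero] by simp
  qed
  have ptw: "of_real (poisson r a) = 1 / (1 - of_real r * cis a) + of_real r * cis (- a) / (1 - of_real r * cis (- a))" for a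
  proof -
    define x where "x = of_real r * cis a"
    have y: "of_real r * cis (- a) = cnj x" by (simp add: x_def complex_eq_iff)
    have n: "1 - x \<noteq> 0" "1 - cnj x \<noteq> 0"
      using one_minus_cis_nz[OF r, of a] one_minus_cis_nz[OF r, of "- a"] by (simp_all add: x_def[symmetric] y)
    have xx: "x * cnj x = of_real (r\<^sup>2)"
    proof -
      have "norm x = r" using r by (simp add: x_def norm_mult)
      then show ?thesis using complex_norm_square[of x] by simp
    qed
    have "of_real (poisson r a) = (1 - of_real (r\<^sup>2)) / ((1 - x) * (1 - cnj x))"
      unfolding poisson_def x_def[symmetric]
      by (simp add: complex_norm_square[of "1 - x", simplified])
    also have "\<dots> = 1 / (1 - x) + cnj x / (1 - cnj x)"
      unfolding xx[symmetric] using n by (simp add: field_simps)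
    finally show ?thesis by (simp only: x_def[symmetric] y)
  qed
  have bd: "norm (P a * w) \<le> A * (1 / (1 - r))" if "norm w \<le> 1 / (1 - r)" for a w
    unfolding norm_mult using P that A0 by (intro mult_mono) auto
  have inv: "1 / norm (1 - of_real r * cis a) \<le> 1 / (1 - r)" for a
    using den_ge[of a] r by (intro frac_le) auto
  have i1: "integrable circ (\<lambda>a. P a * (1 / (1 - of_real r * cis a)))"
    by (intro integrable_circ[where H = "A * (1 / (1 - r))"] bd) (simp_all add: norm_divide inv)
  have i2: "integrable circ (\<lambda>a. P a * (of_real r * cis (- a) / (1 - of_real r * cis (- a))))"
  proof (intro integrable_circ[where H = "A * (1 / (1 - r))"] bd)
    fix a
    have "r / norm (1 - of_real r * cis (- a)) \<le> 1 / norm (1 - of_real r * cis (- a))"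
      using r by (intro divide_right_mono) auto
    then show "norm (of_real r * cis (- a) / (1 - of_real r * cis (- a))) \<le> 1 / (1 - r)"
      using inv[of "- a"] r by (simp add: norm_divide norm_mult)
  qed measurable
  have "(LINT a|circ. P a * of_real (poisson r a))
     = (LINT a|circ. P a * (1 / (1 - of_real r * cis a)) + P a * (of_real r * cis (- a) / (1 - of_real r * cis (- a))))"
    by (simp only: ptw distrib_left)
  also have "\<dots> = (LINT a|circ. P a * (1 / (1 - of_real r * cis a))) + 0"
    using i1 i2 2 by (simp only: Bochner_Integration.integral_add)
  finally show ?thesis using 1 by (simp add: P_def)
qed

lemma nn_integral_poisson:
  assumes r: "0 \<le> r" "r < 1"
  shows "(\<integral>\<^sup>+a. ennreal (poisson r a) \<partial>circ) = 1"
proof -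
  define B :: "nat \<Rightarrow> complex" where "B n = (if n = 0 then 1 else 0)" for n
  have B: "summable (\<lambda>n. norm (B n))"
    by (rule summable_finite[of "{0}"]) (auto simp: B_def)
  have ps: "pseries B z = 1" for z
  proof -
    have "(\<lambda>n. B n * z ^ n) = (\<lambda>n. if n = 0 then 1 else 0)" by (auto simp: B_def)
    then show ?thesis unfolding pseries_def using sums_single[of 0 "\<lambda>_. 1::complex"] by (simp add: sums_iff)
  qed
  have int: "integrable circ (poisson r)"
    using poisson_le_inverse[OF r] poisson_nonneg[OF r] by (intro integrable_circ[where H = "18 / (1 - r)"]) auto
  have "complex_of_real (LINT a|circ. poisson r a) = 1"
    using poisson_repr[OF B r, of 0] by (simp add: ps)
  then have "(LINT a|circ. poisson r a) = 1" by (simp only: of_real_eq_1_iff)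
  then show ?thesis using nn_integral_eq_integral[OF int] poisson_nonneg[OF r] by simp
qed

text \<open>Jensen's inequality by means of the tangent of the power function at \<open>x\<close>.
  Since \<open>x\<close> is finite, its contribution can be cancelled in the extended reals even if
  the mean on the right is infinite; \<open>x\<close> may lie below the mean of
  \<open>u\<close>.\<close>

lemma poisson_power_mean:
  assumes r: "0 \<le> r" "r < 1" and u [measurable]: "u \<in> borel_measurable borel" and u0: "\<And>a. 0 \<le> u a"
    and x: "0 \<le> x" "ennreal x \<le> (\<integral>\<^sup>+a. ennreal (u a * poisson r a) \<partial>circ)" and p: "1 \<le> p"
  shows "ennreal (x powr p) \<le> (\<integral>\<^sup>+a. ennreal (u a powr p * poisson r a) \<partial>circ)"
proof (cases "x = 0")
  case False
  then have x0: "0 < x" using x by simp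
  \<comment> \<open>The tangent inequality is Young's inequality with weights \<open>1 / p\<close>
    and \<open>1 - 1 / p\<close>, multiplied by \<open>p\<close>.\<close>
  have tangent: "p * x powr (p - 1) * v \<le> v powr p + (p - 1) * x powr p" if "0 \<le> v" for v
  proof (cases "v = 0")
    case False
    then have "(v powr p) powr (1 / p) * (x powr p) powr (1 - 1 / p) \<le> (1 / p) * v powr p + (1 - 1 / p) * x powr p"
      using p x0 that by (intro Youngs_inequality_0) auto
    then have "p * ((v powr p) powr (1 / p) * (x powr p) powr (1 - 1 / p)) \<le> p * ((1 / p) * v powr p + (1 - 1 / p) * x powr p)"
      using p by (intro mult_left_mono) auto
    moreover have "(v powr p) powr (1 / p) = v" using that False p by (simp add: powr_powr)
    moreover have "(x powr p) powr (1 - 1 / p) = x powr (p - 1)" using p by (simp add: powr_powr right_diff_distrib)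
    moreover have "p * ((1 / p) * V + (1 - 1 / p) * W) = V + (p - 1) * W" for V W
      using p by (simp add: field_simps)
    moreover have "p * x powr (p - 1) * v = p * (v * x powr (p - 1))" by simp
    ultimately show ?thesis by (simp only:)
  qed (use p x0 in simp)
  define J where "J = (\<integral>\<^sup>+a. ennreal (u a powr p * poisson r a) \<partial>circ)"
  have P0: "0 \<le> poisson r a" for a by (rule poisson_nonneg[OF r])
  have "ennreal (p * x powr (p - 1) * x) \<le> ennreal (p * x powr (p - 1)) * (\<integral>\<^sup>+a. ennreal (u a * poisson r a) \<partial>circ)"
    using x p by (subst ennreal_mult') (auto intro: mult_left_mono)
  also have "\<dots> = (\<integral>\<^sup>+a. ennreal (p * x powr (p - 1)) * ennreal (u a * poisson r a) \<partial>circ)"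
    by (rule nn_integral_cmult[symmetric]) measurable
  also have "\<dots> \<le> (\<integral>\<^sup>+a. ennreal (u a powr p * poisson r a) + ennreal ((p - 1) * x powr p) * ennreal (poisson r a) \<partial>circ)"
  proof (rule nn_integral_mono)
    fix a
    have "(p * x powr (p - 1) * u a) * poisson r a \<le> (u a powr p + (p - 1) * x powr p) * poisson r a"
      using tangent[OF u0] P0 by (intro mult_right_mono) auto
    then show "ennreal (p * x powr (p - 1)) * ennreal (u a * poisson r a)
       \<le> ennreal (u a powr p * poisson r a) + ennreal ((p - 1) * x powr p) * ennreal (poisson r a)"
      using p P0[of a] u0[of a]
      by (simp add: ennreal_mult'[symmetric] ennreal_plus[symmetric] ennreal_leI distrib_right mult.assoc del: ennreal_plus)
  qed
  also have "\<dots> = J + ennreal ((p - 1) * x powr p)"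
    by (simp add: nn_integral_add nn_integral_cmult nn_integral_poisson[OF r] J_def)
  finally have main: "ennreal (p * x powr (p - 1) * x) \<le> J + ennreal ((p - 1) * x powr p)" .
  have "p * x powr (p - 1) * x = x powr p + (p - 1) * x powr p"
    using x0 by (simp add: powr_mult_base[of x "p - 1"] mult.assoc mult.commute[of _ x] algebra_simps)
  then have "ennreal (x powr p) + ennreal ((p - 1) * x powr p) \<le> J + ennreal ((p - 1) * x powr p)"
    using main p by (simp add: ennreal_plus[symmetric] del: ennreal_plus)
  then show ?thesis unfolding J_def by (simp add: ennreal_add_left_cancel_le add.commute)
qed simp

lemma pseries_le_poisson:
  assumes B: "summable (\<lambda>n. norm (B n))" and r: "0 \<le> r" "r < 1"
  shows "ennreal (norm (pseries B (of_real r * cis \<theta>)))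
    \<le> (\<integral>\<^sup>+a. ennreal (norm (pseries B (cis (\<theta> - a))) * poisson r a) \<partial>circ)"
  unfolding poisson_repr[OF assms]
  using norm_integral_circ_le[of "\<lambda>a. pseries B (cis (\<theta> - a)) * of_real (poisson r a)"] poisson_nonneg[OF r]
  by (simp add: norm_mult)

text \<open>The Poisson representation is available for absolutely summable coefficients; shrinking
  the argument by \<open>R < 1\<close> provides them for every holomorphic function on the
  disc.\<close>

lemma holomorphic_dilate_pseries:
  assumes F: "F holomorphic_on ball 0 1" and R: "0 \<le> R" "R < 1"
  obtains B where "summable (\<lambda>n. norm (B n))" "\<And>z. norm z \<le> 1 \<Longrightarrow> pseries B z = F (of_real R * z)"
proof
  define a where "a n = (deriv ^^ n) F 0 / fact n" for n
  define B where "B n = a n * of_real R ^ n" for n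
  have sums: "(\<lambda>n. a n * w ^ n) sums F w" if "norm w < 1" for w
    using holomorphic_power_series[OF F, of w] that by (simp add: a_def)
  define R' where "R' = (1 + R) / 2"
  have "summable (\<lambda>n. a n * of_real R' ^ n)"
  proof (rule sums_summable, rule sums)
    show "norm (complex_of_real R') < 1" using R by (simp only: norm_of_real R'_def) simp
  qed
  then have "summable (\<lambda>n. norm (a n * of_real R ^ n))"
  proof (rule powser_insidea)
    have "norm (complex_of_real R') = R'" using R by (simp only: norm_of_real R'_def) simp
    then show "norm (complex_of_real R) < norm (complex_of_real R')" using R by (simp add: R'_def)
  qed
  then show "summable (\<lambda>n. norm (B n))" by (simp add: B_def)
  fix z :: complex assume "norm z \<le> 1"
  then have "norm (of_real R * z) \<le> R * 1" unfolding norm_mult using R by (intro mult_mono) auto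
  then have "(\<lambda>n. a n * (of_real R * z) ^ n) sums F (of_real R * z)" using R by (intro sums) auto
  then show "pseries B z = F (of_real R * z)"
    unfolding pseries_def B_def by (simp add: power_mult_distrib mult.assoc sums_iff)
qed

section \<open>Subharmonicity of powers of polynomials\<close>

abbreviation boundary_mean :: "real \<Rightarrow> complex poly \<Rightarrow> ennreal" where
  "boundary_mean q f \<equiv> \<integral>\<^sup>+t. ennreal (norm (poly f (cis t)) powr q) \<partial>circ"

text \<open>Division by a finite Blaschke product, carried out inside the polynomials: a factor
  \<open>z - a\<close> with \<open>|a| < 1\<close> is replaced by \<open>1 - cnj a * z\<close>,
  which has the same modulus on the circle, a larger one inside, and no zero in the disc.\<close>

lemma poly_reflect_zeros:
  fixes f :: "complex poly"
  assumes "f \<noteq> 0"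
  shows "\<exists>g. (\<forall>z. norm z \<le> 1 \<longrightarrow> norm (poly f z) \<le> norm (poly g z)) \<and>
     (\<forall>z. norm z = 1 \<longrightarrow> norm (poly f z) = norm (poly g z)) \<and> (\<forall>z. norm z < 1 \<longrightarrow> poly g z \<noteq> 0)"
  using assms
proof (induction "degree f" arbitrary: f rule: less_induct)
  case less
  show ?case
  proof (cases "\<exists>a. norm a < 1 \<and> poly f a = 0")
    case False
    then show ?thesis by (intro exI[of _ f]) auto
  next
    case True
    then obtain a where a: "norm a < 1" "poly f a = 0" by blast
    then obtain f1 where f1: "f = [:-a, 1:] * f1" using poly_eq_0_iff_dvd by (metis dvd_def)
    with less.prems have "f1 \<noteq> 0" by auto
    then have "degree f = Suc (degree f1)" unfolding f1 by (subst degree_mult_eq) auto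
    then obtain g1 where g1: "\<And>z. norm z \<le> 1 \<Longrightarrow> norm (poly f1 z) \<le> norm (poly g1 z)"
      "\<And>z. norm z = 1 \<Longrightarrow> norm (poly f1 z) = norm (poly g1 z)" "\<And>z. norm z < 1 \<Longrightarrow> poly g1 z \<noteq> 0"
      using less.hyps[of f1] \<open>f1 \<noteq> 0\<close> by auto
    define g where "g = [:1, - cnj a:] * g1"
    have id: "(norm (1 - cnj a * z))\<^sup>2 - (norm (z - a))\<^sup>2 = (1 - (norm a)\<^sup>2) * (1 - (norm z)\<^sup>2)" for z
    proof -
      have "(1 - (a1 * z1 + a2 * z2))\<^sup>2 + (a1 * z2 - a2 * z1)\<^sup>2 - ((z1 - a1)\<^sup>2 + (z2 - a2)\<^sup>2)
          = (1 - (a1\<^sup>2 + a2\<^sup>2)) * (1 - (z1\<^sup>2 + z2\<^sup>2))" for a1 a2 z1 z2 :: real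
        by algebra
      from this[of "Re a" "Re z" "Im a" "Im z"] show ?thesis
        unfolding cmod_power2 by (simp add: power2_commute[of "Im a * Re z"] algebra_simps)
    qed
    have le: "norm (z - a) \<le> norm (1 - cnj a * z)" if "norm z \<le> 1" for z
    proof -
      have "0 \<le> (1 - (norm a)\<^sup>2) * (1 - (norm z)\<^sup>2)"
        using a that by (intro mult_nonneg_nonneg) (auto simp: power_le_one)
      then have "(norm (z - a))\<^sup>2 \<le> (norm (1 - cnj a * z))\<^sup>2" using id[of z] by linarith
      then show ?thesis by (rule power2_le_imp_le) simp
    qed
    have eq: "norm (z - a) = norm (1 - cnj a * z)" if "norm z = 1" for z
    proof (rule power2_eq_imp_eq)
      show "(norm (z - a))\<^sup>2 = (norm (1 - cnj a * z))\<^sup>2" using id[of z] unfolding that by simp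
    qed auto
    have nz: "1 - cnj a * z \<noteq> 0" if "norm z < 1" for z
    proof
      assume "1 - cnj a * z = 0"
      then have "norm (cnj a * z) = 1" by (metis eq_iff_diff_eq_0 norm_one)
      moreover have "norm a * norm z \<le> norm a * 1" using that by (intro mult_left_mono) auto
      ultimately show False using a by (simp add: norm_mult)
    qed
    have pf: "poly f z = (z - a) * poly f1 z" "poly g z = (1 - cnj a * z) * poly g1 z" for z
      by (simp_all add: f1 g_def algebra_simps)
    show ?thesis
    proof (rule exI[of _ g], intro conjI allI impI)
      fix z :: complex
      show "norm (poly f z) \<le> norm (poly g z)" if "norm z \<le> 1"
        unfolding pf norm_mult using le[OF that] g1(1)[OF that] by (rule mult_mono) auto
      show "norm (poly f z) = norm (poly g z)" if "norm z = 1"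
        unfolding pf norm_mult using eq[OF that] g1(2)[OF that] by simp
      show "poly g z \<noteq> 0" if "norm z < 1"
        unfolding pf using nz[OF that] g1(3)[OF that] by (simp only: mult_eq_0_iff) simp
    qed
  qed
qed

text \<open>For \<sigma> < 1 convexity is of no use. The zero-free majorant \<open>g\<close> has a
  holomorphic logarithm in the disc, so \<open>|g|^\<sigma>\<close> is the modulus of a holomorphic
  function. That function lives on the open disc only, so the Poisson bound is taken on a circle of
  radius \<open>R < 1\<close>, and uniform continuity of \<open>|g|^\<sigma>\<close> lets
  \<open>R\<close> tend to 1.\<close>

lemma poly_powr_le_poisson:
  fixes f :: "complex poly"
  assumes r: "0 \<le> r" "r < 1" and \<sigma>: "0 < \<sigma>"
  shows "ennreal (norm (poly f (of_real r * cis \<theta>)) powr \<sigma>)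
    \<le> (\<integral>\<^sup>+a. ennreal (norm (poly f (cis (\<theta> - a))) powr \<sigma> * poisson r a) \<partial>circ)"
proof (cases "f = 0")
  case False
  obtain g where g: "\<And>z. norm z \<le> 1 \<Longrightarrow> norm (poly f z) \<le> norm (poly g z)"
     "\<And>z. norm z = 1 \<Longrightarrow> norm (poly f z) = norm (poly g z)" "\<And>z. norm z < 1 \<Longrightarrow> poly g z \<noteq> 0"
    using poly_reflect_zeros[OF False] by blast
  obtain h where h: "h holomorphic_on ball 0 1" "\<And>z. z \<in> ball 0 1 \<Longrightarrow> exp (h z) = poly g z"
    by (rule holomorphic_logarithm_exists[of "ball 0 1" "poly g" 0]) (auto simp: g intro: holomorphic_intros)
  define F where "F z = exp (of_real \<sigma> * h z)" for z
  have F: "F holomorphic_on ball 0 1" unfolding F_def by (intro holomorphic_intros h)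
  have nF: "norm (F z) = norm (poly g z) powr \<sigma>" if "norm z < 1" for z
  proof -
    have "norm (poly g z) = exp (Re (h z))" using h(2)[of z] that by (metis mem_ball_0 norm_exp_eq_Re)
    then show ?thesis by (simp add: F_def powr_def mult.commute)
  qed
  define k where "k z = norm (poly g z) powr \<sigma>" for z
  have k_cont: "continuous_on S k" for S
    unfolding k_def using \<sigma> by (intro continuous_on_powr' continuous_intros) auto
  have unif: "uniformly_continuous_on (cball 0 1) k"
    by (intro compact_uniformly_continuous k_cont) auto
  have kP: "(\<integral>\<^sup>+a. ennreal (k (cis (\<theta> - a)) * poisson r a) \<partial>circ)
      = (\<integral>\<^sup>+a. ennreal (norm (poly f (cis (\<theta> - a))) powr \<sigma> * poisson r a) \<partial>circ)"
    by (simp add: k_def g(2))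
  have meas: "(\<lambda>a. k (cis (\<theta> - a))) \<in> borel_measurable borel"
    by (intro borel_measurable_continuous_onI continuous_on_compose2[OF k_cont[of UNIV]] continuous_intros) auto
  have key: "ennreal (k (of_real r * cis \<theta>)) \<le> (\<integral>\<^sup>+a. ennreal (k (cis (\<theta> - a)) * poisson r a) \<partial>circ)"
  proof (rule ennreal_le_epsilon)
    fix e :: real assume e: "0 < e"
    obtain d where d: "d > 0" "\<And>z w. z \<in> cball 0 1 \<Longrightarrow> w \<in> cball 0 1 \<Longrightarrow> dist z w < d \<Longrightarrow> dist (k z) (k w) < e / 2"
      using unif e unfolding uniformly_continuous_on_def by (metis half_gt_zero)
    \<comment> \<open>Close enough to 1 that dilation changes \<open>k\<close> by at most
      \<open>e / 2\<close>. This error is paid twice, at the point and on the circle.\<close>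
    define R where "R = max 0 (1 - d / 2)"
    have R: "0 \<le> R" "R < 1" "1 - R < d" using d by (auto simp: R_def)
    have close: "\<bar>k (of_real R * z) - k z\<bar> \<le> e / 2" if "norm z \<le> 1" for z
    proof -
      have "norm (of_real R * z) \<le> 1 * 1" unfolding norm_mult using R that by (intro mult_mono) auto
      moreover have "dist (of_real R * z) z < d"
      proof -
        have "of_real R * z - z = - (of_real (1 - R) * z)" by (simp add: algebra_simps)
        then have "dist (of_real R * z) z = (1 - R) * norm z"
          using R by (simp only: dist_norm norm_minus_cancel norm_mult norm_of_real)
        also have "\<dots> \<le> (1 - R) * 1" using R that by (intro mult_left_mono) auto
        finally show ?thesis using R by simp
      qed
      ultimately show ?thesis using d(2)[of "of_real R * z" z] that by (simp add: dist_real_def)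
    qed
    obtain B where B: "summable (\<lambda>n. norm (B n))" "\<And>z. norm z \<le> 1 \<Longrightarrow> pseries B z = F (of_real R * z)"
      using holomorphic_dilate_pseries[OF F R(1,2)] by blast
    have nB: "norm (pseries B z) = k (of_real R * z)" if "norm z \<le> 1" for z
    proof -
      have "norm (of_real R * z) \<le> R * 1" unfolding norm_mult using R that by (intro mult_mono) auto
      then show ?thesis using R that by (simp add: B(2) nF k_def)
    qed
    have "ennreal (k (of_real r * cis \<theta>)) \<le> ennreal (k (of_real R * (of_real r * cis \<theta>)) + e / 2)"
    proof (rule ennreal_leI)
      have "norm (of_real r * cis \<theta>) \<le> 1" using r by (simp add: norm_mult)
      from close[OF this] show "k (of_real r * cis \<theta>) \<le> k (of_real R * (of_real r * cis \<theta>)) + e / 2" by linarith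
    qed
    also have "\<dots> = ennreal (norm (pseries B (of_real r * cis \<theta>))) + ennreal (e / 2)"
      using r e by (subst nB) (auto simp: norm_mult k_def)
    also have "ennreal (norm (pseries B (of_real r * cis \<theta>)))
        \<le> (\<integral>\<^sup>+a. ennreal (norm (pseries B (cis (\<theta> - a))) * poisson r a) \<partial>circ)"
      by (rule pseries_le_poisson[OF B(1) r])
    also have "\<dots> \<le> (\<integral>\<^sup>+a. ennreal (k (cis (\<theta> - a)) * poisson r a) + ennreal (e / 2) * ennreal (poisson r a) \<partial>circ)"
    proof (rule nn_integral_mono)
      fix a
      have "norm (pseries B (cis (\<theta> - a))) * poisson r a \<le> (k (cis (\<theta> - a)) + e / 2) * poisson r a"
      proof (rule mult_right_mono)
        have "norm (cis (\<theta> - a)) \<le> 1" by simp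
        from close[OF this] nB[OF this] show "norm (pseries B (cis (\<theta> - a))) \<le> k (cis (\<theta> - a)) + e / 2" by linarith
      qed (rule poisson_nonneg[OF r])
      then show "ennreal (norm (pseries B (cis (\<theta> - a))) * poisson r a)
          \<le> ennreal (k (cis (\<theta> - a)) * poisson r a) + ennreal (e / 2) * ennreal (poisson r a)"
        using e poisson_nonneg[OF r, of a]
        by (simp add: ennreal_mult'[symmetric] ennreal_plus[symmetric] ennreal_leI distrib_right k_def del: ennreal_plus)
    qed
    also have "\<dots> = (\<integral>\<^sup>+a. ennreal (k (cis (\<theta> - a)) * poisson r a) \<partial>circ) + ennreal (e / 2)"
      using meas by (simp add: nn_integral_add nn_integral_cmult nn_integral_poisson[OF r])
    finally have "ennreal (k (of_real r * cis \<theta>))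
       \<le> (\<integral>\<^sup>+a. ennreal (k (cis (\<theta> - a)) * poisson r a) \<partial>circ) + ennreal (e / 2) + ennreal (e / 2)"
      by (simp add: add_right_mono)
    also have "\<dots> = (\<integral>\<^sup>+a. ennreal (k (cis (\<theta> - a)) * poisson r a) \<partial>circ) + ennreal e"
      using e by (simp add: add.assoc ennreal_plus[symmetric] del: ennreal_plus)
    finally show "ennreal (k (of_real r * cis \<theta>))
       \<le> (\<integral>\<^sup>+a. ennreal (k (cis (\<theta> - a)) * poisson r a) \<partial>circ) + ennreal e" .
  qed
  have "norm (of_real r * cis \<theta>) \<le> 1" using r by (simp add: norm_mult)
  then have "norm (poly f (of_real r * cis \<theta>)) powr \<sigma> \<le> k (of_real r * cis \<theta>)"
    unfolding k_def using g(1) \<sigma> by (intro powr_mono2) auto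
  then show ?thesis using key unfolding kP by (meson ennreal_leI order_trans)
qed simp

section \<open>Integration over the damping parameter\<close>

definition unit_measure :: "real measure" where
  "unit_measure = density lborel (indicator {0<..<1})"

lemma sets_unit [simp, measurable_cong]: "sets unit_measure = sets borel"
  by (simp add: unit_measure_def)

lemma space_unit [simp]: "space unit_measure = UNIV"
  by (simp add: unit_measure_def)

lemma measurable_unit [simp]: "measurable unit_measure M = measurable borel M"
  by (rule measurable_cong_sets) auto

lemma nn_integral_unit:
  assumes "f \<in> borel_measurable borel"
  shows "(\<integral>\<^sup>+e. f e \<partial>unit_measure) = (\<integral>\<^sup>+e. indicator {0<..<1} e * f e \<partial>lborel)"
  unfolding unit_measure_def using assms by (intro nn_integral_density) auto

interpretation unit: finite_measure unit_measure
proof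
  have "emeasure unit_measure (space unit_measure) = (\<integral>\<^sup>+e. 1 \<partial>unit_measure)" by simp
  also have "\<dots> = 1" by (subst nn_integral_unit) auto
  finally show "emeasure unit_measure (space unit_measure) \<noteq> \<infinity>" by simp
qed

interpretation unit_circ: pair_sigma_finite unit_measure circ
  by standard

lemma AE_unit: "AE e in unit_measure. e \<in> {0<..<1}"
  unfolding unit_measure_def by (subst AE_density) (auto simp: indicator_def intro!: AE_I2)

lemma nn_integral_unit_mono:
  assumes "\<And>e. 0 < e \<Longrightarrow> e < 1 \<Longrightarrow> f e \<le> g e"
  shows "(\<integral>\<^sup>+e. f e \<partial>unit_measure) \<le> (\<integral>\<^sup>+e. g e \<partial>unit_measure)"
proof (rule nn_integral_mono_AE)
  show "AE e in unit_measure. f e \<le> g e" using AE_unit by (rule eventually_mono) (auto intro: assms)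
qed

lemma nn_integral_powr_from_0:
  assumes "-1 < a" "0 \<le> c"
  shows "(\<integral>\<^sup>+x. indicator {0..c} x * ennreal (x powr a) \<partial>lborel) = ennreal (c powr (a + 1) / (a + 1))"
  using nn_integral_has_integral_lebesgue[OF _ has_integral_powr_from_0[OF assms]]
  by (simp add: ennreal_mult' ennreal_indicator)

lemma nn_integral_powr_to_inf:
  assumes "e < -1" "0 < a"
  shows "(\<integral>\<^sup>+x. indicator {a..} x * ennreal (x powr e) \<partial>lborel) = ennreal (- (a powr (e + 1)) / (e + 1))"
  using nn_integral_has_integral_lebesgue[OF _ has_integral_powr_to_inf[OF assms]]
  by (simp add: ennreal_mult' ennreal_indicator)

text \<open>Split at \<open>e = 1 / x\<close>. Below it the integral converges at 0 because
  \<open>k < al\<close>, above it at infinity because \<open>0 < k\<close>. Here the integration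
  over \<open>e\<close> turns a truncated power of \<open>x\<close> into the pure power
  \<open>x powr k\<close>.\<close>

lemma unit_min_integral:
  assumes k: "0 < k" "k < al" and x: "0 < x"
  shows "(\<integral>\<^sup>+e. ennreal (e powr (al - 1 - k) * min x (1 / e) powr al) \<partial>unit_measure)
    \<le> ennreal ((1 / (al - k) + 1 / k) * x powr k)"
proof -
  have "(\<integral>\<^sup>+e. ennreal (e powr (al - 1 - k) * min x (1 / e) powr al) \<partial>unit_measure)
     = (\<integral>\<^sup>+e. indicator {0<..<1} e * ennreal (e powr (al - 1 - k) * min x (1 / e) powr al) \<partial>lborel)"
    by (rule nn_integral_unit) measurable
  also have "\<dots> \<le> (\<integral>\<^sup>+e. ennreal (x powr al) * (indicator {0..1 / x} e * ennreal (e powr (al - 1 - k)))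
      + indicator {1 / x..} e * ennreal (e powr (-1 - k)) \<partial>lborel)"
  proof (rule nn_integral_mono)
    fix e :: real
    show "indicator {0<..<1} e * ennreal (e powr (al - 1 - k) * min x (1 / e) powr al)
      \<le> ennreal (x powr al) * (indicator {0..1 / x} e * ennreal (e powr (al - 1 - k)))
      + indicator {1 / x..} e * ennreal (e powr (-1 - k))"
    proof (cases "0 < e \<and> e < 1")
      case e: True
      show ?thesis
      proof (cases "e \<le> 1 / x")
        case True
        have "e powr (al - 1 - k) * min x (1 / e) powr al \<le> e powr (al - 1 - k) * x powr al"
          using e x k by (intro mult_left_mono powr_mono2) auto
        then have "ennreal (e powr (al - 1 - k) * min x (1 / e) powr al) \<le> ennreal (x powr al) * ennreal (e powr (al - 1 - k))"
          by (simp add: ennreal_mult'[symmetric] ennreal_leI mult.commute)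
        then show ?thesis using e True by (simp add: add_increasing2)
      next
        case False
        have "e powr (al - 1 - k) * min x (1 / e) powr al \<le> e powr (al - 1 - k) * (1 / e) powr al"
          using e x k by (intro mult_left_mono powr_mono2) auto
        also have "(1 / e) powr al = e powr (- al)" using e by (simp add: powr_minus_divide powr_divide)
        also have "e powr (al - 1 - k) * e powr (- al) = e powr (-1 - k)" by (simp add: powr_add[symmetric])
        finally have "ennreal (e powr (al - 1 - k) * min x (1 / e) powr al) \<le> ennreal (e powr (-1 - k))"
          by (rule ennreal_leI)
        then show ?thesis using e False by (simp add: add_increasing)
      qed
    qed auto
  qed
  also have "\<dots> = ennreal (x powr al) * (\<integral>\<^sup>+e. indicator {0..1 / x} e * ennreal (e powr (al - 1 - k)) \<partial>lborel)
      + (\<integral>\<^sup>+e. indicator {1 / x..} e * ennreal (e powr (-1 - k)) \<partial>lborel)"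
    by (subst nn_integral_add) (auto simp: nn_integral_cmult)
  also have "\<dots> = ennreal (x powr al) * ennreal ((1 / x) powr (al - k) / (al - k)) + ennreal ((1 / x) powr (- k) / k)"
    using k x nn_integral_powr_from_0[of "al - 1 - k" "1 / x"] nn_integral_powr_to_inf[of "-1 - k" "1 / x"]
    by (simp add: algebra_simps)
  also have "\<dots> = ennreal ((1 / (al - k) + 1 / k) * x powr k)"
  proof -
    have "(1 / x) powr (al - k) = x powr (k - al)" "(1 / x) powr (- k) = x powr k"
      using x by (simp_all add: powr_divide powr_minus_divide[symmetric] powr_minus[symmetric])
    moreover have "x powr al * x powr (k - al) = x powr k" by (simp add: powr_add[symmetric])
    ultimately show ?thesis
      using k by (simp add: ennreal_mult'[symmetric] ennreal_plus[symmetric] distrib_right del: ennreal_plus)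
  qed
  finally show ?thesis .
qed

section \<open>The Hardy-Littlewood-Sobolev inequality on the circle\<close>

lemma AE_chord: "AE t in circ. chord (c + t) \<noteq> 0"
proof -
  have "{t. chord (c + t) = 0} \<subseteq> range (\<lambda>n::int. 2 * pi * of_int n - c)"
  proof
    fix t assume "t \<in> {t. chord (c + t) = 0}"
    then have "cis (c + t) = 1" by (simp add: chord_def)
    then have "cos (c + t) = 1" by (metis cis.simps(1) one_complex.simps(1))
    then obtain n :: int where "c + t = of_int n * 2 * pi" using cos_one_2pi_int by auto
    then have "t = 2 * pi * of_int n - c" by (simp add: algebra_simps)
    then show "t \<in> range (\<lambda>n::int. 2 * pi * of_int n - c)" by blast
  qed
  then have "countable {t. chord (c + t) = 0}" by (rule countable_subset) auto
  then have "{t. chord (c + t) = 0} \<in> null_sets lborel" by (rule countable_imp_null_set_lborel)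
  then have "AE t in lborel. chord (c + t) \<noteq> 0" using AE_not_in by fastforce
  then show ?thesis unfolding circ_def by (subst AE_density) auto
qed

text \<open>The integrand is normalised so that \<open>x * t\<close> is the natural variable: after
  rescaling it is the integral of a power larger than -1 near the origin, and the bound is free of
  \<open>x\<close>.\<close>

lemma chord_singular_integral:
  assumes k: "0 < k" "k < 1" and x: "0 < x"
  shows "(\<integral>\<^sup>+t. ennreal (if x * chord (c + t) \<le> 1 then x * (x * chord (c + t)) powr (k - 1) else 0) \<partial>circ)
    \<le> ennreal (2 / k)"
proof -
  define h where "h t = ennreal (if x * chord t \<le> 1 then x * (x * chord t) powr (k - 1) else 0)" for t
  have [measurable]: "h \<in> borel_measurable borel" unfolding h_def by measurable
  have half: "(\<integral>\<^sup>+t. indicator {0..2 / x} t * ennreal (t powr (k - 1)) \<partial>lborel) = ennreal ((2 / x) powr k / k)"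
    using nn_integral_powr_from_0[of "k - 1" "2 / x"] k x by simp
  have half': "(\<integral>\<^sup>+t. indicator {-(2 / x)..0} t * ennreal ((- t) powr (k - 1)) \<partial>lborel) = ennreal ((2 / x) powr k / k)"
    unfolding half[symmetric]
    by (subst nn_integral_real_affine[where t = 0 and c = "-1"])
       (auto intro!: nn_integral_cong split: split_indicator)
  have "(\<integral>\<^sup>+t. h (c + t) \<partial>circ) = (\<integral>\<^sup>+t. h t \<partial>circ)"
    by (rule nn_integral_circ_shift) (auto simp: h_def)
  also have "\<dots> \<le> ennreal (1 / (2 * pi)) * (\<integral>\<^sup>+t. ennreal (2 * x powr k) *
      (indicator {0..2 / x} t * ennreal (t powr (k - 1)) + indicator {-(2 / x)..0} t * ennreal ((- t) powr (k - 1))) \<partial>lborel)"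
  proof (subst nn_integral_circ, measurable, intro mult_left_mono nn_integral_mono_AE)
    show "AE t in lborel. h t * indicator {-pi..pi} t \<le> ennreal (2 * x powr k) *
      (indicator {0..2 / x} t * ennreal (t powr (k - 1)) + indicator {-(2 / x)..0} t * ennreal ((- t) powr (k - 1)))"
      using AE_lborel_neq[of 0]
    proof (rule eventually_mono)
      fix t :: real assume t0: "t \<noteq> 0"
      show "h t * indicator {-pi..pi} t \<le> ennreal (2 * x powr k) *
        (indicator {0..2 / x} t * ennreal (t powr (k - 1)) + indicator {-(2 / x)..0} t * ennreal ((- t) powr (k - 1)))"
      proof (cases "t \<in> {-pi..pi} \<and> x * chord t \<le> 1")
        case True
        then have "\<bar>t\<bar> \<le> pi" by auto
        then have ct: "\<bar>t\<bar> / 2 \<le> chord t" by (rule chord_ge_abs)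
        have "x * (\<bar>t\<bar> / 2) \<le> x * chord t" using ct x by (intro mult_left_mono) auto
        then have "x * (\<bar>t\<bar> / 2) \<le> 1" using True by simp
        then have tx: "\<bar>t\<bar> \<le> 2 / x" using x by (simp add: field_simps)
        have "(x * chord t) powr (k - 1) \<le> (x * (\<bar>t\<bar> / 2)) powr (k - 1)"
          using ct x k t0 by (intro powr_mono2' mult_left_mono mult_pos_pos) auto
        also have "\<dots> = x powr (k - 1) * (\<bar>t\<bar> powr (k - 1) * (1 / 2) powr (k - 1))"
          using x by (simp add: powr_mult[symmetric])
        also have "\<dots> \<le> x powr (k - 1) * (\<bar>t\<bar> powr (k - 1) * 2)"
        proof (intro mult_left_mono)
          have "(1 / 2 :: real) powr (k - 1) = 2 powr (1 - k)" by (simp add: powr_divide powr_minus_divide[symmetric] powr_minus[symmetric])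
          also have "\<dots> \<le> 2 powr 1" using k by (intro powr_mono) auto
          finally show "(1 / 2 :: real) powr (k - 1) \<le> 2" by simp
        qed auto
        finally have "x * (x * chord t) powr (k - 1) \<le> x * (x powr (k - 1) * (\<bar>t\<bar> powr (k - 1) * 2))"
          using x by (intro mult_left_mono) auto
        also have "\<dots> = (x * x powr (k - 1)) * 2 * \<bar>t\<bar> powr (k - 1)" by simp
        also have "x * x powr (k - 1) = x powr k" using x by (simp add: powr_mult_base)
        finally have le: "x * (x * chord t) powr (k - 1) \<le> 2 * x powr k * \<bar>t\<bar> powr (k - 1)" by (simp add: mult_ac)
        have "h t * indicator {-pi..pi} t = ennreal (x * (x * chord t) powr (k - 1))"
          using True by (simp add: h_def)
        also have "\<dots> \<le> ennreal (2 * x powr k * \<bar>t\<bar> powr (k - 1))" by (rule ennreal_leI[OF le])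
        also have "\<dots> = ennreal (2 * x powr k) * ennreal (\<bar>t\<bar> powr (k - 1))" by (rule ennreal_mult') simp
        also have "ennreal (\<bar>t\<bar> powr (k - 1)) \<le> indicator {0..2 / x} t * ennreal (t powr (k - 1)) + indicator {-(2 / x)..0} t * ennreal ((- t) powr (k - 1))"
          using tx t0 by (cases "t \<ge> 0") (auto simp: add_increasing add_increasing2)
        finally show ?thesis by (simp add: mult_left_mono)
      qed (auto simp: h_def)
    qed
  qed auto
  also have "\<dots> = ennreal (1 / (2 * pi)) * (ennreal (2 * x powr k) * (ennreal ((2 / x) powr k / k) + ennreal ((2 / x) powr k / k)))"
    by (subst nn_integral_cmult, measurable, subst nn_integral_add) (auto simp: half half')
  also have "\<dots> = ennreal ((2 / pi) * (2 powr k / k))"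
  proof -
    have "x powr k * (2 / x) powr k = 2 powr k" using x by (simp add: powr_divide)
    then have "1 / (2 * pi) * (2 * x powr k * ((2 / x) powr k / k + (2 / x) powr k / k)) = (2 / pi) * (2 powr k / k)"
      by (simp add: field_simps)
    then show ?thesis using k by (simp add: ennreal_mult'[symmetric] ennreal_plus[symmetric] del: ennreal_plus)
  qed
  also have "\<dots> \<le> ennreal (1 * (2 / k))"
  proof (intro ennreal_leI mult_mono divide_right_mono)
    show "2 / pi \<le> 1" using pi_ge_two by simp
    have "(2::real) powr k \<le> 2 powr 1" using k by (intro powr_mono) auto
    then show "(2::real) powr k \<le> 2" by simp
  qed (use k in auto)
  finally show ?thesis by (simp add: h_def)
qed

text \<open>In the far region \<open>x * chord\<close> is at least half of
  \<open>1 + x * chord\<close>, which reduces the claim to \<open>chord_integral\<close> at scale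
  \<open>1 / x\<close>. Again the bound does not depend on \<open>x\<close>.\<close>

lemma chord_decay_integral:
  assumes s: "1 < s" and x: "0 < x"
  shows "(\<integral>\<^sup>+t. ennreal (if 1 < x * chord (c + t) then x * (x * chord (c + t)) powr (- s) else 0) \<partial>circ)
    \<le> ennreal (2 powr s * (2 * (2 powr s / (s - 1))))"
proof -
  have "(\<integral>\<^sup>+t. ennreal (if 1 < x * chord (c + t) then x * (x * chord (c + t)) powr (- s) else 0) \<partial>circ)
     \<le> (\<integral>\<^sup>+t. ennreal (2 powr s * x powr (1 - s)) * ennreal ((1 / x + chord (c + 1 * t)) powr (-1 - (s - 1))) \<partial>circ)"
  proof (rule nn_integral_mono)
    fix t
    define d where "d = chord (c + t)"
    show "ennreal (if 1 < x * chord (c + t) then x * (x * chord (c + t)) powr (- s) else 0)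
      \<le> ennreal (2 powr s * x powr (1 - s)) * ennreal ((1 / x + chord (c + 1 * t)) powr (-1 - (s - 1)))"
    proof (cases "1 < x * d")
      case True
      have xd: "1 / x + d = (1 + x * d) / x" using x by (simp add: field_simps)
      have "(x * d) powr (- s) \<le> ((1 + x * d) / 2) powr (- s)"
      proof (rule powr_mono2')
        have mean: "0 < (1 + y) / 2 \<and> (1 + y) / 2 \<le> y" if "1 < y" for y :: real using that by auto
        show "0 < (1 + x * d) / 2" "(1 + x * d) / 2 \<le> x * d" using mean[OF True] by blast+
      qed (use s in simp)
      also have "\<dots> = 2 powr s * (1 + x * d) powr (- s)"
        using True by (simp add: powr_divide powr_minus_divide)
      also have "1 + x * d = x * (1 / x + d)" using x by (simp add: field_simps)
      also have "(x * (1 / x + d)) powr (- s) = x powr (- s) * (1 / x + d) powr (- s)"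
        by (rule powr_mult)
      finally have "x * (x * d) powr (- s) \<le> x * (2 powr s * (x powr (- s) * (1 / x + d) powr (- s)))"
        using x by (intro mult_left_mono) auto
      also have "\<dots> = 2 powr s * (x * x powr (- s)) * (1 / x + d) powr (- s)" by simp
      also have "x * x powr (- s) = x powr (1 - s)" using x by (simp add: powr_mult_base)
      finally have "x * (x * d) powr (- s) \<le> 2 powr s * x powr (1 - s) * (1 / x + d) powr (-1 - (s - 1))" by simp
      then show ?thesis using True by (simp add: d_def ennreal_mult'[symmetric] ennreal_leI)
    qed (simp add: d_def)
  qed
  also have "\<dots> = ennreal (2 powr s * x powr (1 - s)) * (\<integral>\<^sup>+t. ennreal ((1 / x + chord (c + 1 * t)) powr (-1 - (s - 1))) \<partial>circ)"
    by (rule nn_integral_cmult) measurable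
  also have "\<dots> \<le> ennreal (2 powr s * x powr (1 - s)) * ennreal ((1 + 1 / \<bar>1\<bar>) * (2 powr (1 + (s - 1)) / (s - 1)) * (1 / x) powr (- (s - 1)))"
    using s x by (intro mult_left_mono chord_integral) auto
  also have "\<dots> = ennreal (2 powr s * (2 * (2 powr s / (s - 1))))"
  proof -
    have "(1 / x) powr (- (s - 1)) = x powr (s - 1)" using x by (simp add: powr_divide powr_minus_divide[symmetric] powr_minus[symmetric])
    moreover have "x powr (1 - s) * x powr (s - 1) = 1" using x by (simp add: powr_add[symmetric])
    ultimately have "2 powr s * x powr (1 - s) * ((1 + 1 / \<bar>1\<bar>) * (2 powr (1 + (s - 1)) / (s - 1)) * (1 / x) powr (- (s - 1)))
       = 2 powr s * (2 * (2 powr s / (s - 1)))" by simp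
    then show ?thesis using s by (simp add: ennreal_mult'[symmetric])
  qed
  finally show ?thesis .
qed

text \<open>The three summands come from the unit mass of \<open>Y\<close>, from the region near the
  singularity and from the far region. The exponent \<open>s\<close> is the one for which Young's
  inequality with weights \<open>b\<close> and \<open>1 - b\<close> restores the power
  \<open>k - 1\<close> of the chord.\<close>

definition hls_const :: "real \<Rightarrow> real \<Rightarrow> real" where
  "hls_const k b = (let s = (1 - k) / (1 - b) in 1 + 2 / k + 2 powr s * (2 * (2 powr s / (s - 1))))"

lemma hls_const_nonneg:
  assumes "0 < k" "k < b" "b < 1" shows "0 \<le> hls_const k b"
proof -
  have "1 < (1 - k) / (1 - b)" using assms by simp
  then show ?thesis using assms unfolding hls_const_def Let_def
    by (intro add_nonneg_nonneg mult_nonneg_nonneg divide_nonneg_nonneg) auto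
qed

text \<open>The natural scale is \<open>chord = 1 / x\<close>. Below it \<open>Y\<close> is replaced
  by its bound \<open>x\<close>; above it Young's inequality separates \<open>Y\<close>, which has
  mass at most 1, from a power of the chord with exponent below -1.\<close>

lemma hls_half:
  assumes k: "0 < k" "k < b" "b < 1"
    and x: "0 \<le> x" and Y [measurable]: "Y \<in> borel_measurable borel" and Y0: "\<And>t. 0 \<le> Y t"
    and Y1: "(\<integral>\<^sup>+t. ennreal (Y t) \<partial>circ) \<le> 1"
  shows "(\<integral>\<^sup>+t. ennreal (if Y t \<le> x then Y t powr b * chord (c + t) powr (k - 1) else 0) \<partial>circ)
    \<le> ennreal (hls_const k b * x powr (b - k))"
proof -
  define s where "s = (1 - k) / (1 - b)"
  have s: "1 < s" using k by (simp add: s_def)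
  define C where "C = 1 + 2 / k + 2 powr s * (2 * (2 powr s / (s - 1)))"
  have C_eq: "hls_const k b = C" by (simp add: hls_const_def C_def s_def Let_def)
  have C0: "0 \<le> C" using hls_const_nonneg[OF k] by (simp add: C_eq)
  have "(\<integral>\<^sup>+t. ennreal (if Y t \<le> x then Y t powr b * chord (c + t) powr (k - 1) else 0) \<partial>circ)
    \<le> ennreal (C * x powr (b - k))"
    proof (cases "x = 0")
      case True
      have "(if Y t \<le> x then Y t powr b * chord (c + t) powr (k - 1) else 0) = 0" for t
        using Y0[of t] True by auto
      then show ?thesis by simp
    next
      case False
      then have x: "0 < x" using x by simp
      let ?h1 = "\<lambda>t. if x * chord (c + t) \<le> 1 then x * (x * chord (c + t)) powr (k - 1) else 0"
      let ?h2 = "\<lambda>t. if 1 < x * chord (c + t) then x * (x * chord (c + t)) powr (- s) else 0"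
      have ptw: "(if Y t \<le> x then Y t powr b * chord (c + t) powr (k - 1) else 0)
         \<le> x powr (b - k) * (Y t + ?h1 t + ?h2 t)" for t
      proof -
        define d where "d = chord (c + t)"
        have d0: "0 \<le> d" by (simp add: d_def)
        have h0: "0 \<le> x powr (b - k) * (Y t + ?h1 t + ?h2 t)" using Y0[of t] x by (intro mult_nonneg_nonneg add_nonneg_nonneg) auto
        show ?thesis
        proof (cases "Y t \<le> x \<and> 0 < d")
          case True
          show ?thesis
          proof (cases "x * d \<le> 1")
            case xd: True
            have "Y t powr b * d powr (k - 1) \<le> x powr b * d powr (k - 1)"
              using True Y0[of t] k by (intro mult_right_mono powr_mono2) auto
            also have "\<dots> = x powr (b - k) * (x * (x * d) powr (k - 1))"
            proof -
              have "x powr (b - k) * (x * (x * d) powr (k - 1)) = (x powr (b - k) * (x * x powr (k - 1))) * d powr (k - 1)"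
                using x d0 by (simp add: powr_mult)
              also have "x * x powr (k - 1) = x powr k" using x by (simp add: powr_mult_base)
              also have "x powr (b - k) * x powr k = x powr b" by (simp add: powr_add[symmetric])
              finally show ?thesis by simp
            qed
            also have "\<dots> \<le> x powr (b - k) * (Y t + x * (x * d) powr (k - 1))"
              using Y0[of t] by (intro mult_left_mono) auto
            finally show ?thesis using True xd by (simp add: d_def)
          next
            case xd: False
            \<comment> \<open>Chosen so that \<open>Z powr (1 - b)\<close> is
              \<open>d powr (k - 1)\<close> up to a power of \<open>x\<close>; as
              \<open>s > 1\<close>, it has bounded integral over the far region.\<close>
            define Z where "Z = x * (x * d) powr (- s)"
            have Zpos: "0 < Z" using x xd True by (simp add: Z_def)
            have Zp: "Z powr (1 - b) = x powr (k - b) * d powr (k - 1)"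
            proof -
              have "- s * (1 - b) = k - 1" using k by (simp add: s_def field_simps)
              then have "Z powr (1 - b) = x powr (1 - b) * (x * d) powr (k - 1)"
                using x d0 by (simp add: Z_def powr_mult powr_powr)
              also have "\<dots> = (x powr (1 - b) * x powr (k - 1)) * d powr (k - 1)" using x d0 by (simp add: powr_mult)
              also have "x powr (1 - b) * x powr (k - 1) = x powr (k - b)" by (simp add: powr_add[symmetric])
              finally show ?thesis .
            qed
            have YZ: "Y t powr b * Z powr (1 - b) \<le> Y t + Z"
            proof (cases "Y t = 0")
              case False
              then have "Y t powr b * Z powr (1 - b) \<le> b * Y t + (1 - b) * Z"
                using k Y0[of t] Zpos by (intro Youngs_inequality_0) auto
              also have "\<dots> \<le> 1 * Y t + 1 * Z" using k Y0[of t] Zpos by (intro add_mono mult_right_mono) auto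
              finally show ?thesis by simp
            qed (use Zpos in simp)
            have le: "x powr (b - k) * (Y t powr b * Z powr (1 - b)) \<le> x powr (b - k) * (Y t + Z)"
              using YZ by (intro mult_left_mono) auto
            have eq: "x powr (b - k) * (Y t powr b * Z powr (1 - b)) = Y t powr b * d powr (k - 1)"
            proof -
              have "x powr (b - k) * x powr (k - b) = 1" using x by (simp add: powr_add[symmetric])
              then show ?thesis unfolding Zp by (simp add: mult.left_commute mult.assoc[symmetric])
            qed
            have "Y t powr b * d powr (k - 1) \<le> x powr (b - k) * (Y t + Z)"
              using le unfolding eq .
            then show ?thesis using True xd by (simp add: d_def Z_def)
          qed
        next
          case False
          then have "(if Y t \<le> x then Y t powr b * chord (c + t) powr (k - 1) else 0) = 0"
            using d0 by (auto simp: d_def[symmetric] not_less)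
          then show ?thesis using h0 by simp
        qed
      qed
      have "(\<integral>\<^sup>+t. ennreal (if Y t \<le> x then Y t powr b * chord (c + t) powr (k - 1) else 0) \<partial>circ)
        \<le> (\<integral>\<^sup>+t. ennreal (x powr (b - k)) * (ennreal (Y t) + ennreal (?h1 t) + ennreal (?h2 t)) \<partial>circ)"
      proof (rule nn_integral_mono)
        fix t
        have "0 \<le> ?h1 t" "0 \<le> ?h2 t" using x by auto
        then have "ennreal (x powr (b - k)) * (ennreal (Y t) + ennreal (?h1 t) + ennreal (?h2 t))
            = ennreal (x powr (b - k) * (Y t + ?h1 t + ?h2 t))"
          using Y0[of t] by (simp only: ennreal_plus[symmetric] ennreal_mult'[symmetric] powr_ge_zero add_nonneg_nonneg)
        then show "ennreal (if Y t \<le> x then Y t powr b * chord (c + t) powr (k - 1) else 0)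
            \<le> ennreal (x powr (b - k)) * (ennreal (Y t) + ennreal (?h1 t) + ennreal (?h2 t))"
          by (simp only: ennreal_leI[OF ptw])
      qed
      also have "\<dots> = ennreal (x powr (b - k)) * ((\<integral>\<^sup>+t. ennreal (Y t) \<partial>circ) + (\<integral>\<^sup>+t. ennreal (?h1 t) \<partial>circ) + (\<integral>\<^sup>+t. ennreal (?h2 t) \<partial>circ))"
      proof -
        have m: "(\<lambda>t. ennreal (?h1 t)) \<in> borel_measurable circ" "(\<lambda>t. ennreal (?h2 t)) \<in> borel_measurable circ"
          "(\<lambda>t. ennreal (Y t)) \<in> borel_measurable circ"
          by measurable
        have "(\<integral>\<^sup>+t. ennreal (x powr (b - k)) * (ennreal (Y t) + ennreal (?h1 t) + ennreal (?h2 t)) \<partial>circ)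
          = ennreal (x powr (b - k)) * (\<integral>\<^sup>+t. ennreal (Y t) + ennreal (?h1 t) + ennreal (?h2 t) \<partial>circ)"
          by (rule nn_integral_cmult) (intro borel_measurable_add m)
        also have "(\<integral>\<^sup>+t. ennreal (Y t) + ennreal (?h1 t) + ennreal (?h2 t) \<partial>circ)
          = (\<integral>\<^sup>+t. ennreal (Y t) + ennreal (?h1 t) \<partial>circ) + (\<integral>\<^sup>+t. ennreal (?h2 t) \<partial>circ)"
          by (rule nn_integral_add) (intro borel_measurable_add m)+
        also have "(\<integral>\<^sup>+t. ennreal (Y t) + ennreal (?h1 t) \<partial>circ)
          = (\<integral>\<^sup>+t. ennreal (Y t) \<partial>circ) + (\<integral>\<^sup>+t. ennreal (?h1 t) \<partial>circ)"
          by (rule nn_integral_add) (intro m)+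
        finally show ?thesis .
      qed
      also have "\<dots> \<le> ennreal (x powr (b - k)) * (1 + ennreal (2 / k) + ennreal (2 powr s * (2 * (2 powr s / (s - 1)))))"
        using k s x Y1 by (intro mult_left_mono add_mono chord_singular_integral chord_decay_integral) auto
      also have "\<dots> = ennreal (x powr (b - k)) * ennreal C"
      proof -
        have "1 + ennreal (2 / k) + ennreal (2 powr s * (2 * (2 powr s / (s - 1)))) = ennreal C"
          unfolding C_def using k s by (subst ennreal_plus) (auto simp flip: ennreal_1 ennreal_plus)
        then show ?thesis by simp
      qed
      also have "\<dots> = ennreal (C * x powr (b - k))" using C0 by (simp add: ennreal_mult' mult.commute)
      finally show ?thesis .
    qed
  then show ?thesis by (simp only: C_eq)
qed

text \<open>For each pair of points the smaller of \<open>X v\<close> and \<open>Y u\<close> is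
  integrated by \<open>hls_half\<close>, with the larger one as the height. Because
  \<open>a + b = 1 + k\<close>, the larger one is left with exponent exactly 1, and its mass is at
  most 1.\<close>

lemma hardy_littlewood_sobolev:
  assumes k: "0 < k" "k < a" "k < b" "a < 1" "b < 1" "a + b = 1 + k"
    and X [measurable]: "X \<in> borel_measurable borel" and Y [measurable]: "Y \<in> borel_measurable borel"
    and X0: "\<And>t. 0 \<le> X t" and Y0: "\<And>t. 0 \<le> Y t"
    and X1: "(\<integral>\<^sup>+t. ennreal (X t) \<partial>circ) \<le> 1" and Y1: "(\<integral>\<^sup>+t. ennreal (Y t) \<partial>circ) \<le> 1"
  shows "(\<integral>\<^sup>+u. (\<integral>\<^sup>+v. ennreal (X v powr a * Y u powr b * chord (u + v) powr (k - 1)) \<partial>circ) \<partial>circ)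
    \<le> ennreal (hls_const k a + hls_const k b)"
proof -
  define Ca where "Ca = hls_const k a"
  define Cb where "Cb = hls_const k b"
  have Ca: "0 \<le> Ca" and Cb: "0 \<le> Cb" unfolding Ca_def Cb_def using k by (auto intro: hls_const_nonneg)
    define G where "G u v = ennreal (if X v \<le> Y u then X v powr a * chord (u + v) powr (k - 1) else 0)" for u v
    define H where "H u v = ennreal (if Y u \<le> X v then Y u powr b * chord (v + u) powr (k - 1) else 0)" for u v
    have [measurable]: "(\<lambda>v. G u v) \<in> borel_measurable borel" "(\<lambda>v. H u v) \<in> borel_measurable borel"
       "(\<lambda>u. H u v) \<in> borel_measurable borel" for u v unfolding G_def H_def by measurable
    have GH: "ennreal (X v powr a * Y u powr b * chord (u + v) powr (k - 1))
       \<le> ennreal (Y u powr b) * G u v + ennreal (X v powr a) * H u v" for u v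
    proof (cases "X v \<le> Y u")
      case True
      then have "ennreal (Y u powr b) * G u v = ennreal (X v powr a * Y u powr b * chord (u + v) powr (k - 1))"
        by (simp add: G_def ennreal_mult'[symmetric] mult_ac)
      then show ?thesis by (simp add: add_increasing2)
    next
      case False
      then have "ennreal (X v powr a) * H u v = ennreal (X v powr a * Y u powr b * chord (u + v) powr (k - 1))"
        by (simp add: H_def ennreal_mult'[symmetric] mult_ac add.commute)
      then show ?thesis by (simp add: add_increasing)
    qed
    have "(\<integral>\<^sup>+u. (\<integral>\<^sup>+v. ennreal (X v powr a * Y u powr b * chord (u + v) powr (k - 1)) \<partial>circ) \<partial>circ)
      \<le> (\<integral>\<^sup>+u. (\<integral>\<^sup>+v. ennreal (Y u powr b) * G u v + ennreal (X v powr a) * H u v \<partial>circ) \<partial>circ)"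
      by (intro nn_integral_mono GH)
    also have "\<dots> = (\<integral>\<^sup>+u. ennreal (Y u powr b) * (\<integral>\<^sup>+v. G u v \<partial>circ) + (\<integral>\<^sup>+v. ennreal (X v powr a) * H u v \<partial>circ) \<partial>circ)"
      by (intro nn_integral_cong) (simp add: nn_integral_add nn_integral_cmult)
    also have "\<dots> \<le> (\<integral>\<^sup>+u. ennreal Ca * ennreal (Y u) + (\<integral>\<^sup>+v. ennreal (X v powr a) * H u v \<partial>circ) \<partial>circ)"
    proof (intro nn_integral_mono add_mono order_refl)
      fix u
      have "ennreal (Y u powr b) * (\<integral>\<^sup>+v. G u v \<partial>circ) \<le> ennreal (Y u powr b) * ennreal (Ca * Y u powr (a - k))"
        unfolding G_def Ca_def by (intro mult_left_mono hls_half k X X0 X1 Y0) auto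
      also have "\<dots> = ennreal (Ca * (Y u powr b * Y u powr (a - k)))" by (simp add: ennreal_mult'[symmetric] mult_ac)
      also have "Y u powr b * Y u powr (a - k) = Y u powr 1"
        using k by (simp add: powr_add[symmetric]) (simp add: algebra_simps)
      finally show "ennreal (Y u powr b) * (\<integral>\<^sup>+v. G u v \<partial>circ) \<le> ennreal Ca * ennreal (Y u)"
        using Y0[of u] Ca by (simp add: ennreal_mult')
    qed
    also have "\<dots> = ennreal Ca * (\<integral>\<^sup>+u. ennreal (Y u) \<partial>circ) + (\<integral>\<^sup>+u. (\<integral>\<^sup>+v. ennreal (X v powr a) * H u v \<partial>circ) \<partial>circ)"
      unfolding H_def by (subst nn_integral_add) (auto simp: nn_integral_cmult)
    also have "(\<integral>\<^sup>+u. (\<integral>\<^sup>+v. ennreal (X v powr a) * H u v \<partial>circ) \<partial>circ)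
       = (\<integral>\<^sup>+v. (\<integral>\<^sup>+u. ennreal (X v powr a) * H u v \<partial>circ) \<partial>circ)"
      unfolding H_def by (rule circ2.Fubini') measurable
    also have "\<dots> \<le> (\<integral>\<^sup>+v. ennreal Cb * ennreal (X v) \<partial>circ)"
    proof (rule nn_integral_mono)
      fix v
      have "(\<integral>\<^sup>+u. ennreal (X v powr a) * H u v \<partial>circ) = ennreal (X v powr a) * (\<integral>\<^sup>+u. H u v \<partial>circ)"
        by (rule nn_integral_cmult) simp
      also have "\<dots> \<le> ennreal (X v powr a) * ennreal (Cb * X v powr (b - k))"
        unfolding H_def Cb_def by (intro mult_left_mono hls_half k Y Y0 Y1 X0) auto
      also have "\<dots> = ennreal (Cb * (X v powr a * X v powr (b - k)))" by (simp add: ennreal_mult'[symmetric] mult_ac)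
      also have "X v powr a * X v powr (b - k) = X v powr 1"
        using k by (simp add: powr_add[symmetric]) (simp add: algebra_simps)
      finally show "(\<integral>\<^sup>+u. ennreal (X v powr a) * H u v \<partial>circ) \<le> ennreal Cb * ennreal (X v)"
        using X0[of v] Cb by (simp add: ennreal_mult')
    qed
    also have "\<dots> = ennreal Cb * (\<integral>\<^sup>+v. ennreal (X v) \<partial>circ)" by (simp add: nn_integral_cmult)
    finally have "(\<integral>\<^sup>+u. (\<integral>\<^sup>+v. ennreal (X v powr a * Y u powr b * chord (u + v) powr (k - 1)) \<partial>circ) \<partial>circ)
        \<le> ennreal Ca * (\<integral>\<^sup>+u. ennreal (Y u) \<partial>circ) + ennreal Cb * (\<integral>\<^sup>+v. ennreal (X v) \<partial>circ)"
      by (simp add: add_left_mono)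
    also have "\<dots> \<le> ennreal Ca * 1 + ennreal Cb * 1"
      by (intro add_mono mult_left_mono X1 Y1) auto
    also have "\<dots> = ennreal (Ca + Cb)" using Ca Cb by simp
    finally show "(\<integral>\<^sup>+u. (\<integral>\<^sup>+v. ennreal (X v powr a * Y u powr b * chord (u + v) powr (k - 1)) \<partial>circ) \<partial>circ) \<le> ennreal (hls_const k a + hls_const k b)"
    by (simp only: Ca_def Cb_def)
qed

lemma nn_integral_circ_diff:
  assumes h [measurable]: "h \<in> borel_measurable borel" and per: "\<And>x. h (x + 2 * pi) = h x"
  shows "(\<integral>\<^sup>+t. h (c - t) \<partial>circ) = (\<integral>\<^sup>+t. h t \<partial>circ)"
proof -
  have "(\<integral>\<^sup>+t. h (c - t) \<partial>circ) = (\<integral>\<^sup>+t. h (c + t) \<partial>circ)"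
    using nn_integral_circ_reflect[of "\<lambda>t. h (c + t)"] by simp
  then show ?thesis using nn_integral_circ_shift[OF h per] by simp
qed

section \<open>Means of polynomials on smaller circles\<close>

lemma poly_circle_measurable [measurable]:
  "(\<lambda>t. poly f (of_real r * cis t)) \<in> borel_measurable borel"
  "(\<lambda>t. poly f (cis t)) \<in> borel_measurable borel"
  by (intro borel_measurable_continuous_onI continuous_intros)+

lemma poly_sup_le:
  assumes f: "boundary_mean q f \<le> 1" and q: "0 < q" and r: "0 \<le> r" "r < 1"
  shows "norm (poly f (of_real r * cis \<theta>)) powr q \<le> 18 / (1 - r)"
proof -
  define X where "X t = norm (poly f (cis t)) powr q" for t
  have [measurable]: "X \<in> borel_measurable borel" unfolding X_def by measurable
  have "ennreal (norm (poly f (of_real r * cis \<theta>)) powr q) \<le> (\<integral>\<^sup>+a. ennreal (X (\<theta> - a) * poisson r a) \<partial>circ)"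
    unfolding X_def by (rule poly_powr_le_poisson[OF r q])
  also have "\<dots> \<le> (\<integral>\<^sup>+a. ennreal (18 / (1 - r)) * ennreal (X (\<theta> - a)) \<partial>circ)"
  proof (rule nn_integral_mono)
    fix a
    have "X (\<theta> - a) * poisson r a \<le> X (\<theta> - a) * (18 / (1 - r))"
      using poisson_le_inverse[OF r] by (intro mult_left_mono) (auto simp: X_def)
    then show "ennreal (X (\<theta> - a) * poisson r a) \<le> ennreal (18 / (1 - r)) * ennreal (X (\<theta> - a))"
      using r by (subst ennreal_mult[symmetric]) (auto simp: X_def mult.commute intro!: ennreal_leI)
  qed
  also have "\<dots> = ennreal (18 / (1 - r)) * (\<integral>\<^sup>+a. ennreal (X a) \<partial>circ)"
    by (subst nn_integral_cmult, measurable, subst nn_integral_circ_diff[of "\<lambda>t. ennreal (X t)"]) (auto simp: X_def)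
  also have "\<dots> \<le> ennreal (18 / (1 - r)) * 1" using f by (intro mult_left_mono) (auto simp: X_def)
  finally have "ennreal (norm (poly f (of_real r * cis \<theta>)) powr q) \<le> ennreal (18 / (1 - r))" by simp
  then show ?thesis using r by (subst (asm) ennreal_le_iff) auto
qed

lemma poly_mean_le:
  assumes f: "boundary_mean q f \<le> 1" and q: "0 < q" and r: "0 \<le> r" "r < 1"
  shows "(\<integral>\<^sup>+t. ennreal (norm (poly f (of_real r * cis t)) powr q) \<partial>circ) \<le> 1"
proof -
  define X where "X t = norm (poly f (cis t)) powr q" for t
  have [measurable]: "X \<in> borel_measurable borel" unfolding X_def by measurable
  have "(\<integral>\<^sup>+t. ennreal (norm (poly f (of_real r * cis t)) powr q) \<partial>circ)
     \<le> (\<integral>\<^sup>+t. (\<integral>\<^sup>+a. ennreal (X (t - a) * poisson r a) \<partial>circ) \<partial>circ)"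
    unfolding X_def by (intro nn_integral_mono poly_powr_le_poisson[OF r q])
  also have "\<dots> = (\<integral>\<^sup>+a. (\<integral>\<^sup>+t. ennreal (X (t - a) * poisson r a) \<partial>circ) \<partial>circ)"
    by (rule circ2.Fubini') measurable
  also have "\<dots> = (\<integral>\<^sup>+a. ennreal (poisson r a) * (\<integral>\<^sup>+t. ennreal (X t) \<partial>circ) \<partial>circ)"
  proof (rule nn_integral_cong)
    fix a
    have "(\<integral>\<^sup>+t. ennreal (X (t - a) * poisson r a) \<partial>circ) = (\<integral>\<^sup>+t. ennreal (poisson r a) * ennreal (X (- a + t)) \<partial>circ)"
      using poisson_nonneg[OF r] by (intro nn_integral_cong) (simp add: ennreal_mult'[symmetric] mult.commute)
    also have "\<dots> = ennreal (poisson r a) * (\<integral>\<^sup>+t. ennreal (X (- a + t)) \<partial>circ)"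
      by (rule nn_integral_cmult) measurable
    also have "(\<integral>\<^sup>+t. ennreal (X (- a + t)) \<partial>circ) = (\<integral>\<^sup>+t. ennreal (X t) \<partial>circ)"
      by (rule nn_integral_circ_shift) (auto simp: X_def)
    finally show "(\<integral>\<^sup>+t. ennreal (X (t - a) * poisson r a) \<partial>circ) = ennreal (poisson r a) * (\<integral>\<^sup>+t. ennreal (X t) \<partial>circ)" .
  qed
  also have "\<dots> \<le> (\<integral>\<^sup>+a. ennreal (poisson r a) * 1 \<partial>circ)"
    using f by (intro nn_integral_mono mult_left_mono) (auto simp: X_def)
  finally show ?thesis using nn_integral_poisson[OF r] by simp
qed

text \<open>For \<open>j \<ge> q\<close> the extra power of \<open>|f|\<close> is estimated by the
  supremum on the circle, for \<open>j < q\<close> by \<open>1 + |f|^q\<close>. The factor 2 serves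
  the second case.\<close>

lemma poly_higher_mean_le:
  assumes f: "boundary_mean q f \<le> 1" and q: "0 < q" and r: "0 \<le> r" "r < 1"
    and j: "0 < j"
  shows "(\<integral>\<^sup>+t. ennreal (norm (poly f (of_real r * cis t)) powr j) \<partial>circ) \<le> ennreal (2 * (18 / (1 - r)) powr (max 0 (j / q - 1)))"
proof -
  define y where "y t = norm (poly f (of_real r * cis t))" for t
  have [measurable]: "y \<in> borel_measurable borel" unfolding y_def by measurable
  have sup: "y t powr q \<le> 18 / (1 - r)" for t unfolding y_def by (rule poly_sup_le[OF f q r])
  have mean: "(\<integral>\<^sup>+t. ennreal (y t powr q) \<partial>circ) \<le> 1" unfolding y_def by (rule poly_mean_le[OF f q r])
  show ?thesis unfolding y_def[symmetric]
  proof (cases "q \<le> j")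
    case True
    then have e: "0 \<le> j / q - 1" using q by simp
    have "(\<integral>\<^sup>+t. ennreal (y t powr j) \<partial>circ) \<le> (\<integral>\<^sup>+t. ennreal ((18 / (1 - r)) powr (j / q - 1)) * ennreal (y t powr q) \<partial>circ)"
    proof (rule nn_integral_mono)
      fix t
      have "y t powr j = (y t powr q) powr (j / q - 1) * y t powr q"
        using q by (simp add: powr_powr powr_add[symmetric] right_diff_distrib)
      also have "\<dots> \<le> (18 / (1 - r)) powr (j / q - 1) * y t powr q"
        using sup e by (intro mult_right_mono powr_mono2) auto
      finally show "ennreal (y t powr j) \<le> ennreal ((18 / (1 - r)) powr (j / q - 1)) * ennreal (y t powr q)"
        by (simp add: ennreal_mult'[symmetric] ennreal_leI)
    qed
    also have "\<dots> = ennreal ((18 / (1 - r)) powr (j / q - 1)) * (\<integral>\<^sup>+t. ennreal (y t powr q) \<partial>circ)"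
      by (rule nn_integral_cmult) measurable
    also have "\<dots> \<le> ennreal ((18 / (1 - r)) powr (j / q - 1)) * 1" by (intro mult_left_mono mean) simp
    also have "\<dots> \<le> ennreal (2 * (18 / (1 - r)) powr (max 0 (j / q - 1)))"
      using e by (simp add: max_absorb2 ennreal_leI)
    finally show "(\<integral>\<^sup>+t. ennreal (y t powr j) \<partial>circ) \<le> ennreal (2 * (18 / (1 - r)) powr (max 0 (j / q - 1)))" .
  next
    case False
    then have e: "j / q - 1 \<le> 0" using q by simp
    have "(\<integral>\<^sup>+t. ennreal (y t powr j) \<partial>circ) \<le> (\<integral>\<^sup>+t. 1 + ennreal (y t powr q) \<partial>circ)"
    proof (rule nn_integral_mono)
      fix t
      have "y t powr j \<le> 1 + y t powr q"
      proof (cases "y t \<le> 1")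
        case True
        then have "y t powr j \<le> 1 powr j" using j by (intro powr_mono2) (auto simp: y_def)
        then show ?thesis by (simp add: add_increasing2)
      next
        case False
        then have "y t powr j \<le> y t powr q" using \<open>\<not> q \<le> j\<close> by (intro powr_mono) auto
        then show ?thesis by simp
      qed
      then have "ennreal (y t powr j) \<le> ennreal (1 + y t powr q)" by (rule ennreal_leI)
      then show "ennreal (y t powr j) \<le> 1 + ennreal (y t powr q)" by simp
    qed
    also have "\<dots> = 1 + (\<integral>\<^sup>+t. ennreal (y t powr q) \<partial>circ)"
      by (subst nn_integral_add) (auto simp: emeasure_circ)
    also have "\<dots> \<le> 1 + 1" by (intro add_mono mean) simp
    also have "\<dots> = ennreal (2 * (18 / (1 - r)) powr (max 0 (j / q - 1)))"
      using e r by (simp add: max_absorb1)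
    finally show "(\<integral>\<^sup>+t. ennreal (y t powr j) \<partial>circ) \<le> ennreal (2 * (18 / (1 - r)) powr (max 0 (j / q - 1)))" .
  qed
qed

text \<open>For \<open>x = |f|^q\<close> and \<open>al = 1/q - 1/p\<close> this is
  \<open>|f|\<close> itself as long as \<open>x \<le> 1 / D\<close>; above that height it grows only
  like \<open>x powr (1 / p)\<close>. The cap \<open>1 / D\<close> is the order of the Poisson
  kernel's maximum at distance \<open>D\<close> from the circle.\<close>

definition layer :: "real \<Rightarrow> real \<Rightarrow> real \<Rightarrow> real \<Rightarrow> real" where
  "layer p al D x = x powr (1 / p) * (min x (1 / D)) powr al"

lemma layer_nonneg [simp]: "0 \<le> layer p al D x"
  by (simp add: layer_def)

lemma layer_measurable [measurable]: "layer p al D \<in> borel_measurable borel"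
  unfolding layer_def by measurable

text \<open>With \<open>X = |f|^q\<close> on the circle, split \<open>X\<close> at height \<open>1/(1-r)\<close> in the Poisson majorant of
  \<open>|f|^(q/p)\<close>: Jensen's inequality handles the low part, the bound \<open>poisson r \<le> 18/(1-r)\<close> the
  high part. The result is linear in the layers of \<open>X\<close>, also when \<open>q < 1\<close>.\<close>

lemma poly_le_poisson_layer:
  assumes f: "boundary_mean q f \<le> 1"
    and q: "0 < q" "q < p" "1 < p" and r: "0 \<le> r" "r < 1"
  shows "ennreal (norm (poly f (of_real r * cis \<theta>)))
    \<le> ennreal (2 powr (p / q) * 18 powr (p / q - 1))
       * (\<integral>\<^sup>+z. ennreal (layer p (1 / q - 1 / p) (1 - r) (norm (poly f (cis z)) powr q) * poisson r (\<theta> - z)) \<partial>circ)"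
proof -
  define X where "X t = norm (poly f (cis t)) powr q" for t
  have [measurable]: "X \<in> borel_measurable borel" unfolding X_def by measurable
  have X0: "0 \<le> X t" for t by (simp add: X_def)
  have Xper: "X (t + 2 * pi) = X t" for t by (simp add: X_def)
  define D where "D = 1 - r"
  have D: "0 < D" using r by (simp add: D_def)
  define al where "al = 1 / q - 1 / p"
  have al: "0 < al" using q by (simp add: al_def field_simps)
  define t where "t = p / q"
  have t: "1 < t" using q by (simp add: t_def)
  define P where "P = poisson r"
  have P0: "0 \<le> P a" for a unfolding P_def by (rule poisson_nonneg[OF r])
  have [measurable]: "P \<in> borel_measurable borel" by (simp add: P_def)
  define J where "J = (\<integral>\<^sup>+a. ennreal (layer p al D (X (\<theta> - a)) * P a) \<partial>circ)"
  have J_eq: "J = (\<integral>\<^sup>+z. ennreal (layer p al D (X z) * P (\<theta> - z)) \<partial>circ)"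
  proof -
    have "(\<integral>\<^sup>+z. ennreal (layer p al D (X (\<theta> - (\<theta> - z))) * P (\<theta> - z)) \<partial>circ) = J"
      unfolding J_def
    proof (rule nn_integral_circ_diff[of "\<lambda>a. ennreal (layer p al D (X (\<theta> - a)) * P a)"])
      fix x
      have "X (\<theta> - (x + 2 * pi)) = X (\<theta> - x)" using Xper[of "\<theta> - (x + 2 * pi)"] by simp
      then show "ennreal (layer p al D (X (\<theta> - (x + 2 * pi))) * P (x + 2 * pi)) = ennreal (layer p al D (X (\<theta> - x)) * P x)"
        by (simp only: P_def poisson_period)
    qed measurable
    then show ?thesis by simp
  qed
  define u1 where "u1 a = (if X (\<theta> - a) \<le> 1 / D then X (\<theta> - a) powr (1 / p) else 0)" for a
  define u2 where "u2 a = (if X (\<theta> - a) \<le> 1 / D then 0 else X (\<theta> - a) powr (1 / p))" for a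
  have [measurable]: "u1 \<in> borel_measurable borel" "u2 \<in> borel_measurable borel"
    unfolding u1_def u2_def by measurable
  have u0: "0 \<le> u1 a" "0 \<le> u2 a" for a by (auto simp: u1_def u2_def)
  define m1 where "m1 = (\<integral>\<^sup>+a. ennreal (u1 a * P a) \<partial>circ)"
  define m2 where "m2 = (\<integral>\<^sup>+a. ennreal (u2 a * P a) \<partial>circ)"
  define y where "y = norm (poly f (of_real r * cis \<theta>)) powr (q / p)"
  have y0: "0 \<le> y" by (simp add: y_def)
  have yt: "y powr t = norm (poly f (of_real r * cis \<theta>))"
    using q by (simp add: y_def t_def powr_powr)
  have "ennreal y \<le> (\<integral>\<^sup>+a. ennreal (norm (poly f (cis (\<theta> - a))) powr (q / p) * P a) \<partial>circ)"
    unfolding y_def P_def using q by (intro poly_powr_le_poisson r) auto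
  also have "\<dots> = (\<integral>\<^sup>+a. ennreal (u1 a * P a) + ennreal (u2 a * P a) \<partial>circ)"
  proof (rule nn_integral_cong)
    fix a
    have "norm (poly f (cis (\<theta> - a))) powr (q / p) = u1 a + u2 a"
      by (simp add: u1_def u2_def X_def powr_powr)
    then show "ennreal (norm (poly f (cis (\<theta> - a))) powr (q / p) * P a) = ennreal (u1 a * P a) + ennreal (u2 a * P a)"
      using u0[of a] P0[of a] by (simp add: distrib_right)
  qed
  also have "\<dots> = m1 + m2" unfolding m1_def m2_def by (rule nn_integral_add) measurable
  finally have ym: "ennreal y \<le> m1 + m2" .
  have layer_low: "u1 a powr t \<le> layer p al D (X (\<theta> - a))" for a
  proof (cases "X (\<theta> - a) \<le> 1 / D")
    case True
    have "(X (\<theta> - a) powr (1 / p)) powr t = X (\<theta> - a) powr (1 / p + al)"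
      using q by (simp add: powr_powr t_def al_def)
    then show ?thesis using True by (simp add: u1_def layer_def powr_add)
  qed (simp add: u1_def)
  have layer_high: "u2 a * (1 / D) powr al \<le> layer p al D (X (\<theta> - a))" for a
    by (auto simp: u2_def layer_def)
  \<comment> \<open>One of the two parts carries at least half of \<open>y\<close>; raising to the
    power \<open>t = p / q\<close> then recovers \<open>|f|\<close> from
    \<open>|f|^(q/p)\<close>.\<close>
  have "ennreal ((y / 2) powr t) \<le> ennreal (18 powr (t - 1)) * J"
  proof (cases "m2 \<le> m1")
    case True
    have "ennreal (y / 2) \<le> m1"
    proof (rule ccontr)
      assume "\<not> ennreal (y / 2) \<le> m1"
      then have "m1 < ennreal (y / 2)" "m2 < ennreal (y / 2)" using True by auto
      then have "m1 + m2 < ennreal (y / 2) + ennreal (y / 2)" by (rule add_strict_mono)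
      also have "\<dots> = ennreal y" using y0 by (simp add: ennreal_plus[symmetric] del: ennreal_plus)
      finally show False using ym by simp
    qed
    then have "ennreal ((y / 2) powr t) \<le> (\<integral>\<^sup>+a. ennreal (u1 a powr t * P a) \<partial>circ)"
      unfolding m1_def P_def using y0 t u0 by (intro poisson_power_mean[OF r]) auto
    also have "\<dots> \<le> J"
      unfolding J_def using layer_low P0 by (intro nn_integral_mono ennreal_leI mult_right_mono) auto
    also have "\<dots> = 1 * J" by simp
    also have "1 * J \<le> ennreal (18 powr (t - 1)) * J"
      using t by (intro mult_right_mono) (auto simp flip: ennreal_1 intro!: ennreal_leI ge_one_powr_ge_zero)
    finally show ?thesis .
  next
    case False
    have y2: "ennreal (y / 2) \<le> m2"
    proof (rule ccontr)
      assume "\<not> ennreal (y / 2) \<le> m2"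
      then have "m1 < ennreal (y / 2)" "m2 < ennreal (y / 2)" using False by auto
      then have "m1 + m2 < ennreal (y / 2) + ennreal (y / 2)" by (rule add_strict_mono)
      also have "\<dots> = ennreal y" using y0 by (simp add: ennreal_plus[symmetric] del: ennreal_plus)
      finally show False using ym by simp
    qed
    \<comment> \<open>Above height \<open>1 / D\<close> the power \<open>1 / p\<close> of
      \<open>X\<close> is at most \<open>X\<close> times \<open>D powr (1 - 1 / p)\<close>, since
      \<open>1 / p - 1\<close> is negative. Together with the maximum \<open>18 / D\<close> of the
      kernel this leaves the integral of \<open>X\<close>, which is at most 1.\<close>
    have u2_le: "u2 a * P a \<le> (18 * D powr (- (1 / p))) * X (\<theta> - a)" for a
    proof (cases "X (\<theta> - a) \<le> 1 / D")
      case False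
      then have x: "0 < X (\<theta> - a)" "1 / D \<le> X (\<theta> - a)" using D by (auto intro: less_trans[of 0 "1 / D"])
      have "X (\<theta> - a) powr (1 / p) = X (\<theta> - a) * X (\<theta> - a) powr (1 / p - 1)"
        using x by (simp add: powr_mult_base)
      also have "\<dots> \<le> X (\<theta> - a) * (1 / D) powr (1 / p - 1)"
        using x D q by (intro mult_left_mono powr_mono2') auto
      finally have "u2 a * P a \<le> (X (\<theta> - a) * (1 / D) powr (1 / p - 1)) * (18 / D)"
        using False poisson_le_inverse[OF r, of a] P0[of a] x by (intro mult_mono) (auto simp: u2_def P_def D_def)
      also have "(1 / D) powr (1 / p - 1) = D powr (1 - 1 / p)" using D by (simp add: powr_divide powr_minus_divide[symmetric] powr_minus[symmetric])
      also have "X (\<theta> - a) * D powr (1 - 1 / p) * (18 / D) = 18 * (D powr (1 - 1 / p) * D powr (-1)) * X (\<theta> - a)"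
        using D by (simp add: powr_minus_divide)
      also have "D powr (1 - 1 / p) * D powr (-1) = D powr (- (1 / p))"
        by (simp only: powr_add[symmetric]) simp
      finally show ?thesis .
    qed (use D X0 in \<open>simp add: u2_def\<close>)
    have "m2 \<le> (\<integral>\<^sup>+a. ennreal (18 * D powr (- (1 / p))) * ennreal (X (\<theta> - a)) \<partial>circ)"
      unfolding m2_def
    proof (rule nn_integral_mono)
      fix a show "ennreal (u2 a * P a) \<le> ennreal (18 * D powr (- (1 / p))) * ennreal (X (\<theta> - a))"
        using ennreal_leI[OF u2_le[of a]] by (simp add: ennreal_mult')
    qed
    also have "\<dots> = ennreal (18 * D powr (- (1 / p))) * (\<integral>\<^sup>+a. ennreal (X (\<theta> - a)) \<partial>circ)"
      by (rule nn_integral_cmult) measurable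
    also have "(\<integral>\<^sup>+a. ennreal (X (\<theta> - a)) \<partial>circ) = (\<integral>\<^sup>+a. ennreal (X a) \<partial>circ)"
      by (rule nn_integral_circ_diff) (auto simp: X_def)
    also have "ennreal (18 * D powr (- (1 / p))) * (\<integral>\<^sup>+a. ennreal (X a) \<partial>circ) \<le> ennreal (18 * D powr (- (1 / p))) * 1"
      using f by (intro mult_left_mono) (auto simp: X_def)
    finally have "m2 \<le> ennreal (18 * D powr (- (1 / p)))" by (simp only: mult_1_right)
    with y2 have "ennreal (y / 2) \<le> ennreal (18 * D powr (- (1 / p)))" by (rule order_trans)
    then have y18: "y / 2 \<le> 18 * D powr (- (1 / p))" by (subst (asm) ennreal_le_iff) auto
    \<comment> \<open>Only \<open>t - 1\<close> of the \<open>t\<close> powers are spent on the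
      absolute bound of \<open>y\<close>; the last one is kept and replaced by \<open>m2\<close>.
      That makes the result linear in the integral, and \<open>(t - 1) / p = al\<close> gives the
      right power of \<open>1 / D\<close>.\<close>
    have "(y / 2) powr t \<le> 18 powr (t - 1) * ((1 / D) powr al * (y / 2))"
    proof (cases "y = 0")
      case False
      then have "(y / 2) powr t = (y / 2) powr (t - 1) * (y / 2)"
        using powr_mult_base[of "y / 2" "t - 1"] y0 by (simp only: mult.commute) simp
      also have "\<dots> \<le> (18 * D powr (- (1 / p))) powr (t - 1) * (y / 2)"
        using y18 y0 t by (intro mult_right_mono powr_mono2) auto
      also have "(18 * D powr (- (1 / p))) powr (t - 1) = 18 powr (t - 1) * (1 / D) powr al"
      proof -
        have "- (1 / p) * (t - 1) = - al" using q by (simp add: t_def al_def field_simps)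
        then show ?thesis using D by (simp add: powr_mult powr_powr powr_divide powr_minus_divide)
      qed
      finally show ?thesis by (simp add: mult.assoc)
    qed simp
    then have "ennreal ((y / 2) powr t) \<le> ennreal (18 powr (t - 1)) * (ennreal ((1 / D) powr al) * ennreal (y / 2))"
      using y0 by (simp add: ennreal_mult'[symmetric] ennreal_leI)
    also have "\<dots> \<le> ennreal (18 powr (t - 1)) * (ennreal ((1 / D) powr al) * m2)"
      by (intro mult_left_mono y2) auto
    also have "ennreal ((1 / D) powr al) * m2 = (\<integral>\<^sup>+a. ennreal ((1 / D) powr al) * ennreal (u2 a * P a) \<partial>circ)"
      unfolding m2_def by (rule nn_integral_cmult[symmetric]) measurable
    also have "\<dots> \<le> J" unfolding J_def
    proof (rule nn_integral_mono)
      fix a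
      have "(u2 a * (1 / D) powr al) * P a \<le> layer p al D (X (\<theta> - a)) * P a"
        using layer_high P0 by (intro mult_right_mono) auto
      then show "ennreal ((1 / D) powr al) * ennreal (u2 a * P a) \<le> ennreal (layer p al D (X (\<theta> - a)) * P a)"
        using u0[of a] P0[of a] by (simp add: ennreal_mult'[symmetric] ennreal_leI mult_ac)
    qed
    finally show ?thesis by (simp add: mult_left_mono)
  qed
  then have "ennreal (2 powr t) * ennreal ((y / 2) powr t) \<le> ennreal (2 powr t) * (ennreal (18 powr (t - 1)) * J)"
    by (intro mult_left_mono) auto
  moreover have "2 powr t * (y / 2) powr t = y powr t" using y0 by (simp add: powr_divide)
  ultimately have "ennreal (y powr t) \<le> ennreal (2 powr t * 18 powr (t - 1)) * J"
    by (simp add: ennreal_mult'[symmetric] mult.assoc[symmetric])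
  then show ?thesis unfolding yt J_eq by (simp add: t_def P_def X_def D_def al_def)
qed

text \<open>A kernel already regularised at scale \<open>1 - r\<close> is not changed in size by a
  Poisson average at the same scale. A displacement by \<open>b\<close> can raise it only when
  \<open>chord b\<close> is comparable with \<open>U\<close>, and there the quadratic decay of the
  Poisson kernel pays for the loss.\<close>

lemma poisson_kernel_convolution:
  assumes k: "0 < k" "k < 1" and r: "0 \<le> r" "r < 1"
  shows "(\<integral>\<^sup>+v. ennreal ((1 - r + chord (u + v)) powr (k - 1) * poisson r (v - z)) \<partial>circ)
    \<le> ennreal (2 * (1 + 18 * (2 powr (1 + k) / k)) * (1 - r + chord (u + z)) powr (k - 1))"
proof -
  define D where "D = 1 - r"
  have D: "0 < D" using r by (simp add: D_def)
  define U where "U = D + chord (u + z)"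
  have U0: "0 < U" using D chord_nonneg[of "u + z"] by (simp add: U_def add_pos_nonneg del: chord_nonneg)
  have ptw: "(D + chord (u + z + b)) powr (k - 1) * poisson r b
      \<le> 2 * U powr (k - 1) * (poisson r b + 18 * D powr k * (D + chord b) powr (-1 - k))" for b
  proof -
    define V where "V = D + chord (u + z + b)"
    define w where "w = chord b"
    have V0: "D \<le> V" "0 < V" using D chord_nonneg[of "u + z + b"] by (auto simp: V_def add_pos_nonneg)
    have w0: "0 \<le> w" by (simp add: w_def)
    have "chord (u + z) \<le> chord (u + z + b) + chord (- b)"
      using chord_add[of "u + z + b" "- b"] by simp
    then have UVw: "U \<le> V + w" by (simp add: U_def V_def w_def)
    have "U powr (1 - k) \<le> 2 * (V powr (1 - k) + w powr (1 - k))"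
    proof -
      have "U powr (1 - k) \<le> (2 * max V w) powr (1 - k)"
        using UVw U0 k by (intro powr_mono2) auto
      also have "\<dots> = 2 powr (1 - k) * (max V w) powr (1 - k)" using V0 by (simp add: powr_mult)
      also have "\<dots> \<le> 2 powr 1 * (V powr (1 - k) + w powr (1 - k))"
        using k by (intro mult_mono powr_mono) (auto simp: max_def)
      finally show ?thesis by simp
    qed
    then have le: "U powr (k - 1) * V powr (k - 1) * U powr (1 - k) \<le> U powr (k - 1) * V powr (k - 1) * (2 * (V powr (1 - k) + w powr (1 - k)))"
      by (intro mult_left_mono) auto
    have "U powr (k - 1) * U powr (1 - k) = 1" using U0 by (simp add: powr_add[symmetric])
    then have e1: "U powr (k - 1) * V powr (k - 1) * U powr (1 - k) = V powr (k - 1)" by (simp add: mult.assoc mult.left_commute)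
    have "V powr (k - 1) * V powr (1 - k) = 1" using V0 by (simp add: powr_add[symmetric])
    then have e2: "U powr (k - 1) * V powr (k - 1) * (2 * (V powr (1 - k) + w powr (1 - k)))
       = 2 * U powr (k - 1) * (1 + w powr (1 - k) * V powr (k - 1))" by (simp add: algebra_simps)
    have 1: "V powr (k - 1) \<le> 2 * U powr (k - 1) * (1 + w powr (1 - k) * V powr (k - 1))"
      using le unfolding e1 e2 .
    have 2: "w powr (1 - k) * V powr (k - 1) * poisson r b \<le> 18 * D powr k * (D + w) powr (-1 - k)"
    proof -
      have Dw: "0 < D + w" using D w0 by simp
      have W: "w powr (1 - k) * V powr (k - 1) \<le> (D + w) powr (1 - k) * D powr (k - 1)"
        using w0 D V0 k by (intro mult_mono powr_mono2 powr_mono2') auto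
      have "w powr (1 - k) * V powr (k - 1) * poisson r b \<le> ((D + w) powr (1 - k) * D powr (k - 1)) * (18 * D / (D + w)\<^sup>2)"
        by (rule mult_mono[OF W])
           (use poisson_le[OF r, of b] poisson_nonneg[OF r, of b] in \<open>auto simp: D_def w_def\<close>)
      also have "18 * D / (D + w)\<^sup>2 = 18 * (D * (D + w) powr (-2))"
        using Dw by (simp add: powr_minus_divide powr_numeral)
      also have "(D + w) powr (1 - k) * D powr (k - 1) * (18 * (D * (D + w) powr (-2)))
        = 18 * (D * D powr (k - 1)) * ((D + w) powr (1 - k) * (D + w) powr (-2))" by simp
      also have "D * D powr (k - 1) = D powr k" using D by (simp add: powr_mult_base)
      also have "(D + w) powr (1 - k) * (D + w) powr (-2) = (D + w) powr (-1 - k)" by (simp add: powr_add[symmetric])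
      finally show ?thesis .
    qed
    have "V powr (k - 1) * poisson r b \<le> 2 * U powr (k - 1) * (1 + w powr (1 - k) * V powr (k - 1)) * poisson r b"
      using 1 poisson_nonneg[OF r] by (intro mult_right_mono) auto
    also have "\<dots> = 2 * U powr (k - 1) * (poisson r b + w powr (1 - k) * V powr (k - 1) * poisson r b)"
      by (simp add: algebra_simps)
    also have "\<dots> \<le> 2 * U powr (k - 1) * (poisson r b + 18 * D powr k * (D + w) powr (-1 - k))"
      using 2 by (intro mult_left_mono add_left_mono) auto
    finally show ?thesis by (simp add: V_def w_def)
  qed
  have "(\<integral>\<^sup>+v. ennreal ((D + chord (u + v)) powr (k - 1) * poisson r (v - z)) \<partial>circ)
     = (\<integral>\<^sup>+b. ennreal ((D + chord (u + (z + b))) powr (k - 1) * poisson r ((z + b) - z)) \<partial>circ)"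
    by (rule nn_integral_circ_shift[symmetric, of "\<lambda>v. ennreal ((D + chord (u + v)) powr (k - 1) * poisson r (v - z))"])
       (use poisson_period[of r "_ - z"] chord_period[of "u + _"] in \<open>auto simp: algebra_simps\<close>)
  also have "\<dots> \<le> (\<integral>\<^sup>+b. ennreal (2 * U powr (k - 1)) * (ennreal (poisson r b) + ennreal (18 * D powr k) * ennreal ((D + chord b) powr (-1 - k))) \<partial>circ)"
  proof (rule nn_integral_mono)
    fix b
    have "ennreal (2 * U powr (k - 1)) * (ennreal (poisson r b) + ennreal (18 * D powr k) * ennreal ((D + chord b) powr (-1 - k)))
       = ennreal (2 * U powr (k - 1) * (poisson r b + 18 * D powr k * (D + chord b) powr (-1 - k)))"
      using poisson_nonneg[OF r, of b] by (simp add: ennreal_mult' ennreal_plus)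
    then show "ennreal ((D + chord (u + (z + b))) powr (k - 1) * poisson r ((z + b) - z))
       \<le> ennreal (2 * U powr (k - 1)) * (ennreal (poisson r b) + ennreal (18 * D powr k) * ennreal ((D + chord b) powr (-1 - k)))"
      using ennreal_leI[OF ptw[of b]] by (simp add: add.assoc)
  qed
  also have "\<dots> = ennreal (2 * U powr (k - 1)) * (1 + ennreal (18 * D powr k) * (\<integral>\<^sup>+b. ennreal ((D + chord b) powr (-1 - k)) \<partial>circ))"
    by (subst nn_integral_cmult, measurable, subst nn_integral_add, measurable)
       (simp add: nn_integral_poisson[OF r] nn_integral_cmult)
  also have "\<dots> \<le> ennreal (2 * U powr (k - 1)) * (1 + ennreal (18 * D powr k) * ennreal (2 powr (1 + k) / k * D powr (- k)))"
    using k D by (intro mult_left_mono add_left_mono chord_integral_base) auto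
  also have "\<dots> = ennreal (2 * (1 + 18 * (2 powr (1 + k) / k)) * U powr (k - 1))"
  proof -
    have "D powr k * D powr (- k) = 1" using D by (simp add: powr_add[symmetric])
    then have "18 * D powr k * (2 powr (1 + k) / k * D powr (- k)) = 18 * (2 powr (1 + k) / k)"
      by (simp add: mult.left_commute mult.assoc)
    then have eq: "1 + ennreal (18 * D powr k) * ennreal (2 powr (1 + k) / k * D powr (- k)) = ennreal (1 + 18 * (2 powr (1 + k) / k))"
      using k by (subst ennreal_mult'[symmetric]) (auto simp: ennreal_plus)
    show ?thesis unfolding eq using k by (subst ennreal_mult'[symmetric]) (auto simp: mult_ac)
  qed
  finally show ?thesis by (simp add: U_def D_def)
qed

text \<open>The factor \<open>(1-e)^M\<close> is spent in three equal parts: on the symbol, on the kernel and on the polynomial.\<close>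

definition rad :: "real \<Rightarrow> real" where
  "rad e = root 3 (1 - e)"

lemma rad_bounds:
  assumes "0 < e" "e < 1"
  shows "0 < rad e" "rad e < 1" "rad e ^ 3 = 1 - e" "e / 3 \<le> 1 - rad e" "1 - rad e \<le> e"
proof -
  show pos: "0 < rad e" and lt: "rad e < 1" and cube: "rad e ^ 3 = 1 - e"
    using assms by (auto simp: rad_def)
  have "e = (1 - rad e) * (1 + rad e + rad e ^ 2)"
    using cube by (simp add: algebra_simps power2_eq_square power3_eq_cube)
  also have "\<dots> \<le> (1 - rad e) * 3"
  proof (rule mult_left_mono)
    have "rad e ^ 2 \<le> 1" using pos lt by (intro power_le_one) auto
    then show "1 + rad e + rad e ^ 2 \<le> 3" using lt by simp
  qed (use lt in simp)
  finally show "e / 3 \<le> 1 - rad e" by simp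
  have "rad e ^ 3 \<le> rad e ^ 1" using pos lt by (intro power_decreasing) auto
  then show "1 - rad e \<le> e" using cube by simp
qed

lemma rad_measurable [measurable]: "rad \<in> borel_measurable borel"
  unfolding rad_def by (intro borel_measurable_continuous_onI continuous_intros)

lemma poly_rad_measurable [measurable (raw)]:
  assumes "g \<in> borel_measurable M" "h \<in> borel_measurable M"
  shows "(\<lambda>x. norm (poly f (of_real (g x) * cis (h x)))) \<in> borel_measurable M"
proof -
  have "(\<lambda>z. norm (poly f z)) \<in> borel_measurable borel"
    by (intro borel_measurable_continuous_onI continuous_intros)
  then show ?thesis
    by (rule measurable_compose[rotated]) (use assms in measurable)
qed

section \<open>The smooth part, estimated in absolute value\<close>

definition smooth_kernel :: "real \<Rightarrow> real \<Rightarrow> real \<Rightarrow> real" where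
  "smooth_kernel k e t = (1 - rad e) powr (- k) * (1 - rad e + chord t) powr (k - 1)"

lemma smooth_kernel_measurable [measurable (raw)]:
  assumes "g \<in> borel_measurable M" "h \<in> borel_measurable M"
  shows "(\<lambda>x. smooth_kernel k (g x) (h x)) \<in> borel_measurable M"
  using assms unfolding smooth_kernel_def by measurable

abbreviation layer_kernel ::
    "real \<Rightarrow> real \<Rightarrow> real \<Rightarrow> (real \<Rightarrow> real) \<Rightarrow> real \<Rightarrow> real \<Rightarrow> real \<Rightarrow> ennreal" where
  "layer_kernel p k al X e u z \<equiv>
     ennreal (e powr (- k) * min (X z) (1 / e) powr al) * ennreal (X z powr (1 / p) * chord (u + z) powr (k - 1))"

text \<open>The Poisson majorant of \<open>f\<close> is moved to the kernel by Fubini, where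
  \<open>poisson_kernel_convolution\<close> absorbs it. What remains involves only the boundary
  values; replacing \<open>1 - rad e\<close> by \<open>e\<close> costs the power of 3.\<close>

lemma smooth_kernel_poly_le:
  assumes f: "boundary_mean q f \<le> 1"
    and q: "0 < q" "q < p" "1 < p" and al: "al = 1 / q - 1 / p" and k: "0 < k" "k < 1" and e: "0 < e" "e < 1"
  defines "X \<equiv> \<lambda>t. norm (poly f (cis t)) powr q"
  shows "(\<integral>\<^sup>+v. ennreal (smooth_kernel k e (u + v) * norm (poly f (of_real (rad e) * cis v))) \<partial>circ)
    \<le> ennreal (2 powr (p / q) * 18 powr (p / q - 1) * (2 * (1 + 18 * (2 powr (1 + k) / k))) * 3 powr (k + al))
      * (\<integral>\<^sup>+z. layer_kernel p k al X e u z \<partial>circ)"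
proof -
  have [measurable]: "X \<in> borel_measurable borel" unfolding X_def by measurable
  have X0: "0 \<le> X z" for z by (simp add: X_def)
  define r where "r = rad e"
  have r: "0 \<le> r" "r < 1" using rad_bounds[OF e] by (auto simp: r_def)
  define D where "D = 1 - r"
  have D: "0 < D" "e / 3 \<le> D" using r rad_bounds[OF e] by (auto simp: D_def r_def)
  have al0: "0 < al" using q unfolding al by (simp add: field_simps)
  define CM where "CM = 2 powr (p / q) * 18 powr (p / q - 1)"
  define CP where "CP = 2 * (1 + 18 * (2 powr (1 + k) / k))"
  have C0: "0 \<le> CM" "0 \<le> CP" using k by (auto simp: CM_def CP_def)
  define L where "L z = layer p al D (X z)" for z
  have [measurable]: "L \<in> borel_measurable borel" unfolding L_def by measurable
  have L0: "0 \<le> L z" for z by (simp add: L_def)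
  define K where "K v = (D + chord (u + v)) powr (k - 1)" for v
  have [measurable]: "K \<in> borel_measurable borel" unfolding K_def by measurable
  have K0: "0 \<le> K v" for v by (simp add: K_def)
  have P0: "0 \<le> poisson r t" for t by (rule poisson_nonneg[OF r])
  have "(\<integral>\<^sup>+v. ennreal (smooth_kernel k e (u + v) * norm (poly f (of_real r * cis v))) \<partial>circ)
     = (\<integral>\<^sup>+v. ennreal (D powr (- k)) * (ennreal (K v) * ennreal (norm (poly f (of_real r * cis v)))) \<partial>circ)"
    by (intro nn_integral_cong) (simp add: smooth_kernel_def K_def D_def r_def ennreal_mult'[symmetric] mult.assoc)
  also have "\<dots> \<le> (\<integral>\<^sup>+v. ennreal (D powr (- k)) * (ennreal (K v) * (ennreal CM * (\<integral>\<^sup>+z. ennreal (L z * poisson r (v - z)) \<partial>circ))) \<partial>circ)"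
    unfolding CM_def L_def D_def X_def al
    by (intro nn_integral_mono mult_left_mono poly_le_poisson_layer[OF f q r]) auto
  also have "\<dots> = ennreal (D powr (- k)) * (ennreal CM * (\<integral>\<^sup>+v. ennreal (K v) * (\<integral>\<^sup>+z. ennreal (L z * poisson r (v - z)) \<partial>circ) \<partial>circ))"
    by (subst nn_integral_cmult[symmetric], measurable, subst nn_integral_cmult[symmetric], measurable)
       (simp add: mult.left_commute)
  also have "(\<integral>\<^sup>+v. ennreal (K v) * (\<integral>\<^sup>+z. ennreal (L z * poisson r (v - z)) \<partial>circ) \<partial>circ)
     = (\<integral>\<^sup>+v. (\<integral>\<^sup>+z. ennreal (K v * (L z * poisson r (v - z))) \<partial>circ) \<partial>circ)"
  proof (rule nn_integral_cong)
    fix v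
    have "ennreal (K v) * (\<integral>\<^sup>+z. ennreal (L z * poisson r (v - z)) \<partial>circ) = (\<integral>\<^sup>+z. ennreal (K v) * ennreal (L z * poisson r (v - z)) \<partial>circ)"
      by (rule nn_integral_cmult[symmetric]) measurable
    then show "ennreal (K v) * (\<integral>\<^sup>+z. ennreal (L z * poisson r (v - z)) \<partial>circ) = (\<integral>\<^sup>+z. ennreal (K v * (L z * poisson r (v - z))) \<partial>circ)"
      by (simp only: ennreal_mult'[OF K0])
  qed
  also have "\<dots> = (\<integral>\<^sup>+z. (\<integral>\<^sup>+v. ennreal (K v * (L z * poisson r (v - z))) \<partial>circ) \<partial>circ)"
    by (rule circ2.Fubini') measurable
  also have "\<dots> = (\<integral>\<^sup>+z. ennreal (L z) * (\<integral>\<^sup>+v. ennreal (K v * poisson r (v - z)) \<partial>circ) \<partial>circ)"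
  proof (rule nn_integral_cong)
    fix z
    have "(\<integral>\<^sup>+v. ennreal (K v * (L z * poisson r (v - z))) \<partial>circ) = (\<integral>\<^sup>+v. ennreal (L z) * ennreal (K v * poisson r (v - z)) \<partial>circ)"
      by (simp only: ennreal_mult'[OF L0, symmetric] mult.left_commute)
    then show "(\<integral>\<^sup>+v. ennreal (K v * (L z * poisson r (v - z))) \<partial>circ) = ennreal (L z) * (\<integral>\<^sup>+v. ennreal (K v * poisson r (v - z)) \<partial>circ)"
      by (simp only:) (rule nn_integral_cmult, measurable)
  qed
  also have "\<dots> \<le> (\<integral>\<^sup>+z. ennreal (L z) * ennreal (CP * K z) \<partial>circ)"
    unfolding K_def D_def CP_def by (intro nn_integral_mono mult_left_mono poisson_kernel_convolution k r) simp
  also have "ennreal (D powr (- k)) * (ennreal CM * (\<integral>\<^sup>+z. ennreal (L z) * ennreal (CP * K z) \<partial>circ))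
      = (\<integral>\<^sup>+z. ennreal (CM * CP) * (ennreal (D powr (- k) * L z) * ennreal (K z)) \<partial>circ)"
  proof -
    have "ennreal (D powr (- k)) * (ennreal CM * (\<integral>\<^sup>+z. ennreal (L z) * ennreal (CP * K z) \<partial>circ))
       = (\<integral>\<^sup>+z. ennreal (D powr (- k)) * (ennreal CM * (ennreal (L z) * ennreal (CP * K z))) \<partial>circ)"
      by (subst nn_integral_cmult, measurable, subst nn_integral_cmult, measurable)
    also have "\<dots> = (\<integral>\<^sup>+z. ennreal (CM * CP) * (ennreal (D powr (- k) * L z) * ennreal (K z)) \<partial>circ)"
      using C0 L0 K0 by (intro nn_integral_cong) (simp add: ennreal_mult' mult_ac)
    finally show ?thesis .
  qed
  also have "\<dots> \<le> (\<integral>\<^sup>+z. ennreal (CM * CP) * (ennreal (3 powr (k + al)) * (layer_kernel p k al X e u z)) \<partial>circ)"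
  proof (rule nn_integral_mono_AE)
    show "AE z in circ. ennreal (CM * CP) * (ennreal (D powr (- k) * L z) * ennreal (K z))
      \<le> ennreal (CM * CP) * (ennreal (3 powr (k + al)) * (layer_kernel p k al X e u z))"
      using AE_chord[of u]
    proof (rule eventually_mono)
      fix z assume nz: "chord (u + z) \<noteq> 0"
      then have cpos: "0 < chord (u + z)" using chord_nonneg[of "u + z"] by linarith
      have 1: "D powr (- k) \<le> 3 powr k * e powr (- k)"
      proof -
        have "D powr (- k) \<le> (e / 3) powr (- k)" using D e k by (intro powr_mono2') auto
        also have "\<dots> = 3 powr k * e powr (- k)" using e by (simp add: powr_divide powr_minus_divide)
        finally show ?thesis .
      qed
      have 2: "min (X z) (1 / D) powr al \<le> 3 powr al * min (X z) (1 / e) powr al"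
      proof -
        have "1 / D \<le> 1 / (e / 3)" using D e by (intro divide_left_mono) auto
        then have "1 / D \<le> 3 * (1 / e)" by simp
        then have "min (X z) (1 / D) \<le> 3 * min (X z) (1 / e)" using X0[of z] by (auto simp: min_def)
        then have "min (X z) (1 / D) powr al \<le> (3 * min (X z) (1 / e)) powr al"
          using X0[of z] D al0 by (intro powr_mono2) auto
        also have "\<dots> = 3 powr al * min (X z) (1 / e) powr al" by (rule powr_mult)
        finally show ?thesis .
      qed
      have 3: "K z \<le> chord (u + z) powr (k - 1)"
        unfolding K_def using cpos D k by (intro powr_mono2') auto
      have "D powr (- k) * L z * K z = D powr (- k) * (min (X z) (1 / D) powr al * (X z powr (1 / p) * K z))"
        by (simp add: L_def layer_def mult_ac)
      also have "\<dots> \<le> (3 powr k * e powr (- k)) * ((3 powr al * min (X z) (1 / e) powr al) * (X z powr (1 / p) * chord (u + z) powr (k - 1)))"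
        using 1 2 3 K0[of z] by (intro mult_mono mult_nonneg_nonneg) auto
      also have "\<dots> = 3 powr (k + al) * (e powr (- k) * min (X z) (1 / e) powr al * (X z powr (1 / p) * chord (u + z) powr (k - 1)))"
        by (simp add: powr_add mult_ac)
      finally have le: "ennreal (D powr (- k) * L z * K z) \<le> ennreal (3 powr (k + al) * (e powr (- k) * min (X z) (1 / e) powr al * (X z powr (1 / p) * chord (u + z) powr (k - 1))))"
        by (rule ennreal_leI)
      have "ennreal (D powr (- k) * L z) * ennreal (K z) = ennreal (D powr (- k) * L z * K z)"
        using L0[of z] by (simp add: ennreal_mult'[symmetric])
      also note le
      also have "ennreal (3 powr (k + al) * (e powr (- k) * min (X z) (1 / e) powr al * (X z powr (1 / p) * chord (u + z) powr (k - 1))))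
         = ennreal (3 powr (k + al)) * (layer_kernel p k al X e u z)"
        by (simp add: ennreal_mult'[symmetric])
      finally show "ennreal (CM * CP) * (ennreal (D powr (- k) * L z) * ennreal (K z))
      \<le> ennreal (CM * CP) * (ennreal (3 powr (k + al)) * (layer_kernel p k al X e u z))"
        by (rule mult_left_mono) simp
    qed
  qed
  also have "\<dots> = ennreal (CM * CP) * (ennreal (3 powr (k + al)) * (\<integral>\<^sup>+z. layer_kernel p k al X e u z \<partial>circ))"
    by (subst nn_integral_cmult, measurable, subst nn_integral_cmult, measurable)
  also have "\<dots> = ennreal (CM * CP * 3 powr (k + al)) * (\<integral>\<^sup>+z. layer_kernel p k al X e u z \<partial>circ)"
    using C0 by (simp add: ennreal_mult' mult.assoc)
  finally show ?thesis by (simp add: mult_left_mono r_def CM_def CP_def mult.assoc)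
qed

definition pairing_const :: "real \<Rightarrow> real \<Rightarrow> real \<Rightarrow> real" where
  "pairing_const p q k = 2 powr (p / q) * 18 powr (p / q - 1) * (2 * (1 + 18 * (2 powr (1 + k) / k))) * 3 powr (k + (1 / q - 1 / p))
     * ((1 / ((1 / q - 1 / p) - k) + 1 / k) * (hls_const k (1 / p + k) + hls_const k (1 - 1 / p)))"

text \<open>After Fubini the integral over \<open>e\<close> is innermost, with \<open>u\<close> and
  \<open>z\<close> fixed: \<open>unit_min_integral\<close> raises the power of \<open>X\<close> from
  \<open>1 / p\<close> to \<open>1 / p + k\<close>. With \<open>1 - 1 / p\<close> for
  \<open>Y\<close> the exponents add up to \<open>1 + k\<close>, as
  \<open>hardy_littlewood_sobolev\<close> demands.\<close>

lemma smooth_part_pairing: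
  assumes f: "boundary_mean q f \<le> 1"
    and q: "0 < q" "q < p" "1 < p" and al: "al = 1 / q - 1 / p" and k: "0 < k" "k < al" "k < 1 - 1 / p"
    and Y [measurable]: "Y \<in> borel_measurable borel" and Y0: "\<And>t. 0 \<le> Y t" and Y1: "(\<integral>\<^sup>+t. ennreal (Y t) \<partial>circ) \<le> 1"
  shows "(\<integral>\<^sup>+e. ennreal (e powr (al - 1)) * (\<integral>\<^sup>+u. ennreal (Y u powr (1 - 1 / p)) *
      (\<integral>\<^sup>+v. ennreal (smooth_kernel k e (u + v) * norm (poly f (of_real (rad e) * cis v))) \<partial>circ) \<partial>circ) \<partial>unit_measure)
    \<le> ennreal (pairing_const p q k)"
proof -
  define X where "X t = norm (poly f (cis t)) powr q" for t
  have [measurable]: "X \<in> borel_measurable borel" unfolding X_def by measurable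
  have X0: "0 \<le> X z" for z by (simp add: X_def)
  have p0: "0 < 1 / p" using q by simp
  with k have k1: "k < 1" by linarith
  define C1 where "C1 = 2 powr (p / q) * 18 powr (p / q - 1) * (2 * (1 + 18 * (2 powr (1 + k) / k))) * 3 powr (k + al)"
  define C2 where "C2 = 1 / (al - k) + 1 / k"
  define C3 where "C3 = hls_const k (1 / p + k) + hls_const k (1 - 1 / p)"
  have C0: "0 \<le> C1" "0 \<le> C2" using k by (auto simp: C1_def C2_def)
  define M where "M u z = X z powr (1 / p) * Y u powr (1 - 1 / p) * chord (u + z) powr (k - 1)" for u z
  define E where "E e z = e powr (al - 1 - k) * min (X z) (1 / e) powr al" for e z
  have [measurable]: "case_prod M \<in> borel_measurable (borel \<Otimes>\<^sub>M borel)" "case_prod E \<in> borel_measurable (borel \<Otimes>\<^sub>M borel)"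
    unfolding M_def E_def by measurable
  have M0: "0 \<le> M u z" and E0: "0 \<le> E e z" for u z e by (auto simp: M_def E_def)
  have "(\<integral>\<^sup>+e. ennreal (e powr (al - 1)) * (\<integral>\<^sup>+u. ennreal (Y u powr (1 - 1 / p)) *
      (\<integral>\<^sup>+v. ennreal (smooth_kernel k e (u + v) * norm (poly f (of_real (rad e) * cis v))) \<partial>circ) \<partial>circ) \<partial>unit_measure)
    \<le> (\<integral>\<^sup>+e. (\<integral>\<^sup>+u. (\<integral>\<^sup>+z. ennreal C1 * ennreal (E e z * M u z) \<partial>circ) \<partial>circ) \<partial>unit_measure)"
  proof (rule nn_integral_unit_mono)
    fix e :: real assume e: "0 < e" "e < 1"
    have "ennreal (e powr (al - 1)) * (\<integral>\<^sup>+u. ennreal (Y u powr (1 - 1 / p)) *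
      (\<integral>\<^sup>+v. ennreal (smooth_kernel k e (u + v) * norm (poly f (of_real (rad e) * cis v))) \<partial>circ) \<partial>circ)
      \<le> ennreal (e powr (al - 1)) * (\<integral>\<^sup>+u. ennreal (Y u powr (1 - 1 / p)) *
         (ennreal C1 * (\<integral>\<^sup>+z. layer_kernel p k al X e u z \<partial>circ)) \<partial>circ)"
      unfolding C1_def X_def
      by (intro mult_left_mono nn_integral_mono smooth_kernel_poly_le[OF f q al k(1) k1 e]) auto
    also have "\<dots> = (\<integral>\<^sup>+u. ennreal (e powr (al - 1)) * (ennreal (Y u powr (1 - 1 / p)) *
         (ennreal C1 * (\<integral>\<^sup>+z. layer_kernel p k al X e u z \<partial>circ))) \<partial>circ)"
      by (rule nn_integral_cmult[symmetric]) measurable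
    also have "\<dots> = (\<integral>\<^sup>+u. (\<integral>\<^sup>+z. ennreal C1 * ennreal (E e z * M u z) \<partial>circ) \<partial>circ)"
    proof (rule nn_integral_cong)
      fix u
      have "ennreal (e powr (al - 1)) * (ennreal (Y u powr (1 - 1 / p)) *
         (ennreal C1 * (\<integral>\<^sup>+z. layer_kernel p k al X e u z \<partial>circ)))
        = (\<integral>\<^sup>+z. ennreal (e powr (al - 1)) * (ennreal (Y u powr (1 - 1 / p)) *
         (ennreal C1 * (layer_kernel p k al X e u z))) \<partial>circ)"
        by (subst nn_integral_cmult, measurable, subst nn_integral_cmult, measurable, subst nn_integral_cmult, measurable)
      also have "\<dots> = (\<integral>\<^sup>+z. ennreal C1 * ennreal (E e z * M u z) \<partial>circ)"
      proof (rule nn_integral_cong)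
        fix z
        have "e powr (al - 1) * (Y u powr (1 - 1 / p) * (C1 * ((e powr (- k) * min (X z) (1 / e) powr al) * (X z powr (1 / p) * chord (u + z) powr (k - 1)))))
          = C1 * (((e powr (al - 1) * e powr (- k)) * min (X z) (1 / e) powr al) * M u z)"
          by (simp add: M_def mult_ac)
        also have "e powr (al - 1) * e powr (- k) = e powr (al - 1 - k)"
          by (simp only: powr_add[symmetric] diff_conv_add_uminus)
        finally have "e powr (al - 1) * (Y u powr (1 - 1 / p) * (C1 * ((e powr (- k) * min (X z) (1 / e) powr al) * (X z powr (1 / p) * chord (u + z) powr (k - 1)))))
          = C1 * (E e z * M u z)" by (simp only: E_def)
        then show "ennreal (e powr (al - 1)) * (ennreal (Y u powr (1 - 1 / p)) *
         (ennreal C1 * (layer_kernel p k al X e u z)))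
          = ennreal C1 * ennreal (E e z * M u z)"
          using C0 by (simp only: ennreal_mult'[symmetric] powr_ge_zero mult_nonneg_nonneg)
      qed
      finally show "ennreal (e powr (al - 1)) * (ennreal (Y u powr (1 - 1 / p)) *
         (ennreal C1 * (\<integral>\<^sup>+z. layer_kernel p k al X e u z \<partial>circ)))
        = (\<integral>\<^sup>+z. ennreal C1 * ennreal (E e z * M u z) \<partial>circ)" .
    qed
    finally show "ennreal (e powr (al - 1)) * (\<integral>\<^sup>+u. ennreal (Y u powr (1 - 1 / p)) *
      (\<integral>\<^sup>+v. ennreal (smooth_kernel k e (u + v) * norm (poly f (of_real (rad e) * cis v))) \<partial>circ) \<partial>circ)
      \<le> (\<integral>\<^sup>+u. (\<integral>\<^sup>+z. ennreal C1 * ennreal (E e z * M u z) \<partial>circ) \<partial>circ)" .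
  qed
  also have "\<dots> = (\<integral>\<^sup>+u. (\<integral>\<^sup>+e. (\<integral>\<^sup>+z. ennreal C1 * ennreal (E e z * M u z) \<partial>circ) \<partial>unit_measure) \<partial>circ)"
    by (rule unit_circ.Fubini'[symmetric]) measurable
  also have "\<dots> = (\<integral>\<^sup>+u. (\<integral>\<^sup>+z. (\<integral>\<^sup>+e. ennreal C1 * ennreal (E e z * M u z) \<partial>unit_measure) \<partial>circ) \<partial>circ)"
    by (intro nn_integral_cong unit_circ.Fubini'[symmetric]) measurable
  also have "\<dots> \<le> (\<integral>\<^sup>+u. (\<integral>\<^sup>+z. ennreal (C1 * C2) * ennreal (X z powr (1 / p + k) * Y u powr (1 - 1 / p) * chord (u + z) powr (k - 1)) \<partial>circ) \<partial>circ)"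
  proof (intro nn_integral_mono)
    fix u z
    show "(\<integral>\<^sup>+e. ennreal C1 * ennreal (E e z * M u z) \<partial>unit_measure)
      \<le> ennreal (C1 * C2) * ennreal (X z powr (1 / p + k) * Y u powr (1 - 1 / p) * chord (u + z) powr (k - 1))"
    proof (cases "X z = 0")
      case True
      then show ?thesis by (simp add: M_def)
    next
      case False
      then have Xz: "0 < X z" using X0[of z] by simp
      have "(\<integral>\<^sup>+e. ennreal C1 * ennreal (E e z * M u z) \<partial>unit_measure) = (\<integral>\<^sup>+e. ennreal (C1 * M u z) * ennreal (E e z) \<partial>unit_measure)"
        using C0 M0 E0 by (simp add: ennreal_mult' mult_ac)
      also have "\<dots> = ennreal (C1 * M u z) * (\<integral>\<^sup>+e. ennreal (E e z) \<partial>unit_measure)"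
        by (rule nn_integral_cmult) measurable
      also have "\<dots> \<le> ennreal (C1 * M u z) * ennreal (C2 * X z powr k)"
        unfolding E_def C2_def by (intro mult_left_mono unit_min_integral k Xz) auto
      also have "\<dots> = ennreal (C1 * C2 * (M u z * X z powr k))"
        using C0 M0[of u z] by (simp add: ennreal_mult'[symmetric] mult_ac)
      also have "M u z * X z powr k = X z powr (1 / p + k) * Y u powr (1 - 1 / p) * chord (u + z) powr (k - 1)"
        by (simp add: M_def powr_add mult_ac)
      finally show ?thesis using C0 by (simp add: ennreal_mult')
    qed
  qed
  also have "\<dots> = ennreal (C1 * C2) * (\<integral>\<^sup>+u. (\<integral>\<^sup>+z. ennreal (X z powr (1 / p + k) * Y u powr (1 - 1 / p) * chord (u + z) powr (k - 1)) \<partial>circ) \<partial>circ)"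
    by (subst nn_integral_cmult[symmetric], measurable, intro nn_integral_cong nn_integral_cmult, measurable)
  also have "\<dots> \<le> ennreal (C1 * C2) * ennreal C3"
    unfolding C3_def using q k f
    by (intro mult_left_mono hardy_littlewood_sobolev) (auto simp: X_def Y0 Y1)
  also have "\<dots> = ennreal (C1 * C2 * C3)"
    by (rule ennreal_mult'[symmetric]) (use C0 in simp)
  also have "C1 * C2 * C3 = pairing_const p q k"
    by (simp only: pairing_const_def C1_def C2_def C3_def al mult.assoc)
  finally show ?thesis .
qed

subsection \<open>Bilinear estimates\<close>

definition smooth_const :: "real \<Rightarrow> real \<Rightarrow> real" where
  "smooth_const k L = 42 * kern_const k L"

definition error_const :: "real \<Rightarrow> real" where
  "error_const L = (3 + L) * (2 + 8 * (exp pi)\<^sup>2)"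

lemma error_const_nonneg: "1 \<le> L \<Longrightarrow> 0 \<le> error_const L"
  by (simp add: error_const_def)

lemma smooth_const_nonneg: "0 < k \<Longrightarrow> 1 \<le> L \<Longrightarrow> 0 \<le> smooth_const k L"
  by (simp add: smooth_const_def kern_const_def)

lemma poly_circle_sum:
  "poly f (of_real r * cis v) = (\<Sum>n\<le>degree f. (coeff f n * of_real (r ^ n)) * cis (of_int (int n) * v))"
  unfolding poly_altdef by (intro sum.cong refl) (simp add: power_mult_distrib Complex.DeMoivre mult.assoc)

lemma poly_circle_bounded:
  assumes "0 \<le> r" "r \<le> 1"
  shows "norm (poly f (of_real r * cis v)) \<le> (\<Sum>n\<le>degree f. norm (coeff f n))"
  unfolding poly_circle_sum using assms
  by (intro sum_norm_le) (simp add: norm_mult norm_power mult_left_le power_le_one)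

lemma poly_fourier:
  "(LINT v|circ. poly f (of_real r * cis v) * cis (- real n * v)) = coeff f n * of_real (r ^ n)"
proof -
  let ?c = "\<lambda>j. coeff f j * of_real (r ^ j)"
  have "(LINT v|circ. poly f (of_real r * cis v) * cis (- real n * v))
     = (LINT v|circ. (\<Sum>j\<le>degree f. ?c j * cis (of_int (int j - int n) * v)))"
    unfolding poly_circle_sum sum_distrib_right
    by (intro Bochner_Integration.integral_cong refl sum.cong) (simp add: mult.assoc cis_mult algebra_simps)
  also have "\<dots> = (\<Sum>j\<le>degree f. LINT v|circ. ?c j * cis (of_int (int j - int n) * v))"
    by (intro Bochner_Integration.integral_sum integrable_circ[where H = "norm (?c _)"]) (auto simp: norm_mult)
  also have "\<dots> = (\<Sum>j\<le>degree f. if j = n then ?c j else 0)"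
    by (intro sum.cong refl) (simp only: integral_mult_right_zero integral_circ_cis, simp)
  also have "\<dots> = ?c n" by (cases "n \<le> degree f") (auto simp: coeff_eq_0)
  finally show ?thesis .
qed

text \<open>The coefficients of \<open>f\<close> are paired with the columns of the matrix. The
  smooth parts of all columns are summed before taking absolute values; the errors are paired with
  the coefficients by Cauchy-Schwarz, Parseval's identity turning the latter into the mean square of
  \<open>f\<close>.\<close>

lemma bilinear_input_bound:
  fixes \<beta> \<gamma> \<phi> :: real and C :: "nat \<Rightarrow> nat"
  assumes B: "summable (\<lambda>n. norm (B n))" and A: "\<And>t. norm (pseries B (cis t)) \<le> A"
    and e: "0 < e" "e < 1" and R: "0 < R" "R \<le> 1"
    and k: "0 < k" "k < 1" and L: "1 \<le> L" "\<bar>1 + \<beta>\<bar> \<le> L" "1 \<le> L * \<bar>1 + \<beta>\<bar>"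
    and C: "\<And>i. max 0 (\<beta> * real i + \<gamma>) \<le> real (C i)" "\<And>i. real (C i) \<le> max 0 (\<beta> * real i + \<gamma>) + 1"
  shows "ennreal (norm (\<Sum>n\<le>degree f. (coeff f n * of_real (rad e ^ n)) * (of_real (rad e ^ n)
       * tail_coeff B (C n) n (of_real ((rad e)\<^sup>2 * R) * cis \<phi>))))
    \<le> ennreal (A * smooth_const k L) * (\<integral>\<^sup>+v. ennreal (smooth_kernel k e (\<phi> + v) * norm (poly f (of_real (rad e) * cis v))) \<partial>circ)
      + ennreal (A * sqrt (error_const L) * sqrt (LINT v|circ. (norm (poly f (of_real (rad e) * cis v)))\<^sup>2))"
proof -
  define r where "r = rad e"
  have r: "0 < r" "r < 1" using rad_bounds[OF e] by (auto simp: r_def)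
  define s where "s = r\<^sup>2 * R"
  have rr: "r\<^sup>2 \<le> r" using r by (simp add: power2_eq_square mult_left_le)
  have s: "0 < s" "s \<le> r"
  proof -
    show "0 < s" using r R by (simp add: s_def)
    have "s \<le> r\<^sup>2 * 1" unfolding s_def using R by (intro mult_left_mono) auto
    then show "s \<le> r" using rr by simp
  qed
  have A0: "0 \<le> A" using A[of 0] norm_ge_zero order_trans by blast
  define c where "c i = max 0 (\<beta> * real i + \<gamma>)" for i :: nat
  define a where "a n = coeff f n * of_real (r ^ n)" for n
  define w where "w n = smooth_coeff B (c n) n s \<phi>" for n
  define E where "E n = tail_coeff B (C n) n (of_real s * cis \<phi>) - w n" for n
  define F where "F v = poly f (of_real r * cis v)" for v
  have [measurable]: "F \<in> borel_measurable borel" unfolding F_def by measurable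
  \<comment> \<open>The angle \<open>- v\<close> extracts the coefficients of \<open>f\<close> by
    integration against \<open>F\<close>, and the geometric sum in \<open>n\<close> becomes a
    function of \<open>\<phi> + v\<close>.\<close>
  define G where "G v = (\<Sum>n\<in>{0..degree f}. (of_real r * cis (- v)) ^ n * w n)" for v
  have [measurable]: "G \<in> borel_measurable borel" unfolding G_def by measurable
  have Gle: "norm (G v) \<le> A * smooth_const k L * smooth_kernel k e (\<phi> + v)" for v
  proof -
    have "norm (G v) \<le> 42 * A * kern_const k L * ((1 - r) powr (-k) * (1 - r + chord (- v - \<phi>)) powr (k - 1))"
      unfolding G_def w_def c_def using s r k L by (intro smooth_sum_bound B A) auto
    moreover have "chord (- v - \<phi>) = chord (\<phi> + v)"
    proof -
      have "- v - \<phi> = - (\<phi> + v)" by simp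
      then show ?thesis by (simp only: chord_minus)
    qed
    ultimately show ?thesis by (simp add: smooth_const_def smooth_kernel_def r_def mult_ac)
  qed
  define M where "M = (\<Sum>n\<le>degree f. norm (coeff f n))"
  have FM: "norm (F v) \<le> M" for v unfolding F_def M_def using r by (intro poly_circle_bounded) auto
  have term_int: "(LINT v|circ. F v * ((of_real r * cis (- v)) ^ n * w n)) = a n * (of_real (r ^ n) * w n)" for n
  proof -
    have "(of_real r * cis (- v)) ^ n = of_real (r ^ n) * cis (- real n * v)" for v
      by (simp only: power_mult_distrib Complex.DeMoivre of_real_power mult_minus_left mult_minus_right)
    then have "(LINT v|circ. F v * ((of_real r * cis (- v)) ^ n * w n))
        = (LINT v|circ. (of_real (r ^ n) * w n) * (F v * cis (- real n * v)))"
      by (simp only: mult_ac)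
    also have "\<dots> = (of_real (r ^ n) * w n) * (coeff f n * of_real (r ^ n))"
      by (simp only: integral_mult_right_zero F_def poly_fourier)
    finally show ?thesis by (simp only: a_def mult_ac)
  qed
  have "(LINT v|circ. F v * G v) = (LINT v|circ. (\<Sum>n\<in>{0..degree f}. F v * ((of_real r * cis (- v)) ^ n * w n)))"
    by (simp add: G_def sum_distrib_left)
  also have "\<dots> = (\<Sum>n\<in>{0..degree f}. LINT v|circ. F v * ((of_real r * cis (- v)) ^ n * w n))"
  proof (intro Bochner_Integration.integral_sum integrable_circ)
    fix n v
    have "norm (F v) * (r ^ n * norm (w n)) \<le> M * (1 * norm (w n))"
      using FM[of v] r order_trans[OF norm_ge_zero FM[of v]] by (intro mult_mono) (auto simp: power_le_one)
    then show "norm (F v * ((of_real r * cis (- v)) ^ n * w n)) \<le> M * norm (w n)"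
      using r by (simp add: norm_mult norm_power)
  qed measurable
  also have "\<dots> = (\<Sum>n\<le>degree f. a n * (of_real (r ^ n) * w n))"
    unfolding term_int by (simp add: atMost_atLeast0)
  finally have smooth: "(\<Sum>n\<le>degree f. a n * (of_real (r ^ n) * w n)) = (LINT v|circ. F v * G v)" by simp
  have "ennreal (norm (\<Sum>n\<le>degree f. a n * (of_real (r ^ n) * w n))) \<le> (\<integral>\<^sup>+v. ennreal (norm (F v * G v)) \<partial>circ)"
    unfolding smooth by (rule norm_integral_circ_le)
  also have "\<dots> \<le> (\<integral>\<^sup>+v. ennreal (A * smooth_const k L) * ennreal (smooth_kernel k e (\<phi> + v) * norm (F v)) \<partial>circ)"
  proof (rule nn_integral_mono)
    fix v
    have "norm (F v) * norm (G v) \<le> norm (F v) * (A * smooth_const k L * smooth_kernel k e (\<phi> + v))"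
      using Gle by (intro mult_left_mono) auto
    then have "norm (F v * G v) \<le> (A * smooth_const k L) * (smooth_kernel k e (\<phi> + v) * norm (F v))"
      by (simp add: norm_mult mult_ac)
    then show "ennreal (norm (F v * G v)) \<le> ennreal (A * smooth_const k L) * ennreal (smooth_kernel k e (\<phi> + v) * norm (F v))"
      using A0 smooth_const_nonneg[OF k(1) L(1)] by (subst ennreal_mult'[symmetric]) (auto intro: ennreal_leI)
  qed
  also have "\<dots> = ennreal (A * smooth_const k L) * (\<integral>\<^sup>+v. ennreal (smooth_kernel k e (\<phi> + v) * norm (F v)) \<partial>circ)"
    by (rule nn_integral_cmult) measurable
  finally have 1: "ennreal (norm (\<Sum>n\<le>degree f. a n * (of_real (r ^ n) * w n)))
    \<le> ennreal (A * smooth_const k L) * (\<integral>\<^sup>+v. ennreal (smooth_kernel k e (\<phi> + v) * norm (F v)) \<partial>circ)" .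
  have Esq: "(\<Sum>n\<in>{0..degree f}. (norm (E n))\<^sup>2) \<le> (3 + L) * A\<^sup>2 * (2 + 8 * (exp pi)\<^sup>2)"
    unfolding E_def w_def using s r C L
    by (intro error_sum_bound B A card_level_le[where \<beta> = \<beta> and \<gamma> = \<gamma>]) (auto simp: c_def)
  have pars: "(\<Sum>n\<le>degree f. (norm (a n))\<^sup>2) = (LINT v|circ. (norm (F v))\<^sup>2)"
    unfolding F_def poly_circle_sum a_def by (rule parseval_finite[symmetric]) auto
  have "norm (\<Sum>n\<le>degree f. a n * (of_real (r ^ n) * E n)) \<le> (\<Sum>n\<le>degree f. norm (a n) * norm (E n))"
  proof (rule sum_norm_le)
    fix n
    have "norm (of_real (r ^ n) * E n) \<le> 1 * norm (E n)"
      unfolding norm_mult using r by (intro mult_right_mono) (auto simp: norm_power power_le_one)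
    then show "norm (a n * (of_real (r ^ n) * E n)) \<le> norm (a n) * norm (E n)"
      by (simp only: norm_mult[of "a n"] mult_1_left mult_left_mono norm_ge_zero)
  qed
  also have "\<dots> \<le> sqrt ((\<Sum>n\<le>degree f. (norm (a n))\<^sup>2) * (\<Sum>n\<le>degree f. (norm (E n))\<^sup>2))"
    by (rule real_le_rsqrt) (rule Cauchy_Schwarz_ineq_sum)
  also have "\<dots> \<le> sqrt ((LINT v|circ. (norm (F v))\<^sup>2) * (A\<^sup>2 * error_const L))"
    unfolding pars
  proof (intro real_sqrt_le_mono mult_left_mono)
    show "(\<Sum>n\<le>degree f. (norm (E n))\<^sup>2) \<le> A\<^sup>2 * error_const L"
      using Esq by (simp add: error_const_def atMost_atLeast0 mult_ac)
  qed (simp add: integral_nonneg_AE)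
  also have "\<dots> = A * sqrt (error_const L) * sqrt (LINT v|circ. (norm (F v))\<^sup>2)"
    using A0 by (simp add: real_sqrt_mult mult_ac)
  finally have 2: "norm (\<Sum>n\<le>degree f. a n * (of_real (r ^ n) * E n)) \<le> A * sqrt (error_const L) * sqrt (LINT v|circ. (norm (F v))\<^sup>2)" .
  have "(\<Sum>n\<le>degree f. a n * (of_real (r ^ n) * tail_coeff B (C n) n (of_real s * cis \<phi>)))
     = (\<Sum>n\<le>degree f. a n * (of_real (r ^ n) * w n)) + (\<Sum>n\<le>degree f. a n * (of_real (r ^ n) * E n))"
    unfolding sum.distrib[symmetric] by (intro sum.cong refl) (simp add: E_def algebra_simps)
  then have "ennreal (norm (\<Sum>n\<le>degree f. a n * (of_real (r ^ n) * tail_coeff B (C n) n (of_real s * cis \<phi>))))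
     \<le> ennreal (norm (\<Sum>n\<le>degree f. a n * (of_real (r ^ n) * w n))) + ennreal (norm (\<Sum>n\<le>degree f. a n * (of_real (r ^ n) * E n)))"
    by (simp add: ennreal_plus[symmetric] norm_triangle_ineq ennreal_leI del: ennreal_plus)
  also have "\<dots> \<le> ennreal (A * smooth_const k L) * (\<integral>\<^sup>+v. ennreal (smooth_kernel k e (\<phi> + v) * norm (F v)) \<partial>circ)
     + ennreal (A * sqrt (error_const L) * sqrt (LINT v|circ. (norm (F v))\<^sup>2))"
    by (intro add_mono 1 ennreal_leI 2)
  finally show ?thesis by (simp only: F_def a_def s_def r_def)
qed

text \<open>The transposed situation: a row with threshold \<open>D\<close> is the pairing of
  \<open>f\<close> with a tail of the symbol at the reflected angle. Each of the two radii
  contributes one factor \<open>r ^ n\<close>.\<close>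

lemma poly_tail_pairing:
  assumes B: "summable (\<lambda>n. norm (B n))" and r: "0 < r" "r < 1"
  shows "(LINT v|circ. poly f (of_real r * cis v) * tail_coeff B D m (of_real r * cis (- v)))
    = (\<Sum>n\<in>{D..degree f}. B (n + m) * of_real (r ^ n) * (coeff f n * of_real (r ^ n)))"
proof -
  define M where "M = (\<Sum>n\<le>degree f. norm (coeff f n))"
  define c where "c j = B (j + D + m) * of_real (r ^ (j + D))" for j
  have "summable (\<lambda>j. norm (B (j + (D + m))))" using B by (subst summable_iff_shift)
  then have c: "summable (\<lambda>j. norm (c j))"
    by (rule summable_comparison_test'[of _ 0])
       (use r in \<open>auto simp: c_def norm_mult norm_power mult_left_le power_le_one add.assoc\<close>)
  have "(\<lambda>j. c j * (LINT v|circ. poly f (of_real r * cis v) * cis (- real (j + D) * v))) sums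
     (LINT v|circ. poly f (of_real r * cis v) * (\<Sum>j. c j * cis (- real (j + D) * v)))"
    using r poly_circle_bounded[of r f] by (intro sums_integral_circ[where H = M] c) (auto simp: M_def)
  moreover have "(\<Sum>j. c j * cis (- real (j + D) * v)) = tail_coeff B D m (of_real r * cis (- v))" for v
    unfolding tail_coeff_def c_def
    by (intro suminf_cong)
       (simp only: power_mult_distrib Complex.DeMoivre mult.assoc of_real_power mult_minus_left mult_minus_right)
  ultimately have "(\<lambda>j. c j * (coeff f (j + D) * of_real (r ^ (j + D)))) sums
     (LINT v|circ. poly f (of_real r * cis v) * tail_coeff B D m (of_real r * cis (- v)))"
    by (simp only: poly_fourier)
  moreover have "(\<lambda>j. c j * (coeff f (j + D) * of_real (r ^ (j + D)))) sums
     (\<Sum>j\<in>{..<Suc (degree f) - D}. c j * (coeff f (j + D) * of_real (r ^ (j + D))))"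
    by (rule sums_finite) (auto simp: coeff_eq_0)
  ultimately have "(LINT v|circ. poly f (of_real r * cis v) * tail_coeff B D m (of_real r * cis (- v)))
     = (\<Sum>j\<in>{..<Suc (degree f) - D}. c j * (coeff f (j + D) * of_real (r ^ (j + D))))"
    by (rule sums_unique2)
  also have "\<dots> = (\<Sum>n\<in>{D..degree f}. B (n + m) * of_real (r ^ n) * (coeff f n * of_real (r ^ n)))"
    by (rule sum.reindex_bij_witness[of _ "\<lambda>n. n - D" "\<lambda>j. j + D"]) (auto simp: c_def)
  finally show ?thesis .
qed

lemma smooth_coeff_measurable:
  assumes B: "summable (\<lambda>n. norm (B n))"
  shows "(\<lambda>v. smooth_coeff B c i s (- v)) \<in> borel_measurable borel"
proof -
  have "(\<lambda>t. pseries B (cis t)) \<in> borel_measurable borel"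
    by (intro borel_measurable_continuous_onI continuous_on_compose2[OF continuous_on_pseries[OF B]]) (auto intro!: continuous_intros)
  then have [measurable]: "(\<lambda>x. pseries B (cis (- fst x - snd x))) \<in> borel_measurable (borel \<Otimes>\<^sub>M circ)"
    by (rule measurable_compose[rotated]) measurable
  have "(\<lambda>x. pseries B (cis (- fst x - snd x)) * cis (- real i * (- fst x - snd x))
     * (of_real (s powr c) * cis (snd x * c)) / (1 - of_real s * cis (snd x))) \<in> borel_measurable (borel \<Otimes>\<^sub>M circ)"
    by measurable
  then show ?thesis unfolding smooth_coeff_def
    by (intro circ.borel_measurable_lebesgue_integral) (simp add: case_prod_beta')
qed

lemma tail_coeff_measurable:
  assumes B: "summable (\<lambda>n. norm (B n))" and r: "0 \<le> r" "r < 1"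
  shows "(\<lambda>v. tail_coeff B C i (of_real r * cis (- v))) \<in> borel_measurable borel"
proof (rule borel_measurable_continuous_onI)
  have sm: "summable (\<lambda>m. norm (B (m + (C + i))))" using B by (subst summable_iff_shift)
  have "uniform_limit UNIV (\<lambda>N v. \<Sum>m<N. B (m + C + i) * (of_real r * cis (- v)) ^ (m + C))
     (\<lambda>v. \<Sum>m. B (m + C + i) * (of_real r * cis (- v)) ^ (m + C)) sequentially"
  proof (rule Weierstrass_m_test)
    fix n and v :: real
    show "norm (B (n + C + i) * (of_real r * cis (- v)) ^ (n + C)) \<le> norm (B (n + (C + i)))"
      using r by (simp add: norm_mult norm_power mult_left_le power_le_one add.assoc)
  qed (rule sm)
  then have "continuous_on UNIV (\<lambda>v. \<Sum>m. B (m + C + i) * (of_real r * cis (- v)) ^ (m + C))"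
    by (rule uniform_limit_theorem[rotated]) (auto intro!: always_eventually continuous_intros)
  then show "continuous_on UNIV (\<lambda>v. tail_coeff B C i (of_real r * cis (- v)))" by (simp add: tail_coeff_def)
qed

text \<open>Now the geometric sum runs over the rows, with the output angle as variable. For fixed
  \<open>v\<close> the error is a trigonometric polynomial in the output angle whose mean square is
  controlled by \<open>error_sum_bound\<close>; it is paired with \<open>g\<close>, and for
  \<open>f\<close> the first mean is enough.\<close>

lemma bilinear_output_bound:
  fixes \<beta> \<gamma> :: real and C :: "nat \<Rightarrow> nat"
  assumes B: "summable (\<lambda>n. norm (B n))" and A: "\<And>t. norm (pseries B (cis t)) \<le> A" and Apos: "0 < A"
    and e: "0 < e" "e < 1" and R: "0 < R" "R \<le> 1"
    and k: "0 < k" "k < 1" and L: "1 \<le> L" "\<bar>1 + \<beta>\<bar> \<le> L" "1 \<le> L * \<bar>1 + \<beta>\<bar>"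
    and C: "\<And>i. max 0 (\<beta> * real i + \<gamma>) \<le> real (C i)" "\<And>i. real (C i) \<le> max 0 (\<beta> * real i + \<gamma>) + 1"
    and g [measurable]: "g \<in> borel_measurable borel" and g0: "\<And>t. 0 \<le> g t"
    and g2: "(\<integral>\<^sup>+t. ennreal ((g t)\<^sup>2) \<partial>circ) \<le> 2"
  shows "(\<integral>\<^sup>+\<phi>. ennreal (g \<phi>) * ennreal (norm (\<Sum>m\<in>{m0..m1}. (of_real ((rad e)\<^sup>2 * R) * cis \<phi>) ^ m *
       (\<Sum>n\<in>{C m..degree f}. B (n + m) * of_real (rad e ^ n) * (coeff f n * of_real (rad e ^ n))))) \<partial>circ)
    \<le> ennreal (A * smooth_const k L) * (\<integral>\<^sup>+\<phi>. ennreal (g \<phi>) *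
        (\<integral>\<^sup>+v. ennreal (smooth_kernel k e (\<phi> + v) * norm (poly f (of_real (rad e) * cis v))) \<partial>circ) \<partial>circ)
      + ennreal (A * (error_const L + 2)) * (\<integral>\<^sup>+v. ennreal (norm (poly f (of_real (rad e) * cis v))) \<partial>circ)"
proof -
  define r where "r = rad e"
  have r: "0 < r" "r < 1" using rad_bounds[OF e] by (auto simp: r_def)
  define s where "s = r\<^sup>2 * R"
  have rr: "r\<^sup>2 \<le> r" using r by (simp add: power2_eq_square mult_left_le)
  have s: "0 < s" "s \<le> r"
  proof -
    show "0 < s" using r R by (simp add: s_def)
    have "s \<le> r\<^sup>2 * 1" unfolding s_def using R by (intro mult_left_mono) auto
    then show "s \<le> r" using rr by simp
  qed
  define c where "c i = max 0 (\<beta> * real i + \<gamma>)" for i :: nat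
  define F where "F v = poly f (of_real r * cis v)" for v
  have [measurable]: "F \<in> borel_measurable borel" unfolding F_def by measurable
  define M where "M = (\<Sum>n\<le>degree f. norm (coeff f n))"
  have FM: "norm (F v) \<le> M" for v unfolding F_def M_def using r by (intro poly_circle_bounded) auto
  have M0: "0 \<le> M" by (simp add: M_def sum_nonneg)
  define w where "w m v = smooth_coeff B (c m) m r (- v)" for m v
  define T where "T m v = tail_coeff B (C m) m (of_real r * cis (- v))" for m v
  have wT [measurable]: "w m \<in> borel_measurable borel" "T m \<in> borel_measurable borel" for m
    unfolding w_def T_def using smooth_coeff_measurable[OF B] tail_coeff_measurable[OF B] r by auto
  define E where "E m v = T m v - w m v" for m v
  have [measurable]: "E m \<in> borel_measurable borel" for m unfolding E_def by measurable
  have Esq: "(\<Sum>m\<in>{m0..m1}. (norm (E m v))\<^sup>2) \<le> A\<^sup>2 * error_const L" for v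
  proof -
    have "(\<Sum>m\<in>{m0..m1}. (norm (E m v))\<^sup>2) \<le> (3 + L) * A\<^sup>2 * (2 + 8 * (exp pi)\<^sup>2)"
      unfolding E_def T_def w_def using r C L
      by (intro error_sum_bound B A card_level_le[where \<beta> = \<beta> and \<gamma> = \<gamma>]) (auto simp: c_def)
    then show ?thesis by (simp add: error_const_def mult_ac)
  qed
  define y where "y \<phi> m = (of_real s * cis \<phi>) ^ m" for \<phi> m
  have ym: "norm (y \<phi> m) \<le> 1" for \<phi> m using s r by (simp add: y_def norm_power norm_mult power_le_one)
  define G where "G \<phi> v = (\<Sum>m\<in>{m0..m1}. y \<phi> m * w m v)" for \<phi> v
  define H where "H \<phi> v = (\<Sum>m\<in>{m0..m1}. y \<phi> m * E m v)" for \<phi> v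
  have [measurable]: "(\<lambda>(\<phi>, v). H \<phi> v) \<in> borel_measurable (borel \<Otimes>\<^sub>M borel)"
     "(\<lambda>(\<phi>, v). G \<phi> v) \<in> borel_measurable (borel \<Otimes>\<^sub>M borel)"
    unfolding H_def G_def y_def by measurable
  have Gle: "norm (G \<phi> v) \<le> A * smooth_const k L * smooth_kernel k e (\<phi> + v)" for \<phi> v
  proof -
    have "norm (G \<phi> v) \<le> 42 * A * kern_const k L * ((1 - r) powr (-k) * (1 - r + chord (\<phi> - (- v))) powr (k - 1))"
      unfolding G_def w_def c_def y_def using s r k L by (intro smooth_sum_bound B A) auto
    then show ?thesis by (simp add: smooth_const_def smooth_kernel_def r_def mult_ac)
  qed
  have Tb: "norm (T m v) \<le> (\<Sum>j. norm (B j))" for m v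
  proof -
    have sm: "summable (\<lambda>j. norm (B (j + (C m + m))))" using B by (subst summable_iff_shift)
    have le: "norm (B (j + C m + m) * (of_real r * cis (- v)) ^ (j + C m)) \<le> norm (B (j + (C m + m)))" for j
      using r by (simp add: norm_mult norm_power mult_left_le power_le_one add.assoc)
    have "norm (T m v) \<le> (\<Sum>j. norm (B (j + (C m + m))))"
      unfolding T_def tail_coeff_def by (rule norm_suminf_le[OF le sm])
    also have "\<dots> \<le> (\<Sum>j. norm (B j))"
      using suminf_split_initial_segment[OF B, of "C m + m"] by (simp add: sum_nonneg)
    finally show ?thesis .
  qed
  have term_int: "(LINT v|circ. F v * (y \<phi> m * T m v)) = y \<phi> m * (\<Sum>n\<in>{C m..degree f}. B (n + m) * of_real (r ^ n) * (coeff f n * of_real (r ^ n)))" for \<phi> m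
  proof -
    have "(LINT v|circ. F v * (y \<phi> m * T m v)) = (LINT v|circ. y \<phi> m * (F v * T m v))" by (simp add: mult_ac)
    then show ?thesis unfolding F_def T_def by (simp add: poly_tail_pairing[OF B r])
  qed
  define S where "S \<phi> = (\<Sum>m\<in>{m0..m1}. y \<phi> m * (\<Sum>n\<in>{C m..degree f}. B (n + m) * of_real (r ^ n) * (coeff f n * of_real (r ^ n))))" for \<phi>
  have S_eq: "S \<phi> = (LINT v|circ. F v * (G \<phi> v + H \<phi> v))" for \<phi>
  proof -
    have "(LINT v|circ. F v * (G \<phi> v + H \<phi> v)) = (LINT v|circ. (\<Sum>m\<in>{m0..m1}. F v * (y \<phi> m * T m v)))"
      by (simp add: G_def H_def E_def sum.distrib[symmetric] sum_distrib_left[symmetric] right_diff_distrib)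
    also have "\<dots> = (\<Sum>m\<in>{m0..m1}. LINT v|circ. F v * (y \<phi> m * T m v))"
    proof (intro Bochner_Integration.integral_sum integrable_circ)
      fix m v
      have "norm (F v) * (norm (y \<phi> m) * norm (T m v)) \<le> M * (1 * (\<Sum>j. norm (B j)))"
        using FM ym Tb M0 by (intro mult_mono) auto
      then show "norm (F v * (y \<phi> m * T m v)) \<le> M * (\<Sum>j. norm (B j))" by (simp add: norm_mult)
    qed measurable
    finally show ?thesis unfolding S_def term_int by simp
  qed
  define K where "K \<phi> v = smooth_kernel k e (\<phi> + v) * norm (F v)" for \<phi> v
  have K0: "0 \<le> K \<phi> v" for \<phi> v by (simp add: K_def smooth_kernel_def)
  define q where "q = A * smooth_const k L"
  have q0: "0 \<le> q" using Apos smooth_const_nonneg[OF k(1) L(1)] by (simp add: q_def)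
  have [measurable]: "(\<lambda>v. K \<phi> v) \<in> borel_measurable borel" for \<phi> unfolding K_def by measurable
  have Sle: "ennreal (norm (S \<phi>)) \<le> ennreal q * (\<integral>\<^sup>+v. ennreal (K \<phi> v) \<partial>circ) + (\<integral>\<^sup>+v. ennreal (norm (F v) * norm (H \<phi> v)) \<partial>circ)" for \<phi>
  proof -
    have "ennreal (norm (S \<phi>)) \<le> (\<integral>\<^sup>+v. ennreal (norm (F v * (G \<phi> v + H \<phi> v))) \<partial>circ)"
      unfolding S_eq by (rule norm_integral_circ_le)
    also have "\<dots> \<le> (\<integral>\<^sup>+v. ennreal q * ennreal (K \<phi> v) + ennreal (norm (F v) * norm (H \<phi> v)) \<partial>circ)"
    proof (rule nn_integral_mono)
      fix v
      have "norm (F v * (G \<phi> v + H \<phi> v)) \<le> norm (F v) * (norm (G \<phi> v) + norm (H \<phi> v))"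
        unfolding norm_mult by (intro mult_left_mono norm_triangle_ineq) auto
      also have "\<dots> \<le> norm (F v) * (q * smooth_kernel k e (\<phi> + v) + norm (H \<phi> v))"
        using Gle[of \<phi> v] by (intro mult_left_mono add_right_mono) (auto simp: q_def)
      also have "\<dots> = q * K \<phi> v + norm (F v) * norm (H \<phi> v)" by (simp add: K_def algebra_simps)
      finally have "ennreal (norm (F v * (G \<phi> v + H \<phi> v))) \<le> ennreal (q * K \<phi> v + norm (F v) * norm (H \<phi> v))" by (rule ennreal_leI)
      then show "ennreal (norm (F v * (G \<phi> v + H \<phi> v))) \<le> ennreal q * ennreal (K \<phi> v) + ennreal (norm (F v) * norm (H \<phi> v))"
        using q0 K0[of \<phi> v] by (simp add: ennreal_mult')
    qed
    also have "\<dots> = ennreal q * (\<integral>\<^sup>+v. ennreal (K \<phi> v) \<partial>circ) + (\<integral>\<^sup>+v. ennreal (norm (F v) * norm (H \<phi> v)) \<partial>circ)"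
      by (subst nn_integral_add, measurable, subst nn_integral_cmult, measurable)
    finally show ?thesis .
  qed
  \<comment> \<open>Parseval's identity in the output angle; the coefficients are the errors at the
    point \<open>- v\<close>, so the bound is uniform in \<open>v\<close>.\<close>
  have Hsq: "(\<integral>\<^sup>+\<phi>. ennreal ((norm (H \<phi> v))\<^sup>2) \<partial>circ) \<le> ennreal (A\<^sup>2 * error_const L)" for v
  proof -
    define d where "d m = of_real (s ^ m) * E m v" for m
    have Hd: "H \<phi> v = (\<Sum>m\<in>{m0..m1}. d m * cis (of_int (int m) * \<phi>))" for \<phi>
      unfolding H_def d_def y_def by (intro sum.cong refl) (simp add: power_mult_distrib Complex.DeMoivre mult_ac)
    have bd: "(norm (H \<phi> v))\<^sup>2 \<le> (\<Sum>m\<in>{m0..m1}. norm (d m))\<^sup>2" for \<phi>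
      unfolding Hd by (intro power_mono sum_norm_le) (auto simp: norm_mult)
    have "(\<integral>\<^sup>+\<phi>. ennreal ((norm (H \<phi> v))\<^sup>2) \<partial>circ) = ennreal (LINT \<phi>|circ. (norm (H \<phi> v))\<^sup>2)"
      using bd by (intro nn_integral_eq_integral integrable_circ[where H = "(\<Sum>m\<in>{m0..m1}. norm (d m))\<^sup>2"]) (auto simp: Hd)
    also have "(LINT \<phi>|circ. (norm (H \<phi> v))\<^sup>2) = (\<Sum>m\<in>{m0..m1}. (norm (d m))\<^sup>2)"
      unfolding Hd by (rule parseval_finite) auto
    also have "\<dots> \<le> (\<Sum>m\<in>{m0..m1}. (norm (E m v))\<^sup>2)"
    proof (intro sum_mono power_mono)
      fix m show "norm (d m) \<le> norm (E m v)"
        unfolding d_def norm_mult using s r by (intro mult_left_le_one_le) (auto simp: norm_power power_le_one)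
    qed auto
    also have "\<dots> \<le> A\<^sup>2 * error_const L" by (rule Esq)
    finally show ?thesis by (simp add: ennreal_leI)
  qed
  have gH: "(\<integral>\<^sup>+\<phi>. ennreal (g \<phi> * norm (H \<phi> v)) \<partial>circ) \<le> ennreal (A * (error_const L + 2))" for v
  proof -
    \<comment> \<open>The weight \<open>A\<close> in the arithmetic-geometric mean inequality makes
      both terms linear in \<open>A\<close>, so no square roots of extended reals are
      needed.\<close>
    have "(\<integral>\<^sup>+\<phi>. ennreal (g \<phi> * norm (H \<phi> v)) \<partial>circ) \<le> (\<integral>\<^sup>+\<phi>. ennreal A * ennreal ((g \<phi>)\<^sup>2) + ennreal (1 / A) * ennreal ((norm (H \<phi> v))\<^sup>2) \<partial>circ)"
    proof (rule nn_integral_mono)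
      fix \<phi>
      have "2 * (A * g \<phi>) * norm (H \<phi> v) \<le> (A * g \<phi>)\<^sup>2 + (norm (H \<phi> v))\<^sup>2" by (rule sum_squares_bound)
      then have "(2 * (A * g \<phi>) * norm (H \<phi> v)) / A \<le> ((A * g \<phi>)\<^sup>2 + (norm (H \<phi> v))\<^sup>2) / A"
        using Apos by (intro divide_right_mono) auto
      moreover have "(2 * (A * g \<phi>) * norm (H \<phi> v)) / A = 2 * (g \<phi> * norm (H \<phi> v))" using Apos by simp
      moreover have "((A * g \<phi>)\<^sup>2 + (norm (H \<phi> v))\<^sup>2) / A = A * (g \<phi>)\<^sup>2 + (1 / A) * (norm (H \<phi> v))\<^sup>2"
        using Apos by (simp add: power2_eq_square add_divide_distrib)
      moreover have "0 \<le> g \<phi> * norm (H \<phi> v)" using g0 by simp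
      ultimately have "g \<phi> * norm (H \<phi> v) \<le> A * (g \<phi>)\<^sup>2 + (1 / A) * (norm (H \<phi> v))\<^sup>2" by linarith
      then have "ennreal (g \<phi> * norm (H \<phi> v)) \<le> ennreal (A * (g \<phi>)\<^sup>2 + (1 / A) * (norm (H \<phi> v))\<^sup>2)" by (rule ennreal_leI)
      also have "\<dots> = ennreal A * ennreal ((g \<phi>)\<^sup>2) + ennreal (1 / A) * ennreal ((norm (H \<phi> v))\<^sup>2)"
        using Apos by (simp only: ennreal_plus mult_nonneg_nonneg zero_le_power2 less_imp_le zero_le_divide_1_iff ennreal_mult')
      finally show "ennreal (g \<phi> * norm (H \<phi> v)) \<le> ennreal A * ennreal ((g \<phi>)\<^sup>2) + ennreal (1 / A) * ennreal ((norm (H \<phi> v))\<^sup>2)" .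
    qed
    also have "\<dots> = ennreal A * (\<integral>\<^sup>+\<phi>. ennreal ((g \<phi>)\<^sup>2) \<partial>circ) + ennreal (1 / A) * (\<integral>\<^sup>+\<phi>. ennreal ((norm (H \<phi> v))\<^sup>2) \<partial>circ)"
      by (subst nn_integral_add, measurable, subst nn_integral_cmult, measurable, subst nn_integral_cmult, measurable)
    also have "\<dots> \<le> ennreal A * 2 + ennreal (1 / A) * ennreal (A\<^sup>2 * error_const L)"
      by (intro add_mono mult_left_mono g2 Hsq) auto
    also have "ennreal (1 / A) * ennreal (A\<^sup>2 * error_const L) = ennreal (A * error_const L)"
      using Apos by (simp add: ennreal_mult'[symmetric] power2_eq_square)
    also have "ennreal A * 2 = ennreal (A * 2)" using Apos by (simp add: ennreal_mult')
    also have "ennreal (A * 2) + ennreal (A * error_const L) = ennreal (A * (error_const L + 2))"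
      using Apos error_const_nonneg[OF L(1)] by (simp add: ennreal_plus[symmetric] algebra_simps del: ennreal_plus)
    finally show ?thesis .
  qed
  have "(\<integral>\<^sup>+\<phi>. ennreal (g \<phi>) * ennreal (norm (S \<phi>)) \<partial>circ)
    \<le> (\<integral>\<^sup>+\<phi>. ennreal q * (ennreal (g \<phi>) * (\<integral>\<^sup>+v. ennreal (K \<phi> v) \<partial>circ)) + ennreal (g \<phi>) * (\<integral>\<^sup>+v. ennreal (norm (F v) * norm (H \<phi> v)) \<partial>circ) \<partial>circ)"
  proof (rule nn_integral_mono)
    fix \<phi>
    have "ennreal (g \<phi>) * ennreal (norm (S \<phi>)) \<le> ennreal (g \<phi>) * (ennreal q * (\<integral>\<^sup>+v. ennreal (K \<phi> v) \<partial>circ) + (\<integral>\<^sup>+v. ennreal (norm (F v) * norm (H \<phi> v)) \<partial>circ))"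
      by (intro mult_left_mono Sle) auto
    then show "ennreal (g \<phi>) * ennreal (norm (S \<phi>)) \<le> ennreal q * (ennreal (g \<phi>) * (\<integral>\<^sup>+v. ennreal (K \<phi> v) \<partial>circ)) + ennreal (g \<phi>) * (\<integral>\<^sup>+v. ennreal (norm (F v) * norm (H \<phi> v)) \<partial>circ)"
      by (simp only: distrib_left mult.left_commute)
  qed
  also have "\<dots> = ennreal q * (\<integral>\<^sup>+\<phi>. ennreal (g \<phi>) * (\<integral>\<^sup>+v. ennreal (K \<phi> v) \<partial>circ) \<partial>circ)
     + (\<integral>\<^sup>+\<phi>. ennreal (g \<phi>) * (\<integral>\<^sup>+v. ennreal (norm (F v) * norm (H \<phi> v)) \<partial>circ) \<partial>circ)"
    unfolding K_def by (subst nn_integral_add, measurable, subst nn_integral_cmult, measurable)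
  also have "(\<integral>\<^sup>+\<phi>. ennreal (g \<phi>) * (\<integral>\<^sup>+v. ennreal (norm (F v) * norm (H \<phi> v)) \<partial>circ) \<partial>circ)
     = (\<integral>\<^sup>+\<phi>. (\<integral>\<^sup>+v. ennreal (g \<phi>) * ennreal (norm (F v) * norm (H \<phi> v)) \<partial>circ) \<partial>circ)"
    by (intro nn_integral_cong nn_integral_cmult[symmetric]) measurable
  also have "\<dots> = (\<integral>\<^sup>+v. (\<integral>\<^sup>+\<phi>. ennreal (g \<phi>) * ennreal (norm (F v) * norm (H \<phi> v)) \<partial>circ) \<partial>circ)"
    by (rule circ2.Fubini') measurable
  also have "\<dots> = (\<integral>\<^sup>+v. ennreal (norm (F v)) * (\<integral>\<^sup>+\<phi>. ennreal (g \<phi> * norm (H \<phi> v)) \<partial>circ) \<partial>circ)"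
  proof (rule nn_integral_cong)
    fix v
    have "(\<integral>\<^sup>+\<phi>. ennreal (g \<phi>) * ennreal (norm (F v) * norm (H \<phi> v)) \<partial>circ) = (\<integral>\<^sup>+\<phi>. ennreal (norm (F v)) * ennreal (g \<phi> * norm (H \<phi> v)) \<partial>circ)"
      using g0 by (intro nn_integral_cong) (simp add: ennreal_mult' mult_ac)
    also have "\<dots> = ennreal (norm (F v)) * (\<integral>\<^sup>+\<phi>. ennreal (g \<phi> * norm (H \<phi> v)) \<partial>circ)"
      by (rule nn_integral_cmult) measurable
    finally show "(\<integral>\<^sup>+\<phi>. ennreal (g \<phi>) * ennreal (norm (F v) * norm (H \<phi> v)) \<partial>circ) = ennreal (norm (F v)) * (\<integral>\<^sup>+\<phi>. ennreal (g \<phi> * norm (H \<phi> v)) \<partial>circ)" .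
  qed
  also have "\<dots> \<le> (\<integral>\<^sup>+v. ennreal (norm (F v)) * ennreal (A * (error_const L + 2)) \<partial>circ)"
    by (intro nn_integral_mono mult_left_mono gH) auto
  also have "\<dots> = ennreal (A * (error_const L + 2)) * (\<integral>\<^sup>+v. ennreal (norm (F v)) \<partial>circ)"
    by (subst nn_integral_multc, measurable) (rule mult.commute)
  finally have "(\<integral>\<^sup>+\<phi>. ennreal (g \<phi>) * ennreal (norm (S \<phi>)) \<partial>circ)
     \<le> ennreal q * (\<integral>\<^sup>+\<phi>. ennreal (g \<phi>) * (\<integral>\<^sup>+v. ennreal (K \<phi> v) \<partial>circ) \<partial>circ)
      + ennreal (A * (error_const L + 2)) * (\<integral>\<^sup>+v. ennreal (norm (F v)) \<partial>circ)"
    by (simp add: add_left_mono)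
  then show ?thesis by (simp only: S_def y_def s_def r_def F_def K_def q_def)
qed

subsection \<open>Integral means on circles\<close>

text \<open>Connects the gauge integral over \<open>{0..2 * pi}\<close> in \<open>hardy_norm\<close>
  with the normalised measure on \<open>{-pi..pi}\<close> used throughout.\<close>

lemma circle_mean_eq:
  assumes h: "continuous_on UNIV h" and per: "\<And>t. h (t + 2 * pi) = h t" and h0: "\<And>t. 0 \<le> h t"
  shows "ennreal (1 / (2 * pi) * integral {0..2 * pi} h) = (\<integral>\<^sup>+t. ennreal (h t) \<partial>circ)"
proof -
  have [measurable]: "h \<in> borel_measurable borel" using h by (rule borel_measurable_continuous_onI)
  have int: "(h has_integral integral {0..2 * pi} h) {0..2 * pi}"
    using h by (intro integrable_integral integrable_continuous_interval) (auto intro: continuous_on_subset)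
  have "(\<integral>\<^sup>+t. ennreal (h t) \<partial>circ) = ennreal (1 / (2 * pi)) * (\<integral>\<^sup>+x. ennreal (h x) * indicator {0..<0 + 2 * pi} x \<partial>lborel)"
    by (rule nn_integral_circ_Ico) (auto simp: per)
  also have "(\<integral>\<^sup>+x. ennreal (h x) * indicator {0..<0 + 2 * pi} x \<partial>lborel) = (\<integral>\<^sup>+x. ennreal (h x) * indicator {0..2 * pi} x \<partial>lborel)"
    using nn_integral_Icc_Ico[of "\<lambda>x. ennreal (h x)" 0 "2 * pi"] by simp
  also have "\<dots> = (\<integral>\<^sup>+x. indicator {0..2 * pi} x * h x \<partial>lborel)"
    by (intro nn_integral_cong) (auto simp: indicator_def)
  also have "\<dots> = ennreal (integral {0..2 * pi} h)"
    using nn_integral_has_integral_lebesgue[OF _ int] h0 by simp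
  finally show ?thesis by (subst (asm) ennreal_mult'[symmetric]) auto
qed

lemma holomorphic_circle_continuous:
  assumes F: "F holomorphic_on ball 0 1" and R: "0 \<le> R" "R < 1" and p: "0 < p"
  shows "continuous_on UNIV (\<lambda>t. norm (F (of_real R * cis t)) powr p)"
proof -
  have "continuous_on UNIV (\<lambda>t. F (of_real R * cis t))"
    by (rule continuous_on_compose2[OF holomorphic_on_imp_continuous_on[OF F]])
       (use R in \<open>auto intro!: continuous_intros simp: norm_mult\<close>)
  then show ?thesis using p by (intro continuous_on_powr' continuous_intros) auto
qed

lemma hardy_mean_eq:
  assumes F: "F holomorphic_on ball 0 1" and R: "0 \<le> R" "R < 1" and p: "0 < p"
  shows "ennreal (1 / (2 * pi) * integral {0..2 * pi} (\<lambda>t. norm (F (of_real R * cis t)) powr p))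
    = (\<integral>\<^sup>+t. ennreal (norm (F (of_real R * cis t)) powr p) \<partial>circ)"
  by (rule circle_mean_eq[OF holomorphic_circle_continuous[OF assms]]) auto

lemma powr_inverse_cancel: "0 \<le> x \<Longrightarrow> 0 < p \<Longrightarrow> (x powr (1 / p)) powr p = (x :: real)"
  by (simp add: powr_powr)

lemma hardy_norm_leI:
  assumes F: "F holomorphic_on ball 0 1" and p: "0 < p" and K: "0 \<le> K"
    and le: "\<And>R. 0 \<le> R \<Longrightarrow> R < 1 \<Longrightarrow> (\<integral>\<^sup>+t. ennreal (norm (F (of_real R * cis t)) powr p) \<partial>circ) \<le> ennreal (K powr p)"
  shows "hardy_norm p F \<le> ennreal K"
  unfolding hardy_norm_def
proof (rule SUP_least)
  fix R :: real assume "R \<in> {0..<1}"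
  then have R: "0 \<le> R" "R < 1" by auto
  let ?I = "1 / (2 * pi) * integral {0..2 * pi} (\<lambda>t. norm (F (of_real R * cis t)) powr p)"
  have I0: "0 \<le> ?I" by (intro mult_nonneg_nonneg integral_nonneg integrable_continuous_interval
      continuous_on_subset[OF holomorphic_circle_continuous[OF F R p]]) auto
  have "ennreal ?I \<le> ennreal (K powr p)" unfolding hardy_mean_eq[OF F R p] by (rule le[OF R])
  then have "?I \<le> K powr p" by (subst (asm) ennreal_le_iff) auto
  then have "?I powr (1 / p) \<le> (K powr p) powr (1 / p)" using I0 p by (intro powr_mono2) auto
  also have "\<dots> = K" using K p by (simp add: powr_powr)
  finally show "ennreal (?I powr (1 / p)) \<le> ennreal K" by (rule ennreal_leI)
qed

lemma hardy_mean_le_norm: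
  assumes F: "F holomorphic_on ball 0 1" and R: "0 \<le> R" "R < 1" and p: "0 < p"
    and le: "hardy_norm p F \<le> ennreal K" and K: "0 \<le> K"
  shows "(\<integral>\<^sup>+t. ennreal (norm (F (of_real R * cis t)) powr p) \<partial>circ) \<le> ennreal (K powr p)"
proof -
  let ?I = "1 / (2 * pi) * integral {0..2 * pi} (\<lambda>t. norm (F (of_real R * cis t)) powr p)"
  have I0: "0 \<le> ?I" by (intro mult_nonneg_nonneg integral_nonneg integrable_continuous_interval
      continuous_on_subset[OF holomorphic_circle_continuous[OF F R p]]) auto
  have "ennreal (?I powr (1 / p)) \<le> hardy_norm p F"
    unfolding hardy_norm_def using R by (intro SUP_upper) auto
  also note le
  finally have "?I powr (1 / p) \<le> K" using K by (subst (asm) ennreal_le_iff) auto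
  then have "(?I powr (1 / p)) powr p \<le> K powr p" using p by (intro powr_mono2) auto
  then have "?I \<le> K powr p" by (simp only: powr_inverse_cancel[OF I0 p])
  then show ?thesis unfolding hardy_mean_eq[OF F R p, symmetric] by (rule ennreal_leI)
qed

lemma holomorphic_powr_le_poisson:
  assumes F: "F holomorphic_on ball 0 1" and R: "0 \<le> R" "R < 1" and r: "0 \<le> r" "r < 1" and p: "1 \<le> p"
  shows "ennreal (norm (F (of_real (R * r) * cis \<theta>)) powr p)
    \<le> (\<integral>\<^sup>+a. ennreal (norm (F (of_real R * cis (\<theta> - a))) powr p * poisson r a) \<partial>circ)"
proof -
  obtain B where B: "summable (\<lambda>n. norm (B n))" "\<And>z. norm z \<le> 1 \<Longrightarrow> pseries B z = F (of_real R * z)"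
    using holomorphic_dilate_pseries[OF F R] by blast
  have FB: "F (of_real (R * r) * cis \<theta>) = pseries B (of_real r * cis \<theta>)"
    using r by (subst B(2)) (auto simp: norm_mult mult.assoc)
  have meas: "(\<lambda>a. norm (F (of_real R * cis (\<theta> - a)))) \<in> borel_measurable borel"
    using pseries_measurable[OF B(1), of \<theta>] by (simp add: B(2))
  have "ennreal (norm (F (of_real (R * r) * cis \<theta>)))
    \<le> (\<integral>\<^sup>+a. ennreal (norm (F (of_real R * cis (\<theta> - a))) * poisson r a) \<partial>circ)"
    unfolding FB using pseries_le_poisson[OF B(1) r, of \<theta>] by (simp add: B(2))
  then show ?thesis by (intro poisson_power_mean r meas p) auto
qed

text \<open>The converse of Hoelder's inequality. The powers \<open>1 - 1 / p\<close> of probability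
  densities play the role of the dual unit ball, and the extremal density is \<open>h powr p\<close>
  divided by its integral; the bound \<open>M\<close> guarantees that this integral is
  finite.\<close>

lemma pairing_to_norm:
  fixes h :: "real \<Rightarrow> real"
  assumes h [measurable]: "h \<in> borel_measurable borel" and h0: "\<And>t. 0 \<le> h t" and hM: "\<And>t. h t \<le> M"
    and p: "1 < p" and K: "0 \<le> K"
    and pair: "\<And>Y. Y \<in> borel_measurable borel \<Longrightarrow> (\<And>t. 0 \<le> Y t) \<Longrightarrow> (\<integral>\<^sup>+t. ennreal (Y t) \<partial>circ) \<le> 1 \<Longrightarrow>
      (\<integral>\<^sup>+t. ennreal (Y t powr (1 - 1 / p)) * ennreal (h t) \<partial>circ) \<le> ennreal K"
  shows "(\<integral>\<^sup>+t. ennreal (h t powr p) \<partial>circ) \<le> ennreal (K powr p)"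
proof -
  have "(\<integral>\<^sup>+t. ennreal (h t powr p) \<partial>circ) \<le> (\<integral>\<^sup>+t. ennreal (M powr p) \<partial>circ)"
    using h0 hM p by (intro nn_integral_mono ennreal_leI powr_mono2) auto
  then have fin: "(\<integral>\<^sup>+t. ennreal (h t powr p) \<partial>circ) \<le> ennreal (M powr p)" by (simp add: emeasure_circ)
  then obtain P where P: "(\<integral>\<^sup>+t. ennreal (h t powr p) \<partial>circ) = ennreal P" "0 \<le> P"
    by (metis ennreal_cases ennreal_less_top infinity_ennreal_def leD top.not_eq_extremum)
  show ?thesis
  proof (cases "P = 0")
    case False
    then have P0: "0 < P" using P by simp
    define Y where "Y t = h t powr p / P" for t
    have [measurable]: "Y \<in> borel_measurable borel" unfolding Y_def by measurable
    have Y0: "0 \<le> Y t" for t using P0 by (simp add: Y_def)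
    have "(\<integral>\<^sup>+t. ennreal (Y t) \<partial>circ) = (\<integral>\<^sup>+t. ennreal (1 / P) * ennreal (h t powr p) \<partial>circ)"
      using P0 by (intro nn_integral_cong) (simp add: Y_def ennreal_mult'[symmetric])
    also have "\<dots> = ennreal (1 / P) * ennreal P" by (subst nn_integral_cmult, measurable, simp add: P)
    also have "\<dots> = 1" using P0 by (simp add: ennreal_mult'[symmetric])
    finally have Y1: "(\<integral>\<^sup>+t. ennreal (Y t) \<partial>circ) \<le> 1" by simp
    have eq: "Y t powr (1 - 1 / p) * h t = P powr (1 / p - 1) * h t powr p" for t
    proof (cases "h t = 0")
      case False
      then have ht: "0 < h t" using h0[of t] by simp
      have "Y t powr (1 - 1 / p) = (h t powr p) powr (1 - 1 / p) / P powr (1 - 1 / p)"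
        using P0 by (simp add: Y_def powr_divide)
      also have "(h t powr p) powr (1 - 1 / p) = h t powr (p - 1)" using p by (simp add: powr_powr right_diff_distrib)
      also have "h t powr (p - 1) / P powr (1 - 1 / p) = P powr (1 / p - 1) * h t powr (p - 1)"
        using powr_minus_divide[of P "1 - 1 / p"] by simp
      finally have "Y t powr (1 - 1 / p) * h t = P powr (1 / p - 1) * (h t * h t powr (p - 1))" by simp
      then show ?thesis using ht by (simp add: powr_mult_base)
    qed simp
    have "ennreal (P powr (1 / p - 1)) * ennreal P = (\<integral>\<^sup>+t. ennreal (P powr (1 / p - 1)) * ennreal (h t powr p) \<partial>circ)"
      by (subst nn_integral_cmult, measurable, simp add: P)
    also have "\<dots> = (\<integral>\<^sup>+t. ennreal (Y t powr (1 - 1 / p)) * ennreal (h t) \<partial>circ)"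
      by (simp add: ennreal_mult'[symmetric] eq)
    also have "\<dots> \<le> ennreal K" by (rule pair) (use Y0 Y1 in auto)
    finally have "ennreal (P powr (1 / p - 1) * P) \<le> ennreal K" by (simp add: ennreal_mult')
    then have "P powr (1 / p - 1) * P \<le> K" using K by (subst (asm) ennreal_le_iff) auto
    moreover have "P powr (1 / p - 1) * P = P powr (1 / p)"
      using powr_mult_base[of P "1 / p - 1"] P0 by (simp add: mult.commute)
    ultimately have "(P powr (1 / p)) powr p \<le> K powr p" using p by (intro powr_mono2) auto
    then show ?thesis using P P0 p by (simp add: powr_powr ennreal_leI)
  qed (use P in simp)
qed

subsection \<open>Symbols of prescribed growth\<close>

text \<open>Coefficients of the k-th derivative of \<open>z^k\<close> times the series, divided by
  \<open>fact k\<close>. This form of a k-th derivative acts diagonally on coefficients and does not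
  annihilate constants.\<close>

definition binomial_coeff :: "nat \<Rightarrow> (nat \<Rightarrow> complex) \<Rightarrow> nat \<Rightarrow> complex" where
  "binomial_coeff k b M = of_nat ((M + k) choose k) * b M"

text \<open>For \<open>al < k\<close> this is the usual characterisation of the Hoelder-Zygmund class of order \<open>al\<close> by the growth of a
  \<open>k\<close>-th derivative.\<close>

definition growth :: "nat \<Rightarrow> real \<Rightarrow> real \<Rightarrow> (nat \<Rightarrow> complex) \<Rightarrow> bool" where
  "growth k al N b \<longleftrightarrow> (\<forall>z. norm z < 1 \<longrightarrow> summable (\<lambda>M. norm (binomial_coeff k b M * z ^ M)) \<and>
     norm (pseries (binomial_coeff k b) z) \<le> N * (1 - norm z) powr (al - real k))"

definition region_matrix :: "(nat \<Rightarrow> nat \<Rightarrow> bool) \<Rightarrow> (nat \<Rightarrow> complex) \<Rightarrow> nat \<Rightarrow> nat \<Rightarrow> complex" where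
  "region_matrix S b m n = (if S m n then b (m + n) else 0)"

text \<open>Integrated over \<open>e\<close> in (0, 1) against \<open>k * e^(k-1)\<close>, these
  coefficients give back \<open>b M\<close>.\<close>

definition damped :: "real \<Rightarrow> nat \<Rightarrow> (nat \<Rightarrow> complex) \<Rightarrow> nat \<Rightarrow> complex" where
  "damped e k b M = binomial_coeff k b M * of_real ((1 - e) ^ M)"

lemma Beta_moment:
  assumes k: "1 \<le> k"
  shows "has_bochner_integral unit_measure (\<lambda>e. real k * e ^ (k - 1) * (1 - e) ^ M) (1 / real ((M + k) choose k))"
proof (rule has_bochner_integral_nn_integral)
  show "AE e in unit_measure. 0 \<le> real k * e ^ (k - 1) * (1 - e) ^ M"
    using AE_unit by (rule eventually_mono) auto
  have BI: "((\<lambda>t. t powr (real k - 1) * (1 - t) powr (real (M + 1) - 1)) has_integral Beta (real k) (real (M + 1))) {0..1}"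
    using k by (intro has_integral_Beta_real) auto
  have "(\<integral>\<^sup>+e. ennreal (e ^ (k - 1) * (1 - e) ^ M) \<partial>unit_measure)
     = (\<integral>\<^sup>+e. indicator {0<..<1} e * ennreal (e ^ (k - 1) * (1 - e) ^ M) \<partial>lborel)"
    by (rule nn_integral_unit) measurable
  also have "\<dots> = (\<integral>\<^sup>+e. ennreal (indicator {0..1} e * (e powr (real k - 1) * (1 - e) powr (real (M + 1) - 1))) \<partial>lborel)"
  proof (rule nn_integral_cong_AE)
    show "AE e in lborel. indicator {0<..<1} e * ennreal (e ^ (k - 1) * (1 - e) ^ M)
      = ennreal (indicator {0..1} e * (e powr (real k - 1) * (1 - e) powr (real (M + 1) - 1)))"
      using AE_lborel_neq[of 0] AE_lborel_neq[of 1]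
    proof eventually_elim
      case (elim e)
      show ?case
      proof (cases "0 < e \<and> e < 1")
        case True
        then have e: "0 < e" "0 < 1 - e" by auto
        have k1: "real k - 1 = real (k - 1)" and M1: "real (M + 1) - 1 = real M" using k by simp_all
        have "e powr (real k - 1) = e ^ (k - 1)" unfolding k1 by (rule powr_realpow[OF e(1)])
        moreover have "(1 - e) powr (real (M + 1) - 1) = (1 - e) ^ M"
          unfolding M1 by (rule powr_realpow[OF e(2)])
        moreover have "indicator {0<..<1} e = (1::ennreal)" "indicator {0..1} e = (1::real)" using True by auto
        ultimately show ?thesis by (simp only: mult_1_left)
      qed (use elim in \<open>auto simp: indicator_def\<close>)
    qed
  qed
  also have "\<dots> = ennreal (Beta (real k) (real (M + 1)))"
    by (rule nn_integral_has_integral_lebesgue[OF _ BI]) auto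
  also have "Beta (real k) (real (M + 1)) = fact (k - 1) * fact M / fact (M + k)"
  proof -
    have "Gamma (real k) = fact (k - 1)" using Gamma_fact[of "k - 1", where 'a = real] k by (simp add: of_nat_diff)
    moreover have "Gamma (real (M + 1)) = fact M" using Gamma_fact[of M, where 'a = real] by (simp add: add.commute)
    moreover have "Gamma (real k + real (M + 1)) = fact (M + k)"
      using Gamma_fact[of "M + k", where 'a = real] by (simp add: add_ac)
    ultimately show ?thesis by (simp only: Beta_altdef rGamma_inverse_Gamma divide_inverse)
  qed
  finally have *: "(\<integral>\<^sup>+e. ennreal (e ^ (k - 1) * (1 - e) ^ M) \<partial>unit_measure) = ennreal (fact (k - 1) * fact M / fact (M + k))" .
  have "(\<integral>\<^sup>+e. ennreal (real k * e ^ (k - 1) * (1 - e) ^ M) \<partial>unit_measure) = (\<integral>\<^sup>+e. ennreal (real k) * ennreal (e ^ (k - 1) * (1 - e) ^ M) \<partial>unit_measure)"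
    by (simp add: ennreal_mult'[symmetric] mult.assoc)
  also have "\<dots> = ennreal (real k) * ennreal (fact (k - 1) * fact M / fact (M + k))"
    by (subst nn_integral_cmult, measurable, simp only: *)
  also have "\<dots> = ennreal (1 / real ((M + k) choose k))"
  proof -
    have kf: "real k * fact (k - 1) = fact k" using k fact_reduce[of k, where 'a = real] by simp
    have "real ((M + k) choose k) = fact (M + k) / (fact k * fact M)" by (simp add: binomial_fact)
    then have "real k * (fact (k - 1) * fact M / fact (M + k)) = 1 / real ((M + k) choose k)"
      by (simp only: times_divide_eq_right mult.assoc[symmetric] kf) simp
    then show ?thesis by (subst ennreal_mult'[symmetric]) (simp_all only: of_nat_0_le_iff)
  qed
  finally show "(\<integral>\<^sup>+e. ennreal (real k * e ^ (k - 1) * (1 - e) ^ M) \<partial>unit_measure) = ennreal (1 / real ((M + k) choose k))" .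
qed simp_all

lemma growth_shift_summable:
  assumes g: "growth k al N b" and R: "0 \<le> R" "R < 1"
  shows "summable (\<lambda>m. norm (binomial_coeff k b (m + n)) * R ^ m)"
proof -
  define \<rho> where "\<rho> = (1 + R) / 2"
  have \<rho>: "0 < \<rho>" "\<rho> < 1" "R \<le> \<rho>" using R by (auto simp: \<rho>_def)
  have "summable (\<lambda>M. norm (binomial_coeff k b M * of_real \<rho> ^ M))"
    using g \<rho> unfolding growth_def by (metis abs_of_pos norm_of_real)
  then have "summable (\<lambda>m. norm (binomial_coeff k b (m + n) * of_real \<rho> ^ (m + n)))" by (subst summable_iff_shift)
  then have "summable (\<lambda>m. (1 / \<rho> ^ n) * norm (binomial_coeff k b (m + n) * of_real \<rho> ^ (m + n)))" by (rule summable_mult)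
  then show ?thesis
  proof (rule summable_comparison_test'[of _ 0])
    fix m
    have "norm (binomial_coeff k b (m + n)) * R ^ m \<le> norm (binomial_coeff k b (m + n)) * \<rho> ^ m"
      using \<rho> R by (intro mult_left_mono power_mono) auto
    also have "\<dots> = (1 / \<rho> ^ n) * norm (binomial_coeff k b (m + n) * of_real \<rho> ^ (m + n))"
      using \<rho> by (simp add: norm_mult norm_power power_add)
    finally show "norm (norm (binomial_coeff k b (m + n)) * R ^ m) \<le> (1 / \<rho> ^ n) * norm (binomial_coeff k b (m + n) * of_real \<rho> ^ (m + n))"
      using R by simp
  qed
qed

lemma norm_region_row_le:
  assumes "\<And>M. norm (b M) \<le> c M"
  shows "norm (\<Sum>n\<le>degree f. coeff f n * region_matrix S b m n) \<le> (\<Sum>n\<le>degree f. norm (coeff f n) * c (m + n))"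
proof (rule sum_norm_le)
  fix n
  have "norm (region_matrix S b m n) \<le> c (m + n)"
    using assms[of "m + n"] order_trans[OF norm_ge_zero assms[of "m + n"]] by (auto simp: region_matrix_def)
  then show "norm (coeff f n * region_matrix S b m n) \<le> norm (coeff f n) * c (m + n)"
    by (simp add: norm_mult mult_left_mono)
qed

lemma binomial_coeff_norm_ge: "norm (b M) \<le> norm (binomial_coeff k b M)"
proof -
  have "1 \<le> (M + k) choose k" by (simp add: Suc_leI)
  then have "1 * norm (b M) \<le> real ((M + k) choose k) * norm (b M)"
    by (intro mult_right_mono) (simp_all only: norm_ge_zero of_nat_1[symmetric, where 'a = real] of_nat_le_iff)
  then show ?thesis by (simp add: binomial_coeff_def norm_mult)
qed

lemma damped_norm_le: "0 \<le> e \<Longrightarrow> e \<le> 1 \<Longrightarrow> norm (damped e k b M) \<le> norm (binomial_coeff k b M)"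
  unfolding damped_def norm_mult norm_of_real by (rule mult_left_le) (simp_all add: power_le_one)

lemma growth_row_summable:
  assumes g: "growth k al N b" and R: "0 \<le> R" "R < 1"
  shows "summable (\<lambda>m. (\<Sum>n\<le>degree f. norm (coeff f n) * norm (binomial_coeff k b (m + n))) * R ^ m)"
proof -
  have "summable (\<lambda>m. \<Sum>n\<le>degree f. norm (coeff f n) * (norm (binomial_coeff k b (m + n)) * R ^ m))"
    by (intro summable_sum summable_mult growth_shift_summable[OF g R])
  then show ?thesis by (simp add: sum_distrib_right mult.assoc)
qed

lemma matrix_operator_sums:
  assumes g: "growth k al N b" and z: "norm z < 1" and b': "\<And>M. norm (b' M) \<le> norm (binomial_coeff k b M)"
  shows "(\<lambda>m. (\<Sum>n\<le>degree f. coeff f n * region_matrix S b' m n) * z ^ m) sums matrix_operator (region_matrix S b') f z"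
proof -
  have "summable (\<lambda>m. (\<Sum>n\<le>degree f. coeff f n * region_matrix S b' m n) * z ^ m)"
  proof (rule summable_comparison_test'[OF growth_row_summable[OF g norm_ge_zero z, of f], of 0])
    fix m
    show "norm ((\<Sum>n\<le>degree f. coeff f n * region_matrix S b' m n) * z ^ m)
      \<le> (\<Sum>n\<le>degree f. norm (coeff f n) * norm (binomial_coeff k b (m + n))) * norm z ^ m"
      unfolding norm_mult norm_power by (intro mult_right_mono norm_region_row_le b') auto
  qed
  then show ?thesis unfolding matrix_operator_def by (rule summable_sums)
qed

lemma matrix_operator_holomorphic:
  assumes g: "growth k al N b" and b': "\<And>M. norm (b' M) \<le> norm (binomial_coeff k b M)"
  shows "matrix_operator (region_matrix S b') f holomorphic_on ball 0 1"
proof (rule power_series_holomorphic)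
  fix w :: complex assume "w \<in> ball 0 1"
  then show "(\<lambda>m. (\<Sum>n\<le>degree f. coeff f n * region_matrix S b' m n) * (w - 0) ^ m) sums matrix_operator (region_matrix S b') f w"
    using matrix_operator_sums[OF g _ b', of w f S] by simp
qed

text \<open>The Beta average is inserted into every matrix entry and exchanged with the power series
  in \<open>u\<close>. The dominating series uses the coefficients without damping; it converges
  since \<open>|u| < 1\<close>.\<close>

lemma matrix_operator_le_damped:
  assumes g: "growth k al N b" and k: "1 \<le> k" and u: "norm u < 1"
  shows "ennreal (norm (matrix_operator (region_matrix S b) f u))
    \<le> (\<integral>\<^sup>+e. ennreal (real k * e ^ (k - 1)) * ennreal (norm (matrix_operator (region_matrix S (damped e k b)) f u)) \<partial>unit_measure)"
proof -
  define t where "t m e = of_real (real k * e ^ (k - 1)) * ((\<Sum>n\<le>degree f. coeff f n * region_matrix S (damped e k b) m n) * u ^ m)" for m e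
  define G where "G m = real k * ((\<Sum>n\<le>degree f. norm (coeff f n) * norm (binomial_coeff k b (m + n))) * norm u ^ m)" for m
  have G: "summable G" unfolding G_def by (intro summable_mult growth_row_summable[OF g norm_ge_zero u])
  have t_le: "norm (t m e) \<le> G m" if "0 < e" "e < 1" for m e
  proof -
    have "e ^ (k - 1) \<le> 1" using that by (intro power_le_one) auto
    then have "real k * e ^ (k - 1) \<le> real k" by (simp add: mult_left_le)
    moreover have "norm ((\<Sum>n\<le>degree f. coeff f n * region_matrix S (damped e k b) m n) * u ^ m)
      \<le> (\<Sum>n\<le>degree f. norm (coeff f n) * norm (binomial_coeff k b (m + n))) * norm u ^ m"
      unfolding norm_mult norm_power using that by (intro mult_right_mono norm_region_row_le damped_norm_le) auto
    ultimately show ?thesis unfolding t_def G_def norm_mult[of "of_real _"] norm_of_real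
      using that by (intro mult_mono) auto
  qed
  have t_meas [measurable]: "t m \<in> borel_measurable borel" for m
    unfolding t_def region_matrix_def damped_def by measurable
  have t_AE: "AE e in unit_measure. norm (t m e) \<le> G m" for m
    using AE_unit by (rule eventually_mono) (auto intro: t_le)
  have int: "integrable unit_measure (t m)" for m
    using t_AE by (intro unit.integrable_const_bound[of _ "G m"]) auto
  have G0: "0 \<le> G m" for m using t_le[of "1/2" m] norm_ge_zero[of "t m (1/2)"] by linarith
  have mass: "measure unit_measure UNIV = 1"
  proof -
    have "emeasure unit_measure UNIV = (\<integral>\<^sup>+e. 1 \<partial>unit_measure)" by simp
    also have "\<dots> = 1" by (subst nn_integral_unit) auto
    finally show ?thesis by (simp add: measure_def)
  qed
  have "(\<lambda>m. LINT e|unit_measure. t m e) sums (LINT e|unit_measure. (\<Sum>m. t m e))"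
  proof (rule sums_integral)
    show "AE e in unit_measure. summable (\<lambda>m. norm (t m e))"
      using AE_unit
    proof (rule eventually_mono)
      fix e :: real assume "e \<in> {0<..<1}"
      then show "summable (\<lambda>m. norm (t m e))"
        by (intro summable_comparison_test'[OF G, of 0]) (simp add: t_le)
    qed
    show "summable (\<lambda>m. LINT e|unit_measure. norm (t m e))"
    proof (rule summable_comparison_test'[OF G, of 0])
      fix m
      have "(LINT e|unit_measure. norm (t m e)) \<le> (LINT e|unit_measure. G m)"
        by (intro integral_mono_AE integrable_norm int t_AE) auto
      moreover have "0 \<le> (LINT e|unit_measure. norm (t m e))" by (rule integral_nonneg_AE) simp
      ultimately show "norm (LINT e|unit_measure. norm (t m e)) \<le> G m" by (simp add: mass)
    qed
  qed (rule int)
  moreover have "(LINT e|unit_measure. t m e) = (\<Sum>n\<le>degree f. coeff f n * region_matrix S b m n) * u ^ m" for m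
  proof -
    define x where "x n = coeff f n * region_matrix S (binomial_coeff k b) m n * u ^ m" for n
    have mom: "has_bochner_integral unit_measure (\<lambda>e. x n * of_real (real k * e ^ (k - 1) * (1 - e) ^ (m + n)))
        (x n * of_real (1 / real ((m + n + k) choose k)))" for n
      by (intro has_bochner_integral_mult_right has_bochner_integral_of_real Beta_moment k)
    have "t m e = (\<Sum>n\<le>degree f. x n * of_real (real k * e ^ (k - 1) * (1 - e) ^ (m + n)))" for e
      unfolding t_def sum_distrib_left sum_distrib_right
      by (intro sum.cong refl) (simp add: x_def region_matrix_def damped_def)
    then have "(LINT e|unit_measure. t m e) = (\<Sum>n\<le>degree f. x n * of_real (1 / real ((m + n + k) choose k)))"
      by (simp only:) (intro has_bochner_integral_integral_eq has_bochner_integral_sum mom)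
    also have "\<dots> = (\<Sum>n\<le>degree f. coeff f n * region_matrix S b m n) * u ^ m"
      unfolding sum_distrib_right
      by (intro sum.cong refl) (simp add: x_def region_matrix_def binomial_coeff_def)
    finally show ?thesis .
  qed
  ultimately have "(\<lambda>m. (\<Sum>n\<le>degree f. coeff f n * region_matrix S b m n) * u ^ m) sums (LINT e|unit_measure. (\<Sum>m. t m e))" by simp
  then have eq: "matrix_operator (region_matrix S b) f u = (LINT e|unit_measure. (\<Sum>m. t m e))"
    unfolding matrix_operator_def by (simp add: sums_iff)
  have "ennreal (norm (LINT e|unit_measure. (\<Sum>m. t m e))) \<le> (\<integral>\<^sup>+e. ennreal (norm (\<Sum>m. t m e)) \<partial>unit_measure)"
    by (cases "integrable unit_measure (\<lambda>e. \<Sum>m. t m e)") (auto intro: integral_norm_bound_ennreal simp: not_integrable_integral_eq)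
  also have "\<dots> \<le> (\<integral>\<^sup>+e. ennreal (real k * e ^ (k - 1)) * ennreal (norm (matrix_operator (region_matrix S (damped e k b)) f u)) \<partial>unit_measure)"
  proof (rule nn_integral_unit_mono)
    fix e :: real assume e: "0 < e" "e < 1"
    have "(\<lambda>m. t m e) sums (of_real (real k * e ^ (k - 1)) * matrix_operator (region_matrix S (damped e k b)) f u)"
      unfolding t_def using e by (intro sums_mult matrix_operator_sums[OF g u] damped_norm_le) auto
    then have "(\<Sum>m. t m e) = of_real (real k * e ^ (k - 1)) * matrix_operator (region_matrix S (damped e k b)) f u"
      by (simp add: sums_iff)
    moreover have "norm (complex_of_real (real k * e ^ (k - 1))) = real k * e ^ (k - 1)" using e by (simp only: norm_of_real) simp
    ultimately show "ennreal (norm (\<Sum>m. t m e)) \<le> ennreal (real k * e ^ (k - 1)) * ennreal (norm (matrix_operator (region_matrix S (damped e k b)) f u))"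
      using e by (simp only: norm_mult) (simp add: ennreal_mult')
  qed
  finally show ?thesis unfolding eq .
qed

definition rad_coeff :: "real \<Rightarrow> nat \<Rightarrow> (nat \<Rightarrow> complex) \<Rightarrow> nat \<Rightarrow> complex" where
  "rad_coeff e k b M = binomial_coeff k b M * of_real (rad e ^ M)"

definition symbol_bound :: "nat \<Rightarrow> real \<Rightarrow> real \<Rightarrow> real \<Rightarrow> real" where
  "symbol_bound k al N e = N * 3 powr (real k - al) * e powr (al - real k)"

lemma rad_coeff_bounds:
  assumes g: "growth k al N b" and e: "0 < e" "e < 1" and N: "0 \<le> N" and al: "al < real k"
  shows "summable (\<lambda>n. norm (rad_coeff e k b n))" "norm (pseries (rad_coeff e k b) (cis t)) \<le> symbol_bound k al N e"
proof -
  define r where "r = rad e"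
  have r: "0 < r" "r < 1" "e / 3 \<le> 1 - r" using rad_bounds[OF e] by (auto simp: r_def)
  have nr: "norm (of_real r * cis t) = r" using r by (simp add: norm_mult)
  have "summable (\<lambda>M. norm (binomial_coeff k b M * (of_real r * cis 0) ^ M))"
    using g r unfolding growth_def by (metis norm_mult norm_of_real norm_cis mult_1_right abs_of_pos)
  then show "summable (\<lambda>n. norm (rad_coeff e k b n))" by (simp add: rad_coeff_def r_def)
  have eq: "pseries (rad_coeff e k b) (cis t) = pseries (binomial_coeff k b) (of_real r * cis t)"
    unfolding pseries_def rad_coeff_def r_def by (simp add: power_mult_distrib mult.assoc)
  have "norm (pseries (rad_coeff e k b) (cis t)) \<le> N * (1 - r) powr (al - real k)"
    using g nr r unfolding growth_def eq by metis
  also have "\<dots> \<le> N * (e / 3) powr (al - real k)"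
    using r e al N by (intro mult_left_mono powr_mono2') auto
  also have "(e / 3) powr (al - real k) = 3 powr (real k - al) * e powr (al - real k)"
    using e by (simp add: powr_divide powr_minus_divide[symmetric] powr_minus[symmetric])
      (simp add: field_simps powr_diff)
  finally show "norm (pseries (rad_coeff e k b) (cis t)) \<le> symbol_bound k al N e"
    by (simp add: symbol_bound_def mult.assoc)
qed

lemma damped_eq_rad:
  assumes e: "0 < e" "e < 1"
  shows "damped e k b M = rad_coeff e k b M * of_real (rad e ^ M) * of_real (rad e ^ M)"
proof -
  have "(1 - e) ^ M = rad e ^ M * rad e ^ M * rad e ^ M"
    unfolding rad_bounds(3)[OF e, symmetric] power_mult[symmetric] power_add[symmetric]
    by (rule arg_cong[where f = "\<lambda>j. rad e ^ j"]) simp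
  then show ?thesis by (simp only: damped_def rad_coeff_def of_real_mult mult.assoc)
qed

text \<open>With \<open>r = rad e\<close> the damping is \<open>r^(3(m+n))\<close>. One factor
  \<open>r^(m+n)\<close> belongs to the symbol, \<open>r^(2m)\<close> joins \<open>R\<close> in the
  output variable, one \<open>r^n\<close> goes to the polynomial and the last \<open>r^n\<close> to
  the geometric sum over the columns.\<close>

lemma matrix_operator_input_form:
  assumes g: "growth k al N b" and e: "0 < e" "e < 1" and N: "0 \<le> N" and al: "al < real k" and R: "0 < R" "R < 1"
  shows "matrix_operator (region_matrix (\<lambda>m n. C n \<le> m) (damped e k b)) f (of_real R * cis \<phi>)
    = (\<Sum>n\<le>degree f. (coeff f n * of_real (rad e ^ n)) * (of_real (rad e ^ n)
       * tail_coeff (rad_coeff e k b) (C n) n (of_real ((rad e)\<^sup>2 * R) * cis \<phi>)))"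
proof -
  define r where "r = rad e"
  have r: "0 < r" "r < 1" using rad_bounds[OF e] by (auto simp: r_def)
  define B where "B = rad_coeff e k b"
  define u where "u = of_real R * cis \<phi>"
  define s where "s = r\<^sup>2 * R"
  have "r\<^sup>2 \<le> 1" using r by (simp add: power_le_one)
  then have "s \<le> 1 * R" unfolding s_def using R by (intro mult_right_mono) auto
  then have "s < 1" using R by linarith
  moreover have "0 \<le> s" using R by (simp add: s_def)
  ultimately have s: "0 \<le> s" "s < 1" by auto
  note Bs = rad_coeff_bounds[OF g e N al, folded B_def]
  have each: "(\<lambda>m. region_matrix (\<lambda>m n. C n \<le> m) (damped e k b) m n * u ^ m) sums
      (of_real (r ^ n) * of_real (r ^ n) * tail_coeff B (C n) n (of_real s * cis \<phi>))" for n
  proof -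
    define x where "x m = region_matrix (\<lambda>m n. C n \<le> m) (damped e k b) m n * u ^ m" for m
    have "(\<lambda>j. B (j + C n + n) * (of_real s * cis \<phi>) ^ (j + C n)) sums tail_coeff B (C n) n (of_real s * cis \<phi>)"
      unfolding tail_coeff_def by (rule summable_sums) (rule tail_coeff_integral(2)[OF Bs s])
    then have "(\<lambda>j. of_real (r ^ n) * of_real (r ^ n) * (B (j + C n + n) * (of_real s * cis \<phi>) ^ (j + C n))) sums
       (of_real (r ^ n) * of_real (r ^ n) * tail_coeff B (C n) n (of_real s * cis \<phi>))" by (rule sums_mult)
    moreover have "of_real (r ^ n) * of_real (r ^ n) * (B (j + C n + n) * (of_real s * cis \<phi>) ^ (j + C n)) = x (j + C n)" for j
    proof -
      define m where "m = j + C n"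
      have "(of_real s * cis \<phi>) ^ m = of_real (r ^ m) * of_real (r ^ m) * u ^ m"
        by (simp add: s_def u_def power_mult_distrib power2_eq_square mult_ac)
      then have "of_real (r ^ n) * of_real (r ^ n) * (B (m + n) * (of_real s * cis \<phi>) ^ m)
          = B (m + n) * of_real (r ^ (m + n)) * of_real (r ^ (m + n)) * u ^ m"
        by (simp add: power_add mult_ac)
      also have "\<dots> = x m" by (simp add: x_def region_matrix_def m_def damped_eq_rad[OF e] B_def r_def)
      finally show ?thesis by (simp add: m_def)
    qed
    ultimately have "(\<lambda>j. x (j + C n)) sums (of_real (r ^ n) * of_real (r ^ n) * tail_coeff B (C n) n (of_real s * cis \<phi>))" by simp
    moreover have "(\<Sum>i<C n. x i) = 0" by (intro sum.neutral) (auto simp: x_def region_matrix_def)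
    ultimately show ?thesis using sums_iff_shift[of x "C n"] by (simp add: x_def[abs_def])
  qed
  have "(\<lambda>m. \<Sum>n\<le>degree f. coeff f n * (region_matrix (\<lambda>m n. C n \<le> m) (damped e k b) m n * u ^ m)) sums
     (\<Sum>n\<le>degree f. coeff f n * (of_real (r ^ n) * of_real (r ^ n) * tail_coeff B (C n) n (of_real s * cis \<phi>)))"
    by (intro sums_sum sums_mult each)
  then have "(\<lambda>m. (\<Sum>n\<le>degree f. coeff f n * region_matrix (\<lambda>m n. C n \<le> m) (damped e k b) m n) * u ^ m) sums
     (\<Sum>n\<le>degree f. coeff f n * (of_real (r ^ n) * of_real (r ^ n) * tail_coeff B (C n) n (of_real s * cis \<phi>)))"
    by (simp only: sum_distrib_right mult.assoc)
  then have "matrix_operator (region_matrix (\<lambda>m n. C n \<le> m) (damped e k b)) f u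
     = (\<Sum>n\<le>degree f. coeff f n * (of_real (r ^ n) * of_real (r ^ n) * tail_coeff B (C n) n (of_real s * cis \<phi>)))"
    unfolding matrix_operator_def by (simp add: sums_iff)
  then show ?thesis by (simp only: u_def r_def B_def s_def mult.assoc)
qed

text \<open>The same distribution of the damping, for one row: both remaining factors
  \<open>r^n\<close> stay in the inner sum, in the form that \<open>poly_tail_pairing\<close>
  produces, and \<open>r^(2m)\<close> joins \<open>R\<close>.\<close>

lemma region_row_output_form:
  assumes e: "0 < e" "e < 1"
  shows "(\<Sum>n\<le>degree f. coeff f n * region_matrix (\<lambda>m n. D m \<le> n) (damped e k b) m n) * (of_real R * cis \<phi>) ^ m
    = (of_real ((rad e)\<^sup>2 * R) * cis \<phi>) ^ m *
       (\<Sum>n\<in>{D m..degree f}. rad_coeff e k b (n + m) * of_real (rad e ^ n) * (coeff f n * of_real (rad e ^ n)))"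
proof -
  define r where "r = rad e"
  define u where "u = of_real R * cis \<phi>"
  have X: "(of_real (r\<^sup>2 * R) * cis \<phi>) ^ m = of_real (r ^ m) * of_real (r ^ m) * u ^ m"
    by (simp add: u_def power_mult_distrib power2_eq_square mult_ac)
  have "(\<Sum>n\<le>degree f. coeff f n * region_matrix (\<lambda>m n. D m \<le> n) (damped e k b) m n)
     = (\<Sum>n\<in>{D m..degree f}. coeff f n * damped e k b (m + n))"
    by (rule sum.mono_neutral_cong_right) (auto simp: region_matrix_def)
  also have "\<dots> * u ^ m = (\<Sum>n\<in>{D m..degree f}. of_real (r ^ m) * of_real (r ^ m) * u ^ m *
       (rad_coeff e k b (n + m) * of_real (r ^ n) * (coeff f n * of_real (r ^ n))))"
    unfolding sum_distrib_right
    by (intro sum.cong refl) (simp add: damped_eq_rad[OF e] r_def power_add add.commute mult_ac)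
  also have "\<dots> = (of_real (r ^ m) * of_real (r ^ m) * u ^ m) * (\<Sum>n\<in>{D m..degree f}.
       (rad_coeff e k b (n + m) * of_real (r ^ n) * (coeff f n * of_real (r ^ n))))"
    by (simp only: sum_distrib_left)
  finally show ?thesis by (simp only: r_def u_def X[unfolded r_def u_def])
qed

text \<open>Fatou's lemma. The output estimate is uniform over finite ranges of rows, and the
  operator is the limit of such partial sums.\<close>

lemma matrix_operator_pairing_limit:
  assumes g: "growth k al N b" and b': "\<And>M. norm (b' M) \<le> norm (binomial_coeff k b M)" and R: "0 \<le> R" "R < 1"
    and h [measurable]: "h \<in> borel_measurable borel"
    and le: "\<And>l. (\<integral>\<^sup>+\<phi>. ennreal (h \<phi>) * ennreal (norm (\<Sum>m\<in>{0..l}.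
       (\<Sum>n\<le>degree f. coeff f n * region_matrix S b' m n) * (of_real R * cis \<phi>) ^ m)) \<partial>circ) \<le> K"
  shows "(\<integral>\<^sup>+\<phi>. ennreal (h \<phi>) * ennreal (norm (matrix_operator (region_matrix S b') f (of_real R * cis \<phi>))) \<partial>circ) \<le> K"
proof -
  define P where "P l \<phi> = (\<Sum>m\<in>{0..l}. (\<Sum>n\<le>degree f. coeff f n * region_matrix S b' m n) * (of_real R * cis \<phi>) ^ m)" for l \<phi>
  have [measurable]: "P l \<in> borel_measurable borel" for l unfolding P_def by measurable
  have lim: "(\<lambda>l. ennreal (h \<phi>) * ennreal (norm (P l \<phi>))) \<longlonglongrightarrow> ennreal (h \<phi>) * ennreal (norm (matrix_operator (region_matrix S b') f (of_real R * cis \<phi>)))" for \<phi>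
  proof -
    have "norm (of_real R * cis \<phi>) < 1" using R by (simp add: norm_mult)
    from matrix_operator_sums[OF g this b', of f S]
    have "(\<lambda>l. P l \<phi>) \<longlonglongrightarrow> matrix_operator (region_matrix S b') f (of_real R * cis \<phi>)"
      unfolding P_def by (simp add: sums_def_le atMost_atLeast0)
    then have "(\<lambda>l. norm (P l \<phi>)) \<longlonglongrightarrow> norm (matrix_operator (region_matrix S b') f (of_real R * cis \<phi>))" by (rule tendsto_norm)
    then have "(\<lambda>l. ennreal (norm (P l \<phi>))) \<longlonglongrightarrow> ennreal (norm (matrix_operator (region_matrix S b') f (of_real R * cis \<phi>)))"
      by (rule tendsto_ennrealI)
    then show ?thesis by (intro ennreal_tendsto_cmult) auto
  qed
  have "(\<integral>\<^sup>+\<phi>. ennreal (h \<phi>) * ennreal (norm (matrix_operator (region_matrix S b') f (of_real R * cis \<phi>))) \<partial>circ)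
     = (\<integral>\<^sup>+\<phi>. liminf (\<lambda>l. ennreal (h \<phi>) * ennreal (norm (P l \<phi>))) \<partial>circ)"
    using lim_imp_Liminf[OF trivial_limit_sequentially lim] by simp
  also have "\<dots> \<le> liminf (\<lambda>l. \<integral>\<^sup>+\<phi>. ennreal (h \<phi>) * ennreal (norm (P l \<phi>)) \<partial>circ)"
    by (rule nn_integral_liminf) measurable
  also have "\<dots> \<le> liminf (\<lambda>l. K)"
    by (rule Liminf_mono) (use le in \<open>simp add: P_def\<close>)
  also have "\<dots> = K" by (simp add: Liminf_const)
  finally show ?thesis .
qed

section \<open>Pairing estimates for one value of the damping parameter\<close>

definition smooth_pairing :: "real \<Rightarrow> real \<Rightarrow> complex poly \<Rightarrow> (real \<Rightarrow> real) \<Rightarrow> real \<Rightarrow> ennreal" where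
  "smooth_pairing p k f Y e = (\<integral>\<^sup>+u. ennreal (Y u powr (1 - 1 / p)) *
      (\<integral>\<^sup>+v. ennreal (smooth_kernel k e (u + v) * norm (poly f (of_real (rad e) * cis v))) \<partial>circ) \<partial>circ)"

lemma smooth_pairing_measurable [measurable]:
  assumes [measurable]: "Y \<in> borel_measurable borel"
  shows "smooth_pairing p k f Y \<in> borel_measurable borel"
  unfolding smooth_pairing_def by measurable

lemma powr_le_one_plus:
  assumes "0 \<le> (y::real)" "0 \<le> c" "c \<le> 1" shows "y powr c \<le> 1 + y"
proof (cases "y \<le> 1")
  case True
  then have "y powr c \<le> 1 powr c" using assms by (intro powr_mono2) auto
  then show ?thesis using assms by simp
next
  case False
  then have "y powr c \<le> y powr 1" using assms by (intro powr_mono) auto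
  then show ?thesis using assms by simp
qed

lemma density_powr_integral:
  assumes [measurable]: "Y \<in> borel_measurable borel" and Y0: "\<And>t. 0 \<le> Y t" and Y1: "(\<integral>\<^sup>+t. ennreal (Y t) \<partial>circ) \<le> 1"
    and c: "0 \<le> c" "c \<le> 1"
  shows "(\<integral>\<^sup>+t. ennreal (Y t powr c) \<partial>circ) \<le> 2"
proof -
  have "(\<integral>\<^sup>+t. ennreal (Y t powr c) \<partial>circ) \<le> (\<integral>\<^sup>+t. 1 + ennreal (Y t) \<partial>circ)"
  proof (rule nn_integral_mono)
    fix t
    have "ennreal (Y t powr c) \<le> ennreal (1 + Y t)" using powr_le_one_plus[OF Y0 c] by (rule ennreal_leI)
    then show "ennreal (Y t powr c) \<le> 1 + ennreal (Y t)" using Y0[of t] by simp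
  qed
  also have "\<dots> = 1 + (\<integral>\<^sup>+t. ennreal (Y t) \<partial>circ)" by (subst nn_integral_add) (auto simp: emeasure_circ)
  also have "\<dots> \<le> 1 + 1" by (intro add_left_mono Y1)
  finally show ?thesis by simp
qed

lemma inverse_rad_le:
  assumes e: "0 < e" "e < 1" and c: "0 \<le> c"
  shows "(18 / (1 - rad e)) powr c \<le> (54 / e) powr c"
proof (rule powr_mono2)
  have "18 / (1 - rad e) \<le> 18 / (e / 3)" using rad_bounds[OF e] e by (intro divide_left_mono) auto
  then show "18 / (1 - rad e) \<le> 54 / e" by simp
  show "0 \<le> 18 / (1 - rad e)" using rad_bounds[OF e] by simp
qed (rule c)

lemma input_pairing:
  fixes \<beta> \<gamma> :: real and C :: "nat \<Rightarrow> nat"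
  assumes g: "growth k al N b" and N: "0 < N" and al: "al < real k" and e: "0 < e" "e < 1" and R: "0 < R" "R < 1"
    and \<kappa>: "0 < \<kappa>" "\<kappa> < 1" and L: "1 \<le> L" "\<bar>1 + \<beta>\<bar> \<le> L" "1 \<le> L * \<bar>1 + \<beta>\<bar>"
    and C: "\<And>i. max 0 (\<beta> * real i + \<gamma>) \<le> real (C i)" "\<And>i. real (C i) \<le> max 0 (\<beta> * real i + \<gamma>) + 1"
    and f: "boundary_mean q f \<le> 1" and q: "0 < q" and p: "1 < p"
    and Y [measurable]: "Y \<in> borel_measurable borel" and Y0: "\<And>t. 0 \<le> Y t" and Y1: "(\<integral>\<^sup>+t. ennreal (Y t) \<partial>circ) \<le> 1"
  shows "(\<integral>\<^sup>+\<phi>. ennreal (Y \<phi> powr (1 - 1 / p)) * ennreal (norm (matrix_operator (region_matrix (\<lambda>m n. C n \<le> m) (damped e k b)) f (of_real R * cis \<phi>))) \<partial>circ)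
    \<le> ennreal (symbol_bound k al N e * (2 * smooth_const \<kappa> L)) * smooth_pairing p \<kappa> f Y e
     + ennreal (symbol_bound k al N e * (8 * (error_const L + 2)) * (54 / e) powr max 0 (1 / q - 1 / 2))"
proof -
  define A where "A = symbol_bound k al N e"
  have A0: "0 < A" using N e by (simp add: A_def symbol_bound_def)
  note Bs = rad_coeff_bounds[OF g e less_imp_le[OF N] al, folded A_def]
  define r where "r = rad e"
  have r: "0 \<le> r" "r < 1" using rad_bounds[OF e] by (auto simp: r_def)
  define sg where "sg = max 0 (1 / q - 1 / 2)"
  define Q where "Q = A * smooth_const \<kappa> L"
  have sc0: "0 \<le> smooth_const \<kappa> L" by (rule smooth_const_nonneg[OF \<kappa>(1) L(1)])
  have Q0: "0 \<le> Q" using A0 sc0 by (simp add: Q_def)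
  define I2 where "I2 = (LINT v|circ. (norm (poly f (of_real r * cis v)))\<^sup>2)"
  have I20: "0 \<le> I2" unfolding I2_def by (rule integral_nonneg_AE) simp
  \<comment> \<open>The mean of order 2 loses the exponent \<open>2 / q - 1\<close>; its square
    root, which enters the bilinear bound, loses \<open>1 / q - 1 / 2\<close>.\<close>
  have I2_le: "I2 \<le> 2 * (54 / e) powr (2 * sg)"
  proof -
    define M where "M = (\<Sum>n\<le>degree f. norm (coeff f n))"
    have "ennreal I2 = (\<integral>\<^sup>+v. ennreal ((norm (poly f (of_real r * cis v)))\<^sup>2) \<partial>circ)"
      unfolding I2_def using poly_circle_bounded[of r f] r
      by (intro nn_integral_eq_integral[symmetric] integrable_circ[where H = "M\<^sup>2"]) (auto simp: M_def intro!: power_mono)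
    also have "\<dots> = (\<integral>\<^sup>+v. ennreal (norm (poly f (of_real r * cis v)) powr 2) \<partial>circ)"
      by (simp add: powr_numeral)
    also have "\<dots> \<le> ennreal (2 * (18 / (1 - r)) powr (max 0 (2 / q - 1)))"
      by (rule poly_higher_mean_le[OF f q r]) simp
    finally have "I2 \<le> 2 * (18 / (1 - r)) powr (max 0 (2 / q - 1))" by (subst (asm) ennreal_le_iff) auto
    also have "max 0 (2 / q - 1) = 2 * sg" by (simp add: sg_def max_def)
    also have "2 * (18 / (1 - r)) powr (2 * sg) \<le> 2 * (54 / e) powr (2 * sg)"
      unfolding r_def using e by (intro mult_left_mono inverse_rad_le) (auto simp: sg_def)
    finally show ?thesis .
  qed
  define Z where "Z = A * sqrt (error_const L) * sqrt I2"
  have ec0: "0 \<le> error_const L" by (rule error_const_nonneg[OF L(1)])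
  have Z0: "0 \<le> Z" using A0 ec0 I20 by (simp add: Z_def)
  have Z_le: "2 * Z \<le> A * (8 * (error_const L + 2)) * (54 / e) powr sg"
  proof -
    have "sqrt I2 \<le> 2 * (54 / e) powr sg"
    proof (rule real_le_lsqrt)
      have "((54 / e) powr sg)\<^sup>2 = (54 / e) powr (2 * sg)"
        by (simp add: power2_eq_square powr_add[symmetric])
      moreover have "(0::real) \<le> (54 / e) powr (2 * sg)" by simp
      ultimately have "I2 \<le> 4 * ((54 / e) powr sg)\<^sup>2" using I2_le by linarith
      then show "I2 \<le> (2 * (54 / e) powr sg)\<^sup>2" unfolding power_mult_distrib by simp
    qed (use I20 in auto)
    moreover have "sqrt (error_const L) \<le> error_const L + 2"
    proof (rule real_le_lsqrt)
      show "error_const L \<le> (error_const L + 2)\<^sup>2" using ec0 by (simp add: power2_eq_square algebra_simps)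
    qed (use ec0 in auto)
    ultimately have "sqrt (error_const L) * sqrt I2 \<le> (error_const L + 2) * (2 * (54 / e) powr sg)"
      using I20 ec0 by (intro mult_mono) auto
    then have "A * (sqrt (error_const L) * sqrt I2) \<le> A * ((error_const L + 2) * (2 * (54 / e) powr sg))"
      using A0 by (intro mult_left_mono) auto
    moreover have "0 \<le> A * ((error_const L + 2) * (54 / e) powr sg)" using A0 ec0 by simp
    moreover have "A * ((error_const L + 2) * (2 * (54 / e) powr sg)) = 2 * (A * ((error_const L + 2) * (54 / e) powr sg))"
      "A * (8 * (error_const L + 2)) * (54 / e) powr sg = 8 * (A * ((error_const L + 2) * (54 / e) powr sg))"
      "2 * Z = 2 * (A * (sqrt (error_const L) * sqrt I2))" by (simp_all only: Z_def mult_ac)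
    ultimately show ?thesis by linarith
  qed
  define K where "K \<phi> = (\<integral>\<^sup>+v. ennreal (smooth_kernel \<kappa> e (\<phi> + v) * norm (poly f (of_real r * cis v))) \<partial>circ)" for \<phi>
  have [measurable]: "K \<in> borel_measurable borel" unfolding K_def by measurable
  have "(\<integral>\<^sup>+\<phi>. ennreal (Y \<phi> powr (1 - 1 / p)) * ennreal (norm (matrix_operator (region_matrix (\<lambda>m n. C n \<le> m) (damped e k b)) f (of_real R * cis \<phi>))) \<partial>circ)
     \<le> (\<integral>\<^sup>+\<phi>. ennreal Q * (ennreal (Y \<phi> powr (1 - 1 / p)) * K \<phi>) + ennreal Z * ennreal (Y \<phi> powr (1 - 1 / p)) \<partial>circ)"
  proof (rule nn_integral_mono)
    fix \<phi>
    have "ennreal (norm (matrix_operator (region_matrix (\<lambda>m n. C n \<le> m) (damped e k b)) f (of_real R * cis \<phi>))) \<le> ennreal Q * K \<phi> + ennreal Z"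
      unfolding matrix_operator_input_form[OF g e less_imp_le[OF N] al R] Q_def Z_def K_def I2_def r_def
      using R by (intro bilinear_input_bound[where \<beta> = \<beta> and \<gamma> = \<gamma>] Bs e \<kappa> L C) auto
    then have "ennreal (Y \<phi> powr (1 - 1 / p)) * ennreal (norm (matrix_operator (region_matrix (\<lambda>m n. C n \<le> m) (damped e k b)) f (of_real R * cis \<phi>)))
      \<le> ennreal (Y \<phi> powr (1 - 1 / p)) * (ennreal Q * K \<phi> + ennreal Z)" by (rule mult_left_mono) simp
    then show "ennreal (Y \<phi> powr (1 - 1 / p)) * ennreal (norm (matrix_operator (region_matrix (\<lambda>m n. C n \<le> m) (damped e k b)) f (of_real R * cis \<phi>)))
      \<le> ennreal Q * (ennreal (Y \<phi> powr (1 - 1 / p)) * K \<phi>) + ennreal Z * ennreal (Y \<phi> powr (1 - 1 / p))"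
      by (simp only: distrib_left distrib_right mult_ac)
  qed
  also have "\<dots> = ennreal Q * smooth_pairing p \<kappa> f Y e + ennreal Z * (\<integral>\<^sup>+\<phi>. ennreal (Y \<phi> powr (1 - 1 / p)) \<partial>circ)"
    unfolding smooth_pairing_def K_def[symmetric] r_def[symmetric]
    by (subst nn_integral_add, measurable, subst nn_integral_cmult, measurable, subst nn_integral_cmult, measurable)
  also have "\<dots> \<le> ennreal (A * (2 * smooth_const \<kappa> L)) * smooth_pairing p \<kappa> f Y e + ennreal Z * 2"
  proof (intro add_mono mult_right_mono mult_left_mono density_powr_integral Y Y0 Y1 ennreal_leI)
    have "A * smooth_const \<kappa> L \<le> A * (2 * smooth_const \<kappa> L)" using A0 sc0 by (intro mult_left_mono) auto
    then show "Q \<le> A * (2 * smooth_const \<kappa> L)" by (simp add: Q_def)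
  qed (use p in auto)
  also have "ennreal Z * 2 = ennreal (2 * Z)" using Z0 by (simp add: ennreal_mult' mult.commute)
  also have "ennreal (2 * Z) \<le> ennreal (A * (8 * (error_const L + 2)) * (54 / e) powr sg)" by (rule ennreal_leI[OF Z_le])
  finally show ?thesis by (simp add: A_def sg_def add_left_mono)
qed

lemma output_pairing:
  fixes \<beta> \<gamma> :: real and D :: "nat \<Rightarrow> nat"
  assumes g: "growth k al N b" and N: "0 < N" and al: "al < real k" and e: "0 < e" "e < 1" and R: "0 < R" "R < 1"
    and \<kappa>: "0 < \<kappa>" "\<kappa> < 1" and L: "1 \<le> L" "\<bar>1 + \<beta>\<bar> \<le> L" "1 \<le> L * \<bar>1 + \<beta>\<bar>"
    and D: "\<And>i. max 0 (\<beta> * real i + \<gamma>) \<le> real (D i)" "\<And>i. real (D i) \<le> max 0 (\<beta> * real i + \<gamma>) + 1"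
    and f: "boundary_mean q f \<le> 1" and q: "0 < q" and p: "1 < p" "p \<le> 2"
    and Y [measurable]: "Y \<in> borel_measurable borel" and Y0: "\<And>t. 0 \<le> Y t" and Y1: "(\<integral>\<^sup>+t. ennreal (Y t) \<partial>circ) \<le> 1"
  shows "(\<integral>\<^sup>+\<phi>. ennreal (Y \<phi> powr (1 - 1 / p)) * ennreal (norm (\<Sum>m\<in>{m0..m1}.
       (\<Sum>n\<le>degree f. coeff f n * region_matrix (\<lambda>m n. D m \<le> n) (damped e k b) m n) * (of_real R * cis \<phi>) ^ m)) \<partial>circ)
    \<le> ennreal (symbol_bound k al N e * smooth_const \<kappa> L) * smooth_pairing p \<kappa> f Y e
     + ennreal (symbol_bound k al N e * (4 * (error_const L + 2)) * (54 / e) powr max 0 (1 / q - 1))"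
proof -
  define A where "A = symbol_bound k al N e"
  have A0: "0 < A" using N e by (simp add: A_def symbol_bound_def)
  note Bs = rad_coeff_bounds[OF g e less_imp_le[OF N] al, folded A_def]
  define r where "r = rad e"
  have r: "0 \<le> r" "r < 1" using rad_bounds[OF e] by (auto simp: r_def)
  have ec0: "0 \<le> error_const L" by (rule error_const_nonneg[OF L(1)])
  define sg where "sg = max 0 (1 / q - 1)"
  have "(\<integral>\<^sup>+v. ennreal (norm (poly f (of_real r * cis v))) \<partial>circ) \<le> ennreal (2 * (18 / (1 - r)) powr (max 0 (1 / q - 1)))"
    using poly_higher_mean_le[OF f q r, of 1] by simp
  also have "\<dots> \<le> ennreal (2 * (54 / e) powr sg)"
    unfolding sg_def r_def using e by (intro ennreal_leI mult_left_mono inverse_rad_le) auto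
  finally have I1: "(\<integral>\<^sup>+v. ennreal (norm (poly f (of_real r * cis v))) \<partial>circ) \<le> ennreal (2 * (54 / e) powr sg)" .
  have sq: "(Y t powr (1 - 1 / p))\<^sup>2 = Y t powr (2 - 2 / p)" for t
    by (simp add: power2_eq_square powr_add[symmetric])
  \<comment> \<open>This is where \<open>p \<le> 2\<close> is used: the exponent
    \<open>2 - 2 / p\<close> is at most 1, so the dual function is square integrable.\<close>
  have g2: "(\<integral>\<^sup>+t. ennreal ((Y t powr (1 - 1 / p))\<^sup>2) \<partial>circ) \<le> 2"
    unfolding sq using p by (intro density_powr_integral Y Y0 Y1) (auto simp: field_simps)
  have "(\<integral>\<^sup>+\<phi>. ennreal (Y \<phi> powr (1 - 1 / p)) * ennreal (norm (\<Sum>m\<in>{m0..m1}. (of_real ((rad e)\<^sup>2 * R) * cis \<phi>) ^ m *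
       (\<Sum>n\<in>{D m..degree f}. rad_coeff e k b (n + m) * of_real (rad e ^ n) * (coeff f n * of_real (rad e ^ n))))) \<partial>circ)
    \<le> ennreal (A * smooth_const \<kappa> L) * (\<integral>\<^sup>+\<phi>. ennreal (Y \<phi> powr (1 - 1 / p)) *
        (\<integral>\<^sup>+v. ennreal (smooth_kernel \<kappa> e (\<phi> + v) * norm (poly f (of_real (rad e) * cis v))) \<partial>circ) \<partial>circ)
      + ennreal (A * (error_const L + 2)) * (\<integral>\<^sup>+v. ennreal (norm (poly f (of_real (rad e) * cis v))) \<partial>circ)"
    using R by (intro bilinear_output_bound[where \<beta> = \<beta> and \<gamma> = \<gamma>] Bs A0 e \<kappa> L D g2) auto
  also have "\<dots> \<le> ennreal (A * smooth_const \<kappa> L) * smooth_pairing p \<kappa> f Y e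
      + ennreal (A * (error_const L + 2)) * ennreal (2 * (54 / e) powr sg)"
    using I1 by (intro add_mono mult_left_mono) (auto simp: smooth_pairing_def r_def)
  also have "ennreal (A * (error_const L + 2)) * ennreal (2 * (54 / e) powr sg) = ennreal (A * (2 * (error_const L + 2)) * (54 / e) powr sg)"
    using A0 ec0 by (simp add: ennreal_mult'[symmetric] mult_ac)
  also have "\<dots> \<le> ennreal (A * (4 * (error_const L + 2)) * (54 / e) powr sg)"
    using A0 ec0 by (intro ennreal_leI mult_right_mono mult_left_mono) auto
  finally show ?thesis
    unfolding region_row_output_form[OF e] by (simp add: A_def sg_def add_left_mono)
qed

text \<open>The error terms lose this power of \<open>1/e\<close>.\<close>

definition loss_exponent :: "real \<Rightarrow> real \<Rightarrow> real" where
  "loss_exponent p q = max 0 (1 / q - 1 / (if p \<le> 2 then 1 else 2))"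

lemma nat_ceiling_threshold:
  fixes x :: real
  shows "max 0 x \<le> real (nat \<lceil>x\<rceil>)" "real (nat \<lceil>x\<rceil>) \<le> max 0 x + 1" "nat \<lceil>x\<rceil> \<le> m \<longleftrightarrow> x \<le> real m"
proof -
  show "max 0 x \<le> real (nat \<lceil>x\<rceil>)" by linarith
  show "real (nat \<lceil>x\<rceil>) \<le> max 0 x + 1" by linarith
  show "nat \<lceil>x\<rceil> \<le> m \<longleftrightarrow> x \<le> real m" by linarith
qed

text \<open>The strict counterpart of \<open>nat_ceiling_threshold\<close>, for the complement of a
  region defined by a non-strict inequality.\<close>

lemma nat_floor_threshold:
  fixes x :: real
  shows "max 0 x \<le> real (nat (\<lfloor>x\<rfloor> + 1))" "real (nat (\<lfloor>x\<rfloor> + 1)) \<le> max 0 x + 1" "nat (\<lfloor>x\<rfloor> + 1) \<le> m \<longleftrightarrow> x < real m"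
proof -
  show "max 0 x \<le> real (nat (\<lfloor>x\<rfloor> + 1))" by linarith
  show "real (nat (\<lfloor>x\<rfloor> + 1)) \<le> max 0 x + 1" by linarith
  show "nat (\<lfloor>x\<rfloor> + 1) \<le> m \<longleftrightarrow> x < real m" by linarith
qed

text \<open>For \<open>p \<le> 2\<close> the rows must be final segments in \<open>n\<close>. They
  are for \<beta> < 0. For \<beta> > 0 they are initial segments, so the region is written as the
  full matrix minus a region with final segments, which is why the bound is twice the single bound
  \<open>W\<close>. For \<beta> = 0 only the rows are cut.\<close>

lemma threshold_pairing_at:
  fixes \<beta> \<gamma> :: real
  defines "S \<equiv> \<lambda>m n. \<beta> * real n + \<gamma> \<le> real m"
  assumes g: "growth k al N b" and N: "0 < N" and al: "al < real k" and e: "0 < e" "e < 1" and R: "0 < R" "R < 1"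
    and \<kappa>: "0 < \<kappa>" "\<kappa> < 1" and L: "1 \<le> L" "\<bar>1 + \<beta>\<bar> \<le> L" "1 \<le> L * \<bar>1 + \<beta>\<bar>"
    and L': "p \<le> 2 \<Longrightarrow> \<beta> \<noteq> 0 \<Longrightarrow> \<bar>1 + 1 / \<beta>\<bar> \<le> L \<and> 1 \<le> L * \<bar>1 + 1 / \<beta>\<bar>"
    and f: "boundary_mean q f \<le> 1" and q: "0 < q" and p: "1 < p"
    and Y [measurable]: "Y \<in> borel_measurable borel" and Y0: "\<And>t. 0 \<le> Y t" and Y1: "(\<integral>\<^sup>+t. ennreal (Y t) \<partial>circ) \<le> 1"
  shows "(\<integral>\<^sup>+\<phi>. ennreal (Y \<phi> powr (1 - 1 / p)) * ennreal (norm (matrix_operator (region_matrix S (damped e k b)) f (of_real R * cis \<phi>))) \<partial>circ)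
    \<le> ennreal (symbol_bound k al N e * (2 * smooth_const \<kappa> L)) * smooth_pairing p \<kappa> f Y e
     + ennreal (symbol_bound k al N e * (8 * (error_const L + 2)) * (54 / e) powr loss_exponent p q)"
    (is "?lhs \<le> ?rhs")
proof (cases "p \<le> 2")
  case False
  have S: "S = (\<lambda>m n. nat \<lceil>\<beta> * real n + \<gamma>\<rceil> \<le> m)" by (simp only: S_def nat_ceiling_threshold)
  show ?thesis
    using input_pairing[OF g N al e R \<kappa> L nat_ceiling_threshold(1,2) f q p Y Y0 Y1] False
    by (simp only: S loss_exponent_def if_False)
next
  case True
  define A where "A = symbol_bound k al N e"
  have A0: "0 < A" using N e by (simp add: A_def symbol_bound_def)
  define sg where "sg = max 0 (1 / q - 1)"
  have sg: "loss_exponent p q = sg" using True by (simp add: loss_exponent_def sg_def)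
  have ec0: "0 \<le> error_const L" by (rule error_const_nonneg[OF L(1)])
  have sc0: "0 \<le> smooth_const \<kappa> L" by (rule smooth_const_nonneg[OF \<kappa>(1) L(1)])
  define W where "W = ennreal (A * smooth_const \<kappa> L) * smooth_pairing p \<kappa> f Y e + ennreal (A * (4 * (error_const L + 2)) * (54 / e) powr sg)"
  define u where "u \<phi> = of_real R * cis \<phi>" for \<phi>
  define row where "row T \<phi> m = (\<Sum>n\<le>degree f. coeff f n * region_matrix T (damped e k b) m n) * u \<phi> ^ m" for T \<phi> m
  have row_meas [measurable]: "(\<lambda>\<phi>. row T \<phi> m) \<in> borel_measurable borel" for T m
    unfolding row_def u_def by measurable
  define J where "J T l0 l = (\<integral>\<^sup>+\<phi>. ennreal (Y \<phi> powr (1 - 1 / p)) * ennreal (norm (\<Sum>m\<in>{l0..l}. row T \<phi> m)) \<partial>circ)" for T l0 l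
  have W2: "W + W = ?rhs"
  proof -
    have "ennreal (A * (2 * smooth_const \<kappa> L)) = ennreal (A * smooth_const \<kappa> L) + ennreal (A * smooth_const \<kappa> L)"
      using A0 sc0 by (subst ennreal_plus[symmetric]) auto
    moreover have "ennreal (A * (8 * (error_const L + 2)) * (54 / e) powr sg)
      = ennreal (A * (4 * (error_const L + 2)) * (54 / e) powr sg) + ennreal (A * (4 * (error_const L + 2)) * (54 / e) powr sg)"
      using A0 ec0 by (subst ennreal_plus[symmetric]) (auto simp: algebra_simps)
    ultimately show ?thesis unfolding W_def A_def[symmetric] sg by (simp only: distrib_right add_ac)
  qed
  have W_le: "W \<le> ?rhs" unfolding W2[symmetric] by simp
  have piece: "J (\<lambda>m n. D m \<le> n) l0 l \<le> W"
    if "\<bar>1 + \<beta>'\<bar> \<le> L" "1 \<le> L * \<bar>1 + \<beta>'\<bar>" "\<And>i. max 0 (\<beta>' * real i + \<gamma>') \<le> real (D i)"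
      "\<And>i. real (D i) \<le> max 0 (\<beta>' * real i + \<gamma>') + 1" for \<beta>' \<gamma>' D l0 l
    unfolding J_def row_def u_def W_def A_def sg_def
    by (rule output_pairing[OF g N al e R \<kappa> L(1) that f q p True Y Y0 Y1])
  have all: "J (\<lambda>m n. 0 \<le> n) l0 l \<le> W" for l0 l
    by (rule piece[of 0 0 "\<lambda>_. 0"]) (use L(1) in auto)
  have "J S 0 l \<le> ?rhs" for l
  proof (cases "\<beta> = 0")
    case True
    \<comment> \<open>A region with \<beta> = 0 does not depend on \<open>n\<close>: it keeps the
      rows from \<open>nat \<lceil>\<gamma>\<rceil>\<close> on and removes the others.\<close>
    have "(\<Sum>m\<in>{0..l}. row S \<phi> m) = (\<Sum>m\<in>{nat \<lceil>\<gamma>\<rceil>..l}. row (\<lambda>m n. 0 \<le> n) \<phi> m)" for \<phi>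
      by (rule sum.mono_neutral_cong_right)
         (auto simp: row_def region_matrix_def S_def True nat_ceiling_threshold(3) not_le nat_le_iff ceiling_le_iff
           simp del: nat_ceiling_le_eq)
    then have "J S 0 l = J (\<lambda>m n. 0 \<le> n) (nat \<lceil>\<gamma>\<rceil>) l" by (simp add: J_def)
    then show ?thesis using all[of "nat \<lceil>\<gamma>\<rceil>" l] W_le by (metis order_trans)
  next
    case False
    note L'' = L'[OF \<open>p \<le> 2\<close> False]
    show ?thesis
    proof (cases "\<beta> < 0")
      case True
      have "S = (\<lambda>m n. nat \<lceil>1 / \<beta> * real m + - \<gamma> / \<beta>\<rceil> \<le> n)"
        unfolding nat_ceiling_threshold S_def using True by (intro ext) (auto simp: field_simps)
      moreover have "J (\<lambda>m n. nat \<lceil>1 / \<beta> * real m + - \<gamma> / \<beta>\<rceil> \<le> n) 0 l \<le> W"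
        using L'' by (intro piece[of "1 / \<beta>" "- \<gamma> / \<beta>"] nat_ceiling_threshold) auto
      ultimately show ?thesis using W_le by (metis order_trans)
    next
      case f: False
      define T where "T = (\<lambda>m n. nat (\<lfloor>1 / \<beta> * real m + - \<gamma> / \<beta>\<rfloor> + 1) \<le> n)"
      have ST: "S m n \<longleftrightarrow> \<not> T m n" for m n
        unfolding T_def nat_floor_threshold S_def using f False by (auto simp: field_simps)
      have T_le: "J T 0 l \<le> W" unfolding T_def
        using L'' by (intro piece[of "1 / \<beta>" "- \<gamma> / \<beta>"] nat_floor_threshold) auto
      have "J S 0 l \<le> (\<integral>\<^sup>+\<phi>. ennreal (Y \<phi> powr (1 - 1 / p)) * ennreal (norm (\<Sum>m\<in>{0..l}. row (\<lambda>m n. 0 \<le> n) \<phi> m))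
         + ennreal (Y \<phi> powr (1 - 1 / p)) * ennreal (norm (\<Sum>m\<in>{0..l}. row T \<phi> m)) \<partial>circ)"
        unfolding J_def
      proof (rule nn_integral_mono)
        fix \<phi>
        have "row S \<phi> m = row (\<lambda>m n. 0 \<le> n) \<phi> m - row T \<phi> m" for m
          unfolding row_def left_diff_distrib[symmetric] sum_subtractf[symmetric]
          by (intro arg_cong2[where f = times] sum.cong refl) (simp add: region_matrix_def ST)
        then have "norm (\<Sum>m\<in>{0..l}. row S \<phi> m) \<le> norm (\<Sum>m\<in>{0..l}. row (\<lambda>m n. 0 \<le> n) \<phi> m) + norm (\<Sum>m\<in>{0..l}. row T \<phi> m)"
          by (simp add: sum_subtractf norm_triangle_ineq4)
        then have "ennreal (norm (\<Sum>m\<in>{0..l}. row S \<phi> m)) \<le> ennreal (norm (\<Sum>m\<in>{0..l}. row (\<lambda>m n. 0 \<le> n) \<phi> m)) + ennreal (norm (\<Sum>m\<in>{0..l}. row T \<phi> m))"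
          by (metis ennreal_leI ennreal_plus norm_ge_zero)
        then show "ennreal (Y \<phi> powr (1 - 1 / p)) * ennreal (norm (\<Sum>m\<in>{0..l}. row S \<phi> m))
          \<le> ennreal (Y \<phi> powr (1 - 1 / p)) * ennreal (norm (\<Sum>m\<in>{0..l}. row (\<lambda>m n. 0 \<le> n) \<phi> m))
            + ennreal (Y \<phi> powr (1 - 1 / p)) * ennreal (norm (\<Sum>m\<in>{0..l}. row T \<phi> m))"
          unfolding distrib_left[symmetric] by (rule mult_left_mono) simp
      qed
      also have "\<dots> = J (\<lambda>m n. 0 \<le> n) 0 l + J T 0 l"
        unfolding J_def by (rule nn_integral_add) measurable
      also have "\<dots> \<le> W + W" by (intro add_mono all T_le)
      finally show ?thesis unfolding W2 .
    qed
  qed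
  then show ?thesis
    unfolding J_def row_def u_def
    by (intro matrix_operator_pairing_limit[OF g damped_norm_le]) (use e R in auto)
qed

definition threshold_const :: "real \<Rightarrow> real \<Rightarrow> nat \<Rightarrow> real \<Rightarrow> real \<Rightarrow> real \<Rightarrow> real" where
  "threshold_const p q k al \<kappa> L = real k * 3 powr (real k - al) *
     (2 * smooth_const \<kappa> L * pairing_const p q \<kappa> + 8 * (error_const L + 2) * (54 powr loss_exponent p q / (al - loss_exponent p q)))"

text \<open>Strictness comes from \<open>1 / p < 1\<close>, respectively from
  \<open>1 / p < 1 / 2\<close> when \<open>p > 2\<close>. It makes the power
  \<open>al - loss_exponent p q - 1\<close> of \<open>e\<close> integrable at 0.\<close>

lemma loss_exponent_less:
  assumes "0 < q" "q < p" "1 < p" "al = 1 / q - 1 / p"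
  shows "loss_exponent p q < al"
proof -
  have "1 / p < 1 / q" using assms by (intro divide_strict_left_mono) auto
  moreover have "1 / p < 1" using assms by simp
  moreover have "1 / p < 1 / 2" if "\<not> p \<le> 2" using that by (intro divide_strict_left_mono) auto
  ultimately show ?thesis using assms by (auto simp: loss_exponent_def)
qed

lemma pairing_const_nonneg:
  assumes "0 < q" "q < p" "1 < p" "al = 1 / q - 1 / p" "0 < k" "k < al" "k < 1 - 1 / p"
  shows "0 \<le> pairing_const p q k"
proof -
  have "0 \<le> hls_const k (1 / p + k)" "0 \<le> hls_const k (1 - 1 / p)"
    using assms by (auto intro!: hls_const_nonneg)
  then show ?thesis
    unfolding pairing_const_def assms(4)[symmetric] using assms(5,6)
    by (intro mult_nonneg_nonneg add_nonneg_nonneg) auto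
qed

lemma unit_powr_integral:
  assumes "0 < a"
  shows "(\<integral>\<^sup>+e. ennreal (e powr (a - 1)) \<partial>unit_measure) \<le> ennreal (1 / a)"
proof -
  have "(\<integral>\<^sup>+e. ennreal (e powr (a - 1)) \<partial>unit_measure) = (\<integral>\<^sup>+e. indicator {0<..<1} e * ennreal (e powr (a - 1)) \<partial>lborel)"
    by (rule nn_integral_unit) measurable
  also have "\<dots> \<le> (\<integral>\<^sup>+e. indicator {0..1} e * ennreal (e powr (a - 1)) \<partial>lborel)"
    by (intro nn_integral_mono mult_right_mono) (auto simp: indicator_def)
  also have "\<dots> = ennreal (1 / a)" using assms by (subst nn_integral_powr_from_0) auto
  finally show ?thesis .
qed

lemma matrix_operator_joint_measurable:
  "(\<lambda>x. matrix_operator (region_matrix S (damped (fst x) k b)) f (of_real R * cis (snd x))) \<in> borel_measurable (unit_measure \<Otimes>\<^sub>M circ)"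
  unfolding matrix_operator_def region_matrix_def damped_def by measurable

text \<open>Integrates the estimate for fixed damping over \<open>e\<close>. The smooth part goes to
  \<open>smooth_part_pairing\<close>; the error term is a power of \<open>e\<close> with exponent
  above -1.\<close>

lemma threshold_pairing:
  fixes \<beta> \<gamma> :: real
  defines "S \<equiv> \<lambda>m n. \<beta> * real n + \<gamma> \<le> real m"
  assumes g: "growth k al N b" and N: "0 < N" and alk: "al < real k" and k1: "1 \<le> k" and R: "0 < R" "R < 1"
    and L: "1 \<le> L" "\<bar>1 + \<beta>\<bar> \<le> L" "1 \<le> L * \<bar>1 + \<beta>\<bar>"
    and L': "p \<le> 2 \<Longrightarrow> \<beta> \<noteq> 0 \<Longrightarrow> \<bar>1 + 1 / \<beta>\<bar> \<le> L \<and> 1 \<le> L * \<bar>1 + 1 / \<beta>\<bar>"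
    and f: "boundary_mean q f \<le> 1"
    and q: "0 < q" "q < p" "1 < p" and al: "al = 1 / q - 1 / p" and \<kappa>: "0 < \<kappa>" "\<kappa> < al" "\<kappa> < 1 - 1 / p"
    and Y [measurable]: "Y \<in> borel_measurable borel" and Y0: "\<And>t. 0 \<le> Y t" and Y1: "(\<integral>\<^sup>+t. ennreal (Y t) \<partial>circ) \<le> 1"
  shows "(\<integral>\<^sup>+\<phi>. ennreal (Y \<phi> powr (1 - 1 / p)) * ennreal (norm (matrix_operator (region_matrix S b) f (of_real R * cis \<phi>))) \<partial>circ)
    \<le> ennreal (N * threshold_const p q k al \<kappa> L)"
proof -
  define F where "F e \<phi> = ennreal (norm (matrix_operator (region_matrix S (damped e k b)) f (of_real R * cis \<phi>)))" for e \<phi>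
  have Fm: "(\<lambda>x. F (fst x) (snd x)) \<in> borel_measurable (unit_measure \<Otimes>\<^sub>M circ)"
    unfolding F_def using matrix_operator_joint_measurable by measurable
  have [measurable]: "F e \<in> borel_measurable borel" for e
    unfolding F_def matrix_operator_def by measurable
  have [measurable]: "(\<lambda>e. F e \<phi>) \<in> borel_measurable borel" for \<phi>
    unfolding F_def matrix_operator_def region_matrix_def damped_def by measurable
  define y where "y \<phi> = ennreal (Y \<phi> powr (1 - 1 / p))" for \<phi>
  have [measurable]: "y \<in> borel_measurable borel" unfolding y_def by measurable
  define w where "w e = ennreal (real k * e ^ (k - 1))" for e :: real
  have [measurable]: "w \<in> borel_measurable borel" unfolding w_def by measurable
  define sg where "sg = loss_exponent p q"
  have sg: "sg < al" unfolding sg_def by (rule loss_exponent_less[OF q al])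
  have p0: "0 < 1 / p" using q by simp
  have \<kappa>1: "\<kappa> < 1" using \<kappa> p0 by linarith
  have ec0: "0 \<le> error_const L" by (rule error_const_nonneg[OF L(1)])
  have sc0: "0 \<le> smooth_const \<kappa> L" by (rule smooth_const_nonneg[OF \<kappa>(1) L(1)])
  have pc0: "0 \<le> pairing_const p q \<kappa>" by (rule pairing_const_nonneg[OF q al \<kappa>])
  define c0 where "c0 = N * (real k * 3 powr (real k - al))"
  have c0: "0 \<le> c0" using N by (simp add: c0_def)
  define c1 where "c1 = 2 * smooth_const \<kappa> L"
  define c2 where "c2 = 8 * (error_const L + 2) * 54 powr sg"
  have c12: "0 \<le> c1" "0 \<le> c2" using sc0 ec0 by (auto simp: c1_def c2_def)
  have "(\<integral>\<^sup>+\<phi>. ennreal (Y \<phi> powr (1 - 1 / p)) * ennreal (norm (matrix_operator (region_matrix S b) f (of_real R * cis \<phi>))) \<partial>circ)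
    \<le> (\<integral>\<^sup>+\<phi>. y \<phi> * (\<integral>\<^sup>+e. w e * F e \<phi> \<partial>unit_measure) \<partial>circ)"
    unfolding y_def w_def F_def using R
    by (intro nn_integral_mono mult_left_mono matrix_operator_le_damped[OF g k1]) (auto simp: norm_mult)
  also have "\<dots> = (\<integral>\<^sup>+\<phi>. (\<integral>\<^sup>+e. w e * (y \<phi> * F e \<phi>) \<partial>unit_measure) \<partial>circ)"
    by (intro nn_integral_cong, subst nn_integral_cmult[symmetric], measurable) (simp add: mult.left_commute)
  also have "\<dots> = (\<integral>\<^sup>+e. (\<integral>\<^sup>+\<phi>. w e * (y \<phi> * F e \<phi>) \<partial>circ) \<partial>unit_measure)"
    by (rule unit_circ.Fubini') (use Fm in measurable)
  also have "\<dots> = (\<integral>\<^sup>+e. w e * (\<integral>\<^sup>+\<phi>. y \<phi> * F e \<phi> \<partial>circ) \<partial>unit_measure)"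
    by (intro nn_integral_cong nn_integral_cmult) measurable
  also have "\<dots> \<le> (\<integral>\<^sup>+e. ennreal c0 * (ennreal c1 * (ennreal (e powr (al - 1)) * smooth_pairing p \<kappa> f Y e)
      + ennreal c2 * ennreal (e powr ((al - sg) - 1))) \<partial>unit_measure)"
  proof (rule nn_integral_unit_mono)
    fix e :: real assume e: "0 < e" "e < 1"
    \<comment> \<open>The Beta weight \<open>e^(k-1)\<close> meets the size \<open>e^(al-k)\<close>
      of the damped symbol, and \<open>k\<close> disappears from the exponent.\<close>
    have wA: "real k * e ^ (k - 1) * symbol_bound k al N e = c0 * e powr (al - 1)"
    proof -
      have "e ^ (k - 1) = e powr (real k - 1)" using e k1 by (simp add: powr_realpow[symmetric] of_nat_diff)
      then have "e ^ (k - 1) * e powr (al - real k) = e powr (al - 1)" by (simp add: powr_add[symmetric])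
      moreover have "real k * e ^ (k - 1) * symbol_bound k al N e = c0 * (e ^ (k - 1) * e powr (al - real k))"
        by (simp only: c0_def symbol_bound_def mult_ac)
      ultimately show ?thesis by simp
    qed
    have A0: "0 \<le> symbol_bound k al N e" using N by (simp add: symbol_bound_def)
    have w0: "0 \<le> real k * e ^ (k - 1)" using e by simp
    have "w e * (\<integral>\<^sup>+\<phi>. y \<phi> * F e \<phi> \<partial>circ)
       \<le> w e * (ennreal (symbol_bound k al N e * c1) * smooth_pairing p \<kappa> f Y e
         + ennreal (symbol_bound k al N e * (8 * (error_const L + 2)) * (54 / e) powr sg))"
      unfolding y_def F_def S_def c1_def sg_def
      by (intro mult_left_mono threshold_pairing_at[OF g N alk e R \<kappa>(1) \<kappa>1 L L' f q(1,3) Y Y0 Y1]) auto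
    also have "\<dots> = ennreal (real k * e ^ (k - 1) * symbol_bound k al N e * c1) * smooth_pairing p \<kappa> f Y e
        + ennreal (real k * e ^ (k - 1) * symbol_bound k al N e * (8 * (error_const L + 2) * (54 / e) powr sg))"
      unfolding w_def distrib_left mult.assoc[symmetric] ennreal_mult'[OF w0, symmetric] by (simp only: mult_ac)
    also have "\<dots> = ennreal (c0 * e powr (al - 1) * c1) * smooth_pairing p \<kappa> f Y e + ennreal (c0 * (c2 * e powr ((al - sg) - 1)))"
    proof -
      have "e powr (al - 1) * (54 / e) powr sg = 54 powr sg * e powr ((al - sg) - 1)"
      proof -
        have "e powr (al - 1) = e powr ((al - sg) - 1) * e powr sg" by (simp add: powr_add[symmetric])
        then show ?thesis using e by (simp add: powr_divide)
      qed
      then have "c0 * e powr (al - 1) * (8 * (error_const L + 2) * (54 / e) powr sg) = c0 * (c2 * e powr ((al - sg) - 1))"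
        unfolding c2_def by (simp only: mult_ac)
      then show ?thesis by (simp only: wA)
    qed
    also have "\<dots> = ennreal c0 * (ennreal c1 * (ennreal (e powr (al - 1)) * smooth_pairing p \<kappa> f Y e)
      + ennreal c2 * ennreal (e powr ((al - sg) - 1)))"
    proof -
      have 1: "ennreal (c0 * e powr (al - 1) * c1) = ennreal c0 * (ennreal c1 * ennreal (e powr (al - 1)))"
        using c0 c12 by (subst mult.assoc, subst ennreal_mult, simp, simp, subst mult.commute, subst ennreal_mult) auto
      have 2: "ennreal (c0 * (c2 * e powr ((al - sg) - 1))) = ennreal c0 * (ennreal c2 * ennreal (e powr ((al - sg) - 1)))"
        using c0 c12 by (subst ennreal_mult, simp, simp, subst ennreal_mult) auto
      show ?thesis unfolding 1 2 by (simp only: distrib_left mult.assoc)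
    qed
    finally show "w e * (\<integral>\<^sup>+\<phi>. y \<phi> * F e \<phi> \<partial>circ) \<le> \<dots>" .
  qed
  also have "\<dots> = ennreal c0 * (ennreal c1 * (\<integral>\<^sup>+e. ennreal (e powr (al - 1)) * smooth_pairing p \<kappa> f Y e \<partial>unit_measure)
      + ennreal c2 * (\<integral>\<^sup>+e. ennreal (e powr ((al - sg) - 1)) \<partial>unit_measure))"
    by (subst nn_integral_cmult, measurable, subst nn_integral_add, measurable, subst nn_integral_cmult, measurable, subst nn_integral_cmult, measurable)
  also have "\<dots> \<le> ennreal c0 * (ennreal c1 * ennreal (pairing_const p q \<kappa>) + ennreal c2 * ennreal (1 / (al - sg)))"
    using sg unfolding smooth_pairing_def
    by (intro mult_left_mono add_mono smooth_part_pairing[OF f q al \<kappa> Y Y0 Y1] unit_powr_integral) auto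
  also have "\<dots> = ennreal (c0 * (c1 * pairing_const p q \<kappa> + c2 * (1 / (al - sg))))"
  proof -
    have "ennreal c0 * (ennreal c1 * ennreal (pairing_const p q \<kappa>) + ennreal c2 * ennreal d)
       = ennreal (c0 * (c1 * pairing_const p q \<kappa> + c2 * d))" if "0 \<le> d" for d
      using c0 c12 pc0 that by (simp add: ennreal_mult ennreal_plus)
    then show ?thesis using sg by simp
  qed
  also have "c0 * (c1 * pairing_const p q \<kappa> + c2 * (1 / (al - sg))) = N * threshold_const p q k al \<kappa> L"
    by (simp add: c0_def c1_def c2_def sg_def threshold_const_def mult.assoc)
  finally show ?thesis .
qed

lemma threshold_const_pos:
  assumes q: "0 < q" "q < p" "1 < p" and al: "al = 1 / q - 1 / p" and \<kappa>: "0 < \<kappa>" "\<kappa> < al" "\<kappa> < 1 - 1 / p"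
    and L: "1 \<le> L" and k: "1 \<le> k"
  shows "0 < threshold_const p q k al \<kappa> L"
  unfolding threshold_const_def
  using error_const_nonneg[OF L] smooth_const_nonneg[OF \<kappa>(1) L] pairing_const_nonneg[OF q al \<kappa>] loss_exponent_less[OF q al] k
  by (intro mult_pos_pos add_nonneg_pos mult_nonneg_nonneg divide_pos_pos) auto

lemma threshold_hardy_norm_unit:
  fixes \<beta> \<gamma> :: real
  assumes g: "growth k al N b" and N: "0 < N" and alk: "al < real k" and k1: "1 \<le> k"
    and L: "1 \<le> L" "\<bar>1 + \<beta>\<bar> \<le> L" "1 \<le> L * \<bar>1 + \<beta>\<bar>"
    and L': "p \<le> 2 \<Longrightarrow> \<beta> \<noteq> 0 \<Longrightarrow> \<bar>1 + 1 / \<beta>\<bar> \<le> L \<and> 1 \<le> L * \<bar>1 + 1 / \<beta>\<bar>"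
    and f: "boundary_mean q f \<le> 1"
    and q: "0 < q" "q < p" "1 < p" and al: "al = 1 / q - 1 / p" and \<kappa>: "0 < \<kappa>" "\<kappa> < al" "\<kappa> < 1 - 1 / p"
  shows "hardy_norm p (matrix_operator (region_matrix (\<lambda>m n. \<beta> * real n + \<gamma> \<le> real m) b) f) \<le> ennreal (N * threshold_const p q k al \<kappa> L)"
proof -
  define F where "F = matrix_operator (region_matrix (\<lambda>m n. \<beta> * real n + \<gamma> \<le> real m) b) f"
  define K where "K = N * threshold_const p q k al \<kappa> L"
  have K0: "0 \<le> K" using threshold_const_pos[OF q al \<kappa> L(1) k1] N by (simp add: K_def)
  have F: "F holomorphic_on ball 0 1" unfolding F_def by (rule matrix_operator_holomorphic[OF g binomial_coeff_norm_ge])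
  have pos: "(\<integral>\<^sup>+t. ennreal (norm (F (of_real R * cis t)) powr p) \<partial>circ) \<le> ennreal (K powr p)" if R: "0 < R" "R < 1" for R
  proof -
    have cont: "continuous_on UNIV (\<lambda>t. F (of_real R * cis t))"
      by (rule continuous_on_compose2[OF holomorphic_on_imp_continuous_on[OF F]])
         (use R in \<open>auto intro!: continuous_intros simp: norm_mult\<close>)
    have "compact (F ` sphere 0 R)"
      by (intro compact_continuous_image continuous_on_subset[OF holomorphic_on_imp_continuous_on[OF F]]) (use R in auto)
    then obtain M where M: "\<forall>w\<in>F ` sphere 0 R. norm w \<le> M" using compact_imp_bounded bounded_iff by metis
    show ?thesis
    proof (rule pairing_to_norm[where M = M])
      show "(\<lambda>t. norm (F (of_real R * cis t))) \<in> borel_measurable borel"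
        by (intro borel_measurable_continuous_onI continuous_on_norm cont)
      show "norm (F (of_real R * cis t)) \<le> M" for t using M R by (simp add: norm_mult)
      show "(\<integral>\<^sup>+t. ennreal (Y t powr (1 - 1 / p)) * ennreal (norm (F (of_real R * cis t))) \<partial>circ) \<le> ennreal K"
        if Y: "Y \<in> borel_measurable borel" "\<And>t. 0 \<le> Y t" "(\<integral>\<^sup>+t. ennreal (Y t) \<partial>circ) \<le> 1" for Y
        unfolding F_def K_def by (rule threshold_pairing[OF g N alk k1 R L L' f q al \<kappa> Y])
    qed (use q K0 in auto)
  qed
  \<comment> \<open>The pairing estimates require \<open>R > 0\<close>, since real powers of the
    radius are taken. At the centre the Poisson kernel is constantly 1, so the power there is
    bounded by the mean over the circle of radius 1/2.\<close>
  have zero: "(\<integral>\<^sup>+t. ennreal (norm (F (of_real 0 * cis t)) powr p) \<partial>circ) \<le> ennreal (K powr p)"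
  proof -
    have cont: "continuous_on UNIV (\<lambda>t. norm (F (of_real (1 / 2) * cis t)) powr p)"
      by (rule holomorphic_circle_continuous[OF F]) (use q in auto)
    have "ennreal (norm (F (of_real (1 / 2 * 0) * cis 0)) powr p)
      \<le> (\<integral>\<^sup>+a. ennreal (norm (F (of_real (1 / 2) * cis (0 - a))) powr p * poisson 0 a) \<partial>circ)"
      by (rule holomorphic_powr_le_poisson[OF F]) (use q in auto)
    also have "\<dots> = (\<integral>\<^sup>+a. ennreal (norm (F (of_real (1 / 2) * cis (- a))) powr p) \<partial>circ)" by (simp add: poisson_def)
    also have "\<dots> = (\<integral>\<^sup>+a. ennreal (norm (F (of_real (1 / 2) * cis a)) powr p) \<partial>circ)"
      by (rule nn_integral_circ_reflect) (use borel_measurable_continuous_onI[OF cont] in measurable)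
    also have "\<dots> \<le> ennreal (K powr p)" by (rule pos) auto
    finally show ?thesis by (simp add: emeasure_circ)
  qed
  show ?thesis
    unfolding F_def[symmetric] K_def[symmetric]
  proof (rule hardy_norm_leI[OF F _ K0])
    fix R :: real assume "0 \<le> R" "R < 1"
    then show "(\<integral>\<^sup>+t. ennreal (norm (F (of_real R * cis t)) powr p) \<partial>circ) \<le> ennreal (K powr p)"
      using pos[of R] zero by (cases "R = 0") auto
  qed (use q in simp)
qed

section \<open>Homogeneity: from the unit ball to all polynomials\<close>

lemma matrix_operator_smult:
  assumes "summable (\<lambda>m. (\<Sum>n\<le>degree f. coeff f n * M m n) * z ^ m)"
  shows "matrix_operator M (smult c f) z = c * matrix_operator M f z"
proof (cases "c = 0")
  case False
  then have "matrix_operator M (smult c f) z = (\<Sum>m. c * ((\<Sum>n\<le>degree f. coeff f n * M m n) * z ^ m))"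
    by (simp add: matrix_operator_def sum_distrib_left sum_distrib_right mult.assoc)
  then show ?thesis unfolding suminf_mult[OF assms] by (simp add: matrix_operator_def)
qed (simp add: matrix_operator_def)

lemma hardy_norm_cong:
  assumes "\<And>z. norm z < 1 \<Longrightarrow> F z = G z"
  shows "hardy_norm p F = hardy_norm p G"
proof -
  have "F (of_real r * cis t) = G (of_real r * cis t)" if "r \<in> {0..<1}" for r t
    using that by (intro assms) (simp add: norm_mult)
  then show ?thesis unfolding hardy_norm_def by (intro SUP_cong refl) simp
qed

lemma hardy_norm_mult:
  assumes F: "F holomorphic_on ball 0 1" and p: "0 < p"
  shows "hardy_norm p (\<lambda>z. c * F z) = ennreal (norm c) * hardy_norm p F"
proof -
  define I where "I r = 1 / (2 * pi) * integral {0..2 * pi} (\<lambda>t. norm (F (of_real r * cis t)) powr p)" for r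
  have I0: "0 \<le> I r" if "r \<in> {0..<1}" for r
    unfolding I_def using that by (intro mult_nonneg_nonneg integral_nonneg integrable_continuous_interval
      continuous_on_subset[OF holomorphic_circle_continuous[OF F _ _ p]]) auto
  have "(1 / (2 * pi) * integral {0..2 * pi} (\<lambda>t. norm (c * F (of_real r * cis t)) powr p)) powr (1 / p) = norm c * I r powr (1 / p)"
    if r: "r \<in> {0..<1}" for r
  proof -
    have "1 / (2 * pi) * integral {0..2 * pi} (\<lambda>t. norm (c * F (of_real r * cis t)) powr p) = norm c powr p * I r"
      by (simp add: norm_mult powr_mult I_def)
    then show ?thesis using p I0[OF r] by (simp add: powr_mult powr_powr)
  qed
  then have "hardy_norm p (\<lambda>z. c * F z) = (SUP r\<in>{0..<1}. ennreal (norm c) * ennreal (I r powr (1 / p)))"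
    unfolding hardy_norm_def by (intro SUP_cong refl) (simp add: ennreal_mult')
  also have "\<dots> = ennreal (norm c) * hardy_norm p F"
    unfolding hardy_norm_def I_def by (rule SUP_mult_left_ennreal[symmetric])
  finally show ?thesis .
qed

text \<open>Fatou's lemma along radii tending to 1, where a polynomial converges pointwise to its
  boundary values.\<close>

lemma poly_boundary_mean_le:
  assumes q: "0 < q" and le: "hardy_norm q (poly f) \<le> ennreal H" and H: "0 \<le> H"
  shows "boundary_mean q f \<le> ennreal (H powr q)"
proof -
  have holo: "poly f holomorphic_on ball 0 1" by (intro holomorphic_intros)
  define R where "R l = 1 - 1 / real (Suc l)" for l
  have R: "0 \<le> R l" "R l < 1" for l by (auto simp: R_def)
  have "R \<longlonglongrightarrow> 1 - 0" unfolding R_def by (intro tendsto_diff tendsto_const LIMSEQ_Suc[OF lim_1_over_n])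
  then have "R \<longlonglongrightarrow> 1" by simp
  then have "(\<lambda>l. of_real (R l) * cis t) \<longlonglongrightarrow> of_real 1 * cis t" for t by (intro tendsto_intros)
  then have "(\<lambda>l. poly f (of_real (R l) * cis t)) \<longlonglongrightarrow> poly f (cis t)" for t
    by (intro isCont_tendsto_compose[of "cis t" "poly f"]) auto
  then have lim: "(\<lambda>l. ennreal (norm (poly f (of_real (R l) * cis t)) powr q)) \<longlonglongrightarrow> ennreal (norm (poly f (cis t)) powr q)" for t
    using q by (intro tendsto_ennrealI tendsto_powr' tendsto_norm tendsto_const) auto
  have "boundary_mean q f
      = (\<integral>\<^sup>+t. liminf (\<lambda>l. ennreal (norm (poly f (of_real (R l) * cis t)) powr q)) \<partial>circ)"
    using lim_imp_Liminf[OF trivial_limit_sequentially lim] by simp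
  also have "\<dots> \<le> liminf (\<lambda>l. \<integral>\<^sup>+t. ennreal (norm (poly f (of_real (R l) * cis t)) powr q) \<partial>circ)"
    by (rule nn_integral_liminf) measurable
  also have "\<dots> \<le> liminf (\<lambda>l. ennreal (H powr q))"
    by (intro Liminf_mono always_eventually allI hardy_mean_le_norm holo R q le H)
  also have "\<dots> = ennreal (H powr q)" by (simp add: Liminf_const)
  finally show ?thesis .
qed

lemma poly_eq_0_if_mean_0:
  assumes "boundary_mean q f = 0"
  shows "f = 0"
proof (rule poly_eqI)
  fix n
  have "AE t in circ. ennreal (norm (poly f (cis t)) powr q) = 0"
    using assms by (subst (asm) nn_integral_0_iff_AE) auto
  then have ae: "AE t in circ. poly f (of_real 1 * cis t) * cis (- real n * t) = 0"
    by (rule eventually_mono) simp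
  have "coeff f n * of_real (1 ^ n) = (LINT t|circ. poly f (of_real 1 * cis t) * cis (- real n * t))"
    by (rule poly_fourier[symmetric])
  also have "\<dots> = (LINT t|circ. 0)" by (rule integral_cong_AE) (use ae in measurable)
  finally show "coeff f n = coeff 0 n" by simp
qed

text \<open>Normalisation by the value \<open>H\<close> of the Hardy norm. The degenerate values are
  treated separately: infinity is trivial because \<open>K > 0\<close>, and for \<open>H = 0\<close>
  the boundary mean vanishes, which forces \<open>f = 0\<close>.\<close>

lemma homogeneous_bound:
  assumes q: "0 < q" and p: "0 < p" and K: "0 < K"
    and holo: "\<And>f. matrix_operator M f holomorphic_on ball 0 1"
    and summ: "\<And>f z. norm z < 1 \<Longrightarrow> summable (\<lambda>m. (\<Sum>n\<le>degree f. coeff f n * M m n) * z ^ m)"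
    and unit: "\<And>f. boundary_mean q f \<le> 1 \<Longrightarrow> hardy_norm p (matrix_operator M f) \<le> ennreal K"
  shows "hardy_norm p (matrix_operator M f) \<le> ennreal K * hardy_norm q (poly f)"
proof (cases "hardy_norm q (poly f)")
  case top
  then show ?thesis using K by (simp add: ennreal_mult_top)
next
  case (real H)
  define X where "X = boundary_mean q f"
  have X: "X \<le> ennreal (H powr q)" unfolding X_def by (rule poly_boundary_mean_le[OF q]) (use real in auto)
  show ?thesis
  proof (cases "H = 0")
    case True
    then have "X = 0" using X q by simp
    then have "f = 0" unfolding X_def by (rule poly_eq_0_if_mean_0)
    then have "matrix_operator M f = (\<lambda>z. 0 * matrix_operator M 0 z)" by (auto simp: matrix_operator_def)
    then have "hardy_norm p (matrix_operator M f) = 0" using hardy_norm_mult[OF holo p, of 0 0] by simp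
    then show ?thesis by simp
  next
    case False
    then have H: "0 < H" using real by simp
    define f' where "f' = smult (of_real (1 / H)) f"
    have "(\<integral>\<^sup>+t. ennreal (norm (poly f' (cis t)) powr q) \<partial>circ) = (\<integral>\<^sup>+t. ennreal (H powr - q) * ennreal (norm (poly f (cis t)) powr q) \<partial>circ)"
    proof (rule nn_integral_cong)
      fix t
      have "norm (poly f' (cis t)) powr q = (norm (poly f (cis t)) / H) powr q"
        unfolding f'_def using H by (simp add: norm_mult norm_divide)
      also have "\<dots> = H powr - q * norm (poly f (cis t)) powr q"
        using H by (simp add: powr_divide powr_minus_divide)
      finally show "ennreal (norm (poly f' (cis t)) powr q) = ennreal (H powr - q) * ennreal (norm (poly f (cis t)) powr q)"
        by (simp add: ennreal_mult')
    qed
    also have "\<dots> = ennreal (H powr - q) * X" unfolding X_def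
      by (rule nn_integral_cmult) (use poly_circle_measurable(2)[of f] in measurable)
    also have "\<dots> \<le> ennreal (H powr - q) * ennreal (H powr q)" by (intro mult_left_mono X) simp
    also have "\<dots> = 1" using H by (simp add: ennreal_mult'[symmetric] powr_add[symmetric])
    finally have "hardy_norm p (matrix_operator M f') \<le> ennreal K" by (rule unit)
    moreover have "hardy_norm p (matrix_operator M f) = hardy_norm p (\<lambda>z. of_real H * matrix_operator M f' z)"
      unfolding f'_def using H by (intro hardy_norm_cong) (simp add: matrix_operator_smult[OF summ])
    then have "hardy_norm p (matrix_operator M f) = ennreal H * hardy_norm p (matrix_operator M f')"
      using hardy_norm_mult[OF holo p, of "of_real H" f'] H by simp
    ultimately have "hardy_norm p (matrix_operator M f) \<le> ennreal H * ennreal K" by (simp add: mult_left_mono)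
    then show ?thesis using real by (simp add: mult.commute)
  qed
qed

subsection \<open>Growth of the symbol from the operator norm\<close>

lemma neg_binomial_sums:
  fixes x :: complex
  assumes "norm x < 1"
  shows "(\<lambda>n. of_nat ((n + j) choose j) * x ^ n) sums (1 / (1 - x) ^ Suc j)"
proof -
  have x1: "1 - x \<noteq> 0" using assms by auto
  have "(\<lambda>n. (- of_nat (Suc j) gchoose n) * (- x) ^ n) sums (1 + - x) powr (- of_nat (Suc j))"
    by (rule gen_binomial_complex) (use assms in simp)
  moreover have "(1 + - x) powr (- of_nat (Suc j)) = 1 / (1 - x) ^ Suc j"
    using x1 by (simp add: powr_minus powr_nat' divide_inverse del: of_nat_Suc power_Suc)
  moreover have "(- of_nat (Suc j) gchoose n) * (- x) ^ n = of_nat ((n + j) choose j) * x ^ n" for n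
  proof -
    have "(- of_nat (Suc j) gchoose n) = (-1) ^ n * ((of_nat (n + j) :: complex) gchoose n)"
      unfolding gbinomial_minus by (simp add: add_ac)
    also have "(of_nat (n + j) :: complex) gchoose n = of_nat ((n + j) choose n)" by (simp only: binomial_gbinomial)
    also have "(n + j) choose n = (n + j) choose j" using binomial_symmetric[of n "n + j"] by simp
    finally show ?thesis by (simp add: power_mult_distrib[symmetric] mult_ac)
  qed
  ultimately show ?thesis by simp
qed

lemma neg_binomial_summable:
  fixes x :: complex
  assumes "norm x < 1"
  shows "summable (\<lambda>n. norm (of_nat ((n + j) choose j) * x ^ n))"
proof (rule powser_insidea)
  let ?R = "of_real ((1 + norm x) / 2) :: complex"
  have n: "norm ?R = (1 + norm x) / 2" by (simp only: norm_of_real) simp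
  show "summable (\<lambda>n. of_nat ((n + j) choose j) * ?R ^ n)"
    by (rule sums_summable, rule neg_binomial_sums) (use assms n in simp)
  show "norm x < norm ?R" unfolding n using assms by simp
qed

text \<open>The Poisson bound is used on the circle halfway between \<open>|w|\<close> and 1;
  relative to it, \<open>w\<close> lies at depth at least \<open>(1 - |w|) / 2\<close>, which turns
  the constant 18 of the kernel into 36.\<close>

lemma point_evaluation:
  assumes G: "G holomorphic_on ball 0 1" and p: "1 \<le> p" and H: "hardy_norm p G \<le> ennreal H" "0 \<le> H" and w: "norm w < 1"
  shows "norm (G w) \<le> H * (36 / (1 - norm w)) powr (1 / p)"
proof -
  define r where "r = norm w"
  define \<theta> where "\<theta> = Arg w"
  have weq: "w = of_real r * cis \<theta>" unfolding r_def \<theta>_def using rcis_cmod_Arg[of w] by (simp add: rcis_def)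
  define R where "R = (1 + r) / 2"
  have R: "0 \<le> R" "R < 1" "r < R" "0 \<le> r" using w by (auto simp: R_def r_def)
  define r' where "r' = r / R"
  have r': "0 \<le> r'" "r' < 1" "R * r' = r" using R by (auto simp: r'_def)
  define h where "h t = ennreal (norm (G (of_real R * cis t)) powr p)" for t
  have [measurable]: "h \<in> borel_measurable borel"
    unfolding h_def using borel_measurable_continuous_onI[OF holomorphic_circle_continuous[OF G R(1,2), of p]] p by simp
  have hper: "h (t + 2 * pi) = h t" for t by (simp add: h_def)
  have inv: "18 / (1 - r') \<le> 36 / (1 - r)"
  proof -
    have "1 - r' = (R - r) / R" using R by (simp add: r'_def field_simps)
    moreover have "(R - r) / 1 \<le> (R - r) / R" using R by (intro divide_left_mono) auto
    moreover have "R - r = (1 - r) / 2" by (simp add: R_def field_simps)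
    ultimately have le: "(1 - r) / 2 \<le> 1 - r'" by simp
    then have "18 / (1 - r') \<le> 18 / ((1 - r) / 2)" using R by (intro divide_left_mono) auto
    then show ?thesis by simp
  qed
  have r1: "0 < 1 - r" using R by simp
  have "ennreal (norm (G w) powr p) = ennreal (norm (G (of_real (R * r') * cis \<theta>)) powr p)" by (simp only: weq r')
  also have "\<dots> \<le> (\<integral>\<^sup>+a. ennreal (norm (G (of_real R * cis (\<theta> - a))) powr p * poisson r' a) \<partial>circ)"
    by (rule holomorphic_powr_le_poisson[OF G R(1,2) r'(1,2) p])
  also have "\<dots> \<le> (\<integral>\<^sup>+a. ennreal (36 / (1 - r)) * h (\<theta> + - a) \<partial>circ)"
  proof (rule nn_integral_mono)
    fix a
    have "poisson r' a \<le> 36 / (1 - r)" using poisson_le_inverse[OF r'(1,2), of a] inv by linarith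
    then have "norm (G (of_real R * cis (\<theta> - a))) powr p * poisson r' a \<le> 36 / (1 - r) * norm (G (of_real R * cis (\<theta> + - a))) powr p"
      unfolding add_uminus_conv_diff by (subst mult.commute) (rule mult_right_mono, auto)
    then show "ennreal (norm (G (of_real R * cis (\<theta> - a))) powr p * poisson r' a) \<le> ennreal (36 / (1 - r)) * h (\<theta> + - a)"
      unfolding h_def using r1 by (subst ennreal_mult'[symmetric]) (auto intro!: ennreal_leI)
  qed
  also have "\<dots> = ennreal (36 / (1 - r)) * (\<integral>\<^sup>+a. h (\<theta> + - a) \<partial>circ)" by (subst nn_integral_cmult, measurable)
  also have "(\<integral>\<^sup>+a. h (\<theta> + - a) \<partial>circ) = (\<integral>\<^sup>+a. h (\<theta> + a) \<partial>circ)"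
    by (rule nn_integral_circ_reflect[of "\<lambda>a. h (\<theta> + a)"]) measurable
  also have "\<dots> = (\<integral>\<^sup>+a. h a \<partial>circ)" by (rule nn_integral_circ_shift) (auto simp: hper)
  also have "\<dots> \<le> ennreal (H powr p)" unfolding h_def using p by (intro hardy_mean_le_norm[OF G R(1,2) _ H]) simp
  finally have "ennreal (norm (G w) powr p) \<le> ennreal (36 / (1 - r) * H powr p)"
    using r1 by (simp add: ennreal_mult'[symmetric] mult_left_mono)
  then have "norm (G w) powr p \<le> 36 / (1 - r) * H powr p" using r1 by (subst (asm) ennreal_le_iff) auto
  then have "(norm (G w) powr p) powr (1 / p) \<le> (36 / (1 - r) * H powr p) powr (1 / p)" using p by (intro powr_mono2) auto
  also have "\<dots> = (36 / (1 - r)) powr (1 / p) * (H powr p) powr (1 / p)" by (rule powr_mult)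
  finally show ?thesis using p H by (simp add: powr_powr r_def mult.commute)
qed

text \<open>The denominator is comparable with \<open>1 - |w|\<close> plus a chord, so
  \<open>chord_integral_base\<close> applies; \<open>6 powr s\<close> is the product of
  \<open>3 powr s\<close> from this comparison and \<open>2 powr s\<close> from the
  integral.\<close>

lemma cauchy_kernel_mean:
  assumes w: "norm w < 1" and R: "0 \<le> R" "R < 1" and s: "1 < s"
  shows "(\<integral>\<^sup>+t. ennreal (norm (1 - w * (of_real R * cis t)) powr - s) \<partial>circ)
    \<le> ennreal (6 powr s / (s - 1) * (1 - norm w) powr (1 - s))"
proof -
  define r where "r = norm w"
  define \<theta> where "\<theta> = Arg w"
  have weq: "w = of_real r * cis \<theta>" unfolding r_def \<theta>_def using rcis_cmod_Arg[of w] by (simp add: rcis_def)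
  define \<rho> where "\<rho> = r * R"
  have r: "0 \<le> r" "r < 1" using w by (auto simp: r_def)
  have "\<rho> \<le> r * 1" unfolding \<rho>_def using r R by (intro mult_left_mono) auto
  then have \<rho>: "0 \<le> \<rho>" "\<rho> \<le> r" using r R by (auto simp: \<rho>_def)
  have "(\<integral>\<^sup>+t. ennreal (norm (1 - w * (of_real R * cis t)) powr - s) \<partial>circ)
    \<le> (\<integral>\<^sup>+t. ennreal (3 powr s) * ennreal (((1 - r) + chord (\<theta> + t)) powr (- 1 - (s - 1))) \<partial>circ)"
  proof (rule nn_integral_mono)
    fix t
    define D where "D = (1 - r) + chord (\<theta> + t)"
    have D: "0 < D" using r chord_nonneg[of "\<theta> + t"] unfolding D_def by linarith
    have eq: "w * (of_real R * cis t) = of_real \<rho> * cis (\<theta> + t)" by (simp add: weq \<rho>_def cis_mult[symmetric])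
    have "D \<le> (1 - \<rho>) + chord (\<theta> + t)" using \<rho> by (simp add: D_def)
    also have "\<dots> \<le> 3 * norm (1 - w * (of_real R * cis t))"
      unfolding eq using \<rho> r by (intro one_minus_cis_ge) auto
    finally have le: "D / 3 \<le> norm (1 - w * (of_real R * cis t))" by simp
    have "norm (1 - w * (of_real R * cis t)) powr - s \<le> (D / 3) powr - s"
      using D le s by (intro powr_mono2') auto
    also have "\<dots> = 3 powr s * D powr (- 1 - (s - 1))" using D by (simp add: powr_divide powr_minus field_simps)
    finally show "ennreal (norm (1 - w * (of_real R * cis t)) powr - s)
      \<le> ennreal (3 powr s) * ennreal (((1 - r) + chord (\<theta> + t)) powr (- 1 - (s - 1)))"
      unfolding D_def by (subst ennreal_mult'[symmetric]) (auto intro: ennreal_leI)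
  qed
  also have "\<dots> = ennreal (3 powr s) * (\<integral>\<^sup>+t. ennreal (((1 - r) + chord (\<theta> + t)) powr (- 1 - (s - 1))) \<partial>circ)"
    by (subst nn_integral_cmult, measurable)
  also have "(\<integral>\<^sup>+t. ennreal (((1 - r) + chord (\<theta> + t)) powr (- 1 - (s - 1))) \<partial>circ)
     = (\<integral>\<^sup>+t. ennreal (((1 - r) + chord t) powr (- 1 - (s - 1))) \<partial>circ)"
    by (rule nn_integral_circ_shift[where h = "\<lambda>t. ennreal (((1 - r) + chord t) powr (- 1 - (s - 1)))"]) auto
  also have "\<dots> \<le> ennreal (2 powr (1 + (s - 1)) / (s - 1) * (1 - r) powr - (s - 1))"
    using r s by (intro chord_integral_base) auto
  also have "ennreal (3 powr s) * \<dots> = ennreal (6 powr s / (s - 1) * (1 - norm w) powr (1 - s))"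
  proof -
    have "3 powr s * 2 powr (1 + (s - 1)) = (6 powr s :: real)" using powr_mult[of 3 2 s] by simp
    then have "3 powr s * (2 powr (1 + (s - 1)) / (s - 1) * (1 - r) powr - (s - 1)) = 6 powr s / (s - 1) * (1 - r) powr (1 - s)"
      by (simp only: times_divide_eq_left times_divide_eq_right mult.assoc[symmetric] minus_diff_eq)
    then show ?thesis by (simp only: ennreal_mult'[OF powr_ge_zero, symmetric] r_def)
  qed
  finally show ?thesis by (simp add: mult_left_mono)
qed

text \<open>Partial sums of \<open>(1 - w z)^(-(j+1))\<close>.\<close>

definition test_poly :: "nat \<Rightarrow> complex \<Rightarrow> nat \<Rightarrow> complex poly" where
  "test_poly j w J = (\<Sum>n\<le>J. monom (of_nat ((n + j) choose j) * w ^ n) n)"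

lemma coeff_test_poly: "coeff (test_poly j w J) n = (if n \<le> J then of_nat ((n + j) choose j) * w ^ n else 0)"
  by (simp add: test_poly_def coeff_sum)

lemma poly_test_poly: "poly (test_poly j w J) z = (\<Sum>n\<le>J. of_nat ((n + j) choose j) * (w * z) ^ n)"
  by (simp add: test_poly_def poly_sum poly_monom power_mult_distrib mult.assoc)

text \<open>On the closed disc the partial sums converge uniformly, so eventually they exceed the
  kernel by less than 1. As \<open>|1 - w * z| \<le> 2\<close>, that 1 is itself at most
  \<open>2 ^ Suc j\<close> times the kernel.\<close>

lemma test_poly_le:
  assumes w: "norm w < 1"
  shows "\<forall>\<^sub>F J in sequentially. \<forall>z. norm z \<le> 1 \<longrightarrow> norm (poly (test_poly j w J) z) \<le> (1 + 2 ^ Suc j) * (1 / norm (1 - w * z) ^ Suc j)"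
proof -
  have wz: "norm (w * z) < 1" if "norm z \<le> 1" for z
  proof -
    have "norm w * norm z \<le> norm w" using that by (simp add: mult_left_le)
    then show ?thesis using w by (simp add: norm_mult)
  qed
  have "uniform_limit (cball 0 1) (\<lambda>J z. \<Sum>n<J. of_nat ((n + j) choose j) * (w * z) ^ n)
      (\<lambda>z. \<Sum>n. of_nat ((n + j) choose j) * (w * z) ^ n) sequentially"
  proof (rule Weierstrass_m_test)
    fix n and z :: complex assume "z \<in> cball 0 1"
    then have "norm (w * z) ^ n \<le> norm w ^ n" by (intro power_mono) (auto simp: norm_mult mult_left_le)
    then show "norm (of_nat ((n + j) choose j) * (w * z) ^ n) \<le> norm (of_nat ((n + j) choose j) * w ^ n)"
      unfolding norm_mult[of "of_nat _"] norm_power by (rule mult_left_mono) simp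
  qed (rule neg_binomial_summable[OF w])
  then have "\<forall>\<^sub>F J in sequentially. \<forall>z\<in>cball 0 1. dist (\<Sum>n<J. of_nat ((n + j) choose j) * (w * z) ^ n)
      (\<Sum>n. of_nat ((n + j) choose j) * (w * z) ^ n) < 1"
    by (rule uniform_limitD) simp
  then have "\<forall>\<^sub>F J in sequentially. \<forall>z\<in>cball 0 1. dist (\<Sum>n<Suc J. of_nat ((n + j) choose j) * (w * z) ^ n)
      (\<Sum>n. of_nat ((n + j) choose j) * (w * z) ^ n) < 1"
    by (rule eventually_compose_filterlim[OF _ filterlim_Suc])
  then show ?thesis
  proof (rule eventually_mono, intro allI impI)
    fix J and z :: complex
    assume *: "\<forall>z\<in>cball 0 1. dist (\<Sum>n<Suc J. of_nat ((n + j) choose j) * (w * z) ^ n)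
      (\<Sum>n. of_nat ((n + j) choose j) * (w * z) ^ n) < 1" and z: "norm z \<le> 1"
    have "(\<Sum>n. of_nat ((n + j) choose j) * (w * z) ^ n) = 1 / (1 - w * z) ^ Suc j"
      using neg_binomial_sums[OF wz[OF z], of j] by (simp add: sums_iff)
    then have "dist (poly (test_poly j w J) z) (1 / (1 - w * z) ^ Suc j) < 1"
      using *[rule_format, of z] z unfolding poly_test_poly lessThan_Suc_atMost by simp
    then have "norm (poly (test_poly j w J) z) \<le> norm (1 / (1 - w * z) ^ Suc j) + 1"
      unfolding dist_norm using norm_triangle_ineq2[of "poly (test_poly j w J) z" "1 / (1 - w * z) ^ Suc j"] by linarith
    moreover have "norm (1 / (1 - w * z) ^ Suc j) = 1 / norm (1 - w * z) ^ Suc j" by (simp only: norm_divide norm_power norm_one)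
    moreover have "1 \<le> 2 ^ Suc j * (1 / norm (1 - w * z) ^ Suc j)"
    proof -
      have "norm (1 - w * z) \<le> 2" using norm_triangle_ineq4[of 1 "w * z"] wz[OF z] by simp
      then have "norm (1 - w * z) ^ Suc j \<le> 2 ^ Suc j" by (rule power_mono) simp
      moreover have "0 < norm (1 - w * z)" using wz[OF z] by auto
      ultimately show ?thesis by (simp del: power_Suc)
    qed
    ultimately show "norm (poly (test_poly j w J) z) \<le> (1 + 2 ^ Suc j) * (1 / norm (1 - w * z) ^ Suc j)"
      unfolding distrib_right by linarith
  qed
qed

text \<open>The hockey-stick identity: on the antidiagonal \<open>m + n = M\<close> the binomials of
  the test function sum to \<open>(M + Suc j) choose Suc j\<close>. Evaluating the output at the
  same \<open>w\<close> collects \<open>w ^ m * w ^ n = w ^ M\<close>.\<close>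

lemma hankel_test_poly_limit:
  assumes g: "growth (Suc j) al N c" and w: "norm w < 1"
  shows "(\<lambda>J. matrix_operator (region_matrix (\<lambda>m n. True) c) (test_poly j w J) w) \<longlonglongrightarrow> pseries (binomial_coeff (Suc j) c) w"
proof -
  define d where "d n = (of_nat ((n + j) choose j) :: complex)" for n
  have dsum: "(\<Sum>n\<le>M. (n + j) choose j) = (M + Suc j) choose Suc j" for M
    using choose_rising_sum(1)[of j M] by (simp add: add_ac)
  have cs: "summable (\<lambda>M. norm (c M * w ^ M))"
    by (rule summable_comparison_test'[of "\<lambda>M. norm (binomial_coeff (Suc j) c M * w ^ M)" 0])
       (use g w in \<open>auto simp: growth_def norm_mult intro!: mult_right_mono binomial_coeff_norm_ge\<close>)
  \<comment> \<open>The double sum regrouped by antidiagonals. Truncation of the test function at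
    \<open>J\<close> shortens the inner sum, which is complete as soon as \<open>M \<le> J\<close>;
    the full coefficient dominates it for every \<open>J\<close>, so Tannery's theorem
    applies.\<close>
  define e where "e J M = (\<Sum>n\<in>{..J} \<inter> {..M}. d n) * (c M * w ^ M)" for J M
  have op: "matrix_operator (region_matrix (\<lambda>m n. True) c) (test_poly j w J) w = (\<Sum>M. e J M)" for J
  proof -
    let ?f = "test_poly j w J"
    have row: "(\<Sum>n\<le>degree ?f. coeff ?f n * c (m + n)) = (\<Sum>n\<le>J. d n * w ^ n * c (m + n))" for m
    proof -
      have "(\<Sum>n\<le>degree ?f. coeff ?f n * c (m + n)) = (\<Sum>n\<le>max J (degree ?f). coeff ?f n * c (m + n))"
        by (rule sum.mono_neutral_left) (auto simp: coeff_eq_0)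
      also have "\<dots> = (\<Sum>n\<le>J. d n * w ^ n * c (m + n))"
        by (rule sum.mono_neutral_cong_right) (auto simp: coeff_test_poly d_def)
      finally show ?thesis .
    qed
    have one: "(\<lambda>m. d n * w ^ n * c (m + n) * w ^ m) sums (\<Sum>M. if n \<le> M then d n * (c M * w ^ M) else 0)" for n
    proof -
      define x where "x M = (if n \<le> M then d n * (c M * w ^ M) else 0)" for M
      have "summable (\<lambda>M. norm (x M))"
        by (rule summable_comparison_test'[OF summable_mult[OF cs, of "norm (d n)"], of 0]) (auto simp: x_def norm_mult)
      then have "x sums suminf x" by (rule summable_sums[OF summable_norm_cancel])
      then have "(\<lambda>m. x (m + n)) sums (suminf x - (\<Sum>i<n. x i))" by (rule sums_split_initial_segment)
      moreover have "(\<Sum>i<n. x i) = 0" by (intro sum.neutral) (auto simp: x_def)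
      ultimately have "(\<lambda>m. x (m + n)) sums suminf x" by simp
      moreover have "(\<lambda>m. x (m + n)) = (\<lambda>m. d n * w ^ n * c (m + n) * w ^ m)" by (simp add: x_def power_add mult_ac)
      ultimately show ?thesis by (simp only: x_def[abs_def])
    qed
    have "(\<lambda>m. \<Sum>n\<le>J. d n * w ^ n * c (m + n) * w ^ m) sums (\<Sum>n\<le>J. \<Sum>M. if n \<le> M then d n * (c M * w ^ M) else 0)"
      by (intro sums_sum one)
    then have "matrix_operator (region_matrix (\<lambda>m n. True) c) ?f w = (\<Sum>n\<le>J. \<Sum>M. if n \<le> M then d n * (c M * w ^ M) else 0)"
      unfolding matrix_operator_def region_matrix_def by (simp add: row sum_distrib_right sums_iff)
    also have "\<dots> = (\<Sum>M. \<Sum>n\<le>J. if n \<le> M then d n * (c M * w ^ M) else 0)"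
    proof (rule suminf_sum[symmetric])
      fix n
      show "summable (\<lambda>M. if n \<le> M then d n * (c M * w ^ M) else 0)"
        by (rule summable_norm_cancel, rule summable_comparison_test'[OF summable_mult[OF cs, of "norm (d n)"], of 0]) (auto simp: norm_mult)
    qed
    also have "\<dots> = (\<Sum>M. e J M)"
      unfolding e_def sum_distrib_right by (intro suminf_cong sum.mono_neutral_cong_right) auto
    finally show ?thesis .
  qed
  have e_le: "norm (e J M) \<le> norm (binomial_coeff (Suc j) c M * w ^ M)" for J M
  proof -
    have "norm (\<Sum>n\<in>{..J} \<inter> {..M}. d n) \<le> (\<Sum>n\<in>{..J} \<inter> {..M}. real ((n + j) choose j))"
      by (rule order_trans[OF norm_sum]) (simp add: d_def)
    also have "\<dots> \<le> (\<Sum>n\<le>M. real ((n + j) choose j))" by (rule sum_mono2) auto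
    also have "\<dots> = real ((M + Suc j) choose Suc j)" unfolding dsum[symmetric] by simp
    finally have "norm (\<Sum>n\<in>{..J} \<inter> {..M}. d n) * norm (c M * w ^ M) \<le> real ((M + Suc j) choose Suc j) * norm (c M * w ^ M)"
      by (rule mult_right_mono) simp
    then show ?thesis by (simp only: e_def binomial_coeff_def norm_mult norm_of_nat mult.assoc)
  qed
  have "(\<lambda>J. \<Sum>M. e J M) \<longlonglongrightarrow> (\<Sum>M. binomial_coeff (Suc j) c M * w ^ M)"
  proof (rule tannerys_theorem[where M = "\<lambda>M. norm (binomial_coeff (Suc j) c M * w ^ M)" and a = "\<lambda>M J. e J M", THEN conjunct2, THEN conjunct2])
    show "\<forall>\<^sub>F (M, J) in at_top \<times>\<^sub>F sequentially. norm (e J M) \<le> norm (binomial_coeff (Suc j) c M * w ^ M)"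
      by (rule always_eventually) (auto simp: e_le)
    show "summable (\<lambda>M. norm (binomial_coeff (Suc j) c M * w ^ M))" using g w by (simp add: growth_def)
    fix M
    have "e J M = binomial_coeff (Suc j) c M * w ^ M" if "M \<le> J" for J
    proof -
      have "{..J} \<inter> {..M} = {..M}" using that by auto
      moreover have "(\<Sum>n\<le>M. d n) = of_nat ((M + Suc j) choose Suc j)" unfolding d_def dsum[symmetric] by simp
      ultimately show ?thesis by (simp only: e_def binomial_coeff_def mult.assoc)
    qed
    then show "(\<lambda>J. e J M) \<longlonglongrightarrow> binomial_coeff (Suc j) c M * w ^ M"
      by (intro tendsto_eventually) (auto simp: eventually_sequentially)
  qed simp
  then show ?thesis by (simp only: op pseries_def)
qed

text \<open>The factors are the cost of truncating the test function, its mean of order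
  \<open>q\<close> without the power of \<open>1 - |w|\<close>, and the constant of
  \<open>point_evaluation\<close>.\<close>

definition opnorm_const :: "real \<Rightarrow> real \<Rightarrow> nat \<Rightarrow> real" where
  "opnorm_const p q j = (1 + 2 ^ Suc j) * (6 powr (real (Suc j) * q) / (real (Suc j) * q - 1)) powr (1 / q) * 36 powr (1 / p)"

text \<open>The test function has Hardy norm of order \<open>(1 - |w|)^(1/q - k)\<close> with
  \<open>k = Suc j\<close>, and point evaluation costs \<open>(1 - |w|)^(-1/p)\<close>; together
  this is the exponent \<open>al - k\<close>. The assumed growth supplies the convergence of the
  series, and the conclusion replaces its constant by a multiple of \<open>h\<close>.\<close>

lemma growth_from_operator_bound:
  assumes g: "growth (Suc j) al N c" and q: "0 < q" and p: "1 < p" and al: "al = 1 / q - 1 / p" and jq: "1 < real (Suc j) * q"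
    and h: "0 \<le> h" and op: "\<And>f K. 0 < K \<Longrightarrow> hardy_norm q (poly f) \<le> ennreal K \<Longrightarrow>
      hardy_norm p (matrix_operator (region_matrix (\<lambda>m n. True) c) f) \<le> ennreal (h * K)"
  shows "growth (Suc j) al (opnorm_const p q j * h) c"
  unfolding growth_def
proof (intro allI impI conjI)
  fix w :: complex assume w: "norm w < 1"
  then show "summable (\<lambda>M. norm (binomial_coeff (Suc j) c M * w ^ M))" using g by (simp add: growth_def)
  define r where "r = norm w"
  have r: "0 < 1 - r" using w by (simp add: r_def)
  define s where "s = real (Suc j) * q"
  have s: "1 < s" using jq by (simp add: s_def)
  define X where "X = 6 powr s / (s - 1) * (1 - r) powr (1 - s)"
  have X: "0 < X" using s r by (simp add: X_def)
  define K where "K = (1 + 2 ^ Suc j) * X powr (1 / q)"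
  have A: "(0::real) < 1 + 2 ^ Suc j" by (simp add: add_pos_pos del: power_Suc)
  have K: "0 < K" using X A by (simp add: K_def)
  let ?T = "\<lambda>J. matrix_operator (region_matrix (\<lambda>m n. True) c) (test_poly j w J)"
  have "norm (?T J w) \<le> h * K * (36 / (1 - r)) powr (1 / p)"
    if J: "\<forall>z. norm z \<le> 1 \<longrightarrow> norm (poly (test_poly j w J) z) \<le> (1 + 2 ^ Suc j) * (1 / norm (1 - w * z) ^ Suc j)" for J
  proof -
    have "hardy_norm q (poly (test_poly j w J)) \<le> ennreal K"
    proof (rule hardy_norm_leI)
      show "poly (test_poly j w J) holomorphic_on ball 0 1" by (intro holomorphic_intros)
      fix R :: real assume R: "0 \<le> R" "R < 1"
      have "(\<integral>\<^sup>+t. ennreal (norm (poly (test_poly j w J) (of_real R * cis t)) powr q) \<partial>circ)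
         \<le> (\<integral>\<^sup>+t. ennreal ((1 + 2 ^ Suc j) powr q) * ennreal (norm (1 - w * (of_real R * cis t)) powr - s) \<partial>circ)"
      proof (rule nn_integral_mono)
        fix t
        define z where "z = of_real R * cis t"
        have z: "norm z \<le> 1" using R by (simp add: z_def norm_mult)
        have wz: "0 < norm (1 - w * z)"
        proof -
          have "norm w * norm z \<le> norm w" using z by (simp add: mult_left_le)
          then have "norm (w * z) < 1" using w by (simp add: norm_mult)
          then show ?thesis by auto
        qed
        have "norm (poly (test_poly j w J) z) powr q \<le> ((1 + 2 ^ Suc j) * (1 / norm (1 - w * z) ^ Suc j)) powr q"
          using J[rule_format, OF z] q by (intro powr_mono2) auto
        also have "\<dots> = (1 + 2 ^ Suc j) powr q * (1 / norm (1 - w * z) ^ Suc j) powr q"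
          by (rule powr_mult)
        also have "1 / norm (1 - w * z) ^ Suc j = norm (1 - w * z) powr - real (Suc j)"
          using wz by (simp only: powr_minus_divide powr_realpow)
        also have "(norm (1 - w * z) powr - real (Suc j)) powr q = norm (1 - w * z) powr - s"
          by (simp add: powr_powr s_def del: of_nat_Suc)
        finally show "ennreal (norm (poly (test_poly j w J) z) powr q)
          \<le> ennreal ((1 + 2 ^ Suc j) powr q) * ennreal (norm (1 - w * z) powr - s)"
          by (subst ennreal_mult'[symmetric]) (auto intro: ennreal_leI)
      qed
      also have "\<dots> = ennreal ((1 + 2 ^ Suc j) powr q) * (\<integral>\<^sup>+t. ennreal (norm (1 - w * (of_real R * cis t)) powr - s) \<partial>circ)"
        by (subst nn_integral_cmult, measurable)
      also have "\<dots> \<le> ennreal ((1 + 2 ^ Suc j) powr q) * ennreal X"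
        unfolding X_def r_def by (intro mult_left_mono cauchy_kernel_mean w R s) simp
      also have "\<dots> = ennreal (K powr q)"
      proof -
        have "K powr q = (1 + 2 ^ Suc j) powr q * (X powr (1 / q)) powr q" unfolding K_def by (rule powr_mult)
        then show ?thesis using X q by (simp add: powr_inverse_cancel ennreal_mult' del: power_Suc)
      qed
      finally show "(\<integral>\<^sup>+t. ennreal (norm (poly (test_poly j w J) (of_real R * cis t)) powr q) \<partial>circ) \<le> ennreal (K powr q)" .
    qed (use q K in auto)
    from op[OF K this] have "hardy_norm p (?T J) \<le> ennreal (h * K)" .
    then show ?thesis unfolding r_def
      using h K p by (intro point_evaluation matrix_operator_holomorphic[OF g binomial_coeff_norm_ge] w) auto
  qed
  then have "\<forall>\<^sub>F J in sequentially. norm (?T J w) \<le> h * K * (36 / (1 - r)) powr (1 / p)"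
    using test_poly_le[OF w, of j] by (auto elim!: eventually_mono)
  then have "norm (pseries (binomial_coeff (Suc j) c) w) \<le> h * K * (36 / (1 - r)) powr (1 / p)"
    by (intro tendsto_upperbound[OF tendsto_norm[OF hankel_test_poly_limit[OF g w]]]) auto
  also have "\<dots> = opnorm_const p q j * h * (1 - norm w) powr (al - real (Suc j))"
  proof -
    have "X powr (1 / q) = (6 powr s / (s - 1)) powr (1 / q) * (1 - r) powr ((1 - s) / q)"
      unfolding X_def using s by (subst powr_mult) (auto simp: powr_powr)
    moreover have "(36 / (1 - r)) powr (1 / p) = 36 powr (1 / p) * (1 - r) powr (- (1 / p))"
      using r by (simp add: powr_divide powr_minus_divide)
    \<comment> \<open>With \<open>s = Suc j * q\<close>, the exponent \<open>(1 - s) / q\<close> is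
      \<open>1 / q - Suc j\<close>, and subtracting \<open>1 / p\<close> yields
      \<open>al - Suc j\<close>.\<close>
    moreover have e3: "(1 - r) powr ((1 - s) / q) * (1 - r) powr (- (1 / p)) = (1 - r) powr (al - real (Suc j))"
    proof -
      have "(1 - s) / q + - (1 / p) = al - real (Suc j)" using q by (simp add: s_def al diff_divide_distrib del: of_nat_Suc)
      then show ?thesis by (simp only: powr_add[symmetric])
    qed
    ultimately show ?thesis
      unfolding K_def opnorm_const_def r_def[symmetric] s_def[symmetric] e3[symmetric] by (simp only: mult_ac)
  qed
  finally show "norm (pseries (binomial_coeff (Suc j) c) w) \<le> opnorm_const p q j * h * (1 - norm w) powr (al - real (Suc j))" .
qed

subsection \<open>Growth of the symbol from boundary smoothness\<close>

definition fourier :: "(real \<Rightarrow> complex) \<Rightarrow> int \<Rightarrow> complex" where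
  "fourier g k = (LINT t|circ. g t * cis (- (of_int k * t)))"

lemma continuous_periodic_bounded:
  fixes g :: "real \<Rightarrow> complex"
  assumes g: "continuous_on UNIV g" and per: "\<And>t. g (t + 2 * pi) = g t"
  obtains H where "0 \<le> H" "\<And>t. norm (g t) \<le> H"
proof -
  have "compact (g ` {0..2 * pi})"
    by (intro compact_continuous_image continuous_on_subset[OF g]) auto
  then obtain H where H: "\<forall>w\<in>g ` {0..2 * pi}. norm w \<le> H" using compact_imp_bounded bounded_iff by metis
  have per_nat: "g (t + 2 * pi * real n) = g t" for t n
  proof (induction n)
    case (Suc n)
    have "g (t + 2 * pi * real (Suc n)) = g ((t + 2 * pi * real n) + 2 * pi)" by (simp add: algebra_simps)
    then show ?case using per Suc by simp
  qed simp
  have per_int: "g (t + 2 * pi * of_int k) = g t" for t and k :: int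
  proof (cases "0 \<le> k")
    case True
    then have "real_of_int k = real (nat k)" by simp
    then show ?thesis by (simp only: per_nat)
  next
    case False
    define n where "n = nat (- k)"
    have k: "real_of_int k = - real n" using False by (simp add: n_def)
    have "g (t + 2 * pi * of_int k + 2 * pi * real n) = g (t + 2 * pi * of_int k)" by (rule per_nat)
    moreover have "t + 2 * pi * of_int k + 2 * pi * real n = t" unfolding k by simp
    ultimately show ?thesis by (simp only:)
  qed
  have le: "norm (g t) \<le> H" for t
  proof -
    define k where "k = \<lfloor>t / (2 * pi)\<rfloor>"
    have "of_int k \<le> t / (2 * pi)" "t / (2 * pi) \<le> of_int k + 1" unfolding k_def by linarith+
    then have "of_int k * (2 * pi) \<le> t" "t \<le> (of_int k + 1) * (2 * pi)"
      by (simp_all only: pos_le_divide_eq pos_divide_le_eq mult_pos_pos zero_less_numeral pi_gt_zero)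
    then have "t - 2 * pi * of_int k \<in> {0..2 * pi}" by (auto simp: distrib_right mult.commute)
    moreover have "g t = g (t - 2 * pi * of_int k)" using per_int[of "t - 2 * pi * of_int k" k] by simp
    ultimately show ?thesis using H by simp
  qed
  have "0 \<le> H" by (rule order_trans[OF norm_ge_zero le[of 0]])
  then show ?thesis using le by (rule that)
qed

lemma integrable_circ_continuous:
  fixes h :: "real \<Rightarrow> complex"
  assumes h: "continuous_on UNIV h"
  shows "integrable circ h"
proof -
  have "compact (h ` {-pi..pi})" by (intro compact_continuous_image continuous_on_subset[OF h]) auto
  then obtain H where H: "\<forall>w\<in>h ` {-pi..pi}. norm w \<le> H" using compact_imp_bounded bounded_iff by metis
  show ?thesis using H by (intro integrable_circ[where H = H] borel_measurable_continuous_onI h) auto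
qed

text \<open>Carries a change of variable from nonnegative to complex functions: adding the bound
  \<open>H\<close> makes the real and imaginary parts nonnegative.\<close>

lemma integral_circ_subst:
  fixes G :: "real \<Rightarrow> complex" and \<phi> :: "real \<Rightarrow> real"
  assumes G [measurable]: "G \<in> borel_measurable borel" and H: "\<And>t. norm (G t) \<le> H" and per: "\<And>t. G (t + 2 * pi) = G t"
    and \<phi> [measurable]: "\<phi> \<in> borel_measurable borel"
    and nn: "\<And>h::real \<Rightarrow> ennreal. h \<in> borel_measurable borel \<Longrightarrow> (\<And>x. h (x + 2 * pi) = h x) \<Longrightarrow> (\<integral>\<^sup>+t. h (\<phi> t) \<partial>circ) = (\<integral>\<^sup>+t. h t \<partial>circ)"
  shows "(LINT t|circ. G (\<phi> t)) = (LINT t|circ. G t)"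
proof -
  have real: "(LINT t|circ. u (\<phi> t)) = (LINT t|circ. u t)"
    if [measurable]: "u \<in> borel_measurable borel" and uH: "\<And>t. \<bar>u t\<bar> \<le> H" and uper: "\<And>t. u (t + 2 * pi) = u t" for u :: "real \<Rightarrow> real"
  proof -
    have u0: "0 \<le> u t + H" for t using uH[of t] by linarith
    have int: "integrable circ u" "integrable circ (\<lambda>t. u (\<phi> t))"
      using uH by (auto intro!: integrable_circ[where H = H])
    have "(LINT t|circ. u (\<phi> t) + H) = enn2real (\<integral>\<^sup>+t. ennreal (u (\<phi> t) + H) \<partial>circ)"
      by (rule integral_eq_nn_integral) (auto simp: u0)
    also have "(\<integral>\<^sup>+t. ennreal (u (\<phi> t) + H) \<partial>circ) = (\<integral>\<^sup>+t. ennreal (u t + H) \<partial>circ)"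
      by (rule nn) (auto simp: uper)
    also have "enn2real \<dots> = (LINT t|circ. u t + H)"
      by (rule integral_eq_nn_integral[symmetric]) (auto simp: u0)
    finally show ?thesis using int by simp
  qed
  have int: "integrable circ G" "integrable circ (\<lambda>t. G (\<phi> t))"
    using H by (auto intro!: integrable_circ[where H = H])
  have "(LINT t|circ. Re (G (\<phi> t))) = (LINT t|circ. Re (G t))"
    by (rule real[of "\<lambda>t. Re (G t)"]) (auto simp: per intro: order_trans[OF abs_Re_le_cmod H])
  moreover have "(LINT t|circ. Im (G (\<phi> t))) = (LINT t|circ. Im (G t))"
    by (rule real[of "\<lambda>t. Im (G t)"]) (auto simp: per intro: order_trans[OF abs_Im_le_cmod H])
  ultimately show ?thesis using int by (intro complex_eqI) simp_all
qed

lemma integral_circ_shift_reflect: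
  fixes G :: "real \<Rightarrow> complex"
  assumes G [measurable]: "G \<in> borel_measurable borel" and H: "\<And>t. norm (G t) \<le> H" and per: "\<And>t. G (t + 2 * pi) = G t"
  shows "(LINT t|circ. G (\<theta> + t)) = (LINT t|circ. G t)" "(LINT t|circ. G (\<theta> - t)) = (LINT t|circ. G t)"
proof -
  show "(LINT t|circ. G (\<theta> + t)) = (LINT t|circ. G t)"
    by (rule integral_circ_subst[OF G H per]) (auto intro: nn_integral_circ_shift)
  show "(LINT t|circ. G (\<theta> - t)) = (LINT t|circ. G t)"
  proof (rule integral_circ_subst[OF G H per])
    fix h :: "real \<Rightarrow> ennreal" assume h [measurable]: "h \<in> borel_measurable borel" "\<And>x. h (x + 2 * pi) = h x"
    have "(\<integral>\<^sup>+t. h (\<theta> - t) \<partial>circ) = (\<integral>\<^sup>+t. h (\<theta> + - t) \<partial>circ)" by simp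
    also have "\<dots> = (\<integral>\<^sup>+t. h (\<theta> + t) \<partial>circ)" by (rule nn_integral_circ_reflect[of "\<lambda>a. h (\<theta> + a)"]) measurable
    also have "\<dots> = (\<integral>\<^sup>+t. h t \<partial>circ)" by (rule nn_integral_circ_shift) (use h in auto)
    finally show "(\<integral>\<^sup>+t. h (\<theta> - t) \<partial>circ) = (\<integral>\<^sup>+t. h t \<partial>circ)" .
  qed simp
qed

text \<open>The generating function of the binomials \<open>(n + k) choose k\<close>; convolution
  with it turns Fourier coefficients into \<open>binomial_coeff k\<close>.\<close>

definition power_kernel :: "nat \<Rightarrow> real \<Rightarrow> real \<Rightarrow> complex" where
  "power_kernel k r s = 1 / (1 - of_real r * cis s) ^ Suc k"

lemma continuous_on_power_kernel [continuous_intros]: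
  assumes "0 \<le> r" "r < 1" "continuous_on S u"
  shows "continuous_on S (\<lambda>s. power_kernel k r (u s))"
proof -
  have "of_real r * cis x \<noteq> 1" for x
  proof
    assume "of_real r * cis x = 1"
    then have "norm (of_real r * cis x) = 1" by simp
    then show False using assms by (simp add: norm_mult)
  qed
  then show ?thesis unfolding power_kernel_def using assms(3) by (intro continuous_intros) auto
qed

lemma power_kernel_le:
  assumes r: "0 \<le> r" "r < 1"
  shows "norm (power_kernel k r s) \<le> 3 ^ Suc k * ((1 - r) + chord s) powr - real (Suc k)"
proof -
  define D where "D = (1 - r) + chord s"
  have D: "0 < D" using r chord_nonneg[of s] unfolding D_def by linarith
  have "D \<le> 3 * norm (1 - of_real r * cis s)" unfolding D_def using r by (intro one_minus_cis_ge) auto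
  then have "D / 3 \<le> norm (1 - of_real r * cis s)" by simp
  then have "(D / 3) ^ Suc k \<le> norm (1 - of_real r * cis s) ^ Suc k" using D by (intro power_mono) auto
  then have "1 / norm (1 - of_real r * cis s) ^ Suc k \<le> 1 / (D / 3) ^ Suc k"
  proof (rule divide_left_mono)
    have "0 < (D / 3) ^ Suc k" using D by (intro zero_less_power) simp
    moreover from this have "0 < norm (1 - of_real r * cis s) ^ Suc k" using \<open>(D / 3) ^ Suc k \<le> _\<close> by (rule less_le_trans)
    ultimately show "0 < norm (1 - of_real r * cis s) ^ Suc k * (D / 3) ^ Suc k" by (rule mult_pos_pos[rotated])
  qed simp_all
  also have "\<dots> = 3 ^ Suc k * D powr - real (Suc k)"
    using D by (simp only: powr_minus_divide powr_realpow power_divide) simp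
  finally show ?thesis by (simp only: power_kernel_def norm_divide norm_one norm_power D_def)
qed

lemma fourier_bounded:
  assumes g: "continuous_on UNIV g" and H: "\<And>t. norm (g t) \<le> H"
  shows "norm (fourier g k) \<le> H"
proof -
  have "norm (fourier g k) \<le> (LINT t|circ. norm (g t * cis (- (of_int k * t))))"
    unfolding fourier_def by (rule integral_norm_bound)
  also have "\<dots> \<le> (LINT t|circ. H)"
    using H by (intro integral_mono integrable_norm integrable_circ_continuous) (auto intro!: continuous_intros g simp: norm_mult)
  finally show ?thesis by (simp add: measure_circ)
qed

lemma fourier_summable:
  assumes g: "continuous_on UNIV g" and H: "\<And>t. norm (g t) \<le> H" and z: "norm z < 1"
  shows "summable (\<lambda>M. norm (binomial_coeff k (\<lambda>M. fourier g (\<iota> M)) M * z ^ M))"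
proof (rule summable_comparison_test'[OF summable_mult[OF neg_binomial_summable[OF z, of k], of H], of 0])
  fix M
  have "norm (of_nat ((M + k) choose k) * z ^ M) * norm (fourier g (\<iota> M)) \<le> norm (of_nat ((M + k) choose k) * z ^ M) * H"
    by (intro mult_left_mono fourier_bounded[OF g H]) simp
  then show "norm (norm (binomial_coeff k (\<lambda>M. fourier g (\<iota> M)) M * z ^ M)) \<le> H * norm (of_nat ((M + k) choose k) * z ^ M)"
    by (simp add: binomial_coeff_def norm_mult mult_ac)
qed

text \<open>Both signs of the frequency are treated, since the second-difference argument needs the
  kernel together with its reflection.\<close>

lemma power_kernel_convolution:
  assumes g: "continuous_on UNIV g" and H: "\<And>t. norm (g t) \<le> H" and r: "0 \<le> r" "r < 1"
  shows "pseries (binomial_coeff k (\<lambda>M. fourier g (int M))) (of_real r * cis \<theta>) = (LINT t|circ. g t * power_kernel k r (\<theta> - t))"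
    and "pseries (binomial_coeff k (\<lambda>M. fourier g (- int M))) (of_real r * cis \<theta>) = (LINT t|circ. g t * power_kernel k r (\<theta> + t))"
proof -
  have [measurable]: "g \<in> borel_measurable borel" using g by (rule borel_measurable_continuous_onI)
  define c where "c n = (of_nat ((n + k) choose k) :: complex) * of_real r ^ n" for n
  have c: "summable (\<lambda>n. norm (c n))"
    unfolding c_def using r by (intro neg_binomial_summable) simp
  have K: "(\<Sum>n. c n * cis (real n * x)) = power_kernel k r x" for x
  proof -
    have "(\<lambda>n. of_nat ((n + k) choose k) * (of_real r * cis x) ^ n) sums power_kernel k r x"
      unfolding power_kernel_def using r by (intro neg_binomial_sums) (simp add: norm_mult)
    then show ?thesis by (simp only: c_def power_mult_distrib Complex.DeMoivre mult.assoc sums_iff)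
  qed
  have gen: "pseries (binomial_coeff k (\<lambda>M. fourier g (\<epsilon> * int M))) (of_real r * cis \<theta>)
      = (LINT t|circ. g t * power_kernel k r (\<theta> - of_int \<epsilon> * t))" for \<epsilon> :: int
  proof -
    have "(\<lambda>n. c n * (LINT t|circ. g t * cis (real n * (\<theta> - of_int \<epsilon> * t)))) sums
       (LINT t|circ. g t * (\<Sum>n. c n * cis (real n * (\<theta> - of_int \<epsilon> * t))))"
      by (rule sums_integral_circ[OF _ _ H _ c]) auto
    moreover have "c n * (LINT t|circ. g t * cis (real n * (\<theta> - of_int \<epsilon> * t)))
       = binomial_coeff k (\<lambda>M. fourier g (\<epsilon> * int M)) n * (of_real r * cis \<theta>) ^ n" for n
    proof -
      have "g t * cis (real n * (\<theta> - of_int \<epsilon> * t)) = cis (real n * \<theta>) * (g t * cis (- (of_int (\<epsilon> * int n) * t)))" for t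
      proof -
        have "cis (real n * (\<theta> - of_int \<epsilon> * t)) = cis (real n * \<theta>) * cis (- (of_int (\<epsilon> * int n) * t))"
          by (simp add: cis_mult algebra_simps)
        then show ?thesis by (simp only: mult_ac)
      qed
      then have "(LINT t|circ. g t * cis (real n * (\<theta> - of_int \<epsilon> * t))) = cis (real n * \<theta>) * fourier g (\<epsilon> * int n)"
        by (simp only: fourier_def integral_mult_right_zero)
      then show ?thesis by (simp only: c_def binomial_coeff_def power_mult_distrib Complex.DeMoivre mult_ac)
    qed
    ultimately show ?thesis unfolding pseries_def K by (simp add: sums_iff)
  qed
  show "pseries (binomial_coeff k (\<lambda>M. fourier g (int M))) (of_real r * cis \<theta>) = (LINT t|circ. g t * power_kernel k r (\<theta> - t))"
    using gen[of 1] by simp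
  show "pseries (binomial_coeff k (\<lambda>M. fourier g (- int M))) (of_real r * cis \<theta>) = (LINT t|circ. g t * power_kernel k r (\<theta> + t))"
    using gen[of "-1"] by simp
qed

text \<open>The exponent \<open>s\<close> may be zero or negative, where the direct integral would
  be logarithmic or bounded. As the weight is at most 3, \<open>s\<close> can be weakened to any
  positive \<sigma> \<ge> \<open>s\<close>, at the price of a power of 3.\<close>

lemma kernel_weight_integral:
  fixes W :: "real \<Rightarrow> complex"
  assumes r: "0 \<le> r" "r < 1" and \<sigma>: "0 < \<sigma>" "s \<le> \<sigma>" and C: "0 \<le> C"
    and W: "\<And>t. t \<in> {-pi..pi} \<Longrightarrow> norm (W t) \<le> C * ((1 - r) + chord t) powr (- 1 - s)"
  shows "norm (LINT t|circ. W t) \<le> C * (3 powr (\<sigma> - s) * (2 powr (1 + \<sigma>) / \<sigma>)) * (1 - r) powr - \<sigma>"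
proof -
  have "ennreal (norm (LINT t|circ. W t)) \<le> (\<integral>\<^sup>+t. ennreal (norm (W t)) \<partial>circ)" by (rule norm_integral_circ_le)
  also have "\<dots> \<le> (\<integral>\<^sup>+t. ennreal (C * 3 powr (\<sigma> - s)) * ennreal (((1 - r) + chord t) powr (- 1 - \<sigma>)) \<partial>circ)"
  proof (rule nn_integral_circ_mono)
    fix t assume t: "t \<in> {-pi..pi}"
    define D where "D = (1 - r) + chord t"
    have D: "0 < D" "D \<le> 3" using r chord_nonneg[of t] chord_le_2[of t] unfolding D_def by linarith+
    have "- 1 - s = (\<sigma> - s) + (- 1 - \<sigma>)" by simp
    then have "D powr (- 1 - s) = D powr (\<sigma> - s) * D powr (- 1 - \<sigma>)" by (simp only: powr_add)
    also have "\<dots> \<le> 3 powr (\<sigma> - s) * D powr (- 1 - \<sigma>)" using D \<sigma> by (intro mult_right_mono powr_mono2) auto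
    finally have "C * D powr (- 1 - s) \<le> C * (3 powr (\<sigma> - s) * D powr (- 1 - \<sigma>))" using C by (rule mult_left_mono)
    then have "norm (W t) \<le> C * 3 powr (\<sigma> - s) * D powr (- 1 - \<sigma>)" using W[OF t] unfolding D_def by simp
    then show "ennreal (norm (W t)) \<le> ennreal (C * 3 powr (\<sigma> - s)) * ennreal (((1 - r) + chord t) powr (- 1 - \<sigma>))"
      unfolding D_def using C by (subst ennreal_mult'[symmetric]) (auto intro: ennreal_leI)
  qed
  also have "\<dots> = ennreal (C * 3 powr (\<sigma> - s)) * (\<integral>\<^sup>+t. ennreal (((1 - r) + chord t) powr (- 1 - \<sigma>)) \<partial>circ)"
    by (subst nn_integral_cmult, measurable)
  also have "\<dots> \<le> ennreal (C * 3 powr (\<sigma> - s)) * ennreal (2 powr (1 + \<sigma>) / \<sigma> * (1 - r) powr - \<sigma>)"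
    using r \<sigma> by (intro mult_left_mono chord_integral_base) auto
  also have "\<dots> = ennreal (C * (3 powr (\<sigma> - s) * (2 powr (1 + \<sigma>) / \<sigma>)) * (1 - r) powr - \<sigma>)"
    using C by (subst ennreal_mult'[symmetric]) (auto simp: mult.assoc)
  finally show ?thesis using C \<sigma> by (subst (asm) ennreal_le_iff) auto
qed

text \<open>The exponent \<sigma> is not tied to \<open>k\<close> and the smoothness order: the
  induction passes through values of \<open>k\<close> below that order, where \<open>k\<close> minus
  the order is negative and a positive \<sigma> is still wanted.\<close>

definition radial_growth :: "nat \<Rightarrow> real \<Rightarrow> (real \<Rightarrow> complex) \<Rightarrow> bool" where
  "radial_growth k \<sigma> g \<longleftrightarrow> (\<exists>C. \<forall>z. norm z < 1 \<longrightarrow>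
     norm (pseries (binomial_coeff k (\<lambda>M. fourier g (int M))) z) \<le> C * (1 - norm z) powr - \<sigma>)"

lemma radial_growthI:
  assumes "\<And>r \<theta>. 0 \<le> r \<Longrightarrow> r < 1 \<Longrightarrow> norm (pseries (binomial_coeff k (\<lambda>M. fourier g (int M))) (of_real r * cis \<theta>)) \<le> C * (1 - r) powr - \<sigma>"
  shows "radial_growth k \<sigma> g"
  unfolding radial_growth_def
proof (intro exI allI impI)
  fix z :: complex assume z: "norm z < 1"
  have "z = of_real (norm z) * cis (Arg z)" using rcis_cmod_Arg[of z] by (simp add: rcis_def)
  then show "norm (pseries (binomial_coeff k (\<lambda>M. fourier g (int M))) z) \<le> C * (1 - norm z) powr - \<sigma>"
    using assms[of "norm z" "Arg z"] z by simp
qed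

text \<open>The kernel of order one is integrated in absolute value. This would give a logarithm,
  which the positive \<sigma> absorbs.\<close>

lemma radial_growth_0:
  assumes g: "continuous_on UNIV g" and per: "\<And>t. g (t + 2 * pi) = g t" and \<sigma>: "0 < \<sigma>"
  shows "radial_growth 0 \<sigma> g"
proof -
  obtain H where H: "0 \<le> H" "\<And>t. norm (g t) \<le> H" using continuous_periodic_bounded[OF g per] by blast
  have H': "norm (g (x + t)) \<le> H" for x t by (rule H)
  show ?thesis
  proof (rule radial_growthI[where C = "H * 3 * (3 powr (\<sigma> - 0) * (2 powr (1 + \<sigma>) / \<sigma>))"])
    fix r \<theta> :: real assume r: "0 \<le> r" "r < 1"
    define G where "G t = g t * power_kernel 0 r (\<theta> - t)" for t
    have G: "continuous_on UNIV G" unfolding G_def by (intro continuous_intros g r)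
    have Gper: "G (t + 2 * pi) = G t" for t
    proof -
      have "cis (\<theta> - (t + 2 * pi)) = cis (\<theta> - t)" using cis_period[of "\<theta> - (t + 2 * pi)"] by (simp add: algebra_simps)
      then show ?thesis by (simp add: G_def power_kernel_def per)
    qed
    obtain H2 where H2: "\<And>t. norm (G t) \<le> H2" using continuous_periodic_bounded[OF G Gper] by blast
    have "pseries (binomial_coeff 0 (\<lambda>M. fourier g (int M))) (of_real r * cis \<theta>) = (LINT t|circ. G t)"
      unfolding G_def by (rule power_kernel_convolution(1)[OF g H(2) r])
    also have "\<dots> = (LINT t|circ. G (\<theta> - t))"
      by (rule integral_circ_shift_reflect(2)[OF borel_measurable_continuous_onI[OF G] H2 Gper, symmetric])
    also have "norm \<dots> \<le> H * 3 * (3 powr (\<sigma> - 0) * (2 powr (1 + \<sigma>) / \<sigma>)) * (1 - r) powr - \<sigma>"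
    proof (rule kernel_weight_integral[OF r \<sigma>])
      fix t
      have "norm (g (\<theta> - t)) * norm (power_kernel 0 r t) \<le> H * (3 ^ Suc 0 * ((1 - r) + chord t) powr - real (Suc 0))"
        by (intro mult_mono H(2) power_kernel_le r H(1)) auto
      then show "norm (G (\<theta> - t)) \<le> H * 3 * ((1 - r) + chord t) powr (- 1 - 0)" by (simp add: G_def norm_mult mult.assoc)
    qed (use \<sigma> H in auto)
    finally show "norm (pseries (binomial_coeff 0 (\<lambda>M. fourier g (int M))) (of_real r * cis \<theta>))
      \<le> H * 3 * (3 powr (\<sigma> - 0) * (2 powr (1 + \<sigma>) / \<sigma>)) * (1 - r) powr - \<sigma>" .
  qed
qed

text \<open>As the negative frequencies of \<open>g\<close> vanish, adding the reflected kernel changes the integral only by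
  the constant \<open>fourier g 0\<close>, and against an even kernel \<open>g\<close> may be replaced by second differences.\<close>

lemma radial_growth_second_difference:
  assumes g: "continuous_on UNIV g" and per: "\<And>t. g (t + 2 * pi) = g t" and neg: "\<And>M. 0 < M \<Longrightarrow> fourier g (- int M) = 0"
    and al: "0 \<le> al" and diff: "\<And>x h. norm (g (x + h) + g (x - h) - 2 * g x) \<le> C * \<bar>h\<bar> powr al"
    and \<sigma>: "0 < \<sigma>" "real k - al \<le> \<sigma>"
  shows "radial_growth k \<sigma> g"
proof -
  obtain H where H: "0 \<le> H" "\<And>t. norm (g t) \<le> H" using continuous_periodic_bounded[OF g per] by blast
  have C: "0 \<le> C" using diff[of 0 1] order_trans[OF norm_ge_zero diff[of 0 1]] by simp
  define A where "A = C * 2 powr al * (2 * 3 ^ Suc k)"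
  have A: "0 \<le> A" using C by (simp add: A_def)
  define B where "B = A * (3 powr (\<sigma> - (real k - al)) * (2 powr (1 + \<sigma>) / \<sigma>))"
  have B: "0 \<le> B" using A \<sigma> by (simp add: B_def)
  show ?thesis
  proof (rule radial_growthI[where C = "3 * H + B"])
    fix r \<theta> :: real assume r: "0 \<le> r" "r < 1"
    define E where "E s = power_kernel k r s + power_kernel k r (- s)" for s
    have E: "continuous_on S (\<lambda>x. E (u x))" if "continuous_on S u" for S and u :: "real \<Rightarrow> real"
      unfolding E_def using that by (intro continuous_intros r)
    have Eper: "E (s + 2 * pi) = E s" for s
    proof -
      have "cis (- (s + 2 * pi)) = cis (- s)" using cis_period[of "- (s + 2 * pi)"] by simp
      then show ?thesis by (simp only: E_def power_kernel_def cis_period)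
    qed
    have Eev: "E (- s) = E s" for s by (simp add: E_def)
    have sum_eq: "pseries (binomial_coeff k (\<lambda>M. fourier u (int M))) (of_real r * cis \<theta>)
        + pseries (binomial_coeff k (\<lambda>M. fourier u (- int M))) (of_real r * cis (- \<theta>)) = (LINT s|circ. u (\<theta> + s) * E s)"
        "(LINT s|circ. u (\<theta> - s) * E s) = (LINT s|circ. u (\<theta> + s) * E s)"
      if u: "continuous_on UNIV u" "\<And>t. norm (u t) \<le> H'" "\<And>t. u (t + 2 * pi) = u t" for u H'
    proof -
      define G where "G t = u t * E (t - \<theta>)" for t
      have G: "continuous_on UNIV G" unfolding G_def by (intro continuous_intros E u(1))
      have Gper: "G (t + 2 * pi) = G t" for t
      proof -
        have "t + 2 * pi - \<theta> = (t - \<theta>) + 2 * pi" by simp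
        then show ?thesis by (simp only: G_def u(3) Eper)
      qed
      obtain H2 where H2: "\<And>t. norm (G t) \<le> H2" using continuous_periodic_bounded[OF G Gper] by blast
      note sr = integral_circ_shift_reflect[OF borel_measurable_continuous_onI[OF G] H2 Gper, of \<theta>]
      have sr': "(LINT s|circ. u (\<theta> + s) * E s) = (LINT t|circ. G t)" "(LINT s|circ. u (\<theta> - s) * E s) = (LINT t|circ. G t)"
        using sr by (simp_all add: G_def Eev)
      then show "(LINT s|circ. u (\<theta> - s) * E s) = (LINT s|circ. u (\<theta> + s) * E s)" by simp
      have "(LINT t|circ. G t) = (LINT t|circ. u t * power_kernel k r (\<theta> - t) + u t * power_kernel k r (- \<theta> + t))"
        by (rule Bochner_Integration.integral_cong) (simp_all add: G_def E_def algebra_simps)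
      also have "\<dots> = (LINT t|circ. u t * power_kernel k r (\<theta> - t)) + (LINT t|circ. u t * power_kernel k r (- \<theta> + t))"
        by (intro Bochner_Integration.integral_add integrable_circ_continuous continuous_intros u(1) r)
      finally show "pseries (binomial_coeff k (\<lambda>M. fourier u (int M))) (of_real r * cis \<theta>)
        + pseries (binomial_coeff k (\<lambda>M. fourier u (- int M))) (of_real r * cis (- \<theta>)) = (LINT s|circ. u (\<theta> + s) * E s)"
        unfolding sr' power_kernel_convolution[OF u(1,2) r] by simp
    qed
    have single: "pseries (binomial_coeff k c) z = c 0" if "\<And>M. 0 < M \<Longrightarrow> c M = 0" for c z
    proof -
      have "(\<lambda>M. binomial_coeff k c M * z ^ M) sums (\<Sum>M\<in>{0}. binomial_coeff k c M * z ^ M)"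
        by (rule sums_finite) (use that in \<open>auto simp: binomial_coeff_def\<close>)
      then show ?thesis by (simp add: pseries_def sums_iff binomial_coeff_def)
    qed
    have one: "fourier (\<lambda>_. 1) j = (if j = 0 then 1 else 0)" for j
      using integral_circ_cis[of "- j"] by (simp add: fourier_def)
    \<comment> \<open>The constant function has the frequency 0 only, and both the kernel and its
      reflection count it once.\<close>
    have "(LINT s|circ. 1 * E s) = pseries (binomial_coeff k (\<lambda>M. fourier (\<lambda>_. 1) (int M))) (of_real r * cis \<theta>)
        + pseries (binomial_coeff k (\<lambda>M. fourier (\<lambda>_. 1) (- int M))) (of_real r * cis (- \<theta>))"
      by (rule sum_eq(1)[of "\<lambda>_. 1" 1, symmetric]) auto
    also have "\<dots> = 2" by (subst (1 2) single) (auto simp: one)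
    finally have E2: "(LINT s|circ. E s) = 2" by simp
    define P where "P = pseries (binomial_coeff k (\<lambda>M. fourier g (int M))) (of_real r * cis \<theta>)"
    have P: "P + fourier g 0 = (LINT s|circ. g (\<theta> + s) * E s)"
      using sum_eq(1)[OF g H(2) per] single[of "\<lambda>M. fourier g (- int M)"] neg by (simp add: P_def)
    define Q where "Q = (LINT s|circ. (g (\<theta> + s) + g (\<theta> - s) - 2 * g \<theta>) * E s)"
    have "Q = (LINT s|circ. (g (\<theta> + s) * E s + g (\<theta> - s) * E s) - 2 * g \<theta> * E s)"
      unfolding Q_def by (rule Bochner_Integration.integral_cong) (simp_all add: algebra_simps)
    also have "\<dots> = (LINT s|circ. g (\<theta> + s) * E s) + (LINT s|circ. g (\<theta> - s) * E s) - (LINT s|circ. 2 * g \<theta> * E s)"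
      by (subst Bochner_Integration.integral_diff, intro integrable_circ_continuous continuous_intros E continuous_on_compose2[OF g], auto intro!: integrable_circ_continuous continuous_intros E continuous_on_compose2[OF g])
         (subst Bochner_Integration.integral_add, auto intro!: integrable_circ_continuous continuous_intros E continuous_on_compose2[OF g])
    also have "(LINT s|circ. 2 * g \<theta> * E s) = 2 * g \<theta> * 2" by (simp only: integral_mult_right_zero E2)
    \<comment> \<open>Evenness of \<open>E\<close> makes the integrals of both translates of
      \<open>g\<close> equal to \<open>P + fourier g 0\<close>, and the middle term contributes
      \<open>4 * g \<theta>\<close> because \<open>E\<close> has integral 2.\<close>
    finally have Q: "2 * P = Q - 2 * fourier g 0 + 4 * g \<theta>"
      unfolding sum_eq(2)[OF g H(2) per] P[symmetric] by (simp add: algebra_simps)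
    have Q_le: "norm Q \<le> B * (1 - r) powr - \<sigma>"
      unfolding Q_def B_def
    proof (rule kernel_weight_integral[OF r \<sigma> A])
      fix t :: real assume t: "t \<in> {-pi..pi}"
      define D where "D = (1 - r) + chord t"
      have D: "0 < D" using r chord_nonneg[of t] unfolding D_def by linarith
      have "\<bar>t\<bar> / 2 \<le> chord t" using t by (intro chord_ge_abs) auto
      moreover have "chord t \<le> D" using r by (simp add: D_def)
      ultimately have tD: "\<bar>t\<bar> \<le> 2 * D" by simp
      have "norm (g (\<theta> + t) + g (\<theta> - t) - 2 * g \<theta>) \<le> C * \<bar>t\<bar> powr al" by (rule diff)
      also have "\<dots> \<le> C * (2 * D) powr al" using tD al C by (intro mult_left_mono powr_mono2) auto
      also have "\<dots> = C * 2 powr al * D powr al" by (simp add: powr_mult)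
      finally have 1: "norm (g (\<theta> + t) + g (\<theta> - t) - 2 * g \<theta>) \<le> C * 2 powr al * D powr al" .
      have "norm (power_kernel k r t) \<le> 3 ^ Suc k * D powr - real (Suc k)" unfolding D_def by (rule power_kernel_le[OF r])
      moreover have "norm (power_kernel k r (- t)) \<le> 3 ^ Suc k * D powr - real (Suc k)"
        using power_kernel_le[OF r, of k "- t"] by (simp add: D_def)
      ultimately have 2: "norm (E t) \<le> 2 * 3 ^ Suc k * D powr - real (Suc k)"
        unfolding E_def using norm_triangle_ineq[of "power_kernel k r t" "power_kernel k r (- t)"] by linarith
      have "norm ((g (\<theta> + t) + g (\<theta> - t) - 2 * g \<theta>) * E t) \<le> (C * 2 powr al * D powr al) * (2 * 3 ^ Suc k * D powr - real (Suc k))"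
        unfolding norm_mult by (rule mult_mono[OF 1 2]) (use C in auto)
      also have "\<dots> = A * (D powr al * D powr - real (Suc k))" by (simp only: A_def mult_ac)
      also have "D powr al * D powr - real (Suc k) = D powr (- 1 - (real k - al))" by (simp add: powr_add[symmetric] algebra_simps)
      finally show "norm ((g (\<theta> + t) + g (\<theta> - t) - 2 * g \<theta>) * E t) \<le> A * ((1 - r) + chord t) powr (- 1 - (real k - al))"
        by (simp add: D_def)
    qed
    have "norm (2 * P) \<le> norm Q + norm (2 * fourier g 0) + norm (4 * g \<theta>)"
      unfolding Q using norm_triangle_ineq[of "Q - 2 * fourier g 0" "4 * g \<theta>"] norm_triangle_ineq4[of Q "2 * fourier g 0"] by linarith
    then have "2 * norm P \<le> norm Q + 2 * norm (fourier g 0) + 4 * norm (g \<theta>)" by (simp add: norm_mult)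
    also have "\<dots> \<le> B * (1 - r) powr - \<sigma> + 6 * H"
      using Q_le fourier_bounded[OF g H(2), of 0] H(2)[of \<theta>] by linarith
    finally have P_le: "norm P \<le> 3 * H + B * (1 - r) powr - \<sigma>"
      using B mult_nonneg_nonneg[OF B powr_ge_zero[of "1 - r" "- \<sigma>"]] by linarith
    have "(1 - r) powr 0 \<le> (1 - r) powr - \<sigma>" using r \<sigma> by (intro powr_mono') auto
    then have "3 * H * 1 \<le> 3 * H * (1 - r) powr - \<sigma>" using r H by (intro mult_left_mono) auto
    then show "norm (pseries (binomial_coeff k (\<lambda>M. fourier g (int M))) (of_real r * cis \<theta>)) \<le> (3 * H + B) * (1 - r) powr - \<sigma>"
      using P_le unfolding P_def distrib_right by linarith
  qed
qed

section \<open>Induction along the Hoelder-Zygmund scale\<close>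

lemma hoelder_zygmund_continuous:
  assumes "hoelder_zygmund al g"
  shows "continuous_on UNIV g"
  using assms
proof (induction rule: hoelder_zygmund.induct)
  case (hoelder al g C)
  have "isCont g x" for x
  proof -
    have "((\<lambda>h. C * \<bar>h\<bar> powr al) \<longlongrightarrow> C * 0 powr al) (at 0)"
      using hoelder(1) by (intro tendsto_mult tendsto_const tendsto_powr' tendsto_rabs_zero tendsto_ident_at) auto
    then have "((\<lambda>h. C * \<bar>h\<bar> powr al) \<longlongrightarrow> 0) (at 0)" using hoelder(1) by simp
    then have "((\<lambda>h. g (x + h) - g x) \<longlongrightarrow> 0) (at 0)"
      by (rule Lim_null_comparison[rotated]) (simp add: hoelder(3))
    then show ?thesis unfolding isCont_iff by (rule LIM_zero_cancel)
  qed
  then show ?case by (simp add: continuous_at_imp_continuous_on)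
next
  case (derivative al g g')
  then show ?case by (meson continuous_at_imp_continuous_on has_vector_derivative_continuous)
qed

lemma periodic_derivative:
  fixes g :: "real \<Rightarrow> complex"
  assumes g': "\<And>x. (g has_vector_derivative g' x) (at x)" and per: "\<And>t. g (t + 2 * pi) = g t"
  shows "g' (t + 2 * pi) = g' t"
proof -
  have "((\<lambda>x. x + 2 * pi) has_vector_derivative 1) (at t)" by (auto intro!: derivative_eq_intros)
  then have "((g \<circ> (\<lambda>x. x + 2 * pi)) has_vector_derivative 1 *\<^sub>R g' (t + 2 * pi)) (at t)"
    by (rule vector_diff_chain_at) (rule g')
  moreover have "g \<circ> (\<lambda>x. x + 2 * pi) = g" by (auto simp: per)
  ultimately show ?thesis using g'[of t] by (auto intro: vector_derivative_unique_at)
qed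

lemma fourier_derivative:
  assumes g': "\<And>x. (g has_vector_derivative g' x) (at x)" and per: "\<And>t. g (t + 2 * pi) = g t" and c': "continuous_on UNIV g'"
  shows "fourier g' k = \<i> * of_int k * fourier g k"
proof -
  have g: "continuous_on UNIV g" using g' by (meson continuous_at_imp_continuous_on has_vector_derivative_continuous)
  define c where "c t = cis (- (of_int k * t))" for t :: real
  have c: "continuous_on UNIV c" unfolding c_def by (intro continuous_intros)
  have dc: "(c has_vector_derivative (- (\<i> * of_int k)) * c x) (at x)" for x
    unfolding c_def cis_conv_exp by (auto intro!: derivative_eq_intros has_vector_derivative_real_field simp: field_simps)
  have "(LINT t|circ. g t * ((- (\<i> * of_int k)) * c t) + g' t * c t) = (1 / (2 * pi)) *\<^sub>R (g pi * c pi - g (- pi) * c (- pi))"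
  proof (rule integral_circ_FTC)
    show "((\<lambda>t. g t * c t) has_vector_derivative g x * ((- (\<i> * of_int k)) * c x) + g' x * c x) (at x)" for x
      by (rule has_vector_derivative_mult[OF g' dc])
  qed (intro continuous_intros g c c')
  also have "g pi * c pi = g (- pi) * c (- pi)"
  proof -
    have "g pi = g (- pi)" using per[of "- pi"] by simp
    moreover have "c pi = c (- pi)"
    proof -
      have "c pi = c (- pi) * cis (2 * pi * of_int (- k))" by (simp add: c_def cis_mult algebra_simps)
      also have "cis (2 * pi * of_int (- k)) = 1" by (rule cis_multiple_2pi) simp
      finally show ?thesis by simp
    qed
    ultimately show ?thesis by simp
  qed
  also have "(LINT t|circ. g t * ((- (\<i> * of_int k)) * c t) + g' t * c t)
    = (LINT t|circ. (- (\<i> * of_int k)) * (g t * c t)) + (LINT t|circ. g' t * c t)"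
    by (subst Bochner_Integration.integral_add)
       (auto intro!: integrable_circ_continuous continuous_intros g c c' Bochner_Integration.integral_cong simp: mult_ac)
  also have "\<dots> = (- (\<i> * of_int k)) * fourier g k + fourier g' k"
    by (simp only: fourier_def c_def integral_mult_right_zero)
  finally show ?thesis by (simp add: algebra_simps)
qed

text \<open>From \<open>(M + k + 1) choose (k + 1) = ((M + k) choose k) * (1 + M / (k + 1))\<close>:
  the factor \<open>M\<close> is, up to \<i>, differentiation of \<open>g\<close>. So the order
  \<open>k + 1\<close> for \<open>g\<close> is a combination of the order \<open>k\<close> for
  \<open>g\<close> and for its derivative.\<close>

lemma radial_growth_Suc:
  assumes g: "continuous_on UNIV g" and per: "\<And>t. g (t + 2 * pi) = g t"
    and g': "\<And>x. (g has_vector_derivative g' x) (at x)" and c': "continuous_on UNIV g'"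
    and r: "radial_growth k \<sigma> g" "radial_growth k \<sigma> g'"
  shows "radial_growth (Suc k) \<sigma> g"
proof -
  define b where "b M = fourier g (int M)" for M
  define b' where "b' M = fourier g' (int M)" for M
  have b': "b' M = \<i> * of_nat M * b M" for M
    unfolding b_def b'_def by (subst fourier_derivative[OF g' per c']) simp
  define a where "a = - \<i> / of_nat (Suc k)"
  have step: "binomial_coeff (Suc k) b M = binomial_coeff k b M + a * binomial_coeff k b' M" for M
  proof -
    have "Suc (M + k) * ((M + k) choose k) = ((M + Suc k) choose Suc k) * Suc k"
      using Suc_times_binomial_eq[of "M + k" k] by simp
    then have "(of_nat (Suc (M + k)) :: complex) * of_nat ((M + k) choose k) = of_nat ((M + Suc k) choose Suc k) * of_nat (Suc k)"
      by (simp only: of_nat_mult[symmetric])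
    then have "of_nat ((M + Suc k) choose Suc k) = (of_nat (Suc (M + k)) :: complex) * of_nat ((M + k) choose k) / of_nat (Suc k)"
      by (simp only: eq_divide_eq of_nat_eq_0_iff) simp
    also have "\<dots> = of_nat ((M + k) choose k) * (1 + of_nat M / of_nat (Suc k))"
      by (simp add: field_simps del: of_nat_Suc) (simp add: algebra_simps)
    finally have "of_nat ((M + Suc k) choose Suc k) * b M = of_nat ((M + k) choose k) * (1 + of_nat M / of_nat (Suc k)) * b M" by simp
    also have "\<dots> = of_nat ((M + k) choose k) * b M + a * (of_nat ((M + k) choose k) * b' M)"
      unfolding b' a_def by (simp add: algebra_simps)
    finally show ?thesis unfolding binomial_coeff_def .
  qed
  obtain H where H: "\<And>t. norm (g t) \<le> H" using continuous_periodic_bounded[OF g per] by blast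
  obtain H' where H': "\<And>t. norm (g' t) \<le> H'"
    using continuous_periodic_bounded[OF c' periodic_derivative[OF g' per]] by blast
  obtain C where C: "\<And>z. norm z < 1 \<Longrightarrow> norm (pseries (binomial_coeff k b) z) \<le> C * (1 - norm z) powr - \<sigma>"
    using r(1) unfolding radial_growth_def b_def by blast
  obtain C' where C': "\<And>z. norm z < 1 \<Longrightarrow> norm (pseries (binomial_coeff k b') z) \<le> C' * (1 - norm z) powr - \<sigma>"
    using r(2) unfolding radial_growth_def b'_def by blast
  show ?thesis unfolding radial_growth_def b_def[symmetric]
  proof (intro exI allI impI)
    fix z :: complex assume z: "norm z < 1"
    have s: "summable (\<lambda>M. binomial_coeff k b M * z ^ M)" "summable (\<lambda>M. binomial_coeff k b' M * z ^ M)"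
      unfolding b_def b'_def
      by (rule summable_norm_cancel, rule fourier_summable[OF g H z], rule summable_norm_cancel, rule fourier_summable[OF c' H' z])
    have "(\<lambda>M. binomial_coeff k b M * z ^ M + a * (binomial_coeff k b' M * z ^ M)) sums
       (pseries (binomial_coeff k b) z + a * pseries (binomial_coeff k b') z)"
      unfolding pseries_def by (intro sums_add sums_mult summable_sums s)
    then have "pseries (binomial_coeff (Suc k) b) z = pseries (binomial_coeff k b) z + a * pseries (binomial_coeff k b') z"
      by (simp add: pseries_def step sums_iff algebra_simps)
    then have "norm (pseries (binomial_coeff (Suc k) b) z) \<le> norm (pseries (binomial_coeff k b) z) + norm a * norm (pseries (binomial_coeff k b') z)"
      by (metis norm_mult norm_triangle_ineq)
    also have "\<dots> \<le> C * (1 - norm z) powr - \<sigma> + norm a * (C' * (1 - norm z) powr - \<sigma>)"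
      by (intro add_mono mult_left_mono C C' z) simp
    finally show "norm (pseries (binomial_coeff (Suc k) b) z) \<le> (C + norm a * C') * (1 - norm z) powr - \<sigma>"
      by (simp add: algebra_simps)
  qed
qed

text \<open>The two base classes are second-difference conditions. For the derivative class an inner
  induction on \<open>k\<close> starts from bare continuity and uses the outer hypothesis on the
  derivative at each step.\<close>

lemma hoelder_zygmund_radial_growth:
  assumes "hoelder_zygmund al g" "\<And>t. g (t + 2 * pi) = g t" "\<And>M. 0 < M \<Longrightarrow> fourier g (- int M) = 0"
    and "0 < \<sigma>" "real k - al \<le> \<sigma>"
  shows "radial_growth k \<sigma> g"
  using assms
proof (induction arbitrary: k \<sigma> rule: hoelder_zygmund.induct)
  case (hoelder al g C)
  show ?case
  proof (rule radial_growth_second_difference[where al = al and C = "2 * C"])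
    show "continuous_on UNIV g"
      by (rule hoelder_zygmund_continuous, rule hoelder_zygmund.hoelder) (use hoelder in auto)
    fix x h
    have "norm (g (x + h) + g (x - h) - 2 * g x) \<le> norm (g (x + h) - g x) + norm (g (x + - h) - g x)"
      using norm_triangle_ineq[of "g (x + h) - g x" "g (x + - h) - g x"] by (simp add: algebra_simps)
    also have "\<dots> \<le> C * \<bar>h\<bar> powr al + C * \<bar>- h\<bar> powr al" by (intro add_mono hoelder(3))
    finally show "norm (g (x + h) + g (x - h) - 2 * g x) \<le> 2 * C * \<bar>h\<bar> powr al" by simp
  qed (use hoelder in auto)
next
  case (zygmund g C)
  show ?case
    by (rule radial_growth_second_difference[where al = 1 and C = C]) (use zygmund in auto)
next
  case (derivative al g g')
  have g: "continuous_on UNIV g" using derivative(2) by (meson continuous_at_imp_continuous_on has_vector_derivative_continuous)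
  have c': "continuous_on UNIV g'" by (rule hoelder_zygmund_continuous[OF derivative(3)])
  have neg: "fourier g' (- int M) = 0" if "0 < M" for M
    unfolding fourier_derivative[OF derivative(2,5) c'] using derivative(6)[OF that] by simp
  show ?case using \<open>real k - al \<le> \<sigma>\<close>
  proof (induction k)
    case 0
    show ?case by (rule radial_growth_0[OF g derivative(5) \<open>0 < \<sigma>\<close>])
  next
    case (Suc k)
    \<comment> \<open>The derivative has order \<open>al - 1\<close>, and
      \<open>k - (al - 1)\<close> equals \<open>Suc k - al\<close>, so the condition on \<sigma>
      carries over.\<close>
    have "radial_growth k \<sigma> g'"
      by (rule derivative.IH[OF periodic_derivative[OF derivative(2,5)] neg \<open>0 < \<sigma>\<close>]) (use Suc.prems in auto)
    moreover have "radial_growth k \<sigma> g" by (rule Suc.IH) (use Suc.prems in simp)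
    ultimately show ?case by (intro radial_growth_Suc[OF g derivative(5,2) c'])
  qed
qed

text \<open>Compactness of the closed disc: points where \<open>b\<close> is unboundedly large would
  accumulate somewhere, but \<open>b\<close> converges along the subsequence, by continuity at an
  interior limit and by the boundary limit on the circle.\<close>

lemma boundary_values_bounded:
  assumes b: "b holomorphic_on ball 0 1" and lim: "\<And>t. (b \<longlongrightarrow> g t) (at (cis t) within ball 0 1)"
  obtains H where "\<And>z. norm z < 1 \<Longrightarrow> norm (b z) \<le> H"
proof -
  have "\<exists>H. \<forall>z. norm z < 1 \<longrightarrow> norm (b z) \<le> H"
  proof (rule ccontr)
    assume "\<not> ?thesis"
    then have "\<forall>n::nat. \<exists>z. norm z < 1 \<and> real n < norm (b z)" by (metis not_le)
    then obtain z where z: "\<And>n. norm (z n) < 1" "\<And>n. real n < norm (b (z n))" by metis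
    have "\<forall>n. z n \<in> cball 0 1" using z(1) by (simp add: less_imp_le)
    then obtain l s where l: "l \<in> cball 0 1" "strict_mono s" "(z \<circ> s) \<longlonglongrightarrow> l"
      using compact_cball[of "0::complex" 1] unfolding compact_def by metis
    have "\<exists>L. (\<lambda>n. b ((z \<circ> s) n)) \<longlonglongrightarrow> L"
    proof (cases "norm l < 1")
      case True
      then have "isCont b l" using b by (intro continuous_on_interior[OF holomorphic_on_imp_continuous_on[OF b]]) simp
      then show ?thesis using l(3) by (blast intro: isCont_tendsto_compose)
    next
      case False
      then have "norm l = 1" using l by simp
      then have "l = cis (Arg l)" using rcis_cmod_Arg[of l] by (simp add: rcis_def)
      then have L: "(b \<longlongrightarrow> g (Arg l)) (at l within ball 0 1)" using lim[of "Arg l"] by simp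
      have "filterlim (z \<circ> s) (at l within ball 0 1) sequentially"
        unfolding filterlim_at using l(3) z(1) False by (auto intro!: always_eventually)
      then show ?thesis using filterlim_compose[OF L] by blast
    qed
    then have "Bseq (\<lambda>n. b ((z \<circ> s) n))" by (intro convergent_imp_Bseq) (simp only: convergent_def)
    then obtain K where K: "\<And>n. norm (b ((z \<circ> s) n)) \<le> K" by (elim BseqE) blast
    obtain n where "K < real n" using reals_Archimedean2 by blast
    also have "real n \<le> real (s n)" using seq_suble[OF l(2)] by simp
    also have "\<dots> < norm (b ((z \<circ> s) n))" using z(2) by simp
    finally show False using K[of n] by simp
  qed
  then show ?thesis using that by blast
qed

text \<open>On a circle of radius below 1 the Fourier coefficients are Taylor coefficients times
  powers of the radius, or 0 at negative frequencies. The bound from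
  \<open>boundary_values_bounded\<close> dominates as the radius tends to 1.\<close>

lemma boundary_fourier:
  assumes b: "b holomorphic_on ball 0 1" and lim: "\<And>t. (b \<longlongrightarrow> g t) (at (cis t) within ball 0 1)"
    and g: "continuous_on UNIV g"
  shows "fourier g k = (if 0 \<le> k then taylor_coeff b (nat k) else 0)"
proof -
  obtain H where H: "\<And>z. norm z < 1 \<Longrightarrow> norm (b z) \<le> H" using boundary_values_bounded[OF b lim] by blast
  define R where "R l = 1 - 1 / real (Suc l)" for l
  have R: "0 \<le> R l" "R l < 1" for l by (auto simp: R_def)
  have "R \<longlonglongrightarrow> 1 - 0" unfolding R_def by (intro tendsto_diff tendsto_const LIMSEQ_Suc[OF lim_1_over_n])
  then have R1: "R \<longlonglongrightarrow> 1" by simp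
  have nR: "norm (of_real (R l) * cis t) < 1" for l t using R[of l] by (simp add: norm_mult)
  have bc: "continuous_on UNIV (\<lambda>t. b (of_real (R l) * cis t))" for l
    by (rule continuous_on_compose2[OF holomorphic_on_imp_continuous_on[OF b]]) (use nR in \<open>auto intro!: continuous_intros\<close>)
  define c where "c t = cis (- (of_int k * t))" for t :: real
  have c: "continuous_on UNIV c" unfolding c_def by (intro continuous_intros)
  have conv: "(\<lambda>l. LINT t|circ. b (of_real (R l) * cis t) * c t) \<longlonglongrightarrow> (LINT t|circ. g t * c t)"
  proof (rule integral_dominated_convergence[where w = "\<lambda>_. H"])
    show "(\<lambda>t. g t * c t) \<in> borel_measurable circ"
      using borel_measurable_continuous_onI[OF continuous_on_mult[OF g c]] by simp
    show "(\<lambda>t. b (of_real (R l) * cis t) * c t) \<in> borel_measurable circ" for l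
      using borel_measurable_continuous_onI[OF continuous_on_mult[OF bc c]] by simp
    show "AE t in circ. (\<lambda>l. b (of_real (R l) * cis t) * c t) \<longlonglongrightarrow> g t * c t"
    proof (rule AE_I2)
      fix t
      have "(\<lambda>l. of_real (R l) * cis t) \<longlonglongrightarrow> of_real 1 * cis t" by (intro tendsto_intros R1)
      moreover have "of_real (R l) * cis t \<noteq> cis t" for l using nR[of l t] by auto
      ultimately have "filterlim (\<lambda>l. of_real (R l) * cis t) (at (cis t) within ball 0 1) sequentially"
        unfolding filterlim_at using nR by (auto intro!: always_eventually)
      then have "(\<lambda>l. b (of_real (R l) * cis t)) \<longlonglongrightarrow> g t" by (rule filterlim_compose[OF lim])
      then show "(\<lambda>l. b (of_real (R l) * cis t) * c t) \<longlonglongrightarrow> g t * c t" by (intro tendsto_intros)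
    qed
    show "AE t in circ. norm (b (of_real (R l) * cis t) * c t) \<le> H" for l
      using H[OF nR] by (simp add: norm_mult c_def)
  qed (simp add: integrable_circ)
  have coeff: "(LINT t|circ. b (of_real (R l) * cis t) * c t) = (if 0 \<le> k then taylor_coeff b (nat k) * of_real (R l) ^ nat k else 0)" for l
  proof -
    define a where "a n = taylor_coeff b n * of_real (R l) ^ n" for n
    have sums: "(\<lambda>n. taylor_coeff b n * w ^ n) sums b w" if "norm w < 1" for w
      using holomorphic_power_series[OF b, of w] that by (simp add: taylor_coeff_def)
    have "summable (\<lambda>n. norm (taylor_coeff b n * of_real (R l) ^ n))"
    proof (rule powser_insidea)
      let ?R = "of_real ((1 + R l) / 2) :: complex"
      have n: "norm ?R = (1 + R l) / 2" using R[of l] by (simp only: norm_of_real) simp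
      show "summable (\<lambda>n. taylor_coeff b n * ?R ^ n)" using R[of l] n by (intro sums_summable[OF sums]) simp
      show "norm (complex_of_real (R l)) < norm ?R" unfolding n using R[of l] by simp
    qed
    then have as: "summable (\<lambda>n. norm (a n))" by (simp add: a_def)
    have bs: "(\<Sum>n. a n * cis (real n * t)) = b (of_real (R l) * cis t)" for t
      using sums[OF nR[of l t]] by (simp add: a_def power_mult_distrib Complex.DeMoivre sums_iff mult.assoc)
    have "(\<lambda>n. a n * (LINT t|circ. c t * cis (real n * t))) sums (LINT t|circ. c t * (\<Sum>n. a n * cis (real n * t)))"
      by (rule sums_integral_circ[where H = 1]) (auto simp: as c_def)
    then have "(\<lambda>n. a n * (LINT t|circ. c t * cis (real n * t))) sums (LINT t|circ. b (of_real (R l) * cis t) * c t)"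
      unfolding bs by (simp only: mult.commute)
    moreover have "(LINT t|circ. c t * cis (real n * t)) = (if int n = k then 1 else 0)" for n
    proof -
      have "c t * cis (real n * t) = cis (of_int (int n - k) * t)" for t by (simp add: c_def cis_mult algebra_simps)
      then show ?thesis using integral_circ_cis[of "int n - k"] by simp
    qed
    ultimately have S: "(\<lambda>n. a n * (if int n = k then 1 else 0)) sums (LINT t|circ. b (of_real (R l) * cis t) * c t)" by simp
    show ?thesis
    proof (cases "0 \<le> k")
      case True
      have "(\<lambda>n. a n * (if int n = k then 1 else 0)) sums (\<Sum>n\<in>{nat k}. a n * (if int n = k then 1 else 0))"
        by (rule sums_finite) auto
      then show ?thesis using sums_unique2[OF S] True by (simp add: a_def)
    next
      case False
      then have z: "(\<lambda>n. a n * (if int n = k then 1 else 0)) = (\<lambda>n. 0)" by auto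
      show ?thesis using sums_unique2[OF S[unfolded z] sums_zero] False by simp
    qed
  qed
  have "(\<lambda>l. taylor_coeff b (nat k) * of_real (R l) ^ nat k) \<longlonglongrightarrow> taylor_coeff b (nat k) * of_real 1 ^ nat k"
    by (intro tendsto_intros R1)
  then have "(\<lambda>l. if 0 \<le> k then taylor_coeff b (nat k) * of_real (R l) ^ nat k else 0)
      \<longlonglongrightarrow> (if 0 \<le> k then taylor_coeff b (nat k) * of_real 1 ^ nat k else 0)"
    by (cases "0 \<le> k") simp_all
  then have "(\<lambda>l. LINT t|circ. b (of_real (R l) * cis t) * c t) \<longlonglongrightarrow> (if 0 \<le> k then taylor_coeff b (nat k) else 0)"
    unfolding coeff by (simp only: of_real_1 power_one mult_1_right)
  then show ?thesis using LIMSEQ_unique[OF conv] by (simp add: fourier_def c_def)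
qed

lemma Lipschitz_disc_growth:
  assumes b: "b \<in> Lipschitz_disc al" and k: "al < real k"
  obtains N where "growth k al N (taylor_coeff b)"
proof -
  obtain g where holo: "b holomorphic_on ball 0 1" and per: "\<And>t. g (t + 2 * pi) = g t" and hz: "hoelder_zygmund al g"
    and lim: "\<And>t. (b \<longlongrightarrow> g t) (at (cis t) within ball 0 1)"
    using b unfolding Lipschitz_disc_def Lipschitz_circle_def by blast
  have g: "continuous_on UNIV g" by (rule hoelder_zygmund_continuous[OF hz])
  note bf = boundary_fourier[OF holo lim g]
  have tc: "(\<lambda>M. fourier g (int M)) = taylor_coeff b" unfolding bf by auto
  have neg: "fourier g (- int M) = 0" if "0 < M" for M unfolding bf using that by simp
  obtain H where H: "\<And>t. norm (g t) \<le> H" using continuous_periodic_bounded[OF g per] by blast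
  have "radial_growth k (real k - al) g"
    by (rule hoelder_zygmund_radial_growth[OF hz per neg]) (use k in auto)
  then obtain C where "\<And>z. norm z < 1 \<Longrightarrow> norm (pseries (binomial_coeff k (taylor_coeff b)) z) \<le> C * (1 - norm z) powr - (real k - al)"
    unfolding radial_growth_def tc by blast
  then have "growth k al C (taylor_coeff b)"
    unfolding growth_def using fourier_summable[OF g H, of _ k int, unfolded tc] by simp
  then show ?thesis by (rule that)
qed

lemma growth_mono:
  assumes "growth k al N c" "N \<le> N'" shows "growth k al N' c"
  unfolding growth_def
proof (intro allI impI conjI)
  fix z :: complex assume z: "norm z < 1"
  show "summable (\<lambda>M. norm (binomial_coeff k c M * z ^ M))" using assms z by (simp add: growth_def)
  have "norm (pseries (binomial_coeff k c) z) \<le> N * (1 - norm z) powr (al - real k)" using assms z by (simp add: growth_def)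
  also have "\<dots> \<le> N' * (1 - norm z) powr (al - real k)" by (intro mult_right_mono assms) simp
  finally show "norm (pseries (binomial_coeff k c) z) \<le> N' * (1 - norm z) powr (al - real k)" .
qed

lemma poly_hardy_norm_finite:
  assumes q: "0 < q" shows "hardy_norm q (poly f) < \<infinity>"
proof -
  define M where "M = (\<Sum>n\<le>degree f. norm (coeff f n))"
  have "hardy_norm q (poly f) \<le> ennreal M"
  proof (rule hardy_norm_leI)
    fix R :: real assume R: "0 \<le> R" "R < 1"
    have "(\<integral>\<^sup>+t. ennreal (norm (poly f (of_real R * cis t)) powr q) \<partial>circ) \<le> (\<integral>\<^sup>+t. ennreal (M powr q) \<partial>circ)"
      unfolding M_def using R q by (intro nn_integral_mono ennreal_leI powr_mono2 poly_circle_bounded) auto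
    then show "(\<integral>\<^sup>+t. ennreal (norm (poly f (of_real R * cis t)) powr q) \<partial>circ) \<le> ennreal (M powr q)" by (simp add: emeasure_circ)
  qed (auto intro!: holomorphic_intros q sum_nonneg simp: M_def)
  then show ?thesis by (simp add: le_less_trans)
qed

subsection \<open>Truncated Hankel operators\<close>

text \<open>At \<open>\<beta> = 0\<close> the convention \<open>1 / 0 = 0\<close> gives a finite value, which is all that is needed there.\<close>

definition slope_bound :: "real \<Rightarrow> real" where
  "slope_bound \<beta> = 1 + \<bar>1 + \<beta>\<bar> + 1 / \<bar>1 + \<beta>\<bar> + \<bar>1 + 1 / \<beta>\<bar> + 1 / \<bar>1 + 1 / \<beta>\<bar>"

lemma slope_bound_ge:
  assumes "\<beta> \<noteq> -1"
  shows "1 \<le> slope_bound \<beta>" "\<bar>1 + \<beta>\<bar> \<le> slope_bound \<beta>" "1 \<le> slope_bound \<beta> * \<bar>1 + \<beta>\<bar>"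
    "\<beta> \<noteq> 0 \<Longrightarrow> \<bar>1 + 1 / \<beta>\<bar> \<le> slope_bound \<beta> \<and> 1 \<le> slope_bound \<beta> * \<bar>1 + 1 / \<beta>\<bar>"
proof -
  define x y where "x = \<bar>1 + \<beta>\<bar>" and "y = \<bar>1 + 1 / \<beta>\<bar>"
  have s: "slope_bound \<beta> = 1 + x + 1 / x + y + 1 / y" by (simp add: slope_bound_def x_def y_def)
  have x: "0 < x" using assms by (simp add: x_def)
  have y: "0 \<le> y" by (simp add: y_def)
  have nn: "0 \<le> 1 / x" "0 \<le> 1 / y" using x y by simp_all
  show "1 \<le> slope_bound \<beta>" "\<bar>1 + \<beta>\<bar> \<le> slope_bound \<beta>" unfolding s x_def[symmetric] using x y nn by linarith+
  have "1 / x \<le> slope_bound \<beta>" unfolding s using x y nn by linarith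
  then have "1 / x * x \<le> slope_bound \<beta> * x" using x by (intro mult_right_mono) auto
  then show "1 \<le> slope_bound \<beta> * \<bar>1 + \<beta>\<bar>" using x by (simp add: x_def)
  assume "\<beta> \<noteq> 0"
  then have "1 + 1 / \<beta> \<noteq> 0" using assms by (simp add: field_simps)
  then have y': "0 < y" by (simp add: y_def)
  have "y \<le> slope_bound \<beta>" "1 / y \<le> slope_bound \<beta>" unfolding s using x y nn by linarith+
  moreover from this have "1 / y * y \<le> slope_bound \<beta> * y" using y' by (intro mult_right_mono) auto
  ultimately show "\<bar>1 + 1 / \<beta>\<bar> \<le> slope_bound \<beta> \<and> 1 \<le> slope_bound \<beta> * \<bar>1 + 1 / \<beta>\<bar>"
    using y' by (simp add: y_def)
qed

text \<open>Boundedness on compact sets of slopes is obtained from continuity in \<beta>, which also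
  explains why -1 and 0 must be avoided: \<open>1 / (1 + \<beta>)\<close> and
  \<open>1 / \<beta>\<close> enter the constant.\<close>

lemma continuous_on_threshold_const:
  assumes "K \<subseteq> UNIV - {-1, 0}"
  shows "continuous_on K (\<lambda>\<beta>. threshold_const p q k al \<kappa> (slope_bound \<beta>))"
proof -
  have ne: "\<beta> \<noteq> 0 \<and> 1 + \<beta> \<noteq> 0 \<and> 1 + 1 / \<beta> \<noteq> 0" if "\<beta> \<in> K" for \<beta>
  proof -
    have "\<beta> \<noteq> 0" "\<beta> \<noteq> -1" using assms that by auto
    then show ?thesis by (simp add: field_simps)
  qed
  have "continuous_on K slope_bound"
    unfolding slope_bound_def by (intro continuous_intros) (use ne in auto)
  then show ?thesis
    unfolding threshold_const_def smooth_const_def kern_const_def error_const_def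
    by (intro continuous_intros) auto
qed

lemma truncated_hankel_eq:
  "truncated_hankel \<beta> \<gamma> b = matrix_operator (region_matrix (\<lambda>m n. \<beta> * real n + \<gamma> \<le> real m) (taylor_coeff b))"
  unfolding truncated_hankel_def
  by (intro arg_cong[where f = matrix_operator] ext) (simp add: truncation_def hankel_matrix_def region_matrix_def)

lemma hankel_eq: "hankel b = matrix_operator (region_matrix (\<lambda>m n. True) (taylor_coeff b))"
  unfolding hankel_def
  by (intro arg_cong[where f = matrix_operator] ext) (simp add: hankel_matrix_def region_matrix_def)

lemma truncated_hankel_bound:
  assumes g: "growth k al N (taylor_coeff b)" and N: "0 < N" and alk: "al < real k" and k1: "1 \<le> k" and \<beta>: "\<beta> \<noteq> -1"
    and q: "0 < q" "q < p" "1 < p" and al: "al = 1 / q - 1 / p" and \<kappa>: "0 < \<kappa>" "\<kappa> < al" "\<kappa> < 1 - 1 / p"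
  shows "hardy_norm p (truncated_hankel \<beta> \<gamma> b f) \<le> ennreal (N * threshold_const p q k al \<kappa> (slope_bound \<beta>)) * hardy_norm q (poly f)"
  unfolding truncated_hankel_eq
proof (rule homogeneous_bound)
  show "0 < N * threshold_const p q k al \<kappa> (slope_bound \<beta>)"
    by (intro mult_pos_pos N threshold_const_pos q al \<kappa> slope_bound_ge(1) \<beta> k1)
  show "hardy_norm p (matrix_operator (region_matrix (\<lambda>m n. \<beta> * real n + \<gamma> \<le> real m) (taylor_coeff b)) f)
      \<le> ennreal (N * threshold_const p q k al \<kappa> (slope_bound \<beta>))"
    if "boundary_mean q f \<le> 1" for f
    by (rule threshold_hardy_norm_unit[OF g N alk k1 slope_bound_ge(1-3)[OF \<beta>] slope_bound_ge(4)[OF \<beta>] that q al \<kappa>])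
qed (use q matrix_operator_holomorphic[OF g binomial_coeff_norm_ge] sums_summable[OF matrix_operator_sums[OF g _ binomial_coeff_norm_ge]] in auto)

lemma hardy_opnorm_bound:
  assumes g: "growth k al N (taylor_coeff b)" and q: "0 < q" and p: "0 < p" and h: "hardy_opnorm q p (hankel b) \<le> ennreal h" "0 \<le> h"
    and K: "0 < K" and f: "hardy_norm q (poly f) \<le> ennreal K"
  shows "hardy_norm p (hankel b f) \<le> ennreal (h * K)"
proof -
  define f' where "f' = smult (of_real (1 / K)) f"
  have "hardy_norm q (poly f') = hardy_norm q (\<lambda>z. of_real (1 / K) * poly f z)"
    by (intro arg_cong[where f = "hardy_norm q"] ext) (simp add: f'_def)
  also have "\<dots> = ennreal (1 / K) * hardy_norm q (poly f)"
    using hardy_norm_mult[of "poly f" q "of_real (1 / K)"] q K by (simp add: holomorphic_intros norm_divide)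
  also have "\<dots> \<le> ennreal (1 / K) * ennreal K" by (intro mult_left_mono f) simp
  also have "\<dots> = 1" using K by (simp add: ennreal_mult'[symmetric])
  finally have "hardy_norm p (hankel b f') \<le> hardy_opnorm q p (hankel b)"
    unfolding hardy_opnorm_def by (intro SUP_upper) simp
  also note h(1)
  finally have le: "hardy_norm p (hankel b f') \<le> ennreal h" .
  have "hardy_norm p (hankel b f) = hardy_norm p (\<lambda>z. of_real K * hankel b f' z)"
  proof (rule hardy_norm_cong)
    fix z :: complex assume "norm z < 1"
    then show "hankel b f z = of_real K * hankel b f' z"
      unfolding f'_def hankel_eq
      using K by (subst matrix_operator_smult[OF sums_summable[OF matrix_operator_sums[OF g _ binomial_coeff_norm_ge]]]) auto
  qed
  also have "\<dots> = ennreal K * hardy_norm p (hankel b f')"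
    using hardy_norm_mult[of "hankel b f'" p "of_real K"] p K matrix_operator_holomorphic[OF g binomial_coeff_norm_ge]
    by (simp add: hankel_eq)
  also have "\<dots> \<le> ennreal K * ennreal h" by (intro mult_left_mono le) simp
  finally show ?thesis using h(2) K by (simp add: ennreal_mult'[symmetric] mult.commute)
qed

theorem corollary4:
  fixes p q \<alpha> :: real
  assumes "1 < p" and "0 < q" and "q < p" and "\<alpha> = 1 / q - 1 / p"
  shows "(\<forall>b\<in>Lipschitz_disc \<alpha>. \<forall>\<beta> \<gamma>. \<beta> \<noteq> -1 \<longrightarrow> hardy_continuous q p (truncated_hankel \<beta> \<gamma> b)) \<and>
    (\<exists>C :: real \<Rightarrow> real \<Rightarrow> real.
       (\<forall>K. compact K \<and> K \<subseteq> UNIV - {-1, 0} \<longrightarrow> bounded {C \<beta> \<gamma> | \<beta> \<gamma>. \<beta> \<in> K}) \<and>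
       (\<forall>b\<in>Lipschitz_disc \<alpha>. \<forall>\<beta> \<gamma>. \<beta> \<noteq> -1 \<longrightarrow>
          hardy_opnorm q p (truncated_hankel \<beta> \<gamma> b)
            \<le> ennreal (C \<beta> \<gamma>) * hardy_opnorm q p (hankel b)))"
proof -
  note q = assms(2,3,1) and al = assms(4)
  \<comment> \<open>Gives \<open>Suc j > 1 / q\<close>. This puts \<alpha> below
    \<open>k = Suc j\<close>, as the growth condition requires, and makes
    \<open>Suc j * q > 1\<close>, so that the mean of the test kernel is governed by its
    singularity.\<close>
  define j where "j = nat \<lceil>1 / q\<rceil>"
  define k where "k = Suc j"
  have "1 / q < real k" unfolding k_def j_def by linarith
  then have jq: "1 < real (Suc j) * q" using q by (simp add: k_def field_simps)
  have p0: "0 < 1 / p" using q by simp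
  then have alk: "\<alpha> < real k" using \<open>1 / q < real k\<close> al by linarith
  have k1: "1 \<le> k" by (simp add: k_def)
  have "1 / p < 1 / q" using q by (intro divide_strict_left_mono) auto
  then have al0: "0 < \<alpha>" using al by simp
  have p1: "0 < 1 - 1 / p" using q by simp
  \<comment> \<open>Halving keeps \<kappa> strictly below \<alpha>, for the integral over
    \<open>e\<close>, and below \<open>1 - 1 / p\<close>, for the Hardy-Littlewood-Sobolev
    exponents.\<close>
  define \<kappa> where "\<kappa> = min \<alpha> (1 - 1 / p) / 2"
  have \<kappa>: "0 < \<kappa>" "\<kappa> < \<alpha>" "\<kappa> < 1 - 1 / p" using al0 p1 by (auto simp: \<kappa>_def min_def)
  define tc where "tc \<beta> = threshold_const p q k \<alpha> \<kappa> (slope_bound \<beta>)" for \<beta>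
  define oc where "oc = opnorm_const p q j"
  have tc0: "0 < tc \<beta>" if "\<beta> \<noteq> -1" for \<beta>
    unfolding tc_def by (rule threshold_const_pos[OF q al \<kappa> slope_bound_ge(1)[OF that] k1])
  have oc0: "0 < oc"
    unfolding oc_def opnorm_const_def using jq by (intro mult_pos_pos) (auto intro: add_pos_pos)
  note bound = truncated_hankel_bound[OF _ _ alk k1 _ q al \<kappa>, folded tc_def]
  have "hardy_continuous q p (truncated_hankel \<beta> \<gamma> b)" if b: "b \<in> Lipschitz_disc \<alpha>" and \<beta>: "\<beta> \<noteq> -1" for b \<beta> \<gamma>
  proof -
    obtain N0 where "growth k \<alpha> N0 (taylor_coeff b)" by (rule Lipschitz_disc_growth[OF b alk])
    then have g: "growth k \<alpha> (max N0 1) (taylor_coeff b)" by (rule growth_mono) simp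
    have le: "hardy_norm p (truncated_hankel \<beta> \<gamma> b f) \<le> ennreal (max N0 1 * tc \<beta>) * hardy_norm q (poly f)" for f
      by (rule bound[OF g _ \<beta>]) simp
    have "truncated_hankel \<beta> \<gamma> b f \<in> hardy_space p" for f
    proof -
      have "ennreal (max N0 1 * tc \<beta>) * hardy_norm q (poly f) < \<infinity>"
        using poly_hardy_norm_finite[OF q(1), of f] by (simp add: ennreal_mult_less_top)
      then have "hardy_norm p (truncated_hankel \<beta> \<gamma> b f) < \<infinity>" using le[of f] by (rule le_less_trans[rotated])
      moreover have "truncated_hankel \<beta> \<gamma> b f holomorphic_on ball 0 1"
        unfolding truncated_hankel_eq by (rule matrix_operator_holomorphic[OF g binomial_coeff_norm_ge])
      ultimately show ?thesis by (simp add: hardy_space_def)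
    qed
    then show ?thesis unfolding hardy_continuous_def using le by blast
  qed
  moreover have "bounded {tc \<beta> * oc | \<beta> \<gamma>. \<beta> \<in> K}" if K: "compact K" "K \<subseteq> UNIV - {-1, 0}" for K
  proof -
    have "compact ((\<lambda>\<beta>. tc \<beta> * oc) ` K)"
      unfolding tc_def by (intro compact_continuous_image continuous_intros continuous_on_threshold_const K)
    moreover have "{tc \<beta> * oc | \<beta> \<gamma>. \<beta> \<in> K} = (\<lambda>\<beta>. tc \<beta> * oc) ` K" by auto
    ultimately show ?thesis by (simp add: compact_imp_bounded)
  qed
  moreover have "hardy_opnorm q p (truncated_hankel \<beta> \<gamma> b) \<le> ennreal (tc \<beta> * oc) * hardy_opnorm q p (hankel b)"
    if b: "b \<in> Lipschitz_disc \<alpha>" and \<beta>: "\<beta> \<noteq> -1" for b \<beta> \<gamma>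
  proof (cases "hardy_opnorm q p (hankel b)")
    case top
    then show ?thesis using tc0[OF \<beta>] oc0 by (simp add: ennreal_mult_top)
  next
    case (real h)
    obtain N0 where g0: "growth k \<alpha> N0 (taylor_coeff b)" by (rule Lipschitz_disc_growth[OF b alk])
    have "growth (Suc j) \<alpha> (opnorm_const p q j * h) (taylor_coeff b)"
    proof (rule growth_from_operator_bound[OF g0[unfolded k_def] q(1,3) al jq])
      show "hardy_norm p (matrix_operator (region_matrix (\<lambda>m n. True) (taylor_coeff b)) f) \<le> ennreal (h * K)"
        if "0 < K" "hardy_norm q (poly f) \<le> ennreal K" for f K
        using hardy_opnorm_bound[OF g0 q(1) _ _ real(1) that, of p] real q unfolding hankel_eq by simp
    qed (use real in simp)
    then have g: "growth k \<alpha> (oc * h) (taylor_coeff b)" by (simp add: k_def oc_def)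
    show ?thesis
    \<comment> \<open>The bound is stated for a strictly positive growth constant, whereas the norm
      \<open>h\<close> may be 0; adding \<open>e / tc \<beta>\<close> to the constant raises the
      final bound by exactly \<open>e\<close>.\<close>
    proof (rule ennreal_le_epsilon)
      fix e :: real assume e: "0 < e"
      define N where "N = oc * h + e / tc \<beta>"
      have N: "oc * h \<le> N" "0 < N" using e tc0[OF \<beta>] oc0 real by (auto simp: N_def intro: add_nonneg_pos)
      have "hardy_opnorm q p (truncated_hankel \<beta> \<gamma> b) \<le> ennreal (N * tc \<beta>)"
        unfolding hardy_opnorm_def
      proof (rule SUP_least)
        fix f assume f: "f \<in> {f. hardy_norm q (poly f) \<le> 1}"
        have "hardy_norm p (truncated_hankel \<beta> \<gamma> b f) \<le> ennreal (N * tc \<beta>) * hardy_norm q (poly f)"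
          by (rule bound[OF growth_mono[OF g N(1)] N(2) \<beta>])
        also have "\<dots> \<le> ennreal (N * tc \<beta>) * 1" using f by (intro mult_left_mono) auto
        finally show "hardy_norm p (truncated_hankel \<beta> \<gamma> b f) \<le> ennreal (N * tc \<beta>)" by simp
      qed
      also have "N * tc \<beta> = tc \<beta> * oc * h + e" using tc0[OF \<beta>] by (simp add: N_def field_simps)
      also have "ennreal (tc \<beta> * oc * h + e) = ennreal (tc \<beta> * oc) * ennreal h + ennreal e"
        using tc0[OF \<beta>] oc0 e real by (simp add: ennreal_mult'[symmetric])
      finally show "hardy_opnorm q p (truncated_hankel \<beta> \<gamma> b) \<le> ennreal (tc \<beta> * oc) * hardy_opnorm q p (hankel b) + ennreal e"
        using real by simp
    qed
  qed
  \<comment> \<open>The constant does not depend on \<gamma>: the thresholds enter all estimates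
    through their slopes and the rounding error only.\<close>
  ultimately show ?thesis by (intro conjI ballI allI impI exI[of _ "\<lambda>\<beta> \<gamma>. tc \<beta> * oc"]) auto
qed

end
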